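(* Let $M,M'$ be regular indecomposable representations of $(T(n),\Omega)$ (or both of $(T(n),\sigma\Omega)$) and let $M\to M'$ be an irreducible map in the corresponding module category. Then $\iota(M')=\iota(M)-1$.
   Context: Let $k$ be a field and $n\ge 3$. $T(n)$ is the $n$-regular tree; fix a bipartite orientation $\Omega$ (every vertex a sink or a source) and let $\sigma\Omega$ be the opposite orientation. A module is a finite-dimensional $k$-representation of $(T(n),\Omega)$ or $(T(n),\sigma\Omega)$. The shift functor $\sigma$ is the composition of the Bernstein–Gelfand–Ponomarev reflection functors at all sinks (sending representations of $(T(n),\Omega)$ to those of $(T(n),\sigma\Omega)$ and vice versa), $\sigma^-$ its left adjoint, $\sigma^t=(\sigma^-)^{-t}$ for $t<0$. An indecomposable module $M$ is regular if $\sigma^tM\ne 0$ for all $t\in\mathbb Z$. The support $T(M)$ is the full subgraph of $T(n)$ on the vertices $a$ with $M_a\neq 0$; a diameter path is a path in $T(M)$ of maximal length $d(M)$, the radius is $r(M)=\lfloor d(M)/2\rfloor$; $M$ is a sink module if its diameter paths start and end at sinks of the orientation of its quiver. Fact: the shift orbit $\{\sigma^tM\}$ of a regular indecomposable $M$ contains a unique sink module $M_0$ of smallest radius. The index $\iota(M)$ is the integer $t$ with $M\cong\sigma^{t}M_0$. *)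

theory Defs
  imports "Jordan_Normal_Form.Matrix"
begin

text \<open>Vertices of T(n): reduced words over the alphabet {0..<n} (no two consecutive
  letters equal); x and y are adjacent iff one is obtained from the other by appending
  one letter. Every vertex has exactly n neighbours.\<close>

definition tvert :: "nat \<Rightarrow> nat list \<Rightarrow> bool" where
  "tvert n w \<longleftrightarrow> (\<forall>i\<in>set w. i < n) \<and> (\<forall>j. Suc j < length w \<longrightarrow> w ! j \<noteq> w ! Suc j)"

definition tadj :: "nat \<Rightarrow> nat list \<Rightarrow> nat list \<Rightarrow> bool" where
  "tadj n x y \<longleftrightarrow> tvert n x \<and> tvert n y \<and> ((\<exists>i. y = x @ [i]) \<or> (\<exists>i. x = y @ [i]))"

definition nbrs :: "nat \<Rightarrow> nat list \<Rightarrow> nat list set" where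
  "nbrs n a = {b. tadj n a b}"

text \<open>Bipartite orientations: parameter p :: bool. In orientation p the sinks are the
  vertices x with (even (length x) = p), the others are sources. The orientation
  \<not>p is the opposite one (sigma Omega).\<close>

definition is_sink :: "bool \<Rightarrow> nat list \<Rightarrow> bool" where
  "is_sink p x \<longleftrightarrow> (even (length x) = p)"

definition arrow :: "nat \<Rightarrow> bool \<Rightarrow> nat list \<Rightarrow> nat list \<Rightarrow> bool" where
  "arrow n p x y \<longleftrightarrow> tadj n x y \<and> is_sink p y"

text \<open>The space at vertex x is k^(rdim M x) (column vectors); the linear map of the arrow
  x \<rightarrow> y is the matrix rmap M x y.\<close>

record 'k qrep =
  rdim :: "nat list \<Rightarrow> nat"
  rmap :: "nat list \<Rightarrow> nat list \<Rightarrow> 'k mat"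

definition is_rep :: "nat \<Rightarrow> bool \<Rightarrow> 'k qrep \<Rightarrow> bool" where
  "is_rep n p M \<longleftrightarrow> (\<forall>x. \<not> tvert n x \<longrightarrow> rdim M x = 0) \<and> finite {x. rdim M x \<noteq> 0} \<and>
     (\<forall>x y. arrow n p x y \<longrightarrow> rmap M x y \<in> carrier_mat (rdim M y) (rdim M x))"

definition is_zero_rep :: "'k qrep \<Rightarrow> bool" where
  "is_zero_rep M \<longleftrightarrow> (\<forall>x. rdim M x = 0)"

definition is_hom :: "nat \<Rightarrow> bool \<Rightarrow> 'k::comm_ring_1 qrep \<Rightarrow> 'k qrep \<Rightarrow> (nat list \<Rightarrow> 'k mat) \<Rightarrow> bool" where
  "is_hom n p M N f \<longleftrightarrow> is_rep n p M \<and> is_rep n p N \<and>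
     (\<forall>x. f x \<in> carrier_mat (rdim N x) (rdim M x)) \<and>
     (\<forall>x y. arrow n p x y \<longrightarrow> f y * rmap M x y = rmap N x y * f x)"

definition hid :: "'k::comm_ring_1 qrep \<Rightarrow> nat list \<Rightarrow> 'k mat" where
  "hid M = (\<lambda>x. 1\<^sub>m (rdim M x))"

definition hcomp :: "(nat list \<Rightarrow> 'k::comm_ring_1 mat) \<Rightarrow> (nat list \<Rightarrow> 'k mat) \<Rightarrow> nat list \<Rightarrow> 'k mat" where
  "hcomp g f = (\<lambda>x. g x * f x)"

definition split_mono :: "nat \<Rightarrow> bool \<Rightarrow> 'k::comm_ring_1 qrep \<Rightarrow> 'k qrep \<Rightarrow> (nat list \<Rightarrow> 'k mat) \<Rightarrow> bool" where
  "split_mono n p M N f \<longleftrightarrow> is_hom n p M N f \<and> (\<exists>g. is_hom n p N M g \<and> hcomp g f = hid M)"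

definition split_epi :: "nat \<Rightarrow> bool \<Rightarrow> 'k::comm_ring_1 qrep \<Rightarrow> 'k qrep \<Rightarrow> (nat list \<Rightarrow> 'k mat) \<Rightarrow> bool" where
  "split_epi n p M N f \<longleftrightarrow> is_hom n p M N f \<and> (\<exists>g. is_hom n p N M g \<and> hcomp f g = hid N)"

definition is_iso :: "nat \<Rightarrow> bool \<Rightarrow> 'k::comm_ring_1 qrep \<Rightarrow> 'k qrep \<Rightarrow> bool" where
  "is_iso n p M N \<longleftrightarrow> (\<exists>f g. is_hom n p M N f \<and> is_hom n p N M g \<and>
      hcomp g f = hid M \<and> hcomp f g = hid N)"

definition decomposable :: "nat \<Rightarrow> bool \<Rightarrow> 'k::comm_ring_1 qrep \<Rightarrow> bool" where
  "decomposable n p M \<longleftrightarrow> (\<exists>M1 M2 i1 i2 p1 p2.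
      \<not> is_zero_rep M1 \<and> \<not> is_zero_rep M2 \<and>
      is_hom n p M1 M i1 \<and> is_hom n p M2 M i2 \<and> is_hom n p M M1 p1 \<and> is_hom n p M M2 p2 \<and>
      hcomp p1 i1 = hid M1 \<and> hcomp p2 i2 = hid M2 \<and>
      (\<lambda>x. i1 x * p1 x + i2 x * p2 x) = hid M)"

definition indecomposable :: "nat \<Rightarrow> bool \<Rightarrow> 'k::comm_ring_1 qrep \<Rightarrow> bool" where
  "indecomposable n p M \<longleftrightarrow> is_rep n p M \<and> \<not> is_zero_rep M \<and> \<not> decomposable n p M"

definition irreducible_map :: "nat \<Rightarrow> bool \<Rightarrow> 'k::comm_ring_1 qrep \<Rightarrow> 'k qrep \<Rightarrow> (nat list \<Rightarrow> 'k mat) \<Rightarrow> bool" where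
  "irreducible_map n p M N f \<longleftrightarrow> is_hom n p M N f \<and> \<not> split_mono n p M N f \<and> \<not> split_epi n p M N f \<and>
     (\<forall>X h g. is_hom n p M X h \<longrightarrow> is_hom n p X N g \<longrightarrow> hcomp g h = f \<longrightarrow>
        split_mono n p M X h \<or> split_epi n p X N g)"

text \<open>refl_plus n p M N: N (a representation of the opposite orientation \<not>p) is
  sigma M, i.e. obtained from M by the BGP reflection S^+ at all sinks a of p:
  N_b = M_b at sources b, and at each sink a the sequence
  0 \<rightarrow> N_a \<rightarrow> (direct sum over neighbours b of M_b) \<rightarrow> M_a is exact.
  (This determines sigma M up to isomorphism.)\<close>

definition refl_plus :: "nat \<Rightarrow> bool \<Rightarrow> 'k::field qrep \<Rightarrow> 'k qrep \<Rightarrow> bool" where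
  "refl_plus n p M N \<longleftrightarrow> is_rep n p M \<and> is_rep n (\<not> p) N \<and>
     (\<forall>b. \<not> is_sink p b \<longrightarrow> rdim N b = rdim M b) \<and>
     (\<forall>a. tvert n a \<longrightarrow> is_sink p a \<longrightarrow>
        (\<forall>w \<in> carrier_vec (rdim N a).
            finsum_vec TYPE('k) (rdim M a) (\<lambda>b. rmap M b a *\<^sub>v (rmap N a b *\<^sub>v w)) (nbrs n a)
              = 0\<^sub>v (rdim M a)) \<and>
        (\<forall>w \<in> carrier_vec (rdim N a).
            (\<forall>b \<in> nbrs n a. rmap N a b *\<^sub>v w = 0\<^sub>v (rdim M b)) \<longrightarrow> w = 0\<^sub>v (rdim N a)) \<and>
        (\<forall>v. (\<forall>b \<in> nbrs n a. v b \<in> carrier_vec (rdim M b)) \<longrightarrow>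
            finsum_vec TYPE('k) (rdim M a) (\<lambda>b. rmap M b a *\<^sub>v v b) (nbrs n a) = 0\<^sub>v (rdim M a) \<longrightarrow>
            (\<exists>w \<in> carrier_vec (rdim N a). \<forall>b \<in> nbrs n a. rmap N a b *\<^sub>v w = v b)))"

text \<open>refl_minus n p M N: N is sigma^- M, obtained from M by the reflection S^- at all
  sources a of p: N_b = M_b at sinks b, and at each source a the sequence
  M_a \<rightarrow> (direct sum over neighbours b of M_b) \<rightarrow> N_a \<rightarrow> 0 is exact.\<close>

definition refl_minus :: "nat \<Rightarrow> bool \<Rightarrow> 'k::field qrep \<Rightarrow> 'k qrep \<Rightarrow> bool" where
  "refl_minus n p M N \<longleftrightarrow> is_rep n p M \<and> is_rep n (\<not> p) N \<and>
     (\<forall>b. is_sink p b \<longrightarrow> rdim N b = rdim M b) \<and>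
     (\<forall>a. tvert n a \<longrightarrow> \<not> is_sink p a \<longrightarrow>
        (\<forall>w \<in> carrier_vec (rdim M a).
            finsum_vec TYPE('k) (rdim N a) (\<lambda>b. rmap N b a *\<^sub>v (rmap M a b *\<^sub>v w)) (nbrs n a)
              = 0\<^sub>v (rdim N a)) \<and>
        (\<forall>u \<in> carrier_vec (rdim N a). \<exists>v. (\<forall>b \<in> nbrs n a. v b \<in> carrier_vec (rdim M b)) \<and>
            finsum_vec TYPE('k) (rdim N a) (\<lambda>b. rmap N b a *\<^sub>v v b) (nbrs n a) = u) \<and>
        (\<forall>v. (\<forall>b \<in> nbrs n a. v b \<in> carrier_vec (rdim M b)) \<longrightarrow>
            finsum_vec TYPE('k) (rdim N a) (\<lambda>b. rmap N b a *\<^sub>v v b) (nbrs n a) = 0\<^sub>v (rdim N a) \<longrightarrow>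
            (\<exists>w \<in> carrier_vec (rdim M a). \<forall>b \<in> nbrs n a. v b = rmap M a b *\<^sub>v w)))"

text \<open>shifts n p M t q N: M is a representation of orientation p and N is (a model of)
  sigma^t M, a representation of orientation q; sigma^t = (sigma^-)^(-t) for t < 0.\<close>

inductive shifts :: "nat \<Rightarrow> bool \<Rightarrow> 'k::field qrep \<Rightarrow> int \<Rightarrow> bool \<Rightarrow> 'k qrep \<Rightarrow> bool"
  for n p M where
  base: "is_rep n p M \<Longrightarrow> shifts n p M 0 p M"
| fwd: "shifts n p M t q N \<Longrightarrow> 0 \<le> t \<Longrightarrow> refl_plus n q N N' \<Longrightarrow> shifts n p M (t + 1) (\<not> q) N'"
| bwd: "shifts n p M t q N \<Longrightarrow> t \<le> 0 \<Longrightarrow> refl_minus n q N N' \<Longrightarrow> shifts n p M (t - 1) (\<not> q) N'"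

definition regular :: "nat \<Rightarrow> bool \<Rightarrow> 'k::field qrep \<Rightarrow> bool" where
  "regular n p M \<longleftrightarrow> indecomposable n p M \<and>
     (\<forall>t q N. shifts n p M t q N \<longrightarrow> \<not> is_zero_rep N)"

definition supp :: "'k qrep \<Rightarrow> nat list set" where
  "supp M = {x. rdim M x \<noteq> 0}"

definition supp_path :: "nat \<Rightarrow> 'k qrep \<Rightarrow> nat list list \<Rightarrow> bool" where
  "supp_path n M ps \<longleftrightarrow> ps \<noteq> [] \<and> distinct ps \<and> set ps \<subseteq> supp M \<and>
     (\<forall>j. Suc j < length ps \<longrightarrow> tadj n (ps ! j) (ps ! Suc j))"

definition diam :: "nat \<Rightarrow> 'k qrep \<Rightarrow> nat" where
  "diam n M = Max {length ps - 1 | ps. supp_path n M ps}"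

definition radius :: "nat \<Rightarrow> 'k qrep \<Rightarrow> nat" where
  "radius n M = diam n M div 2"

definition diam_path :: "nat \<Rightarrow> 'k qrep \<Rightarrow> nat list list \<Rightarrow> bool" where
  "diam_path n M ps \<longleftrightarrow> supp_path n M ps \<and> length ps - 1 = diam n M"

definition sink_module :: "nat \<Rightarrow> bool \<Rightarrow> 'k qrep \<Rightarrow> bool" where
  "sink_module n q M \<longleftrightarrow> (\<forall>ps. diam_path n M ps \<longrightarrow> is_sink q (hd ps) \<and> is_sink q (last ps))"

definition is_M0 :: "nat \<Rightarrow> bool \<Rightarrow> 'k::field qrep \<Rightarrow> bool \<Rightarrow> 'k qrep \<Rightarrow> bool" where
  "is_M0 n p M q0 M0 \<longleftrightarrow> (\<exists>s. shifts n p M s q0 M0) \<and> sink_module n q0 M0 \<and>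
     (\<forall>s q N. shifts n p M s q N \<longrightarrow> sink_module n q N \<longrightarrow> radius n M0 \<le> radius n N)"

definition index_rel :: "nat \<Rightarrow> bool \<Rightarrow> 'k::field qrep \<Rightarrow> int \<Rightarrow> bool" where
  "index_rel n p M t \<longleftrightarrow> (\<exists>q0 M0 N. is_M0 n p M q0 M0 \<and> shifts n q0 M0 t p N \<and> is_iso n p M N)"

definition iota :: "nat \<Rightarrow> bool \<Rightarrow> 'k::field qrep \<Rightarrow> int" where
  "iota n p M = (THE t. index_rel n p M t)"

end

theory Submission
  imports Defs "Jordan_Normal_Form.Determinant"
begin

text \<open>Let \<open>X\<^sub>s\<close>, \<open>Y\<^sub>s\<close> be the shift orbits of \<open>M = X\<^sub>0\<close> and \<open>M' = Y\<^sub>0\<close>. The sink modules of an orbit are exactly the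
  \<open>X\<^sub>s\<close> with \<open>s \<le> s\<^sub>0(X)\<close>, their radius grows by one in each step down, and \<open>\<iota>(M) = - s\<^sub>0(X)\<close>. An irreducible
  map \<open>X\<^sub>s \<rightarrow> Y\<^sub>s\<close> with \<open>Y\<^sub>s\<close> a sink module forces \<open>X\<^bsub>s-1\<^esub>\<close> to be a sink module, by comparing the supports of
  the four modules in the tree; hence \<open>s\<^sub>0(Y) \<le> s\<^sub>0(X) + 1\<close>. The almost split sequence ending in \<open>M'\<close> gives
  an irreducible map \<open>\<sigma>\<^sup>2M' \<rightarrow> M\<close>, to which the same bound applies: \<open>s\<^sub>0(X) \<le> (s\<^sub>0(Y) - 2) + 1\<close>.\<close>

section \<open>Rank factorizations and neighbour sums\<close>

text \<open>The two bounds together use up exactly the two reflections in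
  \<open>\<sigma>\<^sup>2\<close>, which acts as the Auslander-Reiten translation here; this is why
  two one-sided estimates give an equality. Each estimate is read off from supports: a sink module
  is recognised by a center and a radius in the tree, with the parity that makes its farthest points
  sinks. Applying \<open>\<sigma>\<^sup>-\<close> pushes these points outward. Here
  \<open>n \<ge> 3\<close> enters: every vertex has two neighbours leading away from any given
  vertex, so two antipodal points can be pushed apart. Irreducibility acts on supports by factoring
  a map through a module that differs from its source or target at one vertex. Regularity keeps all
  shifts nonzero, and an indecomposable with nonzero reflection is reflected by short exact
  sequences; hence maps, idempotents and irreducible maps can be moved along an orbit in both
  directions. Reflections are determined only up to isomorphism, so one model is chosen for every
  shift, and uniqueness of the index has to exclude that an orbit returns to an isomorphic module
  after a nonzero shift.\<close>

definition rank_fact :: "'i set \<Rightarrow> 'j set \<Rightarrow> ('i \<Rightarrow> 'j \<Rightarrow> 'k::field) \<Rightarrow> nat \<Rightarrow> ('i \<Rightarrow> nat \<Rightarrow> 'k) \<Rightarrow> (nat \<Rightarrow> 'j \<Rightarrow> 'k)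
    \<Rightarrow> (nat \<Rightarrow> 'i \<Rightarrow> 'k) \<Rightarrow> ('j \<Rightarrow> nat \<Rightarrow> 'k) \<Rightarrow> bool" where
  "rank_fact I J A r a b l m \<longleftrightarrow> (\<forall>i\<in>I. \<forall>j\<in>J. A i j = (\<Sum>s<r. a i s * b s j)) \<and>
    (\<forall>s<r. \<forall>t<r. (\<Sum>i\<in>I. l s i * a i t) = (if s = t then 1 else 0)) \<and>
    (\<forall>s<r. \<forall>t<r. (\<Sum>j\<in>J. b s j * m j t) = (if s = t then 1 else 0))"

lemma rank_factD:
  assumes "rank_fact I J A r a b l m"
  shows "\<And>i j. i\<in>I \<Longrightarrow> j\<in>J \<Longrightarrow> A i j = (\<Sum>s<r. a i s * b s j)"
    "\<And>s t. s<r \<Longrightarrow> t<r \<Longrightarrow> (\<Sum>i\<in>I. l s i * a i t) = (if s = t then 1 else 0)"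
    "\<And>s t. s<r \<Longrightarrow> t<r \<Longrightarrow> (\<Sum>j\<in>J. b s j * m j t) = (if s = t then 1 else 0)"
  using assms unfolding rank_fact_def by blast+

lemma mult_indicator:
  fixes a :: "'k::semiring_1"
  shows "a * (if Q then 1 else 0) = (if Q then a else 0)" "(if Q then 1 else 0) * a = (if Q then a else 0)"
  by auto

text \<open>Induction over the columns. In \<open>A = a * b\<close> the matrix \<open>l\<close> is a
  left inverse of \<open>a\<close> and \<open>m\<close> a right inverse of \<open>b\<close>. A new
  column either lies in the span of \<open>a\<close>, and then only \<open>b\<close> is extended, or
  its remainder is appended to \<open>a\<close>. The index sets are arbitrary finite sets because
  later a column is a pair of a neighbour and a coordinate.\<close>

lemma rank_factorization:
  fixes A :: "'i \<Rightarrow> 'j \<Rightarrow> 'k::field"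
  assumes I: "finite I" and J: "finite J"
  shows "\<exists>r a b l m. rank_fact I J A r a b l m"
  using J
proof (induction J rule: finite_induct)
  case empty
  show ?case by (intro exI[of _ 0]) (simp add: rank_fact_def)
next
  case (insert x J)
  then obtain r a b l m where RF: "rank_fact I J A r a b l m" by blast
  note ab = rank_factD(1)[OF RF] and la = rank_factD(2)[OF RF] and bm = rank_factD(3)[OF RF]
  define y where "y s = (\<Sum>i\<in>I. l s i * A i x)" for s
  \<comment> \<open>\<open>y\<close> gives the coordinates of the new column along \<open>a\<close>
    as read off by \<open>l\<close>, and \<open>c\<close> is the remainder, which \<open>l\<close>
    annihilates.\<close>
  define c where "c i = A i x - (\<Sum>s<r. a i s * y s)" for i
  have lc: "(\<Sum>i\<in>I. l s i * c i) = 0" if "s < r" for s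
  proof -
    have "(\<Sum>i\<in>I. l s i * c i) = y s - (\<Sum>i\<in>I. \<Sum>t<r. l s i * a i t * y t)"
      by (simp add: c_def y_def right_diff_distrib sum_subtractf sum_distrib_left mult.assoc)
    also have "(\<Sum>i\<in>I. \<Sum>t<r. l s i * a i t * y t) = (\<Sum>t<r. (\<Sum>i\<in>I. l s i * a i t) * y t)"
      by (subst sum.swap) (simp add: sum_distrib_right)
    also have "\<dots> = (\<Sum>t<r. if s = t then y t else 0)"
      by (rule sum.cong) (auto simp: la that)
    also have "\<dots> = y s" using that by simp
    finally show ?thesis by simp
  qed
  have nx: "x \<notin> J" "finite J" using insert by auto
  show ?case
  proof (cases "\<forall>i\<in>I. c i = 0")
    case True
    define b' where "b' s j = (if j = x then y s else b s j)" for s j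
    define m' where "m' j t = (if j = x then 0 else m j t)" for j t
    have "A i j = (\<Sum>s<r. a i s * b' s j)" if "i \<in> I" "j \<in> insert x J" for i j
    proof (cases "j = x")
      case True then show ?thesis using \<open>\<forall>i\<in>I. c i = 0\<close> that by (simp add: c_def b'_def)
    next
      case False then show ?thesis using ab that by (simp add: b'_def)
    qed
    moreover have "(\<Sum>j\<in>insert x J. b' s j * m' j t) = (if s = t then 1 else 0)" if "s<r" "t<r" for s t
    proof -
      have "(\<Sum>j\<in>J. b' s j * m' j t) = (\<Sum>j\<in>J. b s j * m j t)"
        using nx by (intro sum.cong) (auto simp: b'_def m'_def)
      then show ?thesis using nx bm that by (simp add: m'_def)
    qed
    ultimately have "rank_fact I (insert x J) A r a b' l m'"
      unfolding rank_fact_def using la by blast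
    then show ?thesis by blast
  next
    case False
    then obtain k where k: "k \<in> I" "c k \<noteq> 0" by blast
    define a' where "a' i s = (if s < r then a i s else c i)" for i s
    define b' where "b' s j = (if s < r then (if j = x then y s else b s j) else (if j = x then 1 else 0))" for s j
    \<comment> \<open>The new functional is the unit functional at \<open>k\<close> minus its part
      on the span of the old columns, scaled to take the value 1 on \<open>c\<close>.\<close>
    define l' where "l' s i = (if s < r then l s i else ((if i = k then 1 else 0) - (\<Sum>t<r. a k t * l t i)) / c k)" for s i
    \<comment> \<open>The last column of \<open>m'\<close> is corrected so that the entries
      \<open>y\<close> in the earlier rows of \<open>b'\<close> cancel.\<close>
    define m' where "m' j t = (if t < r then (if j = x then 0 else m j t) else (if j = x then 1 else - (\<Sum>s<r. m j s * y s)))" for j t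
    have 1: "A i j = (\<Sum>s<Suc r. a' i s * b' s j)" if "i \<in> I" "j \<in> insert x J" for i j
    proof (cases "j = x")
      case True then show ?thesis by (simp add: a'_def b'_def c_def)
    next
      case False then show ?thesis using ab that by (simp add: a'_def b'_def)
    qed
    have row: "(\<Sum>i\<in>I. l' r i * z i) = (z k - (\<Sum>t<r. a k t * (\<Sum>i\<in>I. l t i * z i))) / c k" for z
    proof -
      have "(\<Sum>i\<in>I. l' r i * z i) = (\<Sum>i\<in>I. ((if i = k then z i else 0) - (\<Sum>t<r. a k t * l t i * z i)) / c k)"
        by (intro sum.cong) (auto simp: l'_def left_diff_distrib sum_distrib_right)
      also have "\<dots> = ((\<Sum>i\<in>I. if i = k then z i else 0) - (\<Sum>i\<in>I. \<Sum>t<r. a k t * l t i * z i)) / c k"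
        by (simp add: sum_divide_distrib[symmetric] sum_subtractf)
      also have "(\<Sum>i\<in>I. if i = k then z i else 0) = z k" using k I by simp
      also have "(\<Sum>i\<in>I. \<Sum>t<r. a k t * l t i * z i) = (\<Sum>t<r. a k t * (\<Sum>i\<in>I. l t i * z i))"
        by (subst sum.swap) (simp add: sum_distrib_left mult.assoc)
      finally show ?thesis .
    qed
    have 2: "(\<Sum>i\<in>I. l' s i * a' i t) = (if s = t then 1 else 0)" if st: "s < Suc r" "t < Suc r" for s t
    proof -
      consider "s < r" "t < r" | "s < r" "t = r" | "s = r" "t < r" | "s = r" "t = r" using st by linarith
      then show ?thesis
      proof cases
        case 1 then show ?thesis using la by (simp add: l'_def a'_def)
      next
        case 2 then show ?thesis using lc by (simp add: l'_def a'_def)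
      next
        case 3
        have "(\<Sum>u<r. a k u * (\<Sum>i\<in>I. l u i * a i t)) = (\<Sum>u<r. if u = t then a k u else 0)"
          using 3 la by (intro sum.cong) auto
        then show ?thesis using 3 row[of "\<lambda>i. a i t"] by (simp add: a'_def)
      next
        case 4
        then show ?thesis using row[of c] lc k by (simp add: a'_def)
      qed
    qed
    have 3: "(\<Sum>j\<in>insert x J. b' s j * m' j t) = (if s = t then 1 else 0)" if st: "s < Suc r" "t < Suc r" for s t
    proof -
      have e: "(\<Sum>j\<in>J. b' s j * m' j t) = (\<Sum>j\<in>J. (if s < r then b s j else 0) * (if t < r then m j t else - (\<Sum>s<r. m j s * y s)))"
        using nx by (intro sum.cong) (auto simp: b'_def m'_def)
      consider "s < r" "t < r" | "s < r" "t = r" | "s = r" "t < r" | "s = r" "t = r" using st by linarith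
      then show ?thesis
      proof cases
        case 1 then show ?thesis using bm nx e by (simp add: b'_def m'_def)
      next
        case 2
        have "(\<Sum>j\<in>J. b s j * (\<Sum>u<r. m j u * y u)) = (\<Sum>j\<in>J. \<Sum>u<r. b s j * m j u * y u)"
          by (simp add: sum_distrib_left mult.assoc)
        also have "\<dots> = (\<Sum>u<r. (\<Sum>j\<in>J. b s j * m j u) * y u)"
          by (subst sum.swap) (simp add: sum_distrib_right)
        also have "\<dots> = (\<Sum>u<r. if s = u then y u else 0)"
          by (intro sum.cong) (auto simp: bm 2)
        also have "\<dots> = y s" using 2 by simp
        finally show ?thesis using nx e 2 by (simp add: b'_def m'_def sum_negf)
      next
        case 3 then show ?thesis using nx e by (simp add: b'_def m'_def)
      next
        case 4 then show ?thesis using nx e by (simp add: b'_def m'_def)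
      qed
    qed
    have "rank_fact I (insert x J) A (Suc r) a' b' l' m'"
      unfolding rank_fact_def by (intro conjI ballI allI impI) (rule 1 2 3; assumption)+
    then show ?thesis by blast
  qed
qed

text \<open>With \<open>A = a * b\<close> take \<open>G = m * l\<close>; then
  \<open>A * G * A = a * (b * m) * (l * a) * b = A\<close>. The projections \<open>1 - G * A\<close>
  and \<open>1 - A * G\<close> built from it yield the kernels, cokernels and complements
  below.\<close>

lemma generalized_inverse:
  fixes A :: "'i \<Rightarrow> 'j \<Rightarrow> 'k::field"
  assumes "finite I" "finite J"
  shows "\<exists>G. \<forall>i\<in>I. \<forall>j\<in>J. (\<Sum>x\<in>J. A i x * (\<Sum>y\<in>I. G x y * A y j)) = A i j"
proof -
  obtain r a b l m where RF: "rank_fact I J A r a b l m"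
    using rank_factorization[OF assms, of A] by blast
  note ab = rank_factD(1)[OF RF] and la = rank_factD(2)[OF RF] and bm = rank_factD(3)[OF RF]
  define G where "G x y = (\<Sum>s<r. m x s * l s y)" for x y
  have lA: "(\<Sum>y\<in>I. l s y * A y j) = b s j" if "s < r" "j \<in> J" for s j
  proof -
    have "(\<Sum>y\<in>I. l s y * A y j) = (\<Sum>y\<in>I. \<Sum>t<r. l s y * a y t * b t j)"
      using ab that by (simp add: sum_distrib_left mult.assoc)
    also have "\<dots> = (\<Sum>t<r. (\<Sum>y\<in>I. l s y * a y t) * b t j)"
      by (subst sum.swap) (simp add: sum_distrib_right)
    also have "\<dots> = (\<Sum>t<r. if s = t then b t j else 0)"
      by (intro sum.cong) (auto simp: la that)
    finally show ?thesis using that by simp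
  qed
  have Am: "(\<Sum>x\<in>J. A i x * m x s) = a i s" if "s < r" "i \<in> I" for s i
  proof -
    have "(\<Sum>x\<in>J. A i x * m x s) = (\<Sum>x\<in>J. \<Sum>t<r. a i t * (b t x * m x s))"
      using ab that by (simp add: sum_distrib_right mult.assoc)
    also have "\<dots> = (\<Sum>t<r. a i t * (\<Sum>x\<in>J. b t x * m x s))"
      by (subst sum.swap) (simp add: sum_distrib_left)
    also have "\<dots> = (\<Sum>t<r. if t = s then a i t else 0)"
      by (intro sum.cong) (auto simp: bm that)
    finally show ?thesis using that by simp
  qed
  have "(\<Sum>x\<in>J. A i x * (\<Sum>y\<in>I. G x y * A y j)) = A i j" if ij: "i\<in>I" "j\<in>J" for i j
  proof -
    have "(\<Sum>y\<in>I. G x y * A y j) = (\<Sum>s<r. m x s * b s j)" for x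
    proof -
      have "(\<Sum>y\<in>I. G x y * A y j) = (\<Sum>y\<in>I. \<Sum>s<r. m x s * (l s y * A y j))"
        by (simp add: G_def sum_distrib_right mult.assoc)
      also have "\<dots> = (\<Sum>s<r. m x s * (\<Sum>y\<in>I. l s y * A y j))"
        by (subst sum.swap) (simp add: sum_distrib_left)
      finally show ?thesis using lA ij by simp
    qed
    then have "(\<Sum>x\<in>J. A i x * (\<Sum>y\<in>I. G x y * A y j)) = (\<Sum>x\<in>J. \<Sum>s<r. (A i x * m x s) * b s j)"
      by (simp add: sum_distrib_left mult.assoc)
    also have "\<dots> = (\<Sum>s<r. (\<Sum>x\<in>J. A i x * m x s) * b s j)"
      by (subst sum.swap) (simp add: sum_distrib_right)
    finally show ?thesis using Am ij ab by simp
  qed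
  then show ?thesis by blast
qed

text \<open>The side conditions are equations between dimensions, which the simplifier can
  discharge; the carrier form leaves the dimensions to be guessed.\<close>

lemma mat_assoc:
  fixes C :: "'a::semiring_0 mat"
  shows "dim_col A = dim_row B \<Longrightarrow> dim_col B = dim_row C \<Longrightarrow> (A * B) * C = A * (B * C)"
  by (rule assoc_mult_mat[of _ "dim_row A" "dim_col A" _ "dim_col B" _ "dim_col C"]) (rule carrier_matI; simp)+

text \<open>Factor \<open>E\<close> as \<open>i * p\<close> of full rank. The one-sided inverses
  \<open>L\<close> and \<open>R\<close> give \<open>p * i = L * E * E * R = L * E * R\<close>, and
  the last product is the identity.\<close>

lemma idempotent_split:
  fixes E :: "'k::field mat"
  assumes E: "E \<in> carrier_mat n n" "E * E = E"
  shows "\<exists>r i p. i \<in> carrier_mat n r \<and> p \<in> carrier_mat r n \<and> i * p = E \<and> p * i = 1\<^sub>m r"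
proof -
  define E' where "E' i j = E $$ (i,j)" for i j
  obtain r a b l m where RF: "rank_fact {..<n} {..<n} E' r a b l m"
    using rank_factorization[of "{..<n}" "{..<n}" E'] by blast
  note ab = rank_factD(1)[OF RF] and la = rank_factD(2)[OF RF] and bm = rank_factD(3)[OF RF]
  define i p L R where "i = mat n r (\<lambda>(x,s). a x s)" and "p = mat r n (\<lambda>(s,x). b s x)"
    and "L = mat r n (\<lambda>(s,x). l s x)" and "R = mat n r (\<lambda>(x,s). m x s)"
  have c: "i \<in> carrier_mat n r" "p \<in> carrier_mat r n" "L \<in> carrier_mat r n" "R \<in> carrier_mat n r"
    by (auto simp: i_def p_def L_def R_def)
  have ip: "i * p = E" using E(1) ab
    by (intro eq_matI) (auto simp: i_def p_def scalar_prod_def atLeast0LessThan E'_def)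
  have Li: "L * i = 1\<^sub>m r" using la
    by (intro eq_matI) (auto simp: i_def L_def scalar_prod_def atLeast0LessThan)
  have pR: "p * R = 1\<^sub>m r" using bm
    by (intro eq_matI) (auto simp: p_def R_def scalar_prod_def atLeast0LessThan)
  have "p * i = (L * i) * (p * i) * (p * R)" using c by (simp add: Li pR)
  also have "\<dots> = L * ((i * p) * (i * p)) * R" using c by (simp add: mat_assoc)
  also have "\<dots> = L * (i * p) * R" by (simp add: ip E)
  also have "\<dots> = (L * i) * (p * R)" using c by (simp add: mat_assoc)
  finally have "p * i = 1\<^sub>m r" by (simp add: Li pR)
  then show ?thesis using c ip by blast
qed

section \<open>The map from a neighbour sum: kernel, cokernel and factorization\<close>

text \<open>Turns the family \<open>R\<close> into one matrix whose columns are indexed by pairs of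
  a neighbour and a coordinate, the form in which a generalized inverse is available.\<close>

lemma finsum_vec_mult_index:
  fixes R :: "'b \<Rightarrow> 'k::field mat"
  assumes "finite B" "\<And>b. b \<in> B \<Longrightarrow> R b \<in> carrier_mat d (e b)"
    "\<And>b. b \<in> B \<Longrightarrow> v b \<in> carrier_vec (e b)" "i < d"
  shows "finsum_vec TYPE('k) d (\<lambda>b. R b *\<^sub>v v b) B $ i
    = (\<Sum>(b,j)\<in>Sigma B (\<lambda>b. {..<e b}). R b $$ (i,j) * v b $ j)"
proof -
  have "finsum_vec TYPE('k) d (\<lambda>b. R b *\<^sub>v v b) B $ i = (\<Sum>b\<in>B. (R b *\<^sub>v v b) $ i)"
    by (rule index_finsum_vec) (use assms mult_mat_vec_carrier in blast)+
  also have "\<dots> = (\<Sum>b\<in>B. \<Sum>j<e b. R b $$ (i,j) * v b $ j)"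
    using assms(2-4) by (intro sum.cong refl) (fastforce simp: scalar_prod_def atLeast0LessThan)
  also have "\<dots> = (\<Sum>(b,j)\<in>Sigma B (\<lambda>b. {..<e b}). R b $$ (i,j) * v b $ j)"
    using assms(1) by (intro sum.Sigma) auto
  finally show ?thesis .
qed

lemma finsum_vec_mult_carrier:
  fixes R :: "'b \<Rightarrow> 'k::field mat"
  assumes "\<And>b. b \<in> B \<Longrightarrow> R b \<in> carrier_mat d (e b)" "\<And>b. b \<in> B \<Longrightarrow> v b \<in> carrier_vec (e b)"
  shows "finsum_vec TYPE('k) d (\<lambda>b. R b *\<^sub>v v b) B \<in> carrier_vec d"
proof (rule finsum_vec_closed, rule Pi_I)
  fix b assume "b \<in> B"
  with assms show "R b *\<^sub>v v b \<in> carrier_vec d" by (metis mult_mat_vec_carrier)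
qed

text \<open>\<open>P = 1 - G * A\<close> is a projection onto the kernel of the flattened matrix
  \<open>A\<close>, so the factor \<open>a\<close> of its rank factorization has a basis of the
  kernel as its columns. \<open>K\<close> cuts \<open>a\<close> into blocks, one for each
  neighbour.\<close>

lemma neighbour_sum_kernel:
  fixes R :: "'b \<Rightarrow> 'k::field mat"
  assumes B: "finite B" and R: "\<And>b. b \<in> B \<Longrightarrow> R b \<in> carrier_mat d (e b)"
  shows "\<exists>r K. (\<forall>b\<in>B. K b \<in> carrier_mat (e b) r) \<and>
    (\<forall>w\<in>carrier_vec r. finsum_vec TYPE('k) d (\<lambda>b. R b *\<^sub>v (K b *\<^sub>v w)) B = 0\<^sub>v d) \<and>
    (\<forall>w\<in>carrier_vec r. (\<forall>b\<in>B. K b *\<^sub>v w = 0\<^sub>v (e b)) \<longrightarrow> w = 0\<^sub>v r) \<and>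
    (\<forall>v. (\<forall>b\<in>B. v b \<in> carrier_vec (e b)) \<longrightarrow> finsum_vec TYPE('k) d (\<lambda>b. R b *\<^sub>v v b) B = 0\<^sub>v d \<longrightarrow>
      (\<exists>w\<in>carrier_vec r. \<forall>b\<in>B. K b *\<^sub>v w = v b))"
proof -
  define J where "J = Sigma B (\<lambda>b. {..<e b})"
  have J: "finite J" using B by (auto simp: J_def)
  define A where "A i x = R (fst x) $$ (i, snd x)" for i x
  obtain G where G: "\<And>i j. i<d \<Longrightarrow> j\<in>J \<Longrightarrow> (\<Sum>x\<in>J. A i x * (\<Sum>y<d. G x y * A y j)) = A i j"
    using generalized_inverse[of "{..<d}" J A] J by auto
  define P where "P x y = (if x = y then 1 else 0) - (\<Sum>i<d. G x i * A i y)" for x y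
  have AP: "(\<Sum>x\<in>J. A i x * P x y) = 0" if "i < d" "y \<in> J" for i y
  proof -
    have "(\<Sum>x\<in>J. A i x * P x y) = (\<Sum>x\<in>J. if x = y then A i x else 0) - (\<Sum>x\<in>J. A i x * (\<Sum>z<d. G x z * A z y))"
      by (simp add: P_def right_diff_distrib sum_subtractf mult_indicator)
    then show ?thesis using that J G by simp
  qed
  obtain r a b l m where RF: "rank_fact J J P r a b l m"
    using rank_factorization[OF J J, of P] by blast
  note ab = rank_factD(1)[OF RF] and la = rank_factD(2)[OF RF] and bm = rank_factD(3)[OF RF]
  have aP: "a x s = (\<Sum>y\<in>J. P x y * m y s)" if "x \<in> J" "s < r" for x s
  proof -
    have "(\<Sum>y\<in>J. P x y * m y s) = (\<Sum>y\<in>J. \<Sum>t<r. a x t * (b t y * m y s))"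
      using ab that by (simp add: sum_distrib_right mult.assoc)
    also have "\<dots> = (\<Sum>t<r. a x t * (\<Sum>y\<in>J. b t y * m y s))"
      by (subst sum.swap) (simp add: sum_distrib_left)
    also have "\<dots> = (\<Sum>t<r. if t = s then a x t else 0)"
      by (intro sum.cong) (auto simp: bm that)
    finally show ?thesis using that by simp
  qed
  have Aa: "(\<Sum>x\<in>J. A i x * a x s) = 0" if "i < d" "s < r" for i s
  proof -
    have "(\<Sum>x\<in>J. A i x * a x s) = (\<Sum>x\<in>J. \<Sum>y\<in>J. A i x * P x y * m y s)"
      using aP that by (simp add: sum_distrib_left mult.assoc)
    also have "\<dots> = (\<Sum>y\<in>J. (\<Sum>x\<in>J. A i x * P x y) * m y s)"
      by (subst sum.swap) (simp add: sum_distrib_right)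
    finally show ?thesis using AP that by simp
  qed
  define K where "K b = mat (e b) r (\<lambda>(j,s). a (b,j) s)" for b
  have K: "K b \<in> carrier_mat (e b) r" for b by (simp add: K_def)
  have Kw: "(K b *\<^sub>v w) $ j = (\<Sum>s<r. a (b,j) s * w $ s)" if "w \<in> carrier_vec r" "j < e b" for b w j
    using that by (auto simp: K_def scalar_prod_def atLeast0LessThan)
  have 1: "finsum_vec TYPE('k) d (\<lambda>b. R b *\<^sub>v (K b *\<^sub>v w)) B = 0\<^sub>v d" if w: "w\<in>carrier_vec r" for w
  proof (rule eq_vecI)
    have Kc: "K b *\<^sub>v w \<in> carrier_vec (e b)" for b using K w by (rule mult_mat_vec_carrier)
    show "dim_vec (finsum_vec TYPE('k) d (\<lambda>b. R b *\<^sub>v (K b *\<^sub>v w)) B) = dim_vec (0\<^sub>v d)"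
      using carrier_vecD[OF finsum_vec_mult_carrier[of B R d e "\<lambda>b. K b *\<^sub>v w"]] R Kc by simp
    fix i assume "i < dim_vec (0\<^sub>v d :: 'k vec)"
    then have i: "i < d" by simp
    have "finsum_vec TYPE('k) d (\<lambda>b. R b *\<^sub>v (K b *\<^sub>v w)) B $ i = (\<Sum>(b,j)\<in>J. R b $$ (i,j) * (K b *\<^sub>v w) $ j)"
      unfolding J_def using finsum_vec_mult_index[of B R d e "\<lambda>b. K b *\<^sub>v w" i] B R Kc i by simp
    also have "\<dots> = (\<Sum>x\<in>J. \<Sum>s<r. A i x * a x s * w $ s)"
      by (intro sum.cong) (auto simp: J_def Kw[OF w] A_def sum_distrib_left mult.assoc)
    also have "\<dots> = (\<Sum>s<r. (\<Sum>x\<in>J. A i x * a x s) * w $ s)"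
      by (subst sum.swap) (simp add: sum_distrib_right)
    also have "\<dots> = 0" using Aa i by simp
    finally show "finsum_vec TYPE('k) d (\<lambda>b. R b *\<^sub>v (K b *\<^sub>v w)) B $ i = 0\<^sub>v d $ i" using i by simp
  qed
  have 2: "w = 0\<^sub>v r" if w: "w\<in>carrier_vec r" and z: "\<forall>b\<in>B. K b *\<^sub>v w = 0\<^sub>v (e b)" for w
  proof (rule eq_vecI)
    fix s assume "s < dim_vec (0\<^sub>v r :: 'k vec)" then have s: "s < r" by simp
    have zz: "(\<Sum>t<r. a x t * w $ t) = 0" if xJ: "x \<in> J" for x
    proof -
      obtain b j where x: "x = (b,j)" "b \<in> B" "j < e b" using xJ by (auto simp: J_def)
      then show ?thesis using Kw[OF w, of j b] z by simp
    qed
    have "w $ s = (\<Sum>t<r. if s = t then w $ t else 0)" using s by simp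
    also have "\<dots> = (\<Sum>t<r. (\<Sum>i\<in>J. l s i * a i t) * w $ t)" using la s by (intro sum.cong) auto
    also have "\<dots> = (\<Sum>i\<in>J. l s i * (\<Sum>t<r. a i t * w $ t))"
      by (simp add: sum_distrib_right sum_distrib_left mult.assoc) (rule sum.swap)
    also have "\<dots> = 0" using zz by simp
    finally show "w $ s = 0\<^sub>v r $ s" using s by simp
  qed (use w in simp)
  have 3: "\<exists>w\<in>carrier_vec r. \<forall>b\<in>B. K b *\<^sub>v w = v b"
    if v: "\<forall>b\<in>B. v b \<in> carrier_vec (e b)" and z: "finsum_vec TYPE('k) d (\<lambda>b. R b *\<^sub>v v b) B = 0\<^sub>v d" for v
  proof -
    define V where "V x = v (fst x) $ snd x" for x
    have AV: "(\<Sum>x\<in>J. A i x * V x) = 0" if "i < d" for i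
    proof -
      have "(\<Sum>x\<in>J. A i x * V x) = finsum_vec TYPE('k) d (\<lambda>b. R b *\<^sub>v v b) B $ i"
        unfolding J_def using finsum_vec_mult_index[of B R d e v i] B R v that
        by (simp add: A_def V_def case_prod_unfold)
      then show ?thesis using z that by simp
    qed
    \<comment> \<open>The coordinates of a kernel element \<open>V\<close> are given by the other
      factor, because \<open>P\<close> fixes \<open>V\<close>.\<close>
    define w where "w = vec r (\<lambda>s. \<Sum>y\<in>J. b s y * V y)"
    have "K c *\<^sub>v w = v c" if c: "c \<in> B" for c
    proof (rule eq_vecI)
      fix j assume "j < dim_vec (v c)"
      then have j: "j < e c" using carrier_vecD[OF bspec[OF v c]] by simp
      then have cj: "(c,j) \<in> J" using c by (simp add: J_def)
      have "(K c *\<^sub>v w) $ j = (\<Sum>s<r. a (c,j) s * (\<Sum>y\<in>J. b s y * V y))"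
        using Kw[of w j c] j by (simp add: w_def)
      also have "\<dots> = (\<Sum>y\<in>J. P (c,j) y * V y)"
        using ab[OF cj] by (simp add: sum_distrib_left sum_distrib_right mult.assoc) (rule sum.swap)
      also have "\<dots> = (\<Sum>y\<in>J. if (c,j) = y then V y else 0) - (\<Sum>y\<in>J. \<Sum>i<d. G (c,j) i * (A i y * V y))"
        by (simp add: P_def left_diff_distrib sum_subtractf sum_distrib_right mult.assoc mult_indicator)
      also have "(\<Sum>y\<in>J. \<Sum>i<d. G (c,j) i * (A i y * V y)) = (\<Sum>i<d. G (c,j) i * (\<Sum>y\<in>J. A i y * V y))"
        by (subst sum.swap) (simp add: sum_distrib_left)
      also have "\<dots> = 0" using AV by simp
      finally show "(K c *\<^sub>v w) $ j = v c $ j" using cj J by (simp add: V_def)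
    qed (use bspec[OF v c] in \<open>auto simp: K_def\<close>)
    then show ?thesis by (intro bexI[of _ w]) (auto simp: w_def)
  qed
  show ?thesis by (intro exI[of _ r] exI[of _ K]) (use K 1 2 3 in auto)
qed

text \<open>The dual construction: \<open>P = 1 - A * G\<close> has the image of \<open>A\<close> as
  its kernel, so the factor \<open>b\<close> of its rank factorization is a cokernel map. Its right
  inverse \<open>m\<close> provides preimages, and \<open>P * V = 0\<close> exhibits
  \<open>V\<close> as \<open>A * (G * V)\<close>.\<close>

lemma neighbour_sum_cokernel:
  fixes C :: "'b \<Rightarrow> 'k::field mat"
  assumes B: "finite B" and C: "\<And>b. b \<in> B \<Longrightarrow> C b \<in> carrier_mat (e b) d"
  shows "\<exists>r Q. (\<forall>b\<in>B. Q b \<in> carrier_mat r (e b)) \<and>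
    (\<forall>w\<in>carrier_vec d. finsum_vec TYPE('k) r (\<lambda>b. Q b *\<^sub>v (C b *\<^sub>v w)) B = 0\<^sub>v r) \<and>
    (\<forall>u\<in>carrier_vec r. \<exists>v. (\<forall>b\<in>B. v b \<in> carrier_vec (e b)) \<and> finsum_vec TYPE('k) r (\<lambda>b. Q b *\<^sub>v v b) B = u) \<and>
    (\<forall>v. (\<forall>b\<in>B. v b \<in> carrier_vec (e b)) \<longrightarrow> finsum_vec TYPE('k) r (\<lambda>b. Q b *\<^sub>v v b) B = 0\<^sub>v r \<longrightarrow>
      (\<exists>w\<in>carrier_vec d. \<forall>b\<in>B. v b = C b *\<^sub>v w))"
proof -
  define J where "J = Sigma B (\<lambda>b. {..<e b})"
  have J: "finite J" using B by (auto simp: J_def)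
  define A where "A x i = C (fst x) $$ (snd x, i)" for i x
  obtain G where G: "\<And>i j. i\<in>J \<Longrightarrow> j<d \<Longrightarrow> (\<Sum>x<d. A i x * (\<Sum>y\<in>J. G x y * A y j)) = A i j"
    using generalized_inverse[of J "{..<d}" A] J by auto
  define P where "P x y = (if x = y then 1 else 0) - (\<Sum>i<d. A x i * G i y)" for x y
  have PA: "(\<Sum>y\<in>J. P x y * A y i) = 0" if "i < d" "x \<in> J" for i x
  proof -
    have "(\<Sum>y\<in>J. P x y * A y i) = (\<Sum>y\<in>J. if x = y then A y i else 0) - (\<Sum>y\<in>J. \<Sum>z<d. A x z * (G z y * A y i))"
      by (simp add: P_def left_diff_distrib sum_subtractf sum_distrib_right mult.assoc mult_indicator)
    also have "(\<Sum>y\<in>J. \<Sum>z<d. A x z * (G z y * A y i)) = (\<Sum>z<d. A x z * (\<Sum>y\<in>J. G z y * A y i))"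
      by (subst sum.swap) (simp add: sum_distrib_left)
    finally show ?thesis using that J G by simp
  qed
  obtain r a b l m where RF: "rank_fact J J P r a b l m"
    using rank_factorization[OF J J, of P] by blast
  note ab = rank_factD(1)[OF RF] and la = rank_factD(2)[OF RF] and bm = rank_factD(3)[OF RF]
  have bP: "b s y = (\<Sum>x\<in>J. l s x * P x y)" if "y \<in> J" "s < r" for y s
  proof -
    have "(\<Sum>x\<in>J. l s x * P x y) = (\<Sum>x\<in>J. \<Sum>t<r. l s x * a x t * b t y)"
      using ab that by (simp add: sum_distrib_left mult.assoc)
    also have "\<dots> = (\<Sum>t<r. (\<Sum>x\<in>J. l s x * a x t) * b t y)"
      by (subst sum.swap) (simp add: sum_distrib_right)
    also have "\<dots> = (\<Sum>t<r. if s = t then b t y else 0)"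
      by (intro sum.cong) (auto simp: la that)
    finally show ?thesis using that by simp
  qed
  have bA: "(\<Sum>x\<in>J. b s x * A x i) = 0" if "i < d" "s < r" for i s
  proof -
    have "(\<Sum>x\<in>J. b s x * A x i) = (\<Sum>x\<in>J. \<Sum>y\<in>J. l s y * (P y x * A x i))"
      using bP that by (simp add: sum_distrib_right mult.assoc)
    also have "\<dots> = (\<Sum>y\<in>J. l s y * (\<Sum>x\<in>J. P y x * A x i))"
      by (subst sum.swap) (simp add: sum_distrib_left)
    finally show ?thesis using PA that by simp
  qed
  define Q where "Q c = mat r (e c) (\<lambda>(s,j). b s (c,j))" for c
  have Q: "Q c \<in> carrier_mat r (e c)" for c by (simp add: Q_def)
  have Qi: "finsum_vec TYPE('k) r (\<lambda>c. Q c *\<^sub>v v c) B $ s = (\<Sum>x\<in>J. b s x * v (fst x) $ snd x)"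
    if "\<And>c. c\<in>B \<Longrightarrow> v c \<in> carrier_vec (e c)" "s < r" for v s
  proof -
    have "finsum_vec TYPE('k) r (\<lambda>c. Q c *\<^sub>v v c) B $ s = (\<Sum>(c,j)\<in>J. Q c $$ (s,j) * v c $ j)"
      unfolding J_def using finsum_vec_mult_index[of B Q r e v s] B Q that by simp
    also have "\<dots> = (\<Sum>x\<in>J. b s x * v (fst x) $ snd x)"
      using that(2) by (intro sum.cong) (auto simp: J_def Q_def)
    finally show ?thesis .
  qed
  have Qc: "dim_vec (finsum_vec TYPE('k) r (\<lambda>c. Q c *\<^sub>v v c) B) = r"
    if "\<And>c. c\<in>B \<Longrightarrow> v c \<in> carrier_vec (e c)" for v
    using carrier_vecD[OF finsum_vec_mult_carrier[of B Q r e v]] Q that by simp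
  have Cw: "(C c *\<^sub>v w) $ j = (\<Sum>i<d. A (c,j) i * w $ i)" if "c \<in> B" "w \<in> carrier_vec d" "j < e c" for c w j
    using C[OF that(1)] that by (auto simp: A_def scalar_prod_def atLeast0LessThan)
  have Cwc: "C c *\<^sub>v w \<in> carrier_vec (e c)" if "c \<in> B" "w \<in> carrier_vec d" for c w
    using C that by (auto intro!: mult_mat_vec_carrier)
  have 1: "finsum_vec TYPE('k) r (\<lambda>b. Q b *\<^sub>v (C b *\<^sub>v w)) B = 0\<^sub>v r" if w: "w\<in>carrier_vec d" for w
  proof (rule eq_vecI)
    show "dim_vec (finsum_vec TYPE('k) r (\<lambda>b. Q b *\<^sub>v (C b *\<^sub>v w)) B) = dim_vec (0\<^sub>v r)"
      using Qc[of "\<lambda>b. C b *\<^sub>v w"] Cwc w by simp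
    fix s assume "s < dim_vec (0\<^sub>v r :: 'k vec)"
    then have s: "s < r" by simp
    have "finsum_vec TYPE('k) r (\<lambda>b. Q b *\<^sub>v (C b *\<^sub>v w)) B $ s = (\<Sum>x\<in>J. b s x * (C (fst x) *\<^sub>v w) $ snd x)"
      using Qi[of "\<lambda>b. C b *\<^sub>v w" s] Cwc w s by simp
    also have "\<dots> = (\<Sum>x\<in>J. \<Sum>i<d. b s x * A x i * w $ i)"
      by (intro sum.cong) (auto simp: J_def Cw w sum_distrib_left mult.assoc simp del: index_mult_mat_vec)
    also have "\<dots> = (\<Sum>i<d. (\<Sum>x\<in>J. b s x * A x i) * w $ i)"
      by (subst sum.swap) (simp add: sum_distrib_right)
    also have "\<dots> = 0" using bA s by simp
    finally show "finsum_vec TYPE('k) r (\<lambda>b. Q b *\<^sub>v (C b *\<^sub>v w)) B $ s = 0\<^sub>v r $ s" using s by simp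
  qed
  have 2: "\<exists>v. (\<forall>b\<in>B. v b \<in> carrier_vec (e b)) \<and> finsum_vec TYPE('k) r (\<lambda>b. Q b *\<^sub>v v b) B = u"
    if u: "u\<in>carrier_vec r" for u
  proof -
    define v where "v c = vec (e c) (\<lambda>j. \<Sum>t<r. m (c,j) t * u $ t)" for c
    have v: "v c \<in> carrier_vec (e c)" for c by (simp add: v_def)
    have "finsum_vec TYPE('k) r (\<lambda>b. Q b *\<^sub>v v b) B = u"
    proof (rule eq_vecI)
      fix s assume "s < dim_vec u" then have s: "s < r" using u by simp
      have "finsum_vec TYPE('k) r (\<lambda>b. Q b *\<^sub>v v b) B $ s = (\<Sum>x\<in>J. b s x * v (fst x) $ snd x)"
        using Qi v s by blast
      also have "\<dots> = (\<Sum>x\<in>J. \<Sum>t<r. b s x * m x t * u $ t)"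
        by (intro sum.cong) (auto simp: J_def v_def sum_distrib_left mult.assoc)
      also have "\<dots> = (\<Sum>t<r. (\<Sum>x\<in>J. b s x * m x t) * u $ t)"
        by (subst sum.swap) (simp add: sum_distrib_right)
      also have "\<dots> = (\<Sum>t<r. if s = t then u $ t else 0)"
        using bm s by (intro sum.cong) auto
      finally show "finsum_vec TYPE('k) r (\<lambda>b. Q b *\<^sub>v v b) B $ s = u $ s" using s by simp
    qed (use Qc v u in auto)
    then show ?thesis using v by blast
  qed
  have 3: "\<exists>w\<in>carrier_vec d. \<forall>b\<in>B. v b = C b *\<^sub>v w"
    if v: "\<forall>b\<in>B. v b \<in> carrier_vec (e b)" and z: "finsum_vec TYPE('k) r (\<lambda>b. Q b *\<^sub>v v b) B = 0\<^sub>v r" for v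
  proof -
    define V where "V x = v (fst x) $ snd x" for x
    have bV: "(\<Sum>x\<in>J. b s x * V x) = 0" if "s < r" for s
      using Qi[of v s] v z that by (simp add: V_def)
    define w where "w = vec d (\<lambda>i. \<Sum>y\<in>J. G i y * V y)"
    have wc: "w \<in> carrier_vec d" by (simp add: w_def)
    have "v c = C c *\<^sub>v w" if c: "c \<in> B" for c
    proof (rule eq_vecI)
      have dims: "dim_row (C c) = e c" using C c by auto
      fix j assume "j < dim_vec (C c *\<^sub>v w)"
      then have j: "j < e c" using dims by simp
      then have cj: "(c,j) \<in> J" using c by (simp add: J_def)
      have "0 = (\<Sum>s<r. a (c,j) s * (\<Sum>y\<in>J. b s y * V y))" using bV by simp
      also have "\<dots> = (\<Sum>y\<in>J. P (c,j) y * V y)"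
        using ab[OF cj] by (simp add: sum_distrib_left sum_distrib_right mult.assoc) (rule sum.swap)
      also have "\<dots> = (\<Sum>y\<in>J. if (c,j) = y then V y else 0) - (\<Sum>y\<in>J. \<Sum>i<d. A (c,j) i * (G i y * V y))"
        by (simp add: P_def left_diff_distrib sum_subtractf sum_distrib_right mult.assoc mult_indicator)
      also have "(\<Sum>y\<in>J. \<Sum>i<d. A (c,j) i * (G i y * V y)) = (\<Sum>i<d. A (c,j) i * (\<Sum>y\<in>J. G i y * V y))"
        by (subst sum.swap) (simp add: sum_distrib_left)
      also have "\<dots> = (C c *\<^sub>v w) $ j" using Cw[OF c wc j] by (simp add: w_def)
      finally show "v c $ j = (C c *\<^sub>v w) $ j" using cj J by (simp add: V_def)
    qed (use bspec[OF v c] C[OF c] in auto)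
    then show ?thesis using wc by blast
  qed
  show ?thesis by (intro exI[of _ r] exI[of _ Q]) (use Q 1 2 3 in auto)
qed

text \<open>The columns of \<open>1 - G * A\<close> lie in the kernel of \<open>A\<close>, so the
  assumption makes \<open>A'\<close> vanish on them. This says \<open>A' = (A' * G) * A\<close>, and
  \<open>X\<close> is \<open>A' * G\<close>.\<close>

lemma neighbour_sum_factor:
  fixes R P :: "'b \<Rightarrow> 'k::field mat"
  assumes B: "finite B" and R: "\<And>b. b \<in> B \<Longrightarrow> R b \<in> carrier_mat d (e b)"
    and P: "\<And>b. b \<in> B \<Longrightarrow> P b \<in> carrier_mat d' (e b)"
    and ker: "\<And>v. (\<And>b. b\<in>B \<Longrightarrow> v b \<in> carrier_vec (e b)) \<Longrightarrow> finsum_vec TYPE('k) d (\<lambda>b. R b *\<^sub>v v b) B = 0\<^sub>v d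
      \<Longrightarrow> finsum_vec TYPE('k) d' (\<lambda>b. P b *\<^sub>v v b) B = 0\<^sub>v d'"
  shows "\<exists>X\<in>carrier_mat d' d. \<forall>b\<in>B. X * R b = P b"
proof -
  define J where "J = Sigma B (\<lambda>b. {..<e b})"
  have J: "finite J" using B by (auto simp: J_def)
  define A where "A i x = R (fst x) $$ (i, snd x)" for i x
  define A' where "A' i x = P (fst x) $$ (i, snd x)" for i x
  obtain G where G: "\<And>i j. i<d \<Longrightarrow> j\<in>J \<Longrightarrow> (\<Sum>x\<in>J. A i x * (\<Sum>y<d. G x y * A y j)) = A i j"
    using generalized_inverse[of "{..<d}" J A] J by auto
  define X where "X = mat d' d (\<lambda>(i,k). \<Sum>x\<in>J. A' i x * G x k)"
  have key: "A' i y = (\<Sum>x\<in>J. A' i x * (\<Sum>k<d. G x k * A k y))" if i: "i < d'" and y: "y \<in> J" for i y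
  proof -
    define V where "V x = (if x = y then 1 else 0) - (\<Sum>k<d. G x k * A k y)" for x
    define v where "v b = vec (e b) (\<lambda>j. V (b,j))" for b
    have v: "v b \<in> carrier_vec (e b)" for b by (simp add: v_def)
    have vV: "(\<Sum>(b,j)\<in>J. M b $$ (i,j) * v b $ j) = (\<Sum>x\<in>J. M (fst x) $$ (i, snd x) * V x)" for M :: "'b \<Rightarrow> 'k mat" and i
      by (intro sum.cong) (auto simp: J_def v_def)
    have "finsum_vec TYPE('k) d (\<lambda>b. R b *\<^sub>v v b) B = 0\<^sub>v d"
    proof (rule eq_vecI)
      fix i assume "i < dim_vec (0\<^sub>v d :: 'k vec)" then have i: "i < d" by simp
      have "finsum_vec TYPE('k) d (\<lambda>b. R b *\<^sub>v v b) B $ i = (\<Sum>x\<in>J. A i x * V x)"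
        using finsum_vec_mult_index[of B R d e v i] B R v i vV[of R i] by (simp add: A_def J_def)
      also have "\<dots> = (\<Sum>x\<in>J. if x = y then A i x else 0) - (\<Sum>x\<in>J. A i x * (\<Sum>z<d. G x z * A z y))"
        by (simp add: V_def right_diff_distrib sum_subtractf mult_indicator)
      finally show "finsum_vec TYPE('k) d (\<lambda>b. R b *\<^sub>v v b) B $ i = 0\<^sub>v d $ i"
        using G i y J by simp
    qed (use carrier_vecD[OF finsum_vec_mult_carrier[of B R d e v]] R v in simp)
    then have "finsum_vec TYPE('k) d' (\<lambda>b. P b *\<^sub>v v b) B = 0\<^sub>v d'" using ker v by blast
    then have "0 = (\<Sum>x\<in>J. A' i x * V x)"
      using finsum_vec_mult_index[of B P d' e v i] B P v i vV[of P i] by (simp add: A'_def J_def)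
    also have "\<dots> = (\<Sum>x\<in>J. if x = y then A' i x else 0) - (\<Sum>x\<in>J. A' i x * (\<Sum>z<d. G x z * A z y))"
      by (simp add: V_def right_diff_distrib sum_subtractf mult_indicator)
    finally show ?thesis using y J by simp
  qed
  have "X * R b = P b" if b: "b \<in> B" for b
  proof (rule eq_matI)
    fix i j assume "i < dim_row (P b)" "j < dim_col (P b)"
    then have i: "i < d'" and j: "j < e b" using P[OF b] by auto
    have "(X * R b) $$ (i,j) = (\<Sum>k<d. (\<Sum>x\<in>J. A' i x * G x k) * A k (b,j))"
      using i j R[OF b] by (auto simp: X_def A_def scalar_prod_def atLeast0LessThan)
    also have "\<dots> = (\<Sum>x\<in>J. A' i x * (\<Sum>k<d. G x k * A k (b,j)))"
      by (simp add: sum_distrib_left sum_distrib_right mult.assoc) (rule sum.swap)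
    also have "\<dots> = A' i (b,j)" using key[OF i, of "(b,j)"] b j by (simp add: J_def)
    finally show "(X * R b) $$ (i,j) = P b $$ (i,j)" by (simp add: A'_def)
  qed (use P[OF b] R[OF b] in \<open>auto simp: X_def\<close>)
  then show ?thesis by (intro bexI[of _ X]) (auto simp: X_def)
qed

section \<open>Separation of a vector from a subspace\<close>

text \<open>Elimination of one coordinate at a time. If some element of \<open>S\<close> is nonzero
  at \<open>x\<close>, a multiple of it clears this coordinate from \<open>S\<close> and
  \<open>v\<close>. Otherwise the coordinate is dropped, or it already separates \<open>v\<close>
  from \<open>S\<close>.\<close>

lemma separating_functional:
  fixes S :: "('i \<Rightarrow> 'k::field) set"
  assumes F: "finite F" and S0: "(\<lambda>_. 0) \<in> S"
    and Sadd: "\<And>s t. s \<in> S \<Longrightarrow> t \<in> S \<Longrightarrow> (\<lambda>i. s i + t i) \<in> S"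
    and Ssc: "\<And>c s. s \<in> S \<Longrightarrow> (\<lambda>i. c * s i) \<in> S"
    and supp: "\<And>s i. s \<in> S \<Longrightarrow> i \<notin> F \<Longrightarrow> s i = 0" "\<And>i. i \<notin> F \<Longrightarrow> v i = 0"
    and v: "v \<notin> S"
  shows "\<exists>y. (\<forall>s\<in>S. (\<Sum>i\<in>F. y i * s i) = 0) \<and> (\<Sum>i\<in>F. y i * v i) \<noteq> 0"
  using F S0 Sadd Ssc supp v
proof (induction F arbitrary: S v rule: finite_induct)
  case empty
  then have "v = (\<lambda>_. 0)" by auto
  then show ?case using empty by auto
next
  case (insert x F)
  note Sadd = insert.prems(2) and Ssc = insert.prems(3)
  show ?case
  proof (cases "\<exists>s\<in>S. s x \<noteq> 0")
    case True
    then obtain s where s: "s \<in> S" "s x \<noteq> 0" by blast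
    define s0 where "s0 i = (1 / s x) * s i" for i
    have s0: "s0 \<in> S" "s0 x = 1" using Ssc[OF s(1), of "1 / s x"] s unfolding s0_def[abs_def] by auto
    define S' where "S' = {s \<in> S. s x = 0}"
    define v' where "v' i = v i + (- v x) * s0 i" for i
    have comb: "(\<lambda>i. u i + c * s0 i) \<in> S" if "u \<in> S" for u c
      using Sadd[OF that Ssc[OF s0(1), of c]] by simp
    have v': "v' \<notin> S'"
    proof
      assume "v' \<in> S'"
      then have "(\<lambda>i. v' i + v x * s0 i) \<in> S" by (intro comb) (simp add: S'_def)
      moreover have "(\<lambda>i. v' i + v x * s0 i) = v" by (auto simp: v'_def)
      ultimately show False using insert.prems(6) by simp
    qed
    have "\<exists>y. (\<forall>s\<in>S'. (\<Sum>i\<in>F. y i * s i) = 0) \<and> (\<Sum>i\<in>F. y i * v' i) \<noteq> 0"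
    proof (rule insert.IH)
      show "(\<lambda>_. 0) \<in> S'" using insert.prems by (auto simp: S'_def)
      show "\<And>s t. s \<in> S' \<Longrightarrow> t \<in> S' \<Longrightarrow> (\<lambda>i. s i + t i) \<in> S'" using Sadd by (auto simp: S'_def)
      show "\<And>c s. s \<in> S' \<Longrightarrow> (\<lambda>i. c * s i) \<in> S'" using Ssc by (auto simp: S'_def)
      show "s i = 0" if s: "s \<in> S'" and i: "i \<notin> F" for s i
        using insert.prems(4)[of s i] s i by (cases "i = x") (auto simp: S'_def)
      show "v' i = 0" if i: "i \<notin> F" for i
        using insert.prems(4)[OF s0(1), of i] insert.prems(5)[of i] i s0(2) by (cases "i = x") (auto simp: v'_def)
    qed (rule v')
    then obtain y where y: "\<And>s. s\<in>S' \<Longrightarrow> (\<Sum>i\<in>F. y i * s i) = 0" "(\<Sum>i\<in>F. y i * v' i) \<noteq> 0" by blast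
    \<comment> \<open>The value at \<open>x\<close> is forced by the condition that \<open>z\<close>
      annihilates \<open>s0\<close>.\<close>
    define z where "z i = (if i = x then - (\<Sum>i\<in>F. y i * s0 i) else y i)" for i
    have zz: "(\<Sum>i\<in>insert x F. z i * u i) = (\<Sum>i\<in>F. y i * (u i + (- u x) * s0 i))" for u
    proof -
      have "(\<Sum>i\<in>F. z i * u i) = (\<Sum>i\<in>F. y i * u i)" using insert.hyps by (intro sum.cong) (auto simp: z_def)
      moreover have "(\<Sum>i\<in>F. y i * (u i + (- u x) * s0 i)) = (\<Sum>i\<in>F. y i * u i) - (\<Sum>i\<in>F. y i * s0 i) * u x"
        by (simp add: sum_subtractf sum_distrib_left algebra_simps)
      ultimately show ?thesis using insert.hyps by (simp add: z_def)
    qed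
    have "(\<Sum>i\<in>insert x F. z i * u i) = 0" if "u \<in> S" for u
      unfolding zz by (rule y(1)) (use comb[OF that, of "- u x"] s0 in \<open>simp add: S'_def\<close>)
    moreover have "(\<Sum>i\<in>insert x F. z i * v i) \<noteq> 0" unfolding zz using y(2) by (simp add: v'_def)
    ultimately show ?thesis by blast
  next
    case False
    show ?thesis
    proof (cases "v x = 0")
      case True
      have "\<exists>y. (\<forall>s\<in>S. (\<Sum>i\<in>F. y i * s i) = 0) \<and> (\<Sum>i\<in>F. y i * v i) \<noteq> 0"
      proof (rule insert.IH)
        show "s i = 0" if "s \<in> S" "i \<notin> F" for s i
          using insert.prems(4)[of s i] that False by (cases "i = x") auto
        show "v i = 0" if "i \<notin> F" for i
          using insert.prems(5)[of i] that True by (cases "i = x") auto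
      qed (use insert.prems in auto)
      then obtain y where y: "\<And>s. s\<in>S \<Longrightarrow> (\<Sum>i\<in>F. y i * s i) = 0" "(\<Sum>i\<in>F. y i * v i) \<noteq> 0" by blast
      have "\<And>s. s \<in> S \<Longrightarrow> s x = 0" using False by blast
      then have "(\<Sum>i\<in>insert x F. y i * s i) = 0" if "s \<in> S" for s
        using y(1)[OF that] insert.hyps that by simp
      moreover have "(\<Sum>i\<in>insert x F. y i * v i) \<noteq> 0" using y(2) insert.hyps True by simp
      ultimately show ?thesis by blast
    next
      case nz: False
      show ?thesis
        by (rule exI[of _ "\<lambda>i. if i = x then 1 else 0"])
           (use False nz insert.hyps in \<open>auto simp: mult_indicator\<close>)
    qed
  qed
qed

section \<open>Homomorphisms of representations\<close>

lemma mat_distrib: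
  fixes A B C :: "'a::ring mat"
  shows "dim_row A = dim_row B \<Longrightarrow> dim_col A = dim_col B \<Longrightarrow> dim_col A = dim_row C \<Longrightarrow> (A + B) * C = A * C + B * C"
    "dim_row A = dim_row B \<Longrightarrow> dim_col A = dim_col B \<Longrightarrow> dim_col C = dim_row A \<Longrightarrow> C * (A + B) = C * A + C * B"
    "dim_row A = dim_row B \<Longrightarrow> dim_col A = dim_col B \<Longrightarrow> dim_col A = dim_row C \<Longrightarrow> (A - B) * C = A * C - B * C"
    "dim_row A = dim_row B \<Longrightarrow> dim_col A = dim_col B \<Longrightarrow> dim_col C = dim_row A \<Longrightarrow> C * (A - B) = C * A - C * B"
  subgoal by (rule add_mult_distrib_mat[of _ "dim_row A" "dim_col A" _ _ "dim_col C"]) (rule carrier_matI; simp)+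
  subgoal by (rule mult_add_distrib_mat[of _ "dim_row C" "dim_col C" _ "dim_col A"]) (rule carrier_matI; simp)+
  subgoal by (rule minus_mult_distrib_mat[of _ "dim_row A" "dim_col A" _ _ "dim_col C"]) (rule carrier_matI; simp)+
  subgoal by (rule mult_minus_distrib_mat[of _ "dim_row C" "dim_col C" _ "dim_col A"]) (rule carrier_matI; simp)+
  done

lemma zero_dim_mat_eq:
  "dim_row A = dim_row B \<Longrightarrow> dim_col A = dim_col B \<Longrightarrow> dim_row A = 0 \<or> dim_col A = 0 \<Longrightarrow> A = B"
  by (rule eq_matI) auto

lemma mat_mult_empty:
  fixes A B :: "'a::semiring_0 mat"
  assumes "A \<in> carrier_mat a 0" "B \<in> carrier_mat 0 b" shows "A * B = 0\<^sub>m a b"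
  by (rule eq_matI) (use assms in \<open>auto simp: scalar_prod_def\<close>)

lemma repD: "is_rep n p M \<Longrightarrow> arrow n p x y \<Longrightarrow> rmap M x y \<in> carrier_mat (rdim M y) (rdim M x)"
  by (simp add: is_rep_def)

lemma rep_dims:
  "is_rep n p M \<Longrightarrow> arrow n p x y \<Longrightarrow> dim_row (rmap M x y) = rdim M y"
  "is_rep n p M \<Longrightarrow> arrow n p x y \<Longrightarrow> dim_col (rmap M x y) = rdim M x"
  using repD by blast+

lemma homD:
  assumes "is_hom n p M N f"
  shows "is_rep n p M" "is_rep n p N" "\<And>x. f x \<in> carrier_mat (rdim N x) (rdim M x)"
    "\<And>x. dim_row (f x) = rdim N x" "\<And>x. dim_col (f x) = rdim M x"
    "\<And>x y. arrow n p x y \<Longrightarrow> f y * rmap M x y = rmap N x y * f x"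
  using assms unfolding is_hom_def by blast+

lemma homI:
  "is_rep n p M \<Longrightarrow> is_rep n p N \<Longrightarrow> (\<And>x. f x \<in> carrier_mat (rdim N x) (rdim M x)) \<Longrightarrow>
   (\<And>x y. arrow n p x y \<Longrightarrow> f y * rmap M x y = rmap N x y * f x) \<Longrightarrow> is_hom n p M N f"
  unfolding is_hom_def by blast

lemma hom_id: "is_rep n p M \<Longrightarrow> is_hom n p M M (hid M)"
  by (rule homI) (auto simp: hid_def rep_dims)

lemma hom_comp:
  assumes f: "is_hom n p M N f" and g: "is_hom n p N K g"
  shows "is_hom n p M K (hcomp g f)"
proof (rule homI)
  show "is_rep n p M" "is_rep n p K" using homD f g by blast+
  show "hcomp g f x \<in> carrier_mat (rdim K x) (rdim M x)" for x
    using homD(3)[OF f, of x] homD(3)[OF g, of x] by (simp add: hcomp_def)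
  fix x y assume a: "arrow n p x y"
  note d = homD(4,5)[OF f] homD(4,5)[OF g] rep_dims[OF homD(1)[OF f] a] rep_dims[OF homD(2)[OF f] a] rep_dims[OF homD(2)[OF g] a]
  have "g y * f y * rmap M x y = g y * (f y * rmap M x y)" by (simp add: mat_assoc d)
  also have "\<dots> = (g y * rmap N x y) * f x" by (simp add: mat_assoc d homD(6)[OF f a])
  also have "\<dots> = rmap K x y * (g x * f x)" by (simp add: mat_assoc d homD(6)[OF g a])
  finally show "hcomp g f y * rmap M x y = rmap K x y * hcomp g f x" by (simp add: hcomp_def)
qed

lemma hom_add:
  fixes f g :: "nat list \<Rightarrow> 'k::comm_ring_1 mat"
  assumes f: "is_hom n p M N f" and g: "is_hom n p M N g"
  shows "is_hom n p M N (\<lambda>x. f x + g x)" "is_hom n p M N (\<lambda>x. f x - g x)"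
proof -
  have "(f y + g y) * rmap M x y = rmap N x y * (f x + g x) \<and> (f y - g y) * rmap M x y = rmap N x y * (f x - g x)"
    if a: "arrow n p x y" for x y
    using homD(4,5)[OF f] homD(4,5)[OF g] rep_dims[OF homD(1)[OF f] a] rep_dims[OF homD(2)[OF f] a]
    by (simp add: mat_distrib homD(6)[OF f a] homD(6)[OF g a])
  then show "is_hom n p M N (\<lambda>x. f x + g x)" "is_hom n p M N (\<lambda>x. f x - g x)"
    using homD(1,2)[OF f] homD(4,5)[OF f] homD(4,5)[OF g] by (auto intro!: homI carrier_matI)
qed

lemma hom_smult:
  fixes f :: "nat list \<Rightarrow> 'k::comm_ring_1 mat"
  assumes f: "is_hom n p M N f"
  shows "is_hom n p M N (\<lambda>x. c \<cdot>\<^sub>m f x)"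
proof (rule homI)
  fix x y assume a: "arrow n p x y"
  have "c \<cdot>\<^sub>m f y * rmap M x y = c \<cdot>\<^sub>m (f y * rmap M x y)"
    by (rule mult_smult_assoc_mat[OF homD(3)[OF f] repD[OF homD(1)[OF f] a]])
  also have "\<dots> = rmap N x y * (c \<cdot>\<^sub>m f x)"
    unfolding homD(6)[OF f a] by (rule mult_smult_distrib[OF repD[OF homD(2)[OF f] a] homD(3)[OF f], symmetric])
  finally show "c \<cdot>\<^sub>m f y * rmap M x y = rmap N x y * (c \<cdot>\<^sub>m f x)" .
qed (use homD[OF f] in auto)

lemma hom_zero:
  "is_rep n p M \<Longrightarrow> is_rep n p N \<Longrightarrow> is_hom n p M N (\<lambda>x. 0\<^sub>m (rdim N x) (rdim M x))"
  by (rule homI) (auto simp: rep_dims)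

lemma hcomp_assoc:
  "is_hom n p M N f \<Longrightarrow> is_hom n p N K g \<Longrightarrow> is_hom n p K L h \<Longrightarrow> hcomp (hcomp h g) f = hcomp h (hcomp g f)"
  unfolding hcomp_def by (rule ext, rule mat_assoc) (simp_all add: homD(4,5))

lemma hcomp_id: "is_hom n p M N f \<Longrightarrow> hcomp f (hid M) = f" "is_hom n p M N f \<Longrightarrow> hcomp (hid N) f = f"
  unfolding hcomp_def hid_def by (rule ext; simp add: homD(4,5))+

lemma supp_finite: "is_rep n p M \<Longrightarrow> finite (supp M)"
  by (simp add: is_rep_def supp_def)

lemma supp_tvert: "is_rep n p M \<Longrightarrow> x \<in> supp M \<Longrightarrow> tvert n x"
  by (auto simp: is_rep_def supp_def)

section \<open>Idempotents, decompositions and connectedness\<close>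

text \<open>The idempotent is split at each vertex separately, with unrelated choices. The structure
  maps of \<open>M\<close> transported through these choices make \<open>i\<close> and
  \<open>q\<close> homomorphisms, because \<open>e\<close> commutes with the structure maps.\<close>

lemma split_idempotent_hom:
  fixes e :: "nat list \<Rightarrow> 'k::field mat"
  assumes e: "is_hom n p M M e" and ee: "hcomp e e = e"
  shows "\<exists>N i q. is_hom n p N M i \<and> is_hom n p M N q \<and> hcomp i q = e \<and> hcomp q i = hid N"
proof -
  have "\<exists>r i q. i \<in> carrier_mat (rdim M x) r \<and> q \<in> carrier_mat r (rdim M x) \<and> i * q = e x \<and> q * i = 1\<^sub>m r" for x
    using idempotent_split[OF homD(3)[OF e, of x]] fun_cong[OF ee, of x] by (simp add: hcomp_def)
  then obtain r i q where iq: "\<And>x. i x \<in> carrier_mat (rdim M x) (r x)" "\<And>x. q x \<in> carrier_mat (r x) (rdim M x)"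
    "\<And>x. i x * q x = e x" "\<And>x. q x * i x = 1\<^sub>m (r x)" by metis
  define N where "N = \<lparr>rdim = r, rmap = \<lambda>x y. q y * rmap M x y * i x\<rparr>"
  have N: "rdim N = r" "rmap N x y = q y * rmap M x y * i x" for x y by (simp_all add: N_def)
  have z: "r x = 0" if "rdim M x = 0" for x
  proof (rule ccontr)
    assume "r x \<noteq> 0"
    have "q x * i x = 0\<^sub>m (r x) (r x)" using mat_mult_empty iq(1,2)[of x] that by metis
    then have "(1\<^sub>m (r x) :: 'k mat) $$ (0,0) = 0\<^sub>m (r x) (r x) $$ (0,0)" using iq(4)[of x] by simp
    then show False using \<open>r x \<noteq> 0\<close> by simp
  qed
  note M = homD(1)[OF e]
  have d: "dim_row (i x) = rdim M x" "dim_col (i x) = r x" "dim_row (q x) = r x" "dim_col (q x) = rdim M x" for x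
    using iq by blast+
  have sub: "{x. r x \<noteq> 0} \<subseteq> supp M"
  proof
    fix x assume "x \<in> {x. r x \<noteq> 0}"
    then show "x \<in> supp M" using z[of x] by (auto simp: supp_def)
  qed
  have "is_rep n p N" unfolding is_rep_def N
  proof (intro conjI allI impI)
    show "r x = 0" if "\<not> tvert n x" for x using that sub supp_tvert[OF M] by blast
    show "finite {x. r x \<noteq> 0}" using finite_subset[OF sub supp_finite[OF M]] .
    show "q y * rmap M x y * i x \<in> carrier_mat (r y) (r x)" for x y by (rule carrier_matI) (simp_all add: d)
  qed
  then have Nr: "is_rep n p N" .
  have i: "is_hom n p N M i"
  proof (rule homI[OF Nr M])
    fix x y assume a: "arrow n p x y"
    note d' = d homD(4,5)[OF e] rep_dims[OF M a]
    have "i y * rmap N x y = (i y * q y) * rmap M x y * i x" by (simp add: N mat_assoc d')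
    also have "\<dots> = rmap M x y * (e x * i x)" by (simp add: iq(3) homD(6)[OF e a] mat_assoc d')
    also have "e x * i x = i x * (q x * i x)" by (simp add: iq(3)[symmetric] mat_assoc d')
    finally show "i y * rmap N x y = rmap M x y * i x" using d by (simp add: iq(4))
  qed (use iq N in auto)
  have q: "is_hom n p M N q"
  proof (rule homI[OF M Nr])
    fix x y assume a: "arrow n p x y"
    note d' = d homD(4,5)[OF e] rep_dims[OF M a]
    have "rmap N x y * q x = q y * (rmap M x y * (i x * q x))" by (simp add: N mat_assoc d')
    also have "\<dots> = q y * (e y * rmap M x y)" by (simp add: iq(3) homD(6)[OF e a] mat_assoc d')
    also have "\<dots> = (q y * i y) * (q y * rmap M x y)" by (simp add: iq(3)[symmetric] mat_assoc d')
    finally show "q y * rmap M x y = rmap N x y * q x" using d d' by (simp add: iq(4))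
  qed (use iq N in auto)
  have "hcomp i q = e" "hcomp q i = hid N" by (auto simp: hcomp_def hid_def iq N)
  with i q show ?thesis by blast
qed

definition hzero :: "'k::comm_ring_1 qrep \<Rightarrow> 'k qrep \<Rightarrow> nat list \<Rightarrow> 'k mat" where
  "hzero M N = (\<lambda>x. 0\<^sub>m (rdim N x) (rdim M x))"

text \<open>Both \<open>e\<close> and \<open>1 - e\<close> split off summands that together make up
  \<open>M\<close>, so one of the two summands is zero.\<close>

lemma indecomposable_idempotent:
  fixes e :: "nat list \<Rightarrow> 'k::field mat"
  assumes M: "indecomposable n p M" and e: "is_hom n p M M e" and ee: "hcomp e e = e"
  shows "e = hzero M M \<or> e = hid M"
proof (rule ccontr)
  assume c: "\<not> ?thesis"
  note Mr = homD(1)[OF e]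
  define e' where "e' x = 1\<^sub>m (rdim M x) - e x" for x
  have e': "is_hom n p M M e'" using hom_add(2)[OF hom_id[OF Mr] e] by (simp add: hid_def e'_def[abs_def])
  have eex: "e x * e x = e x" for x using fun_cong[OF ee, of x] by (simp add: hcomp_def)
  note d = homD(4,5)[OF e]
  have e0: "e x - e x = 0\<^sub>m (rdim M x) (rdim M x)" for x using homD(3)[OF e, of x] by auto
  have "e' x * e' x = e' x" for x
  proof -
    have "e' x * e' x = e' x * 1\<^sub>m (rdim M x) - e' x * e x"
      unfolding e'_def by (subst mat_distrib(4)) (simp_all add: d)
    also have "e' x * e x = 0\<^sub>m (rdim M x) (rdim M x)" by (simp add: e'_def mat_distrib d eex e0)
    finally show ?thesis using homD(3)[OF e', of x] by auto
  qed
  then have ee': "hcomp e' e' = e'" by (auto simp: hcomp_def)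
  obtain N i q where N: "is_hom n p N M i" "is_hom n p M N q" "hcomp i q = e" "hcomp q i = hid N"
    using split_idempotent_hom[OF e ee] by blast
  obtain N' i' q' where N': "is_hom n p N' M i'" "is_hom n p M N' q'" "hcomp i' q' = e'" "hcomp q' i' = hid N'"
    using split_idempotent_hom[OF e' ee'] by blast
  have zero: "g = hzero M M" if z: "is_zero_rep K" and j: "is_hom n p K M j" and s: "is_hom n p M K s" and g: "hcomp j s = g" for K j s g
  proof (rule ext)
    fix x
    have "j x * s x = 0\<^sub>m (rdim M x) (rdim M x)"
      using mat_mult_empty[of "j x" "rdim M x" "s x" "rdim M x"] homD(3)[OF j, of x] homD(3)[OF s, of x] z
      by (simp add: is_zero_rep_def)
    then show "g x = hzero M M x" using g by (auto simp: hcomp_def hzero_def)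
  qed
  have "\<not> is_zero_rep N" using zero N c by blast
  moreover have "\<not> is_zero_rep N'"
  proof
    assume "is_zero_rep N'"
    then have "e' = hzero M M" using zero N' by blast
    then have z: "1\<^sub>m (rdim M x) - e x = 0\<^sub>m (rdim M x) (rdim M x)" for x by (metis e'_def hzero_def)
    have "e x = 1\<^sub>m (rdim M x)" for x
    proof (rule eq_matI)
      fix i j assume ij: "i < dim_row (1\<^sub>m (rdim M x) :: 'k mat)" "j < dim_col (1\<^sub>m (rdim M x) :: 'k mat)"
      then have "(1\<^sub>m (rdim M x) - e x) $$ (i,j) = 0" using z by simp
      then show "e x $$ (i,j) = 1\<^sub>m (rdim M x) $$ (i,j)" using ij d by simp
    qed (use d in auto)
    then show False using c by (auto simp: hid_def)
  qed
  moreover have "(\<lambda>x. i x * q x + i' x * q' x) = hid M"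
  proof (rule ext)
    fix x
    have "i x * q x = e x" "i' x * q' x = e' x" using N(3) N'(3) by (metis hcomp_def)+
    then show "i x * q x + i' x * q' x = hid M x"
      using homD(3)[OF e, of x] by (auto simp: hid_def e'_def)
  qed
  ultimately have "decomposable n p M" unfolding decomposable_def using N N' by blast
  then show False using M by (simp add: indecomposable_def)
qed

lemma indecomposable_rep: "indecomposable n p M \<Longrightarrow> is_rep n p M"
  by (simp add: indecomposable_def)

text \<open>A decomposition gives the idempotent \<open>i1 * p1\<close>. If it is zero then
  \<open>M1\<close> is zero, and if it is the identity then \<open>M2\<close> is zero.\<close>

lemma indecomposableI:
  fixes M :: "'k::field qrep"
  assumes r: "is_rep n p M" and nz: "\<not> is_zero_rep M"
    and idem: "\<And>e. is_hom n p M M e \<Longrightarrow> hcomp e e = e \<Longrightarrow> e = hzero M M \<or> e = hid M"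
  shows "indecomposable n p M"
proof -
  have "\<not> decomposable n p M"
  proof
    assume "decomposable n p M"
    then obtain M1 M2 i1 i2 p1 p2 where nz: "\<not> is_zero_rep M1" "\<not> is_zero_rep M2"
      and h: "is_hom n p M1 M i1" "is_hom n p M2 M i2" "is_hom n p M M1 p1" "is_hom n p M M2 p2"
      and e: "hcomp p1 i1 = hid M1" "hcomp p2 i2 = hid M2"
      and s: "(\<lambda>x. i1 x * p1 x + i2 x * p2 x) = hid M"
      unfolding decomposable_def by blast
    note d = homD(4,5)[OF h(1)] homD(4,5)[OF h(2)] homD(4,5)[OF h(3)] homD(4,5)[OF h(4)]
    have e1: "p1 x * i1 x = 1\<^sub>m (rdim M1 x)" and e2: "p2 x * i2 x = 1\<^sub>m (rdim M2 x)" for x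
      using fun_cong[OF e(1), of x] fun_cong[OF e(2), of x] by (auto simp: hcomp_def hid_def)
    have s': "i1 x * p1 x + i2 x * p2 x = 1\<^sub>m (rdim M x)" for x using fun_cong[OF s, of x] by (simp add: hid_def)
    define f where "f = hcomp i1 p1"
    have f: "is_hom n p M M f" unfolding f_def by (rule hom_comp[OF h(3,1)])
    have "f x * f x = f x" for x
    proof -
      have "f x * f x = i1 x * ((p1 x * i1 x) * p1 x)" by (simp add: f_def hcomp_def mat_assoc d)
      then show ?thesis by (simp add: e1 d f_def hcomp_def)
    qed
    then have "hcomp f f = f" by (auto simp: hcomp_def)
    then consider "f = hzero M M" | "f = hid M" using idem[OF f] by blast
    then show False
    proof cases
      case 1
      have "rdim M1 x = 0" for x
      proof (rule ccontr)
        assume nx: "rdim M1 x \<noteq> 0"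
        have "(p1 x * i1 x) * (p1 x * i1 x) = p1 x * (f x) * i1 x" by (simp add: f_def hcomp_def mat_assoc d)
        then have "(1\<^sub>m (rdim M1 x) :: 'k mat) = 0\<^sub>m (rdim M1 x) (rdim M1 x)" by (simp add: e1 1 hzero_def d)
        then have "(1\<^sub>m (rdim M1 x) :: 'k mat) $$ (0,0) = 0\<^sub>m (rdim M1 x) (rdim M1 x) $$ (0,0)" by simp
        then show False using nx by simp
      qed
      then show False using nz by (simp add: is_zero_rep_def)
    next
      case 2
      have "rdim M2 x = 0" for x
      proof (rule ccontr)
        assume nx: "rdim M2 x \<noteq> 0"
        have one: "i1 x * p1 x = 1\<^sub>m (rdim M x)" using fun_cong[OF 2, of x] by (simp add: f_def hcomp_def hid_def)
        have z: "i2 x * p2 x = 0\<^sub>m (rdim M x) (rdim M x)"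
        proof (rule eq_matI)
          fix i j assume ij: "i < dim_row (0\<^sub>m (rdim M x) (rdim M x) :: 'k mat)" "j < dim_col (0\<^sub>m (rdim M x) (rdim M x) :: 'k mat)"
          have "(i1 x * p1 x + i2 x * p2 x) $$ (i,j) = (1\<^sub>m (rdim M x) :: 'k mat) $$ (i,j)" by (simp add: s')
          then have "(1\<^sub>m (rdim M x) + i2 x * p2 x) $$ (i,j) = (1\<^sub>m (rdim M x) :: 'k mat) $$ (i,j)" by (simp only: one)
          then show "(i2 x * p2 x) $$ (i,j) = 0\<^sub>m (rdim M x) (rdim M x) $$ (i,j)" using ij d by simp
        qed (use d in auto)
        have "(p2 x * i2 x) * (p2 x * i2 x) = p2 x * (i2 x * p2 x) * i2 x" by (simp add: mat_assoc d)
        then have "(1\<^sub>m (rdim M2 x) :: 'k mat) = 0\<^sub>m (rdim M2 x) (rdim M2 x)" by (simp add: e2 z d)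
        then have "(1\<^sub>m (rdim M2 x) :: 'k mat) $$ (0,0) = 0\<^sub>m (rdim M2 x) (rdim M2 x) $$ (0,0)" by simp
        then show False using nx by simp
      qed
      then show False using nz by (simp add: is_zero_rep_def)
    qed
  qed
  then show ?thesis using r nz by (simp add: indecomposable_def)
qed

text \<open>When no arrow with nonzero spaces at both ends crosses the boundary of \<open>C\<close>,
  the restriction to \<open>C\<close> is an idempotent endomorphism. Connectedness of supports is
  derived from this.\<close>

lemma indecomposable_connected:
  fixes M :: "'k::field qrep"
  assumes M: "indecomposable n p M"
    and C: "\<And>x y. arrow n p x y \<Longrightarrow> (x \<in> C) \<noteq> (y \<in> C) \<Longrightarrow> rdim M x = 0 \<or> rdim M y = 0"
  shows "supp M \<subseteq> C \<or> supp M \<inter> C = {}"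
proof -
  note Mr = indecomposable_rep[OF M]
  define e where "e x = (if x \<in> C then 1\<^sub>m (rdim M x) else 0\<^sub>m (rdim M x) (rdim M x) :: 'k mat)" for x
  have "is_hom n p M M e"
  proof (rule homI[OF Mr Mr])
    fix x y assume a: "arrow n p x y"
    show "e y * rmap M x y = rmap M x y * e x"
    proof (cases "(x \<in> C) = (y \<in> C)")
      case True then show ?thesis using rep_dims[OF Mr a] by (simp add: e_def)
    next
      case False
      show ?thesis by (rule zero_dim_mat_eq) (use C[OF a False] rep_dims[OF Mr a] in \<open>auto simp: e_def\<close>)
    qed
  qed (auto simp: e_def)
  moreover have "hcomp e e = e" by (auto simp: hcomp_def e_def)
  ultimately have "e = hzero M M \<or> e = hid M" using indecomposable_idempotent[OF M] by blast
  moreover have ne: "(1\<^sub>m k :: 'k mat) \<noteq> 0\<^sub>m k k" if "k \<noteq> 0" for k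
  proof
    assume "(1\<^sub>m k :: 'k mat) = 0\<^sub>m k k"
    then have "(1\<^sub>m k :: 'k mat) $$ (0,0) = 0\<^sub>m k k $$ (0,0)" by simp
    then show False using that by simp
  qed
  ultimately show ?thesis
  proof (elim disjE)
    assume "e = hzero M M"
    then have "e x = 0\<^sub>m (rdim M x) (rdim M x)" for x by (simp add: hzero_def)
    then have "rdim M x = 0" if "x \<in> C" for x using that ne[of "rdim M x"] e_def[of x] by metis
    then have "x \<notin> C" if "x \<in> supp M" for x using that by (auto simp: supp_def)
    then show ?thesis by blast
  next
    assume "e = hid M"
    then have "e x = 1\<^sub>m (rdim M x)" for x by (simp add: hid_def)
    then have "rdim M x = 0" if "x \<notin> C" for x using that ne[of "rdim M x"] e_def[of x] by metis
    then have "x \<in> C" if "x \<in> supp M" for x using that unfolding supp_def by force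
    then show ?thesis by blast
  qed
qed

section \<open>Fitting's lemma and locality of endomorphism rings\<close>

text \<open>Induction on the coordinates. The elements vanishing at \<open>x\<close> stabilise from
  \<open>k1\<close> on. If every member of the chain contains some \<open>t\<close> with
  \<open>t x \<noteq> 0\<close>, subtracting a multiple of \<open>t\<close> moves an element of
  \<open>S k1\<close> into the stable part, so the chain itself is stable from \<open>k1\<close>
  on.\<close>

lemma subspace_chain_stationary:
  fixes S :: "nat \<Rightarrow> ('i \<Rightarrow> 'k::field) set"
  assumes F: "finite F"
    and add: "\<And>m s t. s \<in> S m \<Longrightarrow> t \<in> S m \<Longrightarrow> (\<lambda>i. s i + t i) \<in> S m"
    and sc: "\<And>m c s. s \<in> S m \<Longrightarrow> (\<lambda>i. c * s i) \<in> S m"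
    and supp: "\<And>m s i. s \<in> S m \<Longrightarrow> i \<notin> F \<Longrightarrow> s i = 0"
    and dec: "\<And>m. S (Suc m) \<subseteq> S m" and z: "\<And>m. (\<lambda>_. 0) \<in> S m"
  shows "\<exists>k. \<forall>m\<ge>k. S m = S k"
  using F add sc supp dec z
proof (induction F arbitrary: S rule: finite_induct)
  case empty
  have "S m = {\<lambda>_. 0}" for m
  proof -
    have "s = (\<lambda>_. 0)" if "s \<in> S m" for s using empty(3)[OF that] by (intro ext) simp
    then show ?thesis using empty(5)[of m] by blast
  qed
  then show ?case by simp
next
  case (insert x F)
  define S' where "S' m = {s \<in> S m. s x = 0}" for m
  have dec: "S m \<subseteq> S k" if "k \<le> m" for k m
    using insert.prems(4) that by (rule lift_Suc_antimono_le)
  have "\<exists>k. \<forall>m\<ge>k. S' m = S' k"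
  proof (rule insert.IH)
    show "s i = 0" if "s \<in> S' m" "i \<notin> F" for s m i
      using insert.prems(3)[of s m i] that by (cases "i = x") (auto simp: S'_def)
    show "S' (Suc m) \<subseteq> S' m" for m using insert.prems(4)[of m] by (auto simp: S'_def)
  qed (use insert.prems(1,2,5) in \<open>auto simp: S'_def\<close>)
  then obtain k1 where k1: "\<And>m. m \<ge> k1 \<Longrightarrow> S' m = S' k1" by blast
  show ?case
  proof (cases "\<exists>k. \<forall>s\<in>S k. s x = 0")
    case True
    then obtain k2 where k2: "\<forall>s\<in>S k2. s x = 0" by blast
    have "S m = S' m" if "m \<ge> k2" for m using dec[OF that] k2 by (auto simp: S'_def)
    then have "S m = S (max k1 k2)" if "m \<ge> max k1 k2" for m using k1[of m] k1[of "max k1 k2"] that by simp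
    then show ?thesis by blast
  next
    case False
    have "S k1 \<subseteq> S m" if m: "m \<ge> k1" for m
    proof
      fix s assume s: "s \<in> S k1"
      obtain t where t: "t \<in> S m" "t x \<noteq> 0" using False by blast
      have t1: "t \<in> S k1" using t dec[OF m] by blast
      have "(\<lambda>i. s i + (- s x / t x) * t i) \<in> S k1"
        using insert.prems(1)[OF s insert.prems(2)[OF t1, of "- s x / t x"]] .
      then have "(\<lambda>i. s i + (- s x / t x) * t i) \<in> S' k1" using t by (simp add: S'_def)
      then have "(\<lambda>i. s i + (- s x / t x) * t i) \<in> S m" using k1[OF m] by (auto simp: S'_def)
      from insert.prems(1)[OF this insert.prems(2)[OF t(1), of "s x / t x"]]
      show "s \<in> S m" by simp
    qed
    then show ?thesis using dec by (intro exI[of _ k1]) blast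
  qed
qed

lemma hom_pow:
  assumes "is_hom n p M M t" shows "is_hom n p M M (\<lambda>x. t x ^\<^sub>m k)"
proof (induction k)
  case 0
  have "dim_row (t x) = rdim M x" for x using homD(4)[OF assms] .
  then show ?case using hom_id[OF homD(1)[OF assms]] by (simp add: hid_def)
next
  case (Suc k)
  then show ?case using hom_comp[OF assms Suc] by (simp add: hcomp_def)
qed

lemma pow_mat_comm:
  fixes T R :: "'a::semiring_1 mat"
  assumes T: "T \<in> carrier_mat d d" and R: "R \<in> carrier_mat d d" and c: "T * R = R * T"
  shows "T ^\<^sub>m k * R = R * T ^\<^sub>m k"
proof (induction k)
  case (Suc k)
  have "T ^\<^sub>m Suc k * R = T ^\<^sub>m k * (T * R)" using T R by (simp add: mat_assoc)
  also have "\<dots> = (T ^\<^sub>m k * R) * T" using T R by (simp add: c mat_assoc)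
  also have "\<dots> = R * T ^\<^sub>m Suc k" using T R by (simp add: Suc mat_assoc)
  finally show ?case .
qed (use T R in auto)

text \<open>\<open>e\<close> is the Fitting projection of \<open>T\<close>. The assumption says that
  multiplying by \<open>u = T * R\<close> from the right fixes \<open>T ^\<^sub>m m\<close>. Since
  \<open>e\<close> equals \<open>R ^\<^sub>m m * T ^\<^sub>m m\<close>, it is fixed by every power
  of \<open>u\<close>, in particular by itself.\<close>

lemma fitting_matrix:
  fixes T R :: "'a::comm_ring_1 mat"
  assumes T: "T \<in> carrier_mat d d" and R: "R \<in> carrier_mat d d" and c: "T * R = R * T"
    and m: "T ^\<^sub>m m = T ^\<^sub>m Suc m * R"
  defines "e \<equiv> (T * R) ^\<^sub>m m"
  shows "e * e = e" "T ^\<^sub>m m * e = T ^\<^sub>m m" "e * (T * R) = e"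
proof -
  define u where "u = T * R"
  have u: "u \<in> carrier_mat d d" using T R by (simp add: u_def)
  have Tu: "T ^\<^sub>m m * u = T ^\<^sub>m m" using m T R by (simp add: u_def mat_assoc)
  have Tuk: "T ^\<^sub>m m * u ^\<^sub>m k = T ^\<^sub>m m" for k
  proof (induction k)
    case (Suc k)
    have "T ^\<^sub>m m * u ^\<^sub>m Suc k = (T ^\<^sub>m m * u ^\<^sub>m k) * u" using T u by (simp add: mat_assoc)
    then show ?case using Suc Tu by simp
  qed (use T u in simp)
  show "T ^\<^sub>m m * e = T ^\<^sub>m m" unfolding e_def u_def[symmetric] by (rule Tuk)
  have fac: "u ^\<^sub>m k = R ^\<^sub>m k * T ^\<^sub>m k" for k
  proof (induction k)
    case (Suc k)
    have RT: "T ^\<^sub>m k * R = R * T ^\<^sub>m k" by (rule pow_mat_comm[OF T R c])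
    have "u ^\<^sub>m Suc k = R ^\<^sub>m k * (T ^\<^sub>m k * R) * T" using T R Suc by (simp add: u_def c mat_assoc)
    also have "\<dots> = R ^\<^sub>m Suc k * T ^\<^sub>m Suc k" using T R unfolding RT by (simp add: mat_assoc)
    finally show ?case .
  qed (use T R u in auto)
  have euk: "e * u ^\<^sub>m k = e" for k
  proof -
    have "e * u ^\<^sub>m k = R ^\<^sub>m m * (T ^\<^sub>m m * u ^\<^sub>m k)" unfolding e_def u_def[symmetric] fac[of m] using T R u by (simp add: mat_assoc)
    then show ?thesis unfolding Tuk by (simp add: e_def u_def[symmetric] fac[of m])
  qed
  show "e * e = e" using euk[of m] by (simp add: e_def u_def)
  show "e * (T * R) = e" using euk[of 1] u by (simp add: u_def[symmetric])
qed

text \<open>The products \<open>t ^\<^sub>m m * r\<close>, with \<open>r\<close> among the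
  endomorphisms commuting with \<open>t\<close>, form a descending chain of subspaces in the space
  of matrix entries. Where the chain is stationary, \<open>t ^\<^sub>m k\<close> itself lies in the
  next member and yields \<open>r\<close>; restricting to the commutant ensures that
  \<open>r\<close> is an endomorphism commuting with \<open>t\<close>.\<close>

lemma endo_power_stable:
  fixes t :: "nat list \<Rightarrow> 'k::field mat"
  assumes t: "is_hom n p M M t"
  shows "\<exists>m r. is_hom n p M M r \<and> (\<forall>x. t x * r x = r x * t x) \<and> (\<forall>x. t x ^\<^sub>m m = t x ^\<^sub>m Suc m * r x)"
proof -
  note Mr = homD(1)[OF t] and d = homD(4,5)[OF t]
  \<comment> \<open>\<open>cf\<close> flattens a family of matrices into a function of vertex, row
    and column, with value 0 outside the ranges.\<close>
  define cf where "cf f = (\<lambda>(x,i,j). if i < rdim M x \<and> j < rdim M x then f x $$ (i,j) else (0::'k))" for f :: "nat list \<Rightarrow> 'k mat"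
  define Cm where "Cm = {r. is_hom n p M M r \<and> (\<forall>x. t x * r x = r x * t x)}"
  define S where "S m = (\<lambda>r. cf (\<lambda>x. t x ^\<^sub>m m * r x)) ` Cm" for m
  have S_I: "s \<in> S m" if "r \<in> Cm" "s = cf (\<lambda>x. t x ^\<^sub>m m * r x)" for r s m
    unfolding S_def using that by simp
  define F where "F = Sigma (supp M) (\<lambda>x. {..<rdim M x} \<times> {..<rdim M x})"
  have F: "finite F" unfolding F_def using supp_finite[OF Mr] by auto
  have tp: "t x ^\<^sub>m k \<in> carrier_mat (rdim M x) (rdim M x)" for x k using homD(3)[OF t, of x] by simp
  have Cd: "dim_row (r x) = rdim M x" "dim_col (r x) = rdim M x" if "r \<in> Cm" for r x
    using that homD(4,5)[of n p M M r] by (auto simp: Cm_def)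
  have "\<exists>k. \<forall>m\<ge>k. S m = S k"
  proof (rule subspace_chain_stationary[OF F])
    fix m s s' assume "s \<in> S m" "s' \<in> S m"
    then obtain r r' where r: "r \<in> Cm" "r' \<in> Cm" and s: "s = cf (\<lambda>x. t x ^\<^sub>m m * r x)" "s' = cf (\<lambda>x. t x ^\<^sub>m m * r' x)"
      by (auto simp: S_def)
    have "(\<lambda>x. r x + r' x) \<in> Cm" using r hom_add(1) unfolding Cm_def by (auto simp: mat_distrib Cd[OF r(1)] Cd[OF r(2)] d)
    moreover have "(\<lambda>i. s i + s' i) = cf (\<lambda>x. t x ^\<^sub>m m * (r x + r' x))"
    proof -
      have "t x ^\<^sub>m m * (r x + r' x) = t x ^\<^sub>m m * r x + t x ^\<^sub>m m * r' x" for x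
        by (rule mat_distrib(2)) (simp_all add: Cd[OF r(1)] Cd[OF r(2)] d)
      then show ?thesis unfolding s cf_def
        by (intro ext) (auto simp: Cd[OF r(1)] Cd[OF r(2)] d simp del: index_mult_mat(1))
    qed
    ultimately show "(\<lambda>i. s i + s' i) \<in> S m" by (rule S_I)
  next
    fix m c s assume "s \<in> S m"
    then obtain r where r: "r \<in> Cm" and s: "s = cf (\<lambda>x. t x ^\<^sub>m m * r x)" by (auto simp: S_def)
    have rc: "r x \<in> carrier_mat (rdim M x) (rdim M x)" for x using Cd[OF r, of x] by auto
    have sm: "A * (c \<cdot>\<^sub>m r x) = c \<cdot>\<^sub>m (A * r x)" "(c \<cdot>\<^sub>m r x) * A = c \<cdot>\<^sub>m (r x * A)"
      if "A \<in> carrier_mat (rdim M x) (rdim M x)" for A x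
      using mult_smult_distrib[OF that rc] mult_smult_assoc_mat[OF rc that] by blast+
    have "(\<lambda>x. c \<cdot>\<^sub>m r x) \<in> Cm" using r hom_smult sm[OF homD(3)[OF t]] unfolding Cm_def by auto
    moreover have "(\<lambda>i. c * s i) = cf (\<lambda>x. t x ^\<^sub>m m * (c \<cdot>\<^sub>m r x))"
      unfolding s cf_def using tp by (intro ext) (auto simp: sm Cd[OF r] d)
    ultimately show "(\<lambda>i. c * s i) \<in> S m" by (rule S_I)
  next
    fix m s i assume "s \<in> S m" "i \<notin> F"
    then show "s i = 0" by (cases i) (auto simp: S_def cf_def F_def supp_def)
  next
    fix m
    have "cf (\<lambda>x. t x ^\<^sub>m Suc m * r x) \<in> S m" if r: "r \<in> Cm" for r
    proof -
      have rh: "is_hom n p M M r" and rc: "\<And>x. t x * r x = r x * t x" using r by (auto simp: Cm_def)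
      have "t x * (t x * r x) = (t x * r x) * t x" for x
      proof -
        have "t x * (t x * r x) = t x * (r x * t x)" by (simp only: rc)
        also have "\<dots> = (t x * r x) * t x" by (rule mat_assoc[symmetric]) (simp_all add: d Cd[OF r])
        finally show ?thesis .
      qed
      then have "hcomp t r \<in> Cm" using hom_comp[OF rh t] by (simp add: Cm_def hcomp_def)
      moreover have "cf (\<lambda>x. t x ^\<^sub>m Suc m * r x) = cf (\<lambda>x. t x ^\<^sub>m m * hcomp t r x)"
      proof -
        have "t x ^\<^sub>m Suc m * r x = t x ^\<^sub>m m * hcomp t r x" for x by (simp add: hcomp_def mat_assoc d Cd[OF r] d)
        then show ?thesis by simp
      qed
      ultimately show ?thesis by (rule S_I)
    qed
    then show "S (Suc m) \<subseteq> S m" unfolding S_def[of "Suc m"] by blast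
    have "(\<lambda>x. 0\<^sub>m (rdim M x) (rdim M x)) \<in> Cm" using hom_zero[OF Mr Mr] by (auto simp: Cm_def d)
    moreover have "cf (\<lambda>x. t x ^\<^sub>m m * 0\<^sub>m (rdim M x) (rdim M x)) = (\<lambda>_. 0)" unfolding cf_def by (rule ext) (auto simp: d)
    ultimately show "(\<lambda>_. 0) \<in> S m" by (rule S_I[OF _ sym])
  qed
  then obtain k where "S (Suc k) = S k" using le_Suc_eq by blast
  moreover have "hid M \<in> Cm" using hom_id[OF Mr] by (auto simp: Cm_def hid_def d)
  then have "cf (\<lambda>x. t x ^\<^sub>m k * hid M x) \<in> S k" unfolding S_def by (rule imageI)
  ultimately obtain r where r: "r \<in> Cm" and eq: "cf (\<lambda>x. t x ^\<^sub>m k * hid M x) = cf (\<lambda>x. t x ^\<^sub>m Suc k * r x)"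
    unfolding S_def by blast
  have "t x ^\<^sub>m k = t x ^\<^sub>m Suc k * r x" for x
  proof (rule eq_matI)
    fix i j assume "i < dim_row (t x ^\<^sub>m Suc k * r x)" "j < dim_col (t x ^\<^sub>m Suc k * r x)"
    then have "i < rdim M x" "j < rdim M x" using Cd[OF r] d by auto
    then show "(t x ^\<^sub>m k) $$ (i,j) = (t x ^\<^sub>m Suc k * r x) $$ (i,j)"
      using fun_cong[OF eq, of "(x,i,j)"] by (simp add: cf_def hid_def d)
  qed (use Cd[OF r] d d in auto)
  then show ?thesis using r unfolding Cm_def by blast
qed

definition automorphism :: "nat \<Rightarrow> bool \<Rightarrow> 'k::comm_ring_1 qrep \<Rightarrow> (nat list \<Rightarrow> 'k mat) \<Rightarrow> bool" where
  "automorphism n p M t \<longleftrightarrow> is_hom n p M M t \<and> (\<exists>r. is_hom n p M M r \<and> hcomp r t = hid M \<and> hcomp t r = hid M)"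

text \<open>At each vertex the matrices are square, so a one-sided inverse is two-sided.\<close>

lemma automorphismI:
  fixes t :: "nat list \<Rightarrow> 'k::field mat"
  assumes t: "is_hom n p M M t" and r: "is_hom n p M M r" and e: "hcomp r t = hid M \<or> hcomp t r = hid M"
  shows "automorphism n p M t"
proof -
  have "hcomp r t = hid M \<and> hcomp t r = hid M"
  proof -
    have "r x * t x = 1\<^sub>m (rdim M x) \<longleftrightarrow> t x * r x = 1\<^sub>m (rdim M x)" for x
      using mat_mult_left_right_inverse[OF homD(3)[OF r, of x] homD(3)[OF t, of x]]
        mat_mult_left_right_inverse[OF homD(3)[OF t, of x] homD(3)[OF r, of x]] by blast
    then show ?thesis using e by (auto simp: hcomp_def hid_def fun_eq_iff)
  qed
  then show ?thesis using t r by (auto simp: automorphism_def)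
qed

text \<open>The Fitting idempotent \<open>e\<close> is zero or the identity. In the first case
  \<open>t ^\<^sub>m m = t ^\<^sub>m m * e\<close> vanishes; in the second
  \<open>e * (t * r) = e\<close> says that \<open>r\<close> inverts \<open>t\<close>.\<close>

lemma endo_automorphism_or_nilpotent:
  fixes t :: "nat list \<Rightarrow> 'k::field mat"
  assumes M: "indecomposable n p M" and t: "is_hom n p M M t"
  shows "automorphism n p M t \<or> (\<exists>m. \<forall>x. t x ^\<^sub>m m = 0\<^sub>m (rdim M x) (rdim M x))"
proof -
  obtain m r where r: "is_hom n p M M r" and c: "\<And>x. t x * r x = r x * t x" and m: "\<And>x. t x ^\<^sub>m m = t x ^\<^sub>m Suc m * r x"
    using endo_power_stable[OF t] by blast
  define e where "e x = (t x * r x) ^\<^sub>m m" for x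
  have e: "is_hom n p M M e" using hom_pow[OF hom_comp[OF r t], of m] by (simp add: e_def[abs_def] hcomp_def)
  note f = fitting_matrix[OF homD(3)[OF t] homD(3)[OF r] c m, folded e_def]
  have "hcomp e e = e" using f(1) by (auto simp: hcomp_def)
  then consider "e = hzero M M" | "e = hid M" using indecomposable_idempotent[OF M e] by blast
  then show ?thesis
  proof cases
    case 1
    have "t x ^\<^sub>m m = 0\<^sub>m (rdim M x) (rdim M x)" for x
      using f(2)[of x] homD(3)[OF t, of x] homD(4,5)[OF t, of x] 1 by (simp add: hzero_def split: if_splits)
    then show ?thesis by blast
  next
    case 2
    have "t x * r x = 1\<^sub>m (rdim M x)" for x
      using f(3)[of x] homD(4,5)[OF t, of x] homD(4,5)[OF r, of x] 2 by (simp add: hid_def)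
    then have "hcomp t r = hid M" by (auto simp: hcomp_def hid_def)
    then show ?thesis using automorphismI[OF t r] by blast
  qed
qed

text \<open>Locality of the endomorphism ring. Otherwise \<open>t\<close> and \<open>1 - t\<close>
  are both nilpotent at every vertex; but multiplying the last nonzero power of \<open>t\<close> by
  \<open>1 - t\<close> leaves it unchanged.\<close>

lemma one_minus_automorphism:
  fixes t :: "nat list \<Rightarrow> 'k::field mat"
  assumes M: "indecomposable n p M" and t: "is_hom n p M M t" and nt: "\<not> automorphism n p M t"
  shows "automorphism n p M (\<lambda>x. 1\<^sub>m (rdim M x) - t x)"
proof (rule ccontr)
  assume na: "\<not> ?thesis"
  note Mr = homD(1)[OF t]
  have u: "is_hom n p M M (\<lambda>x. 1\<^sub>m (rdim M x) - t x)"
    using hom_add(2)[OF hom_id[OF Mr] t] by (simp add: hid_def)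
  obtain m where m: "\<And>x. t x ^\<^sub>m m = 0\<^sub>m (rdim M x) (rdim M x)"
    using endo_automorphism_or_nilpotent[OF M t] nt by blast
  obtain k where k: "\<And>x. (1\<^sub>m (rdim M x) - t x) ^\<^sub>m k = 0\<^sub>m (rdim M x) (rdim M x)"
    using endo_automorphism_or_nilpotent[OF M u] na by blast
  obtain x where x: "rdim M x \<noteq> 0" using M by (auto simp: indecomposable_def is_zero_rep_def)
  define d where "d = rdim M x"
  define T where "T = t x"
  have T: "T \<in> carrier_mat d d" using homD(3)[OF t, of x] by (simp add: T_def d_def)
  have ne: "(1\<^sub>m d :: 'k mat) \<noteq> 0\<^sub>m d d"
  proof
    assume "(1\<^sub>m d :: 'k mat) = 0\<^sub>m d d"
    then have "(1\<^sub>m d :: 'k mat) $$ (0,0) = 0\<^sub>m d d $$ (0,0)" by simp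
    then show False using x by (simp add: d_def)
  qed
  have ex: "\<exists>m. T ^\<^sub>m m = 0\<^sub>m d d" using m[of x] by (auto simp: T_def d_def)
  define l where "l = (LEAST m. T ^\<^sub>m m = 0\<^sub>m d d)"
  have l: "T ^\<^sub>m l = 0\<^sub>m d d" unfolding l_def using ex by (rule LeastI_ex)
  have "l \<noteq> 0" using l ne T by (cases l) auto
  then obtain l' where l': "l = Suc l'" by (cases l) auto
  have nz: "T ^\<^sub>m l' \<noteq> 0\<^sub>m d d" using not_less_Least[of l' "\<lambda>m. T ^\<^sub>m m = 0\<^sub>m d d"] l' by (auto simp: l_def[symmetric])
  have P: "T ^\<^sub>m l' \<in> carrier_mat d d" using T by simp
  have "T ^\<^sub>m l' * (1\<^sub>m d - T) = T ^\<^sub>m l' - T ^\<^sub>m l' * T"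
    using T P by (simp add: mat_distrib)
  also have "T ^\<^sub>m l' * T = 0\<^sub>m d d" using l l' by simp
  also have "T ^\<^sub>m l' - 0\<^sub>m d d = T ^\<^sub>m l'" by (rule eq_matI) (use carrier_matD[OF P] in auto)
  finally have s: "T ^\<^sub>m l' * (1\<^sub>m d - T) = T ^\<^sub>m l'" .
  have U: "1\<^sub>m d - T \<in> carrier_mat d d" using T by auto
  have "T ^\<^sub>m l' * (1\<^sub>m d - T) ^\<^sub>m j = T ^\<^sub>m l'" for j
  proof (induction j)
    case 0 show ?case using P U T by simp
  next
    case (Suc j)
    have "T ^\<^sub>m l' * (1\<^sub>m d - T) ^\<^sub>m Suc j = (T ^\<^sub>m l' * (1\<^sub>m d - T) ^\<^sub>m j) * (1\<^sub>m d - T)"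
      using P U pow_carrier_mat[OF U, of j] T by (simp add: mat_assoc)
    then show ?case using Suc s by simp
  qed
  from this[of k] have "T ^\<^sub>m l' = 0\<^sub>m d d" using k[of x] P carrier_matD[OF T] by (simp add: T_def d_def split: if_splits)
  then show False using nz by simp
qed

section \<open>The metric of the tree\<close>

fun lcp_length :: "'a list \<Rightarrow> 'a list \<Rightarrow> nat" where
  "lcp_length (a # x) (b # y) = (if a = b then Suc (lcp_length x y) else 0)"
| "lcp_length [] y = 0"
| "lcp_length x [] = 0"

lemma lcp_length_Nil: "lcp_length x [] = 0"
  by (cases x) auto

lemma lcp_length_sym: "lcp_length x y = lcp_length y x"
  by (induction x y rule: lcp_length.induct) (auto simp: lcp_length_Nil)

lemma lcp_length_le: "lcp_length x y \<le> length x" "lcp_length x y \<le> length y"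
  by (induction x y rule: lcp_length.induct) auto

lemma lcp_length_ultrametric: "min (lcp_length x y) (lcp_length y z) \<le> lcp_length x z"
proof (induction x y arbitrary: z rule: lcp_length.induct)
  case (1 a x b y)
  show ?case
  proof (cases z)
    case (Cons c z')
    then show ?thesis using 1[of z'] by auto
  qed (simp add: lcp_length_Nil)
qed auto

lemma lcp_length_append: "lcp_length (x @ u) (x @ v) = length x + lcp_length u v"
  by (induction x) auto

lemma lcp_length_self: "lcp_length x x = length x"
  by (induction x) auto

lemma lcp_length_prefix: "lcp_length x y = length x \<Longrightarrow> \<exists>z. y = x @ z"
  by (induction x y rule: lcp_length.induct) (auto split: if_splits)

lemma lcp_length_snoc: "lcp_length (u @ [i]) y \<le> length u \<Longrightarrow> lcp_length u y = lcp_length (u @ [i]) y"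
proof (induction u arbitrary: y)
  case Nil
  then show ?case by (cases y) (auto split: if_splits)
next
  case (Cons a u)
  then show ?case by (cases y) auto
qed

text \<open>The path from \<open>x\<close> to \<open>y\<close> deletes the letters of
  \<open>x\<close> after the common prefix and then appends those of \<open>y\<close>. The formula
  makes sense for all lists and is the path metric on reduced words.\<close>

definition tdist :: "'a list \<Rightarrow> 'a list \<Rightarrow> nat" where
  "tdist x y = length x + length y - 2 * lcp_length x y"

lemma tdist_add: "tdist x y + 2 * lcp_length x y = length x + length y"
  using lcp_length_le[of x y] by (simp add: tdist_def)

lemma tdist_sym: "tdist x y = tdist y x"
  by (simp add: tdist_def lcp_length_sym add.commute)

lemma tdist_self[simp]: "tdist x x = 0"
  by (simp add: tdist_def lcp_length_self)

lemma tdist_eq_0: "tdist x y = 0 \<longleftrightarrow> x = y"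
proof
  assume "tdist x y = 0"
  then have "lcp_length x y = length x" "lcp_length x y = length y"
    using lcp_length_le[of x y] tdist_add[of x y] by linarith+
  then show "x = y" using lcp_length_prefix[of x y] by auto
qed simp

text \<open>\<open>lcp_length\<close> is the Gromov product at the empty word, and its ultrametric
  inequality is the tree property. This condition replaces arguments about branching paths in the
  later distance computations.\<close>

lemma four_point: "tdist x y + tdist z w \<le> max (tdist x z + tdist y w) (tdist x w + tdist y z)"
proof -
  let ?l = lcp_length
  have "min (?l x z + ?l y w) (?l x w + ?l y z) \<le> ?l x y + ?l z w"
  proof -
    define a b c d e f where defs: "a = ?l x y" "b = ?l z w" "c = ?l x z" "d = ?l y w" "e = ?l x w" "f = ?l y z"
    have "min c f \<le> a" "min e d \<le> a" "min c e \<le> b" "min f d \<le> b"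
      unfolding defs by (metis lcp_length_ultrametric lcp_length_sym)+
    then have "min (c + d) (e + f) \<le> a + b" by (auto simp: min_def split: if_splits)
    then show ?thesis by (simp add: defs)
  qed
  then show ?thesis
    using tdist_add[of x y] tdist_add[of z w] tdist_add[of x z] tdist_add[of y w] tdist_add[of x w] tdist_add[of y z]
    by linarith
qed

lemma tdist_triangle: "tdist x y \<le> tdist x z + tdist z y"
  using four_point[of x y z z] by (simp add: tdist_sym)

lemma tdist_parity: "even (tdist x y) \<longleftrightarrow> (even (length x) \<longleftrightarrow> even (length y))"
proof -
  have "even (tdist x y + 2 * lcp_length x y) \<longleftrightarrow> even (length x + length y)" by (simp add: tdist_add)
  then show ?thesis by simp
qed

lemma tadj_sym: "tadj n x y \<Longrightarrow> tadj n y x"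
  by (auto simp: tadj_def)

lemma tadj_tvert: "tadj n x y \<Longrightarrow> tvert n x \<and> tvert n y"
  by (simp add: tadj_def)

lemma tdist_snoc: "tdist x (x @ [i]) = 1"
  using lcp_length_append[of x "[]" "[i]"] by (simp add: tdist_def)

lemma tadj_tdist: "tadj n x y \<Longrightarrow> tdist x y = 1"
  unfolding tadj_def using tdist_snoc[of x] tdist_snoc[of y] tdist_sym[of x y] by force

lemma tadj_parity: "tadj n x y \<Longrightarrow> even (length x) \<longleftrightarrow> odd (length y)"
  using tadj_tdist[of n x y] tdist_parity[of x y] by auto

lemma tadj_sink: "tadj n x y \<Longrightarrow> is_sink p x \<longleftrightarrow> \<not> is_sink p y"
  using tadj_parity[of n x y] by (auto simp: is_sink_def)

lemma is_sink_not: "is_sink (\<not> p) x \<longleftrightarrow> \<not> is_sink p x"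
  by (auto simp: is_sink_def)

lemma is_sink_tdist: "is_sink p x \<longleftrightarrow> (is_sink p y \<longleftrightarrow> even (tdist x y))"
  by (auto simp: is_sink_def tdist_parity)

lemma tvert_prefix: "tvert n (u @ v) \<Longrightarrow> tvert n u"
proof -
  assume H: "tvert n (u @ v)"
  have "u ! j \<noteq> u ! Suc j" if "Suc j < length u" for j
  proof -
    have "(u @ v) ! j \<noteq> (u @ v) ! Suc j" using H that unfolding tvert_def by simp
    then show ?thesis using that by (simp add: nth_append)
  qed
  then show "tvert n u" using H unfolding tvert_def by simp
qed

text \<open>Append the next letter of \<open>y\<close> if \<open>x\<close> is a prefix of
  \<open>y\<close>; otherwise delete the last letter of \<open>x\<close>.\<close>

lemma tdist_closer:
  assumes x: "tvert n x" and y: "tvert n y" and ne: "x \<noteq> y"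
  shows "\<exists>x'. tadj n x x' \<and> tdist x y = Suc (tdist x' y)"
proof (cases "lcp_length x y = length x")
  case True
  then obtain z where z: "y = x @ z" using lcp_length_prefix by blast
  then obtain i z' where iz: "z = i # z'" using ne by (cases z) auto
  have y': "y = (x @ [i]) @ z'" using z iz by simp
  have "tadj n x (x @ [i])" using x y tvert_prefix[of n "x @ [i]" z'] y' by (simp add: tadj_def)
  moreover have "lcp_length (x @ [i]) y = Suc (length x)"
    unfolding y' using lcp_length_append[of "x @ [i]" "[]" z'] by simp
  then have "tdist x y = Suc (tdist (x @ [i]) y)" using True y' by (simp add: tdist_def)
  ultimately show ?thesis by blast
next
  case False
  then have lt: "lcp_length x y < length x" using lcp_length_le(1)[of x y] by simp
  then obtain u i where u: "x = u @ [i]" by (cases x rule: rev_cases) auto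
  have "tadj n x u" using x tvert_prefix[of n u "[i]"] u by (auto simp: tadj_def)
  moreover have "lcp_length u y = lcp_length x y" using lcp_length_snoc[of u i y] lt u by simp
  then have "tdist x y = Suc (tdist u y)"
    using u lt lcp_length_le[of x y] tdist_add[of x y] tdist_add[of u y] by simp
  ultimately show ?thesis by blast
qed

text \<open>The distance changes by at most one along an edge, and it cannot stay equal because the
  parity of the word length alternates.\<close>

lemma tadj_tdist_cases:
  assumes "tadj n x y" shows "tdist v y = Suc (tdist v x) \<or> tdist v x = Suc (tdist v y)"
proof -
  have "tdist x y = 1" using tadj_tdist[OF assms] .
  then have "tdist v y \<le> Suc (tdist v x)" "tdist v x \<le> Suc (tdist v y)"
    using tdist_triangle[of v y x] tdist_triangle[of v x y] by (auto simp: tdist_sym)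
  moreover have "even (tdist v x) \<noteq> even (tdist v y)"
    using tdist_parity tadj_parity[OF assms] by blast
  ultimately show ?thesis by (metis le_SucE le_antisym)
qed

text \<open>The four-point condition for \<open>v\<close>, \<open>x\<close> and the two neighbours
  leaves \<open>tdist y y' = 0\<close>: geodesics in a tree are unique.\<close>

lemma tdist_closer_unique:
  assumes "tadj n x y" "tadj n x y'" "tdist v x = Suc (tdist v y)" "tdist v x = Suc (tdist v y')"
  shows "y = y'"
proof -
  have "tdist v x + tdist y y' \<le> max (tdist v y + tdist x y') (tdist v y' + tdist x y)" by (rule four_point)
  then have "tdist y y' = 0" using assms tadj_tdist[OF assms(1)] tadj_tdist[OF assms(2)] by simp
  then show ?thesis by (simp add: tdist_eq_0)
qed

lemma tvert_snoc: "tvert n v \<Longrightarrow> i < n \<Longrightarrow> v = [] \<or> last v \<noteq> i \<Longrightarrow> tvert n (v @ [i])"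
proof -
  assume v: "tvert n v" and i: "i < n" "v = [] \<or> last v \<noteq> i"
  have "(v @ [i]) ! j \<noteq> (v @ [i]) ! Suc j" if j: "Suc j < length (v @ [i])" for j
  proof (cases "Suc j < length v")
    case True
    then show ?thesis using v unfolding tvert_def by (simp add: nth_append)
  next
    case False
    then have "j = length v - 1" "v \<noteq> []" using j by auto
    then show ?thesis using i(2) by (simp add: nth_append last_conv_nth)
  qed
  then show "tvert n (v @ [i])" using v i(1) unfolding tvert_def by simp
qed

lemma three_nbrs:
  assumes n: "n \<ge> 3" and v: "tvert n v"
  shows "\<exists>y1 y2 y3. tadj n v y1 \<and> tadj n v y2 \<and> tadj n v y3 \<and> y1 \<noteq> y2 \<and> y1 \<noteq> y3 \<and> y2 \<noteq> y3"
proof (cases v rule: rev_cases)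
  case Nil
  have "tadj n v [i]" if "i < 3" for i
    using that n tvert_snoc[OF v, of i] v Nil by (auto simp: tadj_def)
  from this[of 0] this[of 1] this[of 2] show ?thesis by (intro exI[of _ "[0]"] exI[of _ "[1]"] exI[of _ "[2]"]) simp
next
  case (snoc u k)
  have a: "tadj n v (v @ [i])" if "i < 3" "i \<noteq> k" for i
    using that n tvert_snoc[OF v, of i] v snoc by (auto simp: tadj_def)
  have b: "tadj n v u" using v snoc tvert_prefix[of n u "[k]"] by (auto simp: tadj_def)
  have "\<exists>i j. i < (3::nat) \<and> j < 3 \<and> i \<noteq> k \<and> j \<noteq> k \<and> i \<noteq> j"
  proof -
    consider "k = 0" | "k = 1" | "k \<noteq> 0 \<and> k \<noteq> 1" by blast
    then show ?thesis
    proof cases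
      case 1 then show ?thesis by (intro exI[of _ 1] exI[of _ 2]) simp
    next
      case 2 then show ?thesis by (intro exI[of _ 0] exI[of _ 2]) simp
    next
      case 3 then show ?thesis by (intro exI[of _ 0] exI[of _ 1]) simp
    qed
  qed
  then obtain i j where ij: "i < (3::nat)" "j < 3" "i \<noteq> k" "j \<noteq> k" "i \<noteq> j" by blast
  have "v @ [i] \<noteq> u" "v @ [j] \<noteq> u" using snoc by auto
  then show ?thesis using a[OF ij(1,3)] a[OF ij(2,4)] b ij(5) by blast
qed

text \<open>Of three neighbours of \<open>v\<close> at most one is closer to \<open>z\<close>. This
  is how \<open>n \<ge> 3\<close> enters the geometry.\<close>

lemma two_farther_nbrs:
  assumes n: "n \<ge> 3" and v: "tvert n v"
  shows "\<exists>y y'. tadj n v y \<and> tadj n v y' \<and> y \<noteq> y' \<and> tdist z y = Suc (tdist z v) \<and> tdist z y' = Suc (tdist z v)"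
proof -
  obtain y1 y2 y3 where y: "tadj n v y1" "tadj n v y2" "tadj n v y3" "y1 \<noteq> y2" "y1 \<noteq> y3" "y2 \<noteq> y3"
    using three_nbrs[OF assms] by blast
  have c: "tdist z y1 = Suc (tdist z v) \<or> tdist z y2 = Suc (tdist z v)"
    "tdist z y1 = Suc (tdist z v) \<or> tdist z y3 = Suc (tdist z v)"
    "tdist z y2 = Suc (tdist z v) \<or> tdist z y3 = Suc (tdist z v)"
    using y tadj_tdist_cases tdist_closer_unique by metis+
  show ?thesis using c y by metis
qed

lemma farther_nbr:
  assumes "n \<ge> 3" "tvert n v"
  obtains y where "tadj n v y" "tdist z y = Suc (tdist z v)"
  using two_farther_nbrs[OF assms] by blast

lemma finite_nbrs: "finite (nbrs n a)"
proof (rule finite_subset)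
  show "nbrs n a \<subseteq> insert (butlast a) ((\<lambda>i. a @ [i]) ` {..<n})"
    by (auto simp: nbrs_def tadj_def tvert_def)
qed simp

section \<open>Supports of indecomposable modules as subtrees\<close>

text \<open>Deleting the edge between \<open>u\<close> and \<open>u'\<close> splits the tree into
  the vertices closer to \<open>u\<close> and those closer to \<open>u'\<close>; an edge joining the
  two sides has to be the deleted one.\<close>

lemma tree_cut_edge:
  assumes u: "tadj n u u'" and xy: "tadj n x y" and x: "tdist x u' = Suc (tdist x u)" and y: "tdist y u = Suc (tdist y u')"
  shows "x = u \<and> y = u'"
proof -
  have uu: "tdist u u' = 1" and d: "tdist x y = 1" using tadj_tdist u xy by blast+
  have "tdist y u = Suc (tdist x u) \<or> tdist x u = Suc (tdist y u)"
    using tadj_tdist_cases[OF xy, of u] by (simp add: tdist_sym)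
  moreover have "tdist y u' = Suc (tdist x u') \<or> tdist x u' = Suc (tdist y u')"
    using tadj_tdist_cases[OF xy, of u'] by (simp add: tdist_sym)
  moreover have "tdist x u' + tdist y u \<le> max (tdist x y + tdist u' u) (tdist x u + tdist u' y)" by (rule four_point)
  ultimately have "tdist x u = 0" "tdist y u' = 0" using x y uu d by (auto simp: tdist_sym)
  then show ?thesis by (simp add: tdist_eq_0)
qed

text \<open>If the next vertex \<open>u'\<close> on the way to \<open>w\<close> had a zero space,
  nothing would be transported across the edge between \<open>u\<close> and \<open>u'\<close>, and
  the side of \<open>u\<close> would split off although \<open>w\<close> lies on the other
  side.\<close>

lemma indecomposable_convex:
  fixes M :: "'k::field qrep"
  assumes M: "indecomposable n p M" and u: "u \<in> supp M" and w: "w \<in> supp M"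
    and u': "tadj n u u'" "tdist u w = Suc (tdist u' w)"
  shows "u' \<in> supp M"
proof (rule ccontr)
  assume z: "u' \<notin> supp M"
  define C where "C = {x. tdist x u' = Suc (tdist x u)}"
  have CD: "x \<in> C \<Longrightarrow> tdist x u' = Suc (tdist x u)" for x by (simp only: C_def mem_Collect_eq)
  have nC: "x \<notin> C \<Longrightarrow> tdist x u = Suc (tdist x u')" for x
    using tadj_tdist_cases[OF u'(1), of x] by (auto simp: C_def)
  have "supp M \<subseteq> C \<or> supp M \<inter> C = {}"
  proof (rule indecomposable_connected[OF M])
    fix x y assume a: "arrow n p x y" and c: "(x \<in> C) \<noteq> (y \<in> C)"
    have t: "tadj n x y" using a by (simp add: arrow_def)
    have "x = u' \<or> y = u'"
    proof (cases "x \<in> C")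
      case True
      then have "y \<notin> C" using c by blast
      from tree_cut_edge[OF u'(1) t CD[OF True] nC[OF this]] show ?thesis by blast
    next
      case False
      then have "y \<in> C" using c by blast
      from tree_cut_edge[OF u'(1) tadj_sym[OF t] CD[OF this] nC[OF False]] show ?thesis by blast
    qed
    then show "rdim M x = 0 \<or> rdim M y = 0" using z by (auto simp: supp_def)
  qed
  moreover have "u \<in> C" using tadj_tdist[OF u'(1)] by (simp add: C_def)
  moreover have "w \<notin> C"
  proof
    assume "w \<in> C"
    from CD[OF this] show False using u'(2) tdist_sym[of w u] tdist_sym[of w u'] by linarith
  qed
  ultimately show False using u w by blast
qed

text \<open>A path without repetitions cannot turn back: a step towards the start would lead to the
  unique closer neighbour, which is the preceding vertex.\<close>

lemma supp_path_tdist: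
  assumes ps: "supp_path n M ps" and i: "i < length ps"
  shows "tdist (ps ! 0) (ps ! i) = i"
  using i
proof (induction i rule: less_induct)
  case (less i)
  have adj: "tadj n (ps ! j) (ps ! Suc j)" if "Suc j < length ps" for j using ps that by (simp add: supp_path_def)
  have dist: "distinct ps" using ps by (simp add: supp_path_def)
  show ?case
  proof (cases i)
    case (Suc j)
    have j: "tdist (ps ! 0) (ps ! j) = j" using less Suc by simp
    have a: "tadj n (ps ! j) (ps ! i)" using adj[of j] less.prems Suc by simp
    show ?thesis
    proof (rule ccontr)
      assume "tdist (ps ! 0) (ps ! i) \<noteq> i"
      then have cl: "tdist (ps ! 0) (ps ! j) = Suc (tdist (ps ! 0) (ps ! i))"
        using tadj_tdist_cases[OF a, of "ps ! 0"] j Suc by auto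
      then obtain k where k: "j = Suc k" using j by (cases j) auto
      have "tadj n (ps ! j) (ps ! k)" using adj[of k] less.prems Suc k tadj_sym by simp
      moreover have "tdist (ps ! 0) (ps ! k) = k" using less Suc k by simp
      ultimately have "ps ! k = ps ! i" using tdist_closer_unique[OF _ a _ cl] j k by simp
      then show False using dist less.prems Suc k nth_eq_iff_index_eq[of ps k i] by simp
    qed
  qed simp
qed

lemma supp_path_length: "supp_path n M ps \<Longrightarrow> tdist (hd ps) (last ps) = length ps - 1"
proof -
  assume ps: "supp_path n M ps"
  then have "ps \<noteq> []" by (simp add: supp_path_def)
  then show ?thesis using supp_path_tdist[OF ps, of "length ps - 1"] by (simp add: hd_conv_nth last_conv_nth)
qed

text \<open>The bound on the distances to \<open>w\<close> is carried along so that a vertex put in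
  front cannot already occur on the path.\<close>

lemma supp_path_exists:
  fixes M :: "'k::field qrep"
  assumes M: "indecomposable n p M" and u: "u \<in> supp M" and w: "w \<in> supp M"
  shows "\<exists>ps. supp_path n M ps \<and> hd ps = u \<and> last ps = w \<and> (\<forall>x\<in>set ps. tdist x w \<le> tdist u w)"
  using u
proof (induction "tdist u w" arbitrary: u)
  case 0
  then have "u = w" by (simp add: tdist_eq_0)
  then show ?case using 0 by (intro exI[of _ "[u]"]) (simp add: supp_path_def)
next
  case (Suc k)
  note r = indecomposable_rep[OF M]
  have "u \<noteq> w" using Suc by auto
  then obtain u' where u': "tadj n u u'" "tdist u w = Suc (tdist u' w)"
    using tdist_closer[OF supp_tvert[OF r Suc.prems] supp_tvert[OF r w]] by blast
  have "u' \<in> supp M" using indecomposable_convex[OF M Suc.prems w u'] .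
  then obtain ps where ps: "supp_path n M ps" "hd ps = u'" "last ps = w" "\<forall>x\<in>set ps. tdist x w \<le> tdist u' w"
    using Suc(1)[of u'] u'(2) Suc(2) by auto
  have ne: "ps \<noteq> []" using ps by (simp add: supp_path_def)
  have "u \<notin> set ps" using ps(4) u'(2) by auto
  moreover have "tadj n ((u # ps) ! j) ((u # ps) ! Suc j)" if "Suc j < length (u # ps)" for j
    using that u'(1) ps ne by (cases j) (auto simp: supp_path_def hd_conv_nth)
  ultimately have "supp_path n M (u # ps)" using ps(1) Suc.prems by (auto simp: supp_path_def)
  then show ?case using ps ne u'(2) by (intro exI[of _ "u # ps"]) auto
qed

section \<open>Reflection functors\<close>

lemma arrow_flip: "arrow n (\<not> p) a b \<longleftrightarrow> arrow n p b a"
proof -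
  have "tadj n a b \<Longrightarrow> is_sink (\<not> p) b = is_sink p a" using tadj_sink[of n a b p] by (simp add: is_sink_not)
  then show ?thesis using tadj_sym[of n a b] tadj_sym[of n b a] by (auto simp: arrow_def)
qed

lemma nbrs_arrow:
  assumes "b \<in> nbrs n a" "is_sink p a"
  shows "arrow n p b a" "arrow n (\<not> p) a b" "\<not> is_sink p b" "b \<noteq> a" "tvert n a" "tvert n b"
proof -
  have t: "tadj n a b" using assms by (simp add: nbrs_def)
  show ns: "\<not> is_sink p b" using tadj_sink[OF t, of p] assms by simp
  show a: "arrow n p b a" using tadj_sym[OF t] assms by (simp add: arrow_def)
  then show "arrow n (\<not> p) a b" by (simp add: arrow_flip)
  show "b \<noteq> a" using ns assms by blast
  show "tvert n a" "tvert n b" using tadj_tvert[OF t] by auto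
qed

lemma arrow_nbrs: "arrow n p b a \<Longrightarrow> b \<in> nbrs n a \<and> is_sink p a \<and> tvert n a \<and> \<not> is_sink p b"
  using tadj_sym[of n b a] tadj_sink[of n b a p] by (auto simp: arrow_def nbrs_def tadj_def)

lemma nbrs_sym: "b \<in> nbrs n a \<longleftrightarrow> a \<in> nbrs n b"
  using tadj_sym by (auto simp: nbrs_def)

text \<open>The total map from the direct sum of the neighbour spaces into the space at
  \<open>a\<close>. An element of the direct sum is represented by a function \<open>v\<close> that
  is read only at the neighbours.\<close>

definition nsum :: "nat \<Rightarrow> 'k::field qrep \<Rightarrow> nat list \<Rightarrow> (nat list \<Rightarrow> 'k vec) \<Rightarrow> 'k vec" where
  "nsum n M a v = finsum_vec TYPE('k) (rdim M a) (\<lambda>b. rmap M b a *\<^sub>v v b) (nbrs n a)"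

lemma finsum_vec_cong:
  assumes "finite B" "\<And>b. b \<in> B \<Longrightarrow> u b = u' b" "\<And>b. b \<in> B \<Longrightarrow> u b \<in> carrier_vec d"
  shows "finsum_vec TYPE('k::comm_monoid_add) d u B = finsum_vec TYPE('k) d u' B"
proof (rule eq_vecI)
  have c: "finsum_vec TYPE('k) d u B \<in> carrier_vec d" "finsum_vec TYPE('k) d u' B \<in> carrier_vec d"
    using finsum_vec_closed[of u B d] finsum_vec_closed[of u' B d] assms(2,3) by (auto simp: Pi_iff)
  then show "dim_vec (finsum_vec TYPE('k) d u B) = dim_vec (finsum_vec TYPE('k) d u' B)" by auto
  fix i assume "i < dim_vec (finsum_vec TYPE('k) d u' B)"
  then have i: "i < d" using c by auto
  have u: "u' \<in> B \<rightarrow> carrier_vec d" "u \<in> B \<rightarrow> carrier_vec d" using assms(2,3) by force+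
  show "finsum_vec TYPE('k) d u B $ i = finsum_vec TYPE('k) d u' B $ i"
    unfolding index_finsum_vec[OF assms(1) i u(1)] index_finsum_vec[OF assms(1) i u(2)]
    by (rule sum.cong) (use assms(2) in auto)
qed

lemma mult_zero_vec: "A \<in> carrier_mat m d \<Longrightarrow> A *\<^sub>v 0\<^sub>v d = (0\<^sub>v m :: 'k::field vec)"
  by (rule eq_vecI) auto

lemma mult_finsum_vec:
  fixes A :: "'k::field mat"
  assumes B: "finite B" and A: "A \<in> carrier_mat m d" and u: "\<And>b. b \<in> B \<Longrightarrow> u b \<in> carrier_vec d"
  shows "A *\<^sub>v finsum_vec TYPE('k) d u B = finsum_vec TYPE('k) m (\<lambda>b. A *\<^sub>v u b) B"
  using B u
proof (induction B rule: finite_induct)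
  case empty
  have "A *\<^sub>v 0\<^sub>v d = 0\<^sub>v m" by (rule eq_vecI) (use A in auto)
  then show ?case by (simp add: finsum_vec_empty)
next
  case (insert b B)
  have c: "u \<in> B \<rightarrow> carrier_vec d" "u b \<in> carrier_vec d" using insert.prems by auto
  have c': "(\<lambda>b. A *\<^sub>v u b) \<in> B \<rightarrow> carrier_vec m" "A *\<^sub>v u b \<in> carrier_vec m"
    using c A mult_mat_vec_carrier by blast+
  have "A *\<^sub>v finsum_vec TYPE('k) d u (insert b B) = A *\<^sub>v (u b + finsum_vec TYPE('k) d u B)"
    using finsum_vec_insert[OF insert(1,2) c] by simp
  also have "\<dots> = A *\<^sub>v u b + A *\<^sub>v finsum_vec TYPE('k) d u B"
    by (rule mult_add_distrib_mat_vec[OF A c(2) finsum_vec_closed[OF c(1)]])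
  also have "\<dots> = finsum_vec TYPE('k) m (\<lambda>b. A *\<^sub>v u b) (insert b B)"
    using insert.IH insert.prems finsum_vec_insert[OF insert(1,2) c'] by simp
  finally show ?case .
qed

lemma nsum_carrier:
  assumes "is_rep n p M" "is_sink p a" "\<And>b. b \<in> nbrs n a \<Longrightarrow> v b \<in> carrier_vec (rdim M b)"
  shows "nsum n M a v \<in> carrier_vec (rdim M a)"
  unfolding nsum_def
  by (rule finsum_vec_mult_carrier[where e = "rdim M"]) (use assms nbrs_arrow(1) repD in blast)+

lemma nsum_cong:
  assumes M: "is_rep n p M" and a: "is_sink p a" and v: "\<And>b. b \<in> nbrs n a \<Longrightarrow> v b \<in> carrier_vec (rdim M b)"
    and e: "\<And>b. b \<in> nbrs n a \<Longrightarrow> v b = v' b"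
  shows "nsum n M a v = nsum n M a v'"
  unfolding nsum_def
proof (rule finsum_vec_cong[OF finite_nbrs])
  fix b assume b: "b \<in> nbrs n a"
  then show "rmap M b a *\<^sub>v v b = rmap M b a *\<^sub>v v' b" using e by simp
  show "rmap M b a *\<^sub>v v b \<in> carrier_vec (rdim M a)"
    using repD[OF M nbrs_arrow(1)[OF b a]] v[OF b] by (rule mult_mat_vec_carrier)
qed

lemma nsum_hom:
  assumes f: "is_hom n p M N f" and a: "is_sink p a" and v: "\<And>b. b \<in> nbrs n a \<Longrightarrow> v b \<in> carrier_vec (rdim M b)"
  shows "nsum n N a (\<lambda>b. f b *\<^sub>v v b) = f a *\<^sub>v nsum n M a v"
proof -
  have c: "rmap M b a *\<^sub>v v b \<in> carrier_vec (rdim M a)" if "b \<in> nbrs n a" for b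
    using repD[OF homD(1)[OF f] nbrs_arrow(1)[OF that a]] v[OF that] by (rule mult_mat_vec_carrier)
  have "f a *\<^sub>v nsum n M a v = finsum_vec TYPE('a) (rdim N a) (\<lambda>b. f a *\<^sub>v (rmap M b a *\<^sub>v v b)) (nbrs n a)"
    unfolding nsum_def by (rule mult_finsum_vec[OF finite_nbrs homD(3)[OF f] c])
  also have "\<dots> = nsum n N a (\<lambda>b. f b *\<^sub>v v b)"
    unfolding nsum_def
  proof (rule finsum_vec_cong[OF finite_nbrs])
    fix b assume b: "b \<in> nbrs n a"
    note ar = nbrs_arrow(1)[OF b a]
    have "f a *\<^sub>v (rmap M b a *\<^sub>v v b) = (f a * rmap M b a) *\<^sub>v v b"
      by (rule assoc_mult_mat_vec[OF homD(3)[OF f] repD[OF homD(1)[OF f] ar] v[OF b], symmetric])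
    also have "\<dots> = rmap N b a *\<^sub>v (f b *\<^sub>v v b)"
      unfolding homD(6)[OF f ar] by (rule assoc_mult_mat_vec[OF repD[OF homD(2)[OF f] ar] homD(3)[OF f] v[OF b]])
    finally show "f a *\<^sub>v (rmap M b a *\<^sub>v v b) = rmap N b a *\<^sub>v (f b *\<^sub>v v b)" .
    show "f a *\<^sub>v (rmap M b a *\<^sub>v v b) \<in> carrier_vec (rdim N a)"
      using homD(3)[OF f] c[OF b] by (rule mult_mat_vec_carrier)
  qed
  finally show ?thesis by simp
qed

section \<open>Exactness conditions at the reflected vertices\<close>

definition nbr_surj :: "nat \<Rightarrow> bool \<Rightarrow> 'k::field qrep \<Rightarrow> bool" where
  "nbr_surj n p M \<longleftrightarrow> (\<forall>a. tvert n a \<longrightarrow> is_sink p a \<longrightarrow> (\<forall>u\<in>carrier_vec (rdim M a).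
     \<exists>v. (\<forall>b\<in>nbrs n a. v b \<in> carrier_vec (rdim M b)) \<and> nsum n M a v = u))"

definition nbr_inj :: "nat \<Rightarrow> bool \<Rightarrow> 'k::field qrep \<Rightarrow> bool" where
  "nbr_inj n p A \<longleftrightarrow> (\<forall>a. tvert n a \<longrightarrow> \<not> is_sink p a \<longrightarrow> (\<forall>w\<in>carrier_vec (rdim A a).
     (\<forall>b\<in>nbrs n a. rmap A a b *\<^sub>v w = 0\<^sub>v (rdim A b)) \<longrightarrow> w = 0\<^sub>v (rdim A a)))"

text \<open>The common core of \<open>\<sigma>\<close> and \<open>\<sigma>\<^sup>-\<close>:
  exactness at the middle term of \<open>A_a \<rightarrow> \<Oplus> M_b \<rightarrow> M_a\<close>
  for every sink \<open>a\<close> of \<open>p\<close>. With injectivity on the left it becomes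
  \<open>refl_plus\<close>, with surjectivity on the right \<open>refl_minus\<close>. The core
  governs existence of lifted and descended maps, the two end conditions govern their
  uniqueness.\<close>

definition pre_refl :: "nat \<Rightarrow> bool \<Rightarrow> 'k::field qrep \<Rightarrow> 'k qrep \<Rightarrow> bool" where
  "pre_refl n p M A \<longleftrightarrow> is_rep n p M \<and> is_rep n (\<not> p) A \<and> (\<forall>b. \<not> is_sink p b \<longrightarrow> rdim A b = rdim M b) \<and>
     (\<forall>a. tvert n a \<longrightarrow> is_sink p a \<longrightarrow>
       (\<forall>w\<in>carrier_vec (rdim A a). nsum n M a (\<lambda>b. rmap A a b *\<^sub>v w) = 0\<^sub>v (rdim M a)) \<and>
       (\<forall>v. (\<forall>b\<in>nbrs n a. v b \<in> carrier_vec (rdim M b)) \<longrightarrow> nsum n M a v = 0\<^sub>v (rdim M a) \<longrightarrow>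
          (\<exists>w\<in>carrier_vec (rdim A a). \<forall>b\<in>nbrs n a. rmap A a b *\<^sub>v w = v b)))"

lemma pre_reflD:
  assumes "pre_refl n p M A"
  shows "is_rep n p M" "is_rep n (\<not> p) A" "\<And>b. \<not> is_sink p b \<Longrightarrow> rdim A b = rdim M b"
    "\<And>a w. is_sink p a \<Longrightarrow> tvert n a \<Longrightarrow> w \<in> carrier_vec (rdim A a) \<Longrightarrow> nsum n M a (\<lambda>b. rmap A a b *\<^sub>v w) = 0\<^sub>v (rdim M a)"
    "\<And>a v. is_sink p a \<Longrightarrow> tvert n a \<Longrightarrow> (\<And>b. b\<in>nbrs n a \<Longrightarrow> v b \<in> carrier_vec (rdim M b)) \<Longrightarrow> nsum n M a v = 0\<^sub>v (rdim M a) \<Longrightarrow>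
       \<exists>w\<in>carrier_vec (rdim A a). \<forall>b\<in>nbrs n a. rmap A a b *\<^sub>v w = v b"
  using assms unfolding pre_refl_def by blast+

lemma refl_plus_iff: "refl_plus n p M A \<longleftrightarrow> pre_refl n p M A \<and> nbr_inj n (\<not> p) A"
proof -
  have d: "(\<forall>b\<in>nbrs n a. rmap A a b *\<^sub>v w = 0\<^sub>v (rdim M b)) \<longleftrightarrow> (\<forall>b\<in>nbrs n a. rmap A a b *\<^sub>v w = 0\<^sub>v (rdim A b))"
    if "is_sink p a" "\<forall>b. \<not> is_sink p b \<longrightarrow> rdim A b = rdim M b" for a w
    using that nbrs_arrow(3)[OF _ that(1)] by metis
  show ?thesis unfolding refl_plus_def pre_refl_def nbr_inj_def nsum_def[symmetric] is_sink_not not_not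
    by (safe; metis d)
qed

lemma refl_minus_iff: "refl_minus n (\<not> p) A M \<longleftrightarrow> pre_refl n p M A \<and> nbr_surj n p M"
proof -
  have d: "(\<forall>b\<in>nbrs n a. v b \<in> carrier_vec (rdim A b)) \<longleftrightarrow> (\<forall>b\<in>nbrs n a. v b \<in> carrier_vec (rdim M b))"
    if "is_sink p a" "\<forall>b. \<not> is_sink p b \<longrightarrow> rdim A b = rdim M b" for a and v :: "nat list \<Rightarrow> 'a vec"
    using that nbrs_arrow(3)[OF _ that(1)] by metis
  have "refl_minus n (\<not> p) A M \<longleftrightarrow> is_rep n p M \<and> is_rep n (\<not> p) A \<and> (\<forall>b. \<not> is_sink p b \<longrightarrow> rdim A b = rdim M b) \<and>
     (\<forall>a. tvert n a \<longrightarrow> is_sink p a \<longrightarrow>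
       (\<forall>w\<in>carrier_vec (rdim A a). nsum n M a (\<lambda>b. rmap A a b *\<^sub>v w) = 0\<^sub>v (rdim M a)) \<and>
       (\<forall>u\<in>carrier_vec (rdim M a). \<exists>v. (\<forall>b\<in>nbrs n a. v b \<in> carrier_vec (rdim A b)) \<and> nsum n M a v = u) \<and>
       (\<forall>v. (\<forall>b\<in>nbrs n a. v b \<in> carrier_vec (rdim A b)) \<longrightarrow> nsum n M a v = 0\<^sub>v (rdim M a) \<longrightarrow>
          (\<exists>w\<in>carrier_vec (rdim A a). \<forall>b\<in>nbrs n a. v b = rmap A a b *\<^sub>v w)))"
    unfolding refl_minus_def nsum_def[symmetric] is_sink_not not_not by (auto 0 0 simp only: eq_commute[of "rdim M _"])
  also have "\<dots> \<longleftrightarrow> is_rep n p M \<and> is_rep n (\<not> p) A \<and> (\<forall>b. \<not> is_sink p b \<longrightarrow> rdim A b = rdim M b) \<and>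
     (\<forall>a. tvert n a \<longrightarrow> is_sink p a \<longrightarrow>
       (\<forall>w\<in>carrier_vec (rdim A a). nsum n M a (\<lambda>b. rmap A a b *\<^sub>v w) = 0\<^sub>v (rdim M a)) \<and>
       (\<forall>u\<in>carrier_vec (rdim M a). \<exists>v. (\<forall>b\<in>nbrs n a. v b \<in> carrier_vec (rdim M b)) \<and> nsum n M a v = u) \<and>
       (\<forall>v. (\<forall>b\<in>nbrs n a. v b \<in> carrier_vec (rdim M b)) \<longrightarrow> nsum n M a v = 0\<^sub>v (rdim M a) \<longrightarrow>
          (\<exists>w\<in>carrier_vec (rdim A a). \<forall>b\<in>nbrs n a. rmap A a b *\<^sub>v w = v b)))"
    apply (intro conj_cong refl all_cong1 imp_cong)
      apply (simp only: d)
     apply (rule d; assumption)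
    apply (intro bex_cong ball_cong refl eq_commute)
    done
  also have "\<dots> \<longleftrightarrow> pre_refl n p M A \<and> nbr_surj n p M"
  proof -
    have split3: "(\<forall>a. T a \<longrightarrow> S a \<longrightarrow> P a \<and> Q a \<and> R a) \<longleftrightarrow>
      (\<forall>a. T a \<longrightarrow> S a \<longrightarrow> P a \<and> R a) \<and> (\<forall>a. T a \<longrightarrow> S a \<longrightarrow> Q a)" for T S P Q R :: "nat list \<Rightarrow> bool"
      by (simp only: imp_conjR all_conj_distrib conj_ac)
    show ?thesis unfolding pre_refl_def nbr_surj_def split3 conj_assoc ..
  qed
  finally show ?thesis .
qed

lemma refl_minus_iff': "refl_minus n p A M \<longleftrightarrow> pre_refl n (\<not> p) M A \<and> nbr_surj n (\<not> p) M"
  using refl_minus_iff[of n "\<not> p" A M] by simp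

lemma mult_unit_vec:
  "C \<in> carrier_mat m d \<Longrightarrow> j < d \<Longrightarrow> C *\<^sub>v unit_vec d j = col (C :: 'k::field mat) j"
  by (rule eq_vecI) auto

text \<open>The solutions for the unit vectors are the columns of \<open>G\<close>, which turns
  solvability for each single vector into a linear map.\<close>

lemma lift_columns:
  fixes K C :: "'b \<Rightarrow> 'k::field mat"
  assumes K: "\<And>b. b \<in> B \<Longrightarrow> K b \<in> carrier_mat (e b) d'" and C: "\<And>b. b \<in> B \<Longrightarrow> C b \<in> carrier_mat (e b) d"
    and ex: "\<And>w. w \<in> carrier_vec d \<Longrightarrow> \<exists>z\<in>carrier_vec d'. \<forall>b\<in>B. K b *\<^sub>v z = C b *\<^sub>v w"
  shows "\<exists>G\<in>carrier_mat d' d. \<forall>b\<in>B. K b * G = C b"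
proof -
  have "\<forall>j. \<exists>z. z \<in> carrier_vec d' \<and> (\<forall>b\<in>B. K b *\<^sub>v z = C b *\<^sub>v unit_vec d j)"
    using ex[OF unit_vec_carrier] by blast
  then obtain z where z: "\<And>j. z j \<in> carrier_vec d'" "\<And>j b. b \<in> B \<Longrightarrow> K b *\<^sub>v z j = C b *\<^sub>v unit_vec d j" by metis
  define G where "G = mat d' d (\<lambda>(i,j). z j $ i)"
  have G: "G \<in> carrier_mat d' d" by (simp add: G_def)
  have cG: "col G j = z j" if "j < d" for j
    by (rule eq_vecI) (use that z(1)[of j] in \<open>auto simp: G_def\<close>)
  have "K b * G = C b" if b: "b \<in> B" for b
  proof (rule mat_col_eqI)
    fix j assume "j < dim_col (C b)"
    then have j: "j < d" using C[OF b] by simp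
    show "col (K b * G) j = col (C b) j"
      using col_mult2[OF K[OF b] G j] cG[OF j] z(2)[OF b, of j] mult_unit_vec[OF C[OF b] j] by simp
  qed (use K[OF b] C[OF b] G in auto)
  then show ?thesis using G by blast
qed

section \<open>Lifting and descending homomorphisms\<close>

text \<open>At a sink \<open>a\<close> the map \<open>f\<close> carries the image of
  \<open>A_a\<close> into the kernel of the neighbour sum of \<open>M'\<close>, which is the image
  of \<open>A'_a\<close>, and preimages give \<open>g a\<close>. At the other vertices
  \<open>g\<close> equals \<open>f\<close>; all later comparisons of maps rest on this
  agreement.\<close>

lemma pre_refl_lift:
  fixes M M' A A' :: "'k::field qrep"
  assumes MA: "pre_refl n p M A" and MA': "pre_refl n p M' A'" and f: "is_hom n p M M' f"
  shows "\<exists>g. is_hom n (\<not> p) A A' g \<and> (\<forall>b. \<not> is_sink p b \<longrightarrow> g b = f b)"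
proof -
  note D = pre_reflD[OF MA] and D' = pre_reflD[OF MA']
  have "\<exists>G\<in>carrier_mat (rdim A' a) (rdim A a). \<forall>b\<in>nbrs n a. rmap A' a b * G = f b * rmap A a b"
    if a: "is_sink p a" "tvert n a" for a
  proof (rule lift_columns[where e = "rdim A'"])
    fix b assume b: "b \<in> nbrs n a"
    note ar = nbrs_arrow(2)[OF b a(1)] and nb = nbrs_arrow(3)[OF b a(1)]
    show "rmap A' a b \<in> carrier_mat (rdim A' b) (rdim A' a)" using repD[OF D'(2) ar] .
    show "f b * rmap A a b \<in> carrier_mat (rdim A' b) (rdim A a)"
      using homD(3)[OF f, of b] repD[OF D(2) ar] D(3)[OF nb] D'(3)[OF nb] by simp
  next
    fix w :: "'k vec" assume w: "w \<in> carrier_vec (rdim A a)"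
    have c: "rmap A a b *\<^sub>v w \<in> carrier_vec (rdim M b)" if "b \<in> nbrs n a" for b
      using repD[OF D(2) nbrs_arrow(2)[OF that a(1)]] D(3)[OF nbrs_arrow(3)[OF that a(1)]] w
      by (simp add: mult_mat_vec_carrier)
    have "nsum n M' a (\<lambda>b. f b *\<^sub>v (rmap A a b *\<^sub>v w)) = f a *\<^sub>v 0\<^sub>v (rdim M a)"
      using nsum_hom[OF f a(1), of "\<lambda>b. rmap A a b *\<^sub>v w"] c D(4)[OF a w] by simp
    also have "\<dots> = 0\<^sub>v (rdim M' a)" by (rule mult_zero_vec[OF homD(3)[OF f]])
    finally have z: "nsum n M' a (\<lambda>b. f b *\<^sub>v (rmap A a b *\<^sub>v w)) = 0\<^sub>v (rdim M' a)" .
    have c': "f b *\<^sub>v (rmap A a b *\<^sub>v w) \<in> carrier_vec (rdim M' b)" if "b \<in> nbrs n a" for b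
      using homD(3)[OF f] c[OF that] by (rule mult_mat_vec_carrier)
    obtain z where z: "z\<in>carrier_vec (rdim A' a)" "\<And>b. b\<in>nbrs n a \<Longrightarrow> rmap A' a b *\<^sub>v z = f b *\<^sub>v (rmap A a b *\<^sub>v w)"
      using D'(5)[OF a c' z] by blast
    have "rmap A' a b *\<^sub>v z = (f b * rmap A a b) *\<^sub>v w" if "b \<in> nbrs n a" for b
      using z(2)[OF that] assoc_mult_mat_vec[OF homD(3)[OF f, of b], of "rmap A a b" "rdim A a" w] w
        repD[OF D(2) nbrs_arrow(2)[OF that a(1)]] D(3)[OF nbrs_arrow(3)[OF that a(1)]] by simp
    then show "\<exists>z\<in>carrier_vec (rdim A' a). \<forall>b\<in>nbrs n a. rmap A' a b *\<^sub>v z = (f b * rmap A a b) *\<^sub>v w" using z(1) by blast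
  qed
  then obtain G where G: "\<And>a. is_sink p a \<Longrightarrow> tvert n a \<Longrightarrow> G a \<in> carrier_mat (rdim A' a) (rdim A a)"
    "\<And>a b. is_sink p a \<Longrightarrow> tvert n a \<Longrightarrow> b\<in>nbrs n a \<Longrightarrow> rmap A' a b * G a = f b * rmap A a b" by metis
  define g where "g x = (if is_sink p x then if tvert n x then G x else 0\<^sub>m (rdim A' x) (rdim A x) else f x)" for x
  have "is_hom n (\<not> p) A A' g"
  proof (rule homI[OF D(2) D'(2)])
    show "g x \<in> carrier_mat (rdim A' x) (rdim A x)" for x
      using G(1) homD(3)[OF f, of x] D(3)[of x] D'(3)[of x] by (auto simp: g_def)
    fix x y assume "arrow n (\<not> p) x y"
    then have "arrow n p y x" by (simp add: arrow_flip)
    then have "y \<in> nbrs n x" "is_sink p x" "tvert n x" "\<not> is_sink p y" using arrow_nbrs by blast+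
    then show "g y * rmap A x y = rmap A' x y * g x" using G(2) by (simp add: g_def)
  qed
  then show ?thesis by (intro exI[of _ g]) (simp add: g_def)
qed

text \<open>Dual to lifting. At a sink, \<open>g\<close> followed by the neighbour sum of
  \<open>M'\<close> vanishes on the kernel of the neighbour sum of \<open>M\<close>, because that
  kernel is the image of \<open>A_a\<close>. It therefore factors through the neighbour sum of
  \<open>M\<close>, and the factor is \<open>f a\<close>.\<close>

lemma pre_refl_descend:
  fixes M M' A A' :: "'k::field qrep"
  assumes MA: "pre_refl n p M A" and MA': "pre_refl n p M' A'" and g: "is_hom n (\<not> p) A A' g"
  shows "\<exists>f. is_hom n p M M' f \<and> (\<forall>b. \<not> is_sink p b \<longrightarrow> f b = g b)"
proof -
  note D = pre_reflD[OF MA] and D' = pre_reflD[OF MA']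
  have "\<exists>G\<in>carrier_mat (rdim M' a) (rdim M a). \<forall>b\<in>nbrs n a. G * rmap M b a = rmap M' b a * g b"
    if a: "is_sink p a" "tvert n a" for a
  proof (rule neighbour_sum_factor[where e = "rdim M", OF finite_nbrs])
    have gc: "g b \<in> carrier_mat (rdim M' b) (rdim M b)" if "b \<in> nbrs n a" for b
      using homD(3)[OF g, of b] D(3)[OF nbrs_arrow(3)[OF that a(1)]] D'(3)[OF nbrs_arrow(3)[OF that a(1)]] by simp
    fix b assume b: "b \<in> nbrs n a"
    note ar = nbrs_arrow(1)[OF b a(1)]
    show "rmap M b a \<in> carrier_mat (rdim M a) (rdim M b)" using repD[OF D(1) ar] .
    show "rmap M' b a * g b \<in> carrier_mat (rdim M' a) (rdim M b)" using repD[OF D'(1) ar] gc[OF b] by simp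
  next
    have gc: "g b \<in> carrier_mat (rdim M' b) (rdim M b)" if "b \<in> nbrs n a" for b
      using homD(3)[OF g, of b] D(3)[OF nbrs_arrow(3)[OF that a(1)]] D'(3)[OF nbrs_arrow(3)[OF that a(1)]] by simp
    fix v :: "nat list \<Rightarrow> 'k vec" assume v: "\<And>b. b \<in> nbrs n a \<Longrightarrow> v b \<in> carrier_vec (rdim M b)"
      and z: "finsum_vec TYPE('k) (rdim M a) (\<lambda>b. rmap M b a *\<^sub>v v b) (nbrs n a) = 0\<^sub>v (rdim M a)"
    obtain w where w: "w\<in>carrier_vec (rdim A a)" "\<And>b. b\<in>nbrs n a \<Longrightarrow> rmap A a b *\<^sub>v w = v b"
      using D(5)[OF a v] z by (auto simp: nsum_def)
    have w': "g a *\<^sub>v w \<in> carrier_vec (rdim A' a)" using homD(3)[OF g] w(1) by (rule mult_mat_vec_carrier)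
    have c: "g b *\<^sub>v v b \<in> carrier_vec (rdim M' b)" if "b \<in> nbrs n a" for b
      using gc[OF that] v[OF that] by (rule mult_mat_vec_carrier)
    have e: "g b *\<^sub>v v b = rmap A' a b *\<^sub>v (g a *\<^sub>v w)" if b: "b \<in> nbrs n a" for b
    proof -
      note ar = nbrs_arrow(2)[OF b a(1)]
      have "g b *\<^sub>v (rmap A a b *\<^sub>v w) = (g b * rmap A a b) *\<^sub>v w"
        by (rule assoc_mult_mat_vec[OF homD(3)[OF g] repD[OF D(2) ar] w(1), symmetric])
      also have "\<dots> = rmap A' a b *\<^sub>v (g a *\<^sub>v w)"
        unfolding homD(6)[OF g ar] by (rule assoc_mult_mat_vec[OF repD[OF D'(2) ar] homD(3)[OF g] w(1)])
      finally show ?thesis using w(2)[OF b] by simp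
    qed
    have "finsum_vec TYPE('k) (rdim M' a) (\<lambda>b. (rmap M' b a * g b) *\<^sub>v v b) (nbrs n a) = nsum n M' a (\<lambda>b. g b *\<^sub>v v b)"
      unfolding nsum_def
    proof (rule finsum_vec_cong[OF finite_nbrs])
      fix b assume b: "b \<in> nbrs n a"
      note r = repD[OF D'(1) nbrs_arrow(1)[OF b a(1)]]
      show "(rmap M' b a * g b) *\<^sub>v v b = rmap M' b a *\<^sub>v (g b *\<^sub>v v b)"
        by (rule assoc_mult_mat_vec[OF r gc[OF b] v[OF b]])
      then show "(rmap M' b a * g b) *\<^sub>v v b \<in> carrier_vec (rdim M' a)"
        using mult_mat_vec_carrier[OF r c[OF b]] by simp
    qed
    also have "\<dots> = nsum n M' a (\<lambda>b. rmap A' a b *\<^sub>v (g a *\<^sub>v w))"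
      by (rule nsum_cong[OF D'(1) a(1) c e])
    also have "\<dots> = 0\<^sub>v (rdim M' a)" by (rule D'(4)[OF a w'])
    finally show "finsum_vec TYPE('k) (rdim M' a) (\<lambda>b. (rmap M' b a * g b) *\<^sub>v v b) (nbrs n a) = 0\<^sub>v (rdim M' a)" .
  qed
  then obtain G where G: "\<And>a. is_sink p a \<Longrightarrow> tvert n a \<Longrightarrow> G a \<in> carrier_mat (rdim M' a) (rdim M a)"
    "\<And>a b. is_sink p a \<Longrightarrow> tvert n a \<Longrightarrow> b\<in>nbrs n a \<Longrightarrow> G a * rmap M b a = rmap M' b a * g b" by metis
  define f where "f x = (if is_sink p x then if tvert n x then G x else 0\<^sub>m (rdim M' x) (rdim M x) else g x)" for x
  have "is_hom n p M M' f"
  proof (rule homI[OF D(1) D'(1)])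
    show "f x \<in> carrier_mat (rdim M' x) (rdim M x)" for x
      using G(1) homD(3)[OF g, of x] D(3)[of x] D'(3)[of x] by (auto simp: f_def)
    fix y x assume "arrow n p y x"
    then have "y \<in> nbrs n x" "is_sink p x" "tvert n x" "\<not> is_sink p y" using arrow_nbrs by blast+
    then show "f x * rmap M y x = rmap M' y x * f y" using G(2) by (simp add: f_def)
  qed
  then show ?thesis by (intro exI[of _ f]) (simp add: f_def)
qed

text \<open>Uniqueness of lifts: at a source the two maps become equal after every outgoing
  structure map of \<open>A'\<close>, and these are jointly injective.\<close>

lemma hom_eq_nbr_inj:
  fixes A A' :: "'k::field qrep"
  assumes g: "is_hom n p A A' g" and g': "is_hom n p A A' g'" and i: "nbr_inj n p A'"
    and e: "\<And>b. is_sink p b \<Longrightarrow> g b = g' b"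
  shows "g = g'"
proof (rule ext)
  fix x
  have rz: "rdim A x = 0" if "\<not> tvert n x" using that homD(1)[OF g] by (auto simp: is_rep_def)
  show "g x = g' x"
  proof (cases "is_sink p x \<or> \<not> tvert n x")
    case True
    then show ?thesis
    proof
      assume "\<not> tvert n x" then show ?thesis using rz homD(4,5)[OF g] homD(4,5)[OF g'] by (intro zero_dim_mat_eq) auto
    qed (rule e)
  next
    case False
    then have x: "\<not> is_sink p x" "tvert n x" by auto
    show ?thesis
    proof (rule mat_col_eqI)
      fix j assume "j < dim_col (g' x)"
      then have j: "j < rdim A x" using homD(5)[OF g'] by simp
      define w where "w = col (g x) j - col (g' x) j"
      have c: "col (g x) j \<in> carrier_vec (rdim A' x)" "col (g' x) j \<in> carrier_vec (rdim A' x)"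
        using homD(4)[OF g] homD(4)[OF g'] by (auto intro!: carrier_vecI)
      have w: "w \<in> carrier_vec (rdim A' x)" using c by (simp add: w_def)
      have "rmap A' x b *\<^sub>v w = 0\<^sub>v (rdim A' b)" if b: "b \<in> nbrs n x" for b
      proof -
        have ar: "arrow n p x b" using nbrs_arrow[OF b, of "\<not> p"] x by (simp add: is_sink_not)
        have sb: "is_sink p b" using ar by (simp add: arrow_def)
        note r = repD[OF homD(2)[OF g] ar]
        have "rmap A' x b *\<^sub>v col (g x) j = col (g b * rmap A x b) j"
          using col_mult2[OF r homD(3)[OF g] j] homD(6)[OF g ar] by simp
        also have "\<dots> = rmap A' x b *\<^sub>v col (g' x) j"
          using col_mult2[OF r homD(3)[OF g'] j] homD(6)[OF g' ar] e[OF sb] by simp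
        finally have "rmap A' x b *\<^sub>v w = rmap A' x b *\<^sub>v col (g' x) j - rmap A' x b *\<^sub>v col (g' x) j"
          unfolding w_def using mult_minus_distrib_mat_vec[OF r c] by simp
        also have "\<dots> = 0\<^sub>v (rdim A' b)" using mult_mat_vec_carrier[OF r c(2)] by (rule minus_cancel_vec)
        finally show ?thesis .
      qed
      then have w0: "w = 0\<^sub>v (rdim A' x)" using i x w unfolding nbr_inj_def by blast
      show "col (g x) j = col (g' x) j"
      proof (rule eq_vecI)
        fix i assume "i < dim_vec (col (g' x) j)"
        then have ii: "i < rdim A' x" using homD(4)[OF g'] by simp
        have w_i: "w $ i = 0" using w0 ii by simp
        have "i < dim_vec (col (g' x) j)" using homD(4)[OF g'] ii by simp
        from index_minus_vec(1)[OF this, of "col (g x) j"]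
        have "w $ i = col (g x) j $ i - col (g' x) j $ i" by (simp only: w_def)
        then show "col (g x) j $ i = col (g' x) j $ i" using w_i by simp
      qed (use homD(4)[OF g] homD(4)[OF g'] in auto)
    qed (use homD(4,5)[OF g] homD(4,5)[OF g'] in auto)
  qed
qed

text \<open>Uniqueness of descents: at a sink every vector is a sum of images from the neighbours,
  where the two maps agree.\<close>

lemma hom_eq_nbr_surj:
  fixes M M' :: "'k::field qrep"
  assumes f: "is_hom n p M M' f" and f': "is_hom n p M M' f'" and s: "nbr_surj n p M"
    and e: "\<And>b. \<not> is_sink p b \<Longrightarrow> f b = f' b"
  shows "f = f'"
proof (rule ext)
  fix x
  have rz: "rdim M x = 0" if "\<not> tvert n x" using that homD(1)[OF f] by (auto simp: is_rep_def)
  show "f x = f' x"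
  proof (cases "\<not> is_sink p x \<or> \<not> tvert n x")
    case True
    then show ?thesis
    proof
      assume "\<not> tvert n x" then show ?thesis using rz homD(4,5)[OF f] homD(4,5)[OF f'] by (intro zero_dim_mat_eq) auto
    qed (rule e)
  next
    case False
    then have x: "is_sink p x" "tvert n x" by auto
    show ?thesis
    proof (rule mat_col_eqI)
      fix j assume "j < dim_col (f' x)"
      then have j: "j < rdim M x" using homD(5)[OF f'] by simp
      obtain v where v: "\<And>b. b\<in>nbrs n x \<Longrightarrow> v b \<in> carrier_vec (rdim M b)" "nsum n M x v = unit_vec (rdim M x) j"
        using s x unit_vec_carrier[of "rdim M x" j] unfolding nbr_surj_def by blast
      have c: "f b *\<^sub>v v b \<in> carrier_vec (rdim M' b)" if "b \<in> nbrs n x" for b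
        using homD(3)[OF f] v(1)[OF that] by (rule mult_mat_vec_carrier)
      have "f x *\<^sub>v unit_vec (rdim M x) j = nsum n M' x (\<lambda>b. f b *\<^sub>v v b)"
        using nsum_hom[OF f x(1) v(1)] v(2) by simp
      also have "\<dots> = nsum n M' x (\<lambda>b. f' b *\<^sub>v v b)"
        by (rule nsum_cong[OF homD(2)[OF f] x(1) c]) (use e nbrs_arrow(3)[OF _ x(1)] in auto)
      also have "\<dots> = f' x *\<^sub>v unit_vec (rdim M x) j"
        using nsum_hom[OF f' x(1) v(1)] v(2) by simp
      finally show "col (f x) j = col (f' x) j"
        using mult_unit_vec[OF homD(3)[OF f] j] mult_unit_vec[OF homD(3)[OF f'] j] by simp
    qed (use homD(4,5)[OF f] homD(4,5)[OF f'] in auto)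
  qed
qed

section \<open>Existence of reflections\<close>

lemma refl_plus_exists:
  fixes M :: "'k::field qrep"
  assumes M: "is_rep n p M"
  shows "\<exists>A. refl_plus n p M A"
proof -
  have "\<forall>a. \<exists>r K. is_sink p a \<longrightarrow> (\<forall>b\<in>nbrs n a. K b \<in> carrier_mat (rdim M b) r) \<and>
    (\<forall>w\<in>carrier_vec r. finsum_vec TYPE('k) (rdim M a) (\<lambda>b. rmap M b a *\<^sub>v (K b *\<^sub>v w)) (nbrs n a) = 0\<^sub>v (rdim M a)) \<and>
    (\<forall>w\<in>carrier_vec r. (\<forall>b\<in>nbrs n a. K b *\<^sub>v w = 0\<^sub>v (rdim M b)) \<longrightarrow> w = 0\<^sub>v r) \<and>
    (\<forall>v. (\<forall>b\<in>nbrs n a. v b \<in> carrier_vec (rdim M b)) \<longrightarrow> finsum_vec TYPE('k) (rdim M a) (\<lambda>b. rmap M b a *\<^sub>v v b) (nbrs n a) = 0\<^sub>v (rdim M a) \<longrightarrow>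
      (\<exists>w\<in>carrier_vec r. \<forall>b\<in>nbrs n a. K b *\<^sub>v w = v b))" (is "\<forall>a. \<exists>r K. is_sink p a \<longrightarrow> ?P a r K")
  proof
    fix a show "\<exists>r K. is_sink p a \<longrightarrow> ?P a r K"
    proof (cases "is_sink p a")
      case True
      have "\<exists>r K. ?P a r K"
        by (rule neighbour_sum_kernel[OF finite_nbrs]) (rule repD[OF M nbrs_arrow(1)[OF _ True]])
      then show ?thesis by blast
    qed blast
  qed
  then have "\<exists>r. \<forall>a. \<exists>K. is_sink p a \<longrightarrow> ?P a (r a) K" by (rule choice)
  then obtain r where "\<forall>a. \<exists>K. is_sink p a \<longrightarrow> ?P a (r a) K" ..
  then have "\<exists>K. \<forall>a. is_sink p a \<longrightarrow> ?P a (r a) (K a)" by (rule choice)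
  then obtain K where K0: "\<forall>a. is_sink p a \<longrightarrow> ?P a (r a) (K a)" ..
  have rK: "\<And>a. is_sink p a \<Longrightarrow> ?P a (r a) (K a)" by (rule mp[OF spec[OF K0]])
  define A where "A = \<lparr>rdim = (\<lambda>x. if is_sink p x then if tvert n x then r x else 0 else rdim M x), rmap = K\<rparr>"
  have A: "rdim A x = (if is_sink p x then if tvert n x then r x else 0 else rdim M x)" "rmap A = K" for x
    by (simp_all add: A_def)
  \<comment> \<open>A nonzero kernel at \<open>x\<close> forces a neighbour into the support of
    \<open>M\<close>, so the new support stays within distance one of the old one and is
    finite.\<close>
  have sub: "{x. rdim A x \<noteq> 0} \<subseteq> supp M \<union> (\<Union>b\<in>supp M. nbrs n b)"
  proof
    fix x assume "x \<in> {x. rdim A x \<noteq> 0}"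
    then have x: "rdim A x \<noteq> 0" by simp
    show "x \<in> supp M \<union> (\<Union>b\<in>supp M. nbrs n b)"
    proof (cases "is_sink p x")
      case True
      then have r: "r x \<noteq> 0" using x A by (simp split: if_splits)
      have "\<exists>b\<in>nbrs n x. rdim M b \<noteq> 0"
      proof (rule ccontr)
        assume "\<not> ?thesis"
        then have z: "\<And>b. b \<in> nbrs n x \<Longrightarrow> rdim M b = 0" by blast
        have "K x b *\<^sub>v unit_vec (r x) 0 = 0\<^sub>v (rdim M b)" if "b \<in> nbrs n x" for b
          by (rule eq_vecI) (use rK[OF True] that z[OF that] in auto)
        then have "unit_vec (r x) 0 = (0\<^sub>v (r x) :: 'k vec)" using rK[OF True] unit_vec_carrier by blast
        then show False using r by simp
      qed
      then show ?thesis using nbrs_sym by (auto simp: supp_def)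
    next
      case False then show ?thesis using x A by (simp add: supp_def)
    qed
  qed
  have "is_rep n (\<not> p) A"
    unfolding is_rep_def
  proof (intro conjI allI impI)
    show "rdim A x = 0" if "\<not> tvert n x" for x using that M by (auto simp: A is_rep_def)
    show "finite {x. rdim A x \<noteq> 0}"
      using sub supp_finite[OF M] finite_nbrs by (auto intro: finite_subset)
    fix x y assume "arrow n (\<not> p) x y"
    then have "arrow n p y x" by (simp add: arrow_flip)
    then have "y \<in> nbrs n x" "is_sink p x" "tvert n x" "\<not> is_sink p y" using arrow_nbrs by blast+
    then show "rmap A x y \<in> carrier_mat (rdim A y) (rdim A x)" using rK[of x] by (simp add: A)
  qed
  then have "refl_plus n p M A"
    unfolding refl_plus_def using M rK by (simp add: A)
  then show ?thesis by blast
qed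

lemma refl_minus_exists:
  fixes M :: "'k::field qrep"
  assumes M: "is_rep n p M"
  shows "\<exists>N. refl_minus n p M N"
proof -
  have "\<forall>a. \<exists>r Q. \<not> is_sink p a \<longrightarrow> (\<forall>b\<in>nbrs n a. Q b \<in> carrier_mat r (rdim M b)) \<and>
    (\<forall>w\<in>carrier_vec (rdim M a). finsum_vec TYPE('k) r (\<lambda>b. Q b *\<^sub>v (rmap M a b *\<^sub>v w)) (nbrs n a) = 0\<^sub>v r) \<and>
    (\<forall>u\<in>carrier_vec r. \<exists>v. (\<forall>b\<in>nbrs n a. v b \<in> carrier_vec (rdim M b)) \<and> finsum_vec TYPE('k) r (\<lambda>b. Q b *\<^sub>v v b) (nbrs n a) = u) \<and>
    (\<forall>v. (\<forall>b\<in>nbrs n a. v b \<in> carrier_vec (rdim M b)) \<longrightarrow> finsum_vec TYPE('k) r (\<lambda>b. Q b *\<^sub>v v b) (nbrs n a) = 0\<^sub>v r \<longrightarrow>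
      (\<exists>w\<in>carrier_vec (rdim M a). \<forall>b\<in>nbrs n a. v b = rmap M a b *\<^sub>v w))" (is "\<forall>a. \<exists>r Q. \<not> is_sink p a \<longrightarrow> ?P a r Q")
  proof
    fix a show "\<exists>r Q. \<not> is_sink p a \<longrightarrow> ?P a r Q"
    proof (cases "is_sink p a")
      case False
      then have s: "is_sink (\<not> p) a" by (simp add: is_sink_not)
      have "\<exists>r Q. ?P a r Q"
        by (rule neighbour_sum_cokernel[OF finite_nbrs]) (use repD[OF M] nbrs_arrow(2)[OF _ s] in simp)
      then show ?thesis by blast
    qed blast
  qed
  then have "\<exists>r. \<forall>a. \<exists>Q. \<not> is_sink p a \<longrightarrow> ?P a (r a) Q" by (rule choice)
  then obtain r where "\<forall>a. \<exists>Q. \<not> is_sink p a \<longrightarrow> ?P a (r a) Q" ..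
  then have "\<exists>Q. \<forall>a. \<not> is_sink p a \<longrightarrow> ?P a (r a) (Q a)" by (rule choice)
  then obtain Q where Q0: "\<forall>a. \<not> is_sink p a \<longrightarrow> ?P a (r a) (Q a)" ..
  have rQ: "\<And>a. \<not> is_sink p a \<Longrightarrow> ?P a (r a) (Q a)" by (rule mp[OF spec[OF Q0]])
  define N where "N = \<lparr>rdim = (\<lambda>x. if is_sink p x then rdim M x else if tvert n x then r x else 0), rmap = (\<lambda>b a. Q a b)\<rparr>"
  have N: "rdim N x = (if is_sink p x then rdim M x else if tvert n x then r x else 0)" "rmap N b a = Q a b" for x a b
    by (simp_all add: N_def)
  have sub: "{x. rdim N x \<noteq> 0} \<subseteq> supp M \<union> (\<Union>b\<in>supp M. nbrs n b)"
  proof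
    fix x assume "x \<in> {x. rdim N x \<noteq> 0}"
    then have x: "rdim N x \<noteq> 0" by simp
    show "x \<in> supp M \<union> (\<Union>b\<in>supp M. nbrs n b)"
    proof (cases "is_sink p x")
      case False
      then have r: "r x \<noteq> 0" using x N by (simp split: if_splits)
      have "\<exists>b\<in>nbrs n x. rdim M b \<noteq> 0"
      proof (rule ccontr)
        assume "\<not> ?thesis"
        then have z: "\<And>b. b \<in> nbrs n x \<Longrightarrow> rdim M b = 0" by blast
        have Qc: "\<And>b. b \<in> nbrs n x \<Longrightarrow> Q x b \<in> carrier_mat (r x) (rdim M b)" using rQ[OF False] by blast
        obtain v where v: "\<And>b. b\<in>nbrs n x \<Longrightarrow> v b \<in> carrier_vec (rdim M b)"
          "finsum_vec TYPE('k) (r x) (\<lambda>b. Q x b *\<^sub>v v b) (nbrs n x) = unit_vec (r x) 0"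
          using rQ[OF False] unit_vec_carrier[of "r x" 0] by blast
        have "finsum_vec TYPE('k) (r x) (\<lambda>b. Q x b *\<^sub>v v b) (nbrs n x) $ 0 =
          (\<Sum>(b,j)\<in>Sigma (nbrs n x) (\<lambda>b. {..<rdim M b}). Q x b $$ (0,j) * v b $ j)"
          by (rule finsum_vec_mult_index[OF finite_nbrs Qc v(1)]) (use r in auto)
        also have "Sigma (nbrs n x) (\<lambda>b. {..<rdim M b}) = {}" using z by auto
        finally show False using v(2) r by simp
      qed
      then show ?thesis using nbrs_sym by (auto simp: supp_def)
    next
      case True then show ?thesis using x N by (simp add: supp_def)
    qed
  qed
  have "is_rep n (\<not> p) N"
    unfolding is_rep_def
  proof (intro conjI allI impI)
    show "rdim N x = 0" if "\<not> tvert n x" for x using that M by (auto simp: N is_rep_def)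
    show "finite {x. rdim N x \<noteq> 0}"
      using sub supp_finite[OF M] finite_nbrs by (auto intro: finite_subset)
    fix y x assume "arrow n (\<not> p) y x"
    then have "y \<in> nbrs n x" "\<not> is_sink p x" "tvert n x" "is_sink p y" using arrow_nbrs[of n "\<not> p" y x] by (auto simp: is_sink_not)
    then show "rmap N y x \<in> carrier_mat (rdim N x) (rdim N y)" using rQ[of x] by (simp add: N)
  qed
  then have "refl_minus n p M N"
    unfolding refl_minus_def using M rQ by (simp add: N)
  then show ?thesis by blast
qed

text \<open>At each sink \<open>a\<close> of \<open>p\<close> the sequence \<open>0 \<rightarrow> A\<^sub>a \<rightarrow> \<Oplus> M\<^sub>b \<rightarrow> M\<^sub>a \<rightarrow> 0\<close> is short exact, so that
  \<open>A = \<sigma>M\<close> and \<open>M = \<sigma>\<^sup>-A\<close> at once.\<close>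

definition full_refl :: "nat \<Rightarrow> bool \<Rightarrow> 'k::field qrep \<Rightarrow> 'k qrep \<Rightarrow> bool" where
  "full_refl n p M A \<longleftrightarrow> pre_refl n p M A \<and> nbr_surj n p M \<and> nbr_inj n (\<not> p) A"

lemma full_reflD:
  assumes "full_refl n p M A"
  shows "pre_refl n p M A" "nbr_surj n p M" "nbr_inj n (\<not> p) A" "refl_plus n p M A" "refl_minus n (\<not> p) A M"
  using assms by (auto simp: full_refl_def refl_plus_iff refl_minus_iff)

section \<open>Transport of irreducible maps and isomorphisms\<close>

lemma irreducibleD:
  assumes "irreducible_map n p M N f"
  shows "is_hom n p M N f" "\<not> split_mono n p M N f" "\<not> split_epi n p M N f"
    "\<And>X h g. is_hom n p M X h \<Longrightarrow> is_hom n p X N g \<Longrightarrow> hcomp g h = f \<Longrightarrow> split_mono n p M X h \<or> split_epi n p X N g"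
  using assms unfolding irreducible_map_def by blast+

lemma hcomp_hid_transfer:
  assumes "hcomp r g = hid A" "r' b = r b" "g' b = g b" "rdim M b = rdim A b"
  shows "hcomp r' g' b = hid M b"
proof -
  have "r b * g b = 1\<^sub>m (rdim A b)" using fun_cong[OF assms(1), of b] by (simp add: hcomp_def hid_def)
  then show ?thesis using assms(2-4) by (simp add: hcomp_def hid_def)
qed

text \<open>By unique lifting and descending, the maps between \<open>M\<close> and
  \<open>M'\<close> correspond to the maps between \<open>A\<close> and \<open>A'\<close>, and so do
  their one-sided inverses.\<close>

lemma irreducible_refl_plus:
  fixes M M' A A' :: "'k::field qrep"
  assumes F: "full_refl n p M A" and F': "full_refl n p M' A'" and f: "irreducible_map n p M M' f"
  shows "\<exists>g. irreducible_map n (\<not> p) A A' g"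
proof -
  note D = full_reflD[OF F] and D' = full_reflD[OF F'] and If = irreducibleD[OF f]
  note P = pre_reflD[OF D(1)] and P' = pre_reflD[OF D'(1)]
  obtain g where g: "is_hom n (\<not> p) A A' g" and gf: "\<And>b. \<not> is_sink p b \<Longrightarrow> g b = f b"
    using pre_refl_lift[OF D(1) D'(1) If(1)] by blast
  have "\<not> split_mono n (\<not> p) A A' g"
  proof
    assume "split_mono n (\<not> p) A A' g"
    then obtain r where r: "is_hom n (\<not> p) A' A r" "hcomp r g = hid A" unfolding split_mono_def by blast
    obtain q where q: "is_hom n p M' M q" "\<And>b. \<not> is_sink p b \<Longrightarrow> q b = r b"
      using pre_refl_descend[OF D'(1) D(1) r(1)] by blast
    have "hcomp q f = hid M"
      by (rule hom_eq_nbr_surj[OF hom_comp[OF If(1) q(1)] hom_id[OF P(1)] D(2)],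
          rule hcomp_hid_transfer[OF r(2)]) (simp_all add: q gf P)
    then show False using If(1,2) q(1) unfolding split_mono_def by blast
  qed
  moreover have "\<not> split_epi n (\<not> p) A A' g"
  proof
    assume "split_epi n (\<not> p) A A' g"
    then obtain r where r: "is_hom n (\<not> p) A' A r" "hcomp g r = hid A'" unfolding split_epi_def by blast
    obtain q where q: "is_hom n p M' M q" "\<And>b. \<not> is_sink p b \<Longrightarrow> q b = r b"
      using pre_refl_descend[OF D'(1) D(1) r(1)] by blast
    have "hcomp f q = hid M'"
      by (rule hom_eq_nbr_surj[OF hom_comp[OF q(1) If(1)] hom_id[OF P'(1)] D'(2)],
          rule hcomp_hid_transfer[OF r(2)]) (simp_all add: q gf P')
    then show False using If(1,3) q(1) unfolding split_epi_def by blast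
  qed
  moreover have "split_mono n (\<not> p) A X h \<or> split_epi n (\<not> p) X A' k"
    if h: "is_hom n (\<not> p) A X h" and k: "is_hom n (\<not> p) X A' k" and kh: "hcomp k h = g" for X h k
  proof -
    \<comment> \<open>A factorization through an arbitrary \<open>X\<close> is compared with one
      through \<open>Y\<close>, a model of \<open>\<sigma>\<^sup>-X\<close>. Middle exactness
      between \<open>Y\<close> and \<open>X\<close> suffices to descend both factors and to lift a
      one-sided inverse back; uniqueness is invoked only at the outer modules.\<close>
    obtain Y where Y: "refl_minus n (\<not> p) X Y" using refl_minus_exists[OF homD(2)[OF h]] by blast
    then have YX: "pre_refl n p Y X" by (simp add: refl_minus_iff)
    obtain h' where h': "is_hom n p M Y h'" "\<And>b. \<not> is_sink p b \<Longrightarrow> h' b = h b"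
      using pre_refl_descend[OF D(1) YX h] by blast
    obtain k' where k': "is_hom n p Y M' k'" "\<And>b. \<not> is_sink p b \<Longrightarrow> k' b = k b"
      using pre_refl_descend[OF YX D'(1) k] by blast
    have "hcomp k' h' = f"
      by (rule hom_eq_nbr_surj[OF hom_comp[OF h'(1) k'(1)] If(1) D(2)])
         (use fun_cong[OF kh] gf h'(2) k'(2) in \<open>simp add: hcomp_def\<close>)
    from If(4)[OF h'(1) k'(1) this] show ?thesis
    proof
      assume "split_mono n p M Y h'"
      then obtain r where r: "is_hom n p Y M r" "hcomp r h' = hid M" unfolding split_mono_def by blast
      obtain s where s: "is_hom n (\<not> p) X A s" "\<And>b. \<not> is_sink p b \<Longrightarrow> s b = r b"
        using pre_refl_lift[OF YX D(1) r(1)] by blast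
      have "hcomp s h = hid A"
        by (rule hom_eq_nbr_inj[OF hom_comp[OF h s(1)] hom_id[OF P(2)] D(3)],
            rule hcomp_hid_transfer[OF r(2)]) (simp_all add: s h' P is_sink_not)
      then show ?thesis using h s(1) unfolding split_mono_def by blast
    next
      assume "split_epi n p Y M' k'"
      then obtain r where r: "is_hom n p M' Y r" "hcomp k' r = hid M'" unfolding split_epi_def by blast
      obtain s where s: "is_hom n (\<not> p) A' X s" "\<And>b. \<not> is_sink p b \<Longrightarrow> s b = r b"
        using pre_refl_lift[OF D'(1) YX r(1)] by blast
      have "hcomp k s = hid A'"
        by (rule hom_eq_nbr_inj[OF hom_comp[OF s(1) k] hom_id[OF P'(2)] D'(3)],
            rule hcomp_hid_transfer[OF r(2)]) (simp_all add: s k' P' is_sink_not)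
      then show ?thesis using k s(1) unfolding split_epi_def by blast
    qed
  qed
  ultimately have "irreducible_map n (\<not> p) A A' g" using g unfolding irreducible_map_def by blast
  then show ?thesis by blast
qed

lemma irreducible_refl_minus:
  fixes M M' A A' :: "'k::field qrep"
  assumes F: "full_refl n p M A" and F': "full_refl n p M' A'" and g: "irreducible_map n (\<not> p) A A' g"
  shows "\<exists>f. irreducible_map n p M M' f"
proof -
  note D = full_reflD[OF F] and D' = full_reflD[OF F'] and Ig = irreducibleD[OF g]
  note P = pre_reflD[OF D(1)] and P' = pre_reflD[OF D'(1)]
  obtain f where f: "is_hom n p M M' f" and fg: "\<And>b. \<not> is_sink p b \<Longrightarrow> f b = g b"
    using pre_refl_descend[OF D(1) D'(1) Ig(1)] by blast
  have "\<not> split_mono n p M M' f"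
  proof
    assume "split_mono n p M M' f"
    then obtain r where r: "is_hom n p M' M r" "hcomp r f = hid M" unfolding split_mono_def by blast
    obtain q where q: "is_hom n (\<not> p) A' A q" "\<And>b. \<not> is_sink p b \<Longrightarrow> q b = r b"
      using pre_refl_lift[OF D'(1) D(1) r(1)] by blast
    have "hcomp q g = hid A"
      by (rule hom_eq_nbr_inj[OF hom_comp[OF Ig(1) q(1)] hom_id[OF P(2)] D(3)],
          rule hcomp_hid_transfer[OF r(2)]) (simp_all add: q fg P is_sink_not)
    then show False using Ig(1,2) q(1) unfolding split_mono_def by blast
  qed
  moreover have "\<not> split_epi n p M M' f"
  proof
    assume "split_epi n p M M' f"
    then obtain r where r: "is_hom n p M' M r" "hcomp f r = hid M'" unfolding split_epi_def by blast
    obtain q where q: "is_hom n (\<not> p) A' A q" "\<And>b. \<not> is_sink p b \<Longrightarrow> q b = r b"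
      using pre_refl_lift[OF D'(1) D(1) r(1)] by blast
    have "hcomp g q = hid A'"
      by (rule hom_eq_nbr_inj[OF hom_comp[OF q(1) Ig(1)] hom_id[OF P'(2)] D'(3)],
          rule hcomp_hid_transfer[OF r(2)]) (simp_all add: q fg P' is_sink_not)
    then show False using Ig(1,3) q(1) unfolding split_epi_def by blast
  qed
  moreover have "split_mono n p M Y h \<or> split_epi n p Y M' k"
    if h: "is_hom n p M Y h" and k: "is_hom n p Y M' k" and kh: "hcomp k h = f" for Y h k
  proof -
    \<comment> \<open>Here the middle module \<open>Y\<close> is arbitrary, and the factorization is
      moved to \<open>X\<close>, a model of \<open>\<sigma>Y\<close>.\<close>
    obtain X where X: "refl_plus n p Y X" using refl_plus_exists[OF homD(2)[OF h]] by blast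
    then have YX: "pre_refl n p Y X" by (simp add: refl_plus_iff)
    obtain h' where h': "is_hom n (\<not> p) A X h'" "\<And>b. \<not> is_sink p b \<Longrightarrow> h' b = h b"
      using pre_refl_lift[OF D(1) YX h] by blast
    obtain k' where k': "is_hom n (\<not> p) X A' k'" "\<And>b. \<not> is_sink p b \<Longrightarrow> k' b = k b"
      using pre_refl_lift[OF YX D'(1) k] by blast
    have "hcomp k' h' = g"
      by (rule hom_eq_nbr_inj[OF hom_comp[OF h'(1) k'(1)] Ig(1) D'(3)])
         (use fun_cong[OF kh] fg h'(2) k'(2) in \<open>simp add: hcomp_def is_sink_not\<close>)
    from Ig(4)[OF h'(1) k'(1) this] show ?thesis
    proof
      assume "split_mono n (\<not> p) A X h'"
      then obtain r where r: "is_hom n (\<not> p) X A r" "hcomp r h' = hid A" unfolding split_mono_def by blast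
      obtain s where s: "is_hom n p Y M s" "\<And>b. \<not> is_sink p b \<Longrightarrow> s b = r b"
        using pre_refl_descend[OF YX D(1) r(1)] by blast
      have "hcomp s h = hid M"
        by (rule hom_eq_nbr_surj[OF hom_comp[OF h s(1)] hom_id[OF P(1)] D(2)],
            rule hcomp_hid_transfer[OF r(2)]) (simp_all add: s h' P)
      then show ?thesis using h s(1) unfolding split_mono_def by blast
    next
      assume "split_epi n (\<not> p) X A' k'"
      then obtain r where r: "is_hom n (\<not> p) A' X r" "hcomp k' r = hid A'" unfolding split_epi_def by blast
      obtain s where s: "is_hom n p M' Y s" "\<And>b. \<not> is_sink p b \<Longrightarrow> s b = r b"
        using pre_refl_descend[OF D'(1) YX r(1)] by blast
      have "hcomp k s = hid M'"
        by (rule hom_eq_nbr_surj[OF hom_comp[OF s(1) k] hom_id[OF P'(1)] D'(2)],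
            rule hcomp_hid_transfer[OF r(2)]) (simp_all add: s k' P')
      then show ?thesis using k s(1) unfolding split_epi_def by blast
    qed
  qed
  ultimately have "irreducible_map n p M M' f" using f unfolding irreducible_map_def by blast
  then show ?thesis by blast
qed

lemma iso_refl_plus:
  fixes M M' A A' :: "'k::field qrep"
  assumes MA: "refl_plus n p M A" and MA': "refl_plus n p M' A'" and iso: "is_iso n p M M'"
  shows "is_iso n (\<not> p) A A'"
proof -
  have P: "pre_refl n p M A" "nbr_inj n (\<not> p) A" "pre_refl n p M' A'" "nbr_inj n (\<not> p) A'"
    using MA MA' by (auto simp: refl_plus_iff)
  note Q = pre_reflD[OF P(1)] and Q' = pre_reflD[OF P(3)]
  obtain f g where f: "is_hom n p M M' f" and g: "is_hom n p M' M g" and e: "hcomp g f = hid M" "hcomp f g = hid M'"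
    using iso unfolding is_iso_def by blast
  obtain h where h: "is_hom n (\<not> p) A A' h" "\<And>b. \<not> is_sink p b \<Longrightarrow> h b = f b" using pre_refl_lift[OF P(1,3) f] by blast
  obtain k where k: "is_hom n (\<not> p) A' A k" "\<And>b. \<not> is_sink p b \<Longrightarrow> k b = g b" using pre_refl_lift[OF P(3,1) g] by blast
  have "hcomp k h = hid A"
    by (rule hom_eq_nbr_inj[OF hom_comp[OF h(1) k(1)] hom_id[OF Q(2)] P(2)],
        rule hcomp_hid_transfer[OF e(1)]) (simp_all add: h k Q is_sink_not)
  moreover have "hcomp h k = hid A'"
    by (rule hom_eq_nbr_inj[OF hom_comp[OF k(1) h(1)] hom_id[OF Q'(2)] P(4)],
        rule hcomp_hid_transfer[OF e(2)]) (simp_all add: h k Q' is_sink_not)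
  ultimately show ?thesis using h(1) k(1) unfolding is_iso_def by blast
qed

lemma iso_refl_minus:
  fixes M M' A A' :: "'k::field qrep"
  assumes MA: "refl_minus n p A M" and MA': "refl_minus n p A' M'" and iso: "is_iso n p A A'"
  shows "is_iso n (\<not> p) M M'"
proof -
  have P: "pre_refl n (\<not> p) M A" "nbr_surj n (\<not> p) M" "pre_refl n (\<not> p) M' A'" "nbr_surj n (\<not> p) M'"
    using MA MA' by (auto simp: refl_minus_iff')
  note Q = pre_reflD[OF P(1)] and Q' = pre_reflD[OF P(3)]
  obtain f g where f: "is_hom n p A A' f" and g: "is_hom n p A' A g" and e: "hcomp g f = hid A" "hcomp f g = hid A'"
    using iso unfolding is_iso_def by blast
  obtain h where h: "is_hom n (\<not> p) M M' h" "\<And>b. \<not> is_sink (\<not> p) b \<Longrightarrow> h b = f b"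
    using pre_refl_descend[OF P(1,3), of f] f by auto
  obtain k where k: "is_hom n (\<not> p) M' M k" "\<And>b. \<not> is_sink (\<not> p) b \<Longrightarrow> k b = g b"
    using pre_refl_descend[OF P(3,1), of g] g by auto
  have "hcomp k h = hid M"
    by (rule hom_eq_nbr_surj[OF hom_comp[OF h(1) k(1)] hom_id[OF Q(1)] P(2)],
        rule hcomp_hid_transfer[OF e(1)]) (simp_all add: h k Q)
  moreover have "hcomp h k = hid M'"
    by (rule hom_eq_nbr_surj[OF hom_comp[OF k(1) h(1)] hom_id[OF Q'(1)] P(4)],
        rule hcomp_hid_transfer[OF e(2)]) (simp_all add: h k Q')
  ultimately show ?thesis using h(1) k(1) unfolding is_iso_def by blast
qed

section \<open>Short exactness of reflections of indecomposables\<close>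

text \<open>\<open>E = 1 - A * G\<close> is a projection whose kernel is the image of the neighbour
  sum; a failure of surjectivity thus shows up as a nonzero idempotent.\<close>

lemma neighbour_sum_projection:
  fixes R :: "'b \<Rightarrow> 'k::field mat"
  assumes B: "finite B" and R: "\<And>b. b \<in> B \<Longrightarrow> R b \<in> carrier_mat d (e b)"
  shows "\<exists>E\<in>carrier_mat d d. E * E = E \<and> (\<forall>b\<in>B. E * R b = 0\<^sub>m d (e b)) \<and>
    (\<forall>u\<in>carrier_vec d. E *\<^sub>v u = 0\<^sub>v d \<longrightarrow>
       (\<exists>v. (\<forall>b\<in>B. v b \<in> carrier_vec (e b)) \<and> finsum_vec TYPE('k) d (\<lambda>b. R b *\<^sub>v v b) B = u))"
proof -
  define J where "J = Sigma B (\<lambda>b. {..<e b})"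
  have J: "finite J" using B by (auto simp: J_def)
  define A where "A i x = R (fst x) $$ (i, snd x)" for i x
  obtain G where G: "\<And>i j. i<d \<Longrightarrow> j\<in>J \<Longrightarrow> (\<Sum>x\<in>J. A i x * (\<Sum>y<d. G x y * A y j)) = A i j"
    using generalized_inverse[of "{..<d}" J A] J by auto
  define X where "X i k = (\<Sum>x\<in>J. A i x * G x k)" for i k
  define E' where "E' i k = (if i = k then 1 else 0) - X i k" for i k
  have sX: "(\<Sum>k<d. X i k * z k) = (\<Sum>x\<in>J. A i x * (\<Sum>k<d. G x k * z k))" for i z
    unfolding X_def by (simp add: sum_distrib_left sum_distrib_right mult.assoc) (rule sum.swap)
  have sE: "(\<Sum>k<d. E' i k * z k) = z i - (\<Sum>x\<in>J. A i x * (\<Sum>k<d. G x k * z k))" if "i < d" for i z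
    using that by (simp add: E'_def left_diff_distrib sum_subtractf mult_indicator sX)
  have EA: "(\<Sum>k<d. E' i k * A k x) = 0" if "i < d" "x \<in> J" for i x
    using sE[OF that(1), of "\<lambda>k. A k x"] G[OF that] by simp
  define E where "E = mat d d (\<lambda>(i,k). E' i k)"
  have E: "E \<in> carrier_mat d d" by (simp add: E_def)
  have "E * E = E"
  proof (rule eq_matI)
    fix i l assume "i < dim_row E" "l < dim_col E"
    then have il: "i < d" "l < d" by (auto simp: E_def)
    have "(E * E) $$ (i,l) = (\<Sum>k<d. E' i k * E' k l)"
      using il by (simp add: E_def scalar_prod_def atLeast0LessThan)
    also have "\<dots> = (\<Sum>k<d. if k = l then E' i k else 0) - (\<Sum>k<d. \<Sum>x\<in>J. E' i k * A k x * G x l)"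
      by (simp add: E'_def[of _ l] X_def right_diff_distrib sum_subtractf mult_indicator sum_distrib_left mult.assoc)
    also have "(\<Sum>k<d. \<Sum>x\<in>J. E' i k * A k x * G x l) = (\<Sum>x\<in>J. (\<Sum>k<d. E' i k * A k x) * G x l)"
      by (subst sum.swap) (simp add: sum_distrib_right)
    also have "\<dots> = 0" using EA il by simp
    finally show "(E * E) $$ (i,l) = E $$ (i,l)" using il by (simp add: E_def)
  qed (simp_all add: E_def)
  moreover have "E * R b = 0\<^sub>m d (e b)" if b: "b \<in> B" for b
  proof (rule eq_matI)
    fix i j assume "i < dim_row (0\<^sub>m d (e b) :: 'k mat)" "j < dim_col (0\<^sub>m d (e b) :: 'k mat)"
    then have ij: "i < d" "j < e b" by auto
    have "(E * R b) $$ (i,j) = (\<Sum>k<d. E' i k * A k (b,j))"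
      using ij R[OF b] by (simp add: E_def A_def scalar_prod_def atLeast0LessThan)
    also have "\<dots> = 0" using EA[of i "(b,j)"] ij b by (simp add: J_def)
    finally show "(E * R b) $$ (i,j) = 0\<^sub>m d (e b) $$ (i,j)" using ij by simp
  qed (use R[OF b] in \<open>auto simp: E_def\<close>)
  moreover have "\<exists>v. (\<forall>b\<in>B. v b \<in> carrier_vec (e b)) \<and> finsum_vec TYPE('k) d (\<lambda>b. R b *\<^sub>v v b) B = u"
    if u: "u \<in> carrier_vec d" and Eu: "E *\<^sub>v u = 0\<^sub>v d" for u
  proof -
    define v where "v b = vec (e b) (\<lambda>j. \<Sum>k<d. G (b,j) k * u $ k)" for b
    have v: "v b \<in> carrier_vec (e b)" for b by (simp add: v_def)
    have "finsum_vec TYPE('k) d (\<lambda>b. R b *\<^sub>v v b) B = u"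
    proof (rule eq_vecI)
      have "finsum_vec TYPE('k) d (\<lambda>b. R b *\<^sub>v v b) B \<in> carrier_vec d"
        by (rule finsum_vec_mult_carrier[where e = e]) (use R v in blast)+
      then show "dim_vec (finsum_vec TYPE('k) d (\<lambda>b. R b *\<^sub>v v b) B) = dim_vec u" using u by auto
      fix i assume "i < dim_vec u" then have i: "i < d" using u by auto
      have "finsum_vec TYPE('k) d (\<lambda>b. R b *\<^sub>v v b) B $ i = (\<Sum>(b,j)\<in>J. R b $$ (i,j) * v b $ j)"
        unfolding J_def by (rule finsum_vec_mult_index[OF B R v i])
      also have "\<dots> = (\<Sum>x\<in>J. A i x * (\<Sum>k<d. G x k * u $ k))"
        by (rule sum.cong) (auto simp: J_def A_def v_def)
      also have "\<dots> = u $ i - (\<Sum>k<d. E' i k * u $ k)" using sE[OF i, of "\<lambda>k. u $ k"] by simp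
      also have "(\<Sum>k<d. E' i k * u $ k) = (E *\<^sub>v u) $ i"
        using i u by (auto simp: E_def scalar_prod_def atLeast0LessThan)
      finally show "finsum_vec TYPE('k) d (\<lambda>b. R b *\<^sub>v v b) B $ i = u $ i" using Eu i by simp
    qed
    then show ?thesis using v by blast
  qed
  ultimately show ?thesis using E by blast
qed

lemma one_mat_ne_zero: "k \<noteq> 0 \<Longrightarrow> (1\<^sub>m k :: 'k::field mat) \<noteq> 0\<^sub>m k k"
proof
  assume "k \<noteq> 0" "(1\<^sub>m k :: 'k mat) = 0\<^sub>m k k"
  then have "(1\<^sub>m k :: 'k mat) $$ (0,0) = 0\<^sub>m k k $$ (0,0)" by simp
  then show False using \<open>k \<noteq> 0\<close> by simp
qed

text \<open>An idempotent at \<open>a\<close> that annihilates all adjacent structure maps extends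
  by zero to an endomorphism. Being nonzero it is the identity, so no other vertex carries a nonzero
  space.\<close>

lemma indecomposable_local_idempotent:
  fixes M :: "'k::field qrep"
  assumes M: "indecomposable n p M" and E: "E \<in> carrier_mat (rdim M a) (rdim M a)" "E * E = E" "E \<noteq> 0\<^sub>m (rdim M a) (rdim M a)"
    and l: "\<And>b. arrow n p b a \<Longrightarrow> E * rmap M b a = 0\<^sub>m (rdim M a) (rdim M b)"
    and r: "\<And>b. arrow n p a b \<Longrightarrow> rmap M a b * E = 0\<^sub>m (rdim M b) (rdim M a)"
  shows "supp M \<subseteq> {a}"
proof -
  note Mr = indecomposable_rep[OF M]
  define e where "e x = (if x = a then E else 0\<^sub>m (rdim M x) (rdim M x))" for x
  have na: "\<not> arrow n p a a" using tadj_parity[of n a a] by (auto simp: arrow_def)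
  have "is_hom n p M M e"
  proof (rule homI[OF Mr Mr])
    show "e x \<in> carrier_mat (rdim M x) (rdim M x)" for x using E by (simp add: e_def)
    fix x y assume ar: "arrow n p x y"
    then have "x \<noteq> y" using na tadj_parity[of n x y] by (auto simp: arrow_def)
    then show "e y * rmap M x y = rmap M x y * e x"
      using ar l[of x] r[of y] rep_dims[OF Mr ar] by (auto simp: e_def)
  qed
  moreover have "hcomp e e = e" using E by (auto simp: hcomp_def e_def)
  ultimately have "e = hzero M M \<or> e = hid M" by (rule indecomposable_idempotent[OF M])
  moreover have "e \<noteq> hzero M M" using E(3) by (auto simp: e_def hzero_def dest!: fun_cong[of _ _ a])
  ultimately have e1: "e = hid M" by blast
  have "x = a" if "rdim M x \<noteq> 0" for x
  proof (rule ccontr)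
    assume "x \<noteq> a"
    then have "(1\<^sub>m (rdim M x) :: 'k mat) = 0\<^sub>m (rdim M x) (rdim M x)" using fun_cong[OF e1, of x] by (simp add: e_def hid_def)
    then show False using one_mat_ne_zero[where 'k = 'k, OF that] by simp
  qed
  then show ?thesis by (auto simp: supp_def)
qed

lemma nbr_inj_empty:
  fixes A :: "'k::field qrep"
  assumes A: "is_rep n p A" "nbr_inj n p A" and a: "\<not> is_sink p a" and z: "\<And>b. b \<in> nbrs n a \<Longrightarrow> rdim A b = 0"
  shows "rdim A a = 0"
proof (rule ccontr)
  assume nz: "rdim A a \<noteq> 0"
  then have t: "tvert n a" using A by (auto simp: is_rep_def)
  have "rmap A a b *\<^sub>v unit_vec (rdim A a) 0 = 0\<^sub>v (rdim A b)" if "b \<in> nbrs n a" for b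
  proof -
    have "arrow n p a b" using nbrs_arrow(2)[OF that, of "\<not> p"] a by (simp add: is_sink_not)
    then show ?thesis using repD[OF A(1)] z[OF that] by (intro eq_vecI) fastforce+
  qed
  then have "unit_vec (rdim A a) 0 = (0\<^sub>v (rdim A a) :: 'k vec)"
    using A(2) t a unit_vec_carrier unfolding nbr_inj_def by blast
  then show False using nz by simp
qed

lemma nbr_surj_empty:
  fixes M :: "'k::field qrep"
  assumes M: "is_rep n p M" "nbr_surj n p M" and a: "is_sink p a" and z: "\<And>b. b \<in> nbrs n a \<Longrightarrow> rdim M b = 0"
  shows "rdim M a = 0"
proof (rule ccontr)
  assume nz: "rdim M a \<noteq> 0"
  then have t: "tvert n a" using M by (auto simp: is_rep_def)
  obtain v where v: "\<And>b. b\<in>nbrs n a \<Longrightarrow> v b \<in> carrier_vec (rdim M b)" "nsum n M a v = unit_vec (rdim M a) 0"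
    using M(2) t a unit_vec_carrier unfolding nbr_surj_def by blast
  have "nsum n M a v $ 0 = (\<Sum>(b,j)\<in>Sigma (nbrs n a) (\<lambda>b. {..<rdim M b}). rmap M b a $$ (0,j) * v b $ j)"
    unfolding nsum_def
    by (rule finsum_vec_mult_index[OF finite_nbrs _ v(1)]) (use nz repD[OF M(1) nbrs_arrow(1)[OF _ a]] in auto)
  also have "Sigma (nbrs n a) (\<lambda>b. {..<rdim M b}) = {}" using z by auto
  finally show False using v(2) nz by simp
qed

text \<open>If the neighbour sum at a sink \<open>a\<close> misses part of \<open>M_a\<close>, the
  projection \<open>E\<close> confines \<open>M\<close> to the vertex \<open>a\<close>, and then all
  spaces of \<open>A\<close> are zero. So \<open>\<sigma>\<close> fails to be short exact only on
  indecomposables that it sends to zero.\<close>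

lemma refl_plus_full:
  fixes M A :: "'k::field qrep"
  assumes M: "indecomposable n p M" and MA: "refl_plus n p M A" and nz: "\<not> is_zero_rep A"
  shows "full_refl n p M A"
proof -
  have P: "pre_refl n p M A" "nbr_inj n (\<not> p) A" using MA by (auto simp: refl_plus_iff)
  note Q = pre_reflD[OF P(1)]
  have "nbr_surj n p M"
    unfolding nbr_surj_def
  proof (intro allI impI ballI)
    fix a and u :: "'k vec" assume a: "tvert n a" "is_sink p a" and u: "u \<in> carrier_vec (rdim M a)"
    obtain E where E: "E \<in> carrier_mat (rdim M a) (rdim M a)" "E * E = E" "\<And>b. b\<in>nbrs n a \<Longrightarrow> E * rmap M b a = 0\<^sub>m (rdim M a) (rdim M b)"
      "\<And>u. u\<in>carrier_vec (rdim M a) \<Longrightarrow> E *\<^sub>v u = 0\<^sub>v (rdim M a) \<Longrightarrow>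
       \<exists>v. (\<forall>b\<in>nbrs n a. v b \<in> carrier_vec (rdim M b)) \<and> nsum n M a v = u"
      using neighbour_sum_projection[where B = "nbrs n a" and R = "\<lambda>b. rmap M b a" and d = "rdim M a" and e = "rdim M",
          OF finite_nbrs repD[OF Q(1) nbrs_arrow(1)[OF _ a(2)]]] unfolding nsum_def by blast
    have "E = 0\<^sub>m (rdim M a) (rdim M a)"
    proof (rule ccontr)
      assume ne: "E \<noteq> 0\<^sub>m (rdim M a) (rdim M a)"
      have s: "supp M \<subseteq> {a}"
      proof (rule indecomposable_local_idempotent[OF M E(1,2) ne])
        show "E * rmap M b a = 0\<^sub>m (rdim M a) (rdim M b)" if "arrow n p b a" for b
          using E(3) arrow_nbrs[OF that] by blast
        show "rmap M a b * E = 0\<^sub>m (rdim M b) (rdim M a)" if "arrow n p a b" for b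
          using arrow_nbrs[OF that] a by blast
      qed
      have nA: "rdim A b = 0" if "\<not> is_sink p b" for b
      proof -
        have "b \<noteq> a" using that a by auto
        then have "b \<notin> supp M" using s by blast
        then show ?thesis using Q(3)[OF that] by (simp add: supp_def)
      qed
      have "rdim A x = 0" for x
      proof (cases "is_sink p x")
        case True
        show ?thesis by (rule nbr_inj_empty[OF Q(2) P(2)]) (use True nA nbrs_arrow(3)[OF _ True] in \<open>auto simp: is_sink_not\<close>)
      qed (rule nA)
      then show False using nz by (simp add: is_zero_rep_def)
    qed
    then have "E *\<^sub>v u = 0\<^sub>v (rdim M a)" using u by (intro eq_vecI) auto
    then show "\<exists>v. (\<forall>b\<in>nbrs n a. v b \<in> carrier_vec (rdim M b)) \<and> nsum n M a v = u" using E(4) u by blast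
  qed
  then show ?thesis using P by (simp add: full_refl_def)
qed

text \<open>Dually, a nonzero vector \<open>w\<close> killed by all outgoing maps spans a direct
  summand, so \<open>A\<close> lives at that vertex alone and \<open>M\<close> vanishes.\<close>

lemma refl_minus_full:
  fixes M A :: "'k::field qrep"
  assumes A: "indecomposable n (\<not> p) A" and MA: "refl_minus n (\<not> p) A M" and nz: "\<not> is_zero_rep M"
  shows "full_refl n p M A"
proof -
  have P: "pre_refl n p M A" "nbr_surj n p M" using MA by (auto simp: refl_minus_iff)
  note Q = pre_reflD[OF P(1)]
  have "nbr_inj n (\<not> p) A"
    unfolding nbr_inj_def is_sink_not not_not
  proof (intro allI impI ballI, rule ccontr)
    fix a and w :: "'k vec" assume a: "tvert n a" "is_sink p a" and w: "w \<in> carrier_vec (rdim A a)"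
      and wz: "\<forall>b\<in>nbrs n a. rmap A a b *\<^sub>v w = 0\<^sub>v (rdim A b)" and w0: "w \<noteq> 0\<^sub>v (rdim A a)"
    obtain k where k: "k < rdim A a" "w $ k \<noteq> 0" using w0 w by (metis carrier_vecD eq_vecI index_zero_vec)
    \<comment> \<open>The projection onto the line of \<open>w\<close> along the vectors with zero
      entry at \<open>k\<close>.\<close>
    define E where "E = mat (rdim A a) (rdim A a) (\<lambda>(i,j). if j = k then w $ i / w $ k else 0)"
    have E: "E \<in> carrier_mat (rdim A a) (rdim A a)" by (simp add: E_def)
    have RE: "C * E = mat (dim_row C) (rdim A a) (\<lambda>(i,j). if j = k then (C *\<^sub>v w) $ i / w $ k else 0)"
      if C: "dim_col C = rdim A a" for C :: "'k mat"
    proof (rule eq_matI)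
      fix i j assume "i < dim_row (mat (dim_row C) (rdim A a) (\<lambda>(i,j). if j = k then (C *\<^sub>v w) $ i / w $ k else 0))"
        "j < dim_col (mat (dim_row C) (rdim A a) (\<lambda>(i,j). if j = k then (C *\<^sub>v w) $ i / w $ k else 0))"
      then have ij: "i < dim_row C" "j < rdim A a" by auto
      have "(C * E) $$ (i,j) = (\<Sum>l<rdim A a. C $$ (i,l) * (if j = k then w $ l / w $ k else 0))"
        using ij C by (simp add: E_def scalar_prod_def atLeast0LessThan)
      also have "\<dots> = (if j = k then (\<Sum>l<rdim A a. C $$ (i,l) * w $ l) / w $ k else 0)"
        by (simp add: sum_divide_distrib)
      also have "(\<Sum>l<rdim A a. C $$ (i,l) * w $ l) = (C *\<^sub>v w) $ i"
        using ij C w by (auto simp: scalar_prod_def atLeast0LessThan)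
      finally show "(C * E) $$ (i,j) = mat (dim_row C) (rdim A a) (\<lambda>(i,j). if j = k then (C *\<^sub>v w) $ i / w $ k else 0) $$ (i,j)"
        using ij by simp
    qed (simp_all add: E_def)
    have Ew: "(E *\<^sub>v w) $ i = w $ i" if "i < rdim A a" for i
    proof -
      have "(E *\<^sub>v w) $ i = (\<Sum>l<rdim A a. (if l = k then w $ i / w $ k else 0) * w $ l)"
        using that w by (simp add: E_def scalar_prod_def atLeast0LessThan)
      also have "\<dots> = (\<Sum>l<rdim A a. if l = k then w $ i / w $ k * w $ l else 0)"
        by (rule sum.cong) auto
      finally show ?thesis using k by simp
    qed
    have EE: "E * E = E"
      using RE[of E] E by (intro eq_matI) (auto simp: E_def[symmetric] Ew simp del: index_mult_mat_vec, auto simp: E_def)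
    have "E $$ (k,k) = 1" using k by (simp add: E_def)
    then have ne: "E \<noteq> 0\<^sub>m (rdim A a) (rdim A a)" using k by auto
    have s: "supp A \<subseteq> {a}"
    proof (rule indecomposable_local_idempotent[OF A E EE ne])
      show "E * rmap A b a = 0\<^sub>m (rdim A a) (rdim A b)" if "arrow n (\<not> p) b a" for b
        using arrow_nbrs[OF that] a by (simp add: is_sink_not)
      show "rmap A a b * E = 0\<^sub>m (rdim A b) (rdim A a)" if ar: "arrow n (\<not> p) a b" for b
      proof -
        have "b \<in> nbrs n a" using ar by (simp add: arrow_def nbrs_def)
        then have "rmap A a b *\<^sub>v w = 0\<^sub>v (rdim A b)" using wz by blast
        then show ?thesis using RE[of "rmap A a b"] rep_dims[OF Q(2) ar] by (intro eq_matI) auto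
      qed
    qed
    have nM: "rdim M b = 0" if "\<not> is_sink p b" for b
    proof -
      have "b \<noteq> a" using that a by auto
      then have "b \<notin> supp A" using s by blast
      then show ?thesis using Q(3)[OF that] by (simp add: supp_def)
    qed
    have "rdim M x = 0" for x
    proof (cases "is_sink p x")
      case True
      show ?thesis by (rule nbr_surj_empty[OF Q(1) P(2) True]) (use nM nbrs_arrow(3)[OF _ True] in auto)
    qed (rule nM)
    then show False using nz by (simp add: is_zero_rep_def)
  qed
  then show ?thesis using P by (simp add: full_refl_def)
qed

text \<open>Idempotent endomorphisms of \<open>M\<close> and \<open>A\<close> correspond under
  unique lifting and descending, and so do the zero maps and the identities.\<close>

lemma full_refl_indecomposable:
  fixes M A :: "'k::field qrep"
  assumes F: "full_refl n p M A"
  shows "indecomposable n p M \<longleftrightarrow> indecomposable n (\<not> p) A"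
proof -
  note D = full_reflD[OF F]
  note Q = pre_reflD[OF D(1)]
  have zr: "is_zero_rep M \<longleftrightarrow> is_zero_rep A"
  proof
    assume "is_zero_rep M"
    then have nA: "rdim A b = 0" if "\<not> is_sink p b" for b using Q(3)[OF that] by (simp add: is_zero_rep_def)
    have "rdim A x = 0" for x
    proof (cases "is_sink p x")
      case True
      show ?thesis by (rule nbr_inj_empty[OF Q(2) D(3)]) (use True nA nbrs_arrow(3)[OF _ True] in \<open>auto simp: is_sink_not\<close>)
    qed (rule nA)
    then show "is_zero_rep A" by (simp add: is_zero_rep_def)
  next
    assume "is_zero_rep A"
    then have nM: "rdim M b = 0" if "\<not> is_sink p b" for b using Q(3)[OF that] by (simp add: is_zero_rep_def)
    have "rdim M x = 0" for x
    proof (cases "is_sink p x")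
      case True
      show ?thesis by (rule nbr_surj_empty[OF Q(1) D(2) True]) (use nM nbrs_arrow(3)[OF _ True] in auto)
    qed (rule nM)
    then show "is_zero_rep M" by (simp add: is_zero_rep_def)
  qed
  show ?thesis
  proof
    assume M: "indecomposable n p M"
    show "indecomposable n (\<not> p) A"
    proof (rule indecomposableI[OF Q(2)])
      show "\<not> is_zero_rep A" using zr M by (simp add: indecomposable_def)
      fix e assume e: "is_hom n (\<not> p) A A e" "hcomp e e = e"
      obtain f where f: "is_hom n p M M f" "\<And>b. \<not> is_sink p b \<Longrightarrow> f b = e b"
        using pre_refl_descend[OF D(1) D(1) e(1)] by blast
      have "hcomp f f = f"
        by (rule hom_eq_nbr_surj[OF hom_comp[OF f(1) f(1)] f(1) D(2)])
           (use f(2) fun_cong[OF e(2)] in \<open>simp add: hcomp_def\<close>)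
      then have "f = hzero M M \<or> f = hid M" by (rule indecomposable_idempotent[OF M f(1)])
      then show "e = hzero A A \<or> e = hid A"
      proof
        assume "f = hzero M M"
        then have "e = hzero A A"
          by (intro hom_eq_nbr_inj[OF e(1) hom_zero[OF Q(2) Q(2), folded hzero_def] D(3)])
             (use f(2) Q(3) in \<open>force simp: is_sink_not hzero_def\<close>)
        then show ?thesis ..
      next
        assume "f = hid M"
        then have "e = hid A"
          by (intro hom_eq_nbr_inj[OF e(1) hom_id[OF Q(2)] D(3)])
             (use f(2) Q(3) in \<open>force simp: is_sink_not hid_def\<close>)
        then show ?thesis ..
      qed
    qed
  next
    assume A: "indecomposable n (\<not> p) A"
    show "indecomposable n p M"
    proof (rule indecomposableI[OF Q(1)])
      show "\<not> is_zero_rep M" using zr A by (simp add: indecomposable_def)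
      fix f assume f: "is_hom n p M M f" "hcomp f f = f"
      obtain e where e: "is_hom n (\<not> p) A A e" "\<And>b. \<not> is_sink p b \<Longrightarrow> e b = f b"
        using pre_refl_lift[OF D(1) D(1) f(1)] by blast
      have "hcomp e e = e"
        by (rule hom_eq_nbr_inj[OF hom_comp[OF e(1) e(1)] e(1) D(3)])
           (use e(2) fun_cong[OF f(2)] in \<open>simp add: hcomp_def is_sink_not\<close>)
      then have "e = hzero A A \<or> e = hid A" by (rule indecomposable_idempotent[OF A e(1)])
      then show "f = hzero M M \<or> f = hid M"
      proof
        assume "e = hzero A A"
        then have "f = hzero M M"
          by (intro hom_eq_nbr_surj[OF f(1) hom_zero[OF Q(1) Q(1), folded hzero_def] D(2)])
             (use e(2) Q(3) in \<open>force simp: hzero_def\<close>)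
        then show ?thesis ..
      next
        assume "e = hid A"
        then have "f = hid M"
          by (intro hom_eq_nbr_surj[OF f(1) hom_id[OF Q(1)] D(2)])
             (use e(2) Q(3) in \<open>force simp: hid_def\<close>)
        then show ?thesis ..
      qed
    qed
  qed
qed

section \<open>The Auslander--Reiten formula\<close>

lemma mat_minus_zero: "A \<in> carrier_mat a b \<Longrightarrow> A - 0\<^sub>m a b = (A :: 'k::ring mat)"
  by (rule eq_matI) auto

section \<open>Trace pairing and cochains\<close>

text \<open>The trace of \<open>X * Y\<close>, written as a double sum so that its cyclic property
  becomes an exchange of summations.\<close>

definition ptr :: "'k::comm_ring_1 mat \<Rightarrow> 'k mat \<Rightarrow> 'k" where
  "ptr X Y = (\<Sum>i<dim_row X. \<Sum>j<dim_col X. X $$ (i,j) * Y $$ (j,i))"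

lemma ptr_assoc:
  assumes "X \<in> carrier_mat a b" "A \<in> carrier_mat b c" "Y \<in> carrier_mat c a"
  shows "ptr (X * A) Y = ptr X (A * Y)"
proof -
  have "ptr (X * A) Y = (\<Sum>i<a. \<Sum>j<c. \<Sum>k<b. X $$ (i,k) * A $$ (k,j) * Y $$ (j,i))"
    using assms by (auto simp: ptr_def scalar_prod_def atLeast0LessThan sum_distrib_right intro!: sum.cong)
  also have "\<dots> = (\<Sum>i<a. \<Sum>k<b. \<Sum>j<c. X $$ (i,k) * A $$ (k,j) * Y $$ (j,i))"
    by (rule sum.cong[OF refl]) (rule sum.swap)
  also have "\<dots> = ptr X (A * Y)"
    using assms by (auto simp: ptr_def scalar_prod_def atLeast0LessThan sum_distrib_left mult.assoc intro!: sum.cong)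
  finally show ?thesis .
qed

lemma ptr_sym:
  assumes "X \<in> carrier_mat a b" "Y \<in> carrier_mat b a"
  shows "ptr X Y = ptr Y X"
proof -
  have "ptr X Y = (\<Sum>i<a. \<Sum>j<b. Y $$ (j,i) * X $$ (i,j))" using assms by (auto simp: ptr_def mult.commute)
  also have "\<dots> = ptr Y X" using assms by (subst sum.swap) (auto simp: ptr_def)
  finally show ?thesis .
qed

text \<open>Pairing with these matrices reads off single entries of \<open>X *\<^sub>v w\<close>;
  they serve as test families concentrated at one vertex.\<close>

definition rank_one :: "nat \<Rightarrow> nat \<Rightarrow> nat \<Rightarrow> 'k::comm_ring_1 vec \<Rightarrow> 'k mat" where
  "rank_one m d l w = mat m d (\<lambda>(j,s). if s = l then w $ j else 0)"

lemma ptr_rank_one: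
  assumes X: "X \<in> carrier_mat d m" and w: "w \<in> carrier_vec m" and l: "l < d"
  shows "ptr X (rank_one m d l w) = (X *\<^sub>v w) $ l"
proof -
  have "ptr X (rank_one m d l w) = (\<Sum>i<d. \<Sum>j<m. X $$ (i,j) * (if i = l then w $ j else 0))"
    unfolding ptr_def using X by (auto simp: rank_one_def intro!: sum.cong)
  also have "\<dots> = (\<Sum>i<d. if i = l then \<Sum>j<m. X $$ (i,j) * w $ j else 0)"
    by (rule sum.cong) auto
  also have "\<dots> = (\<Sum>j<m. X $$ (l,j) * w $ j)" using l by simp
  also have "\<dots> = (X *\<^sub>v w) $ l" using X w l by (auto simp: scalar_prod_def atLeast0LessThan)
  finally show ?thesis .
qed

lemma ptr_columns:
  assumes X: "X \<in> carrier_mat d m" and C: "C \<in> carrier_mat m d"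
  shows "ptr X C = (\<Sum>l<d. (X *\<^sub>v col C l) $ l)"
  using X C by (auto simp: ptr_def scalar_prod_def atLeast0LessThan intro!: sum.cong)

lemma ptr_add:
  assumes "X \<in> carrier_mat a b" "Y \<in> carrier_mat b a" "Z \<in> carrier_mat b a"
  shows "ptr X (Y + Z) = ptr X Y + ptr X Z" "ptr X (Y - Z) = ptr X Y - ptr X Z"
  using assms by (simp_all add: ptr_def ring_distribs sum.distrib sum_subtractf)

lemma ptr_zero: "X \<in> carrier_mat a b \<Longrightarrow> ptr X (0\<^sub>m b a) = 0"
  by (simp add: ptr_def)

text \<open>The two-term complex computing \<open>Ext\<close> of representations: families of maps
  at the vertices and families of maps along the arrows. An arrow family is the off-diagonal block
  of an extension of \<open>M\<close> by \<open>V\<close>, and it is a coboundary exactly when this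
  extension splits.\<close>

definition coboundary :: "nat \<Rightarrow> bool \<Rightarrow> 'k::comm_ring_1 qrep \<Rightarrow> 'k qrep \<Rightarrow> (nat list \<Rightarrow> nat list \<Rightarrow> 'k mat) \<Rightarrow> bool" where
  "coboundary n p M V u \<longleftrightarrow> (\<exists>c. (\<forall>x. c x \<in> carrier_mat (rdim V x) (rdim M x)) \<and>
     (\<forall>b a. arrow n p b a \<longrightarrow> u b a = c a * rmap M b a - rmap V b a * c b))"

definition cochain :: "nat \<Rightarrow> bool \<Rightarrow> 'k::comm_ring_1 qrep \<Rightarrow> 'k qrep \<Rightarrow> (nat list \<Rightarrow> nat list \<Rightarrow> 'k mat) \<Rightarrow> bool" where
  "cochain n p M V u \<longleftrightarrow> (\<forall>b a. arrow n p b a \<longrightarrow> u b a \<in> carrier_mat (rdim V a) (rdim M b))"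

text \<open>The Auslander--Reiten formula: with \<open>N = \<sigma>M\<close> and \<open>T = \<sigma>N\<close>, this pairing identifies
  \<open>Hom(V, T)\<close> with the dual of \<open>Ext(M, V)\<close>, cochains modulo coboundaries.\<close>

definition pairing :: "nat \<Rightarrow> bool \<Rightarrow> 'k::comm_ring_1 qrep \<Rightarrow> 'k qrep \<Rightarrow> (nat list \<Rightarrow> 'k mat) \<Rightarrow> (nat list \<Rightarrow> nat list \<Rightarrow> 'k mat) \<Rightarrow> 'k" where
  "pairing n p M N h u = (\<Sum>b\<in>{b\<in>supp M. \<not> is_sink p b}. \<Sum>a\<in>nbrs n b. ptr (rmap N a b * h a) (u b a))"

text \<open>Indexes the matrix entries of a cochain. Restricting to sources in the support of
  \<open>M\<close> keeps the set finite and loses nothing, since at other sources the matrices have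
  no columns.\<close>

definition edge_entries :: "nat \<Rightarrow> bool \<Rightarrow> 'k qrep \<Rightarrow> 'k qrep \<Rightarrow> (nat list \<times> nat list \<times> nat \<times> nat) set" where
  "edge_entries n p M V = Sigma {b\<in>supp M. \<not> is_sink p b} (\<lambda>b. Sigma (nbrs n b) (\<lambda>a. {..<rdim M b} \<times> {..<rdim V a}))"

lemma edge_entries_iff:
  "(b,a,i,j) \<in> edge_entries n p M V \<longleftrightarrow> rdim M b \<noteq> 0 \<and> \<not> is_sink p b \<and> a \<in> nbrs n b \<and> i < rdim M b \<and> j < rdim V a"
  by (auto simp: edge_entries_def supp_def)

lemma finite_edge_entries: "is_rep n p M \<Longrightarrow> finite (edge_entries n p M V)"
  unfolding edge_entries_def using supp_finite[of n p M] finite_nbrs by (auto intro!: finite_SigmaI)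

lemma source_nbr_arrow: "\<not> is_sink p b \<Longrightarrow> a \<in> nbrs n b \<Longrightarrow> arrow n p b a"
  using nbrs_arrow(2)[of a n b "\<not> p"] by (simp add: is_sink_not)

lemma sum_edge_entries:
  fixes M V :: "'k::field qrep"
  assumes M: "is_rep n p M" and X: "\<And>b a. \<not> is_sink p b \<Longrightarrow> a \<in> nbrs n b \<Longrightarrow> X a b \<in> carrier_mat (rdim M b) (rdim V a)"
  shows "(\<Sum>(b,a,i,j)\<in>edge_entries n p M V. X a b $$ (i,j) * u b a $$ (j,i))
    = (\<Sum>b\<in>{b\<in>supp M. \<not> is_sink p b}. \<Sum>a\<in>nbrs n b. ptr (X a b) (u b a))"
proof -
  have "(\<Sum>b\<in>{b\<in>supp M. \<not> is_sink p b}. \<Sum>a\<in>nbrs n b. ptr (X a b) (u b a))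
    = (\<Sum>b\<in>{b\<in>supp M. \<not> is_sink p b}. \<Sum>a\<in>nbrs n b. \<Sum>(i,j)\<in>{..<rdim M b} \<times> {..<rdim V a}. X a b $$ (i,j) * u b a $$ (j,i))"
  proof (intro sum.cong refl)
    fix b a assume "b \<in> {b\<in>supp M. \<not> is_sink p b}" "a \<in> nbrs n b"
    then have "X a b \<in> carrier_mat (rdim M b) (rdim V a)" using X by blast
    then show "ptr (X a b) (u b a) = (\<Sum>(i,j)\<in>{..<rdim M b} \<times> {..<rdim V a}. X a b $$ (i,j) * u b a $$ (j,i))"
      by (simp add: ptr_def sum.cartesian_product)
  qed
  also have "\<dots> = (\<Sum>b\<in>{b\<in>supp M. \<not> is_sink p b}. \<Sum>(a,i,j)\<in>Sigma (nbrs n b) (\<lambda>a. {..<rdim M b} \<times> {..<rdim V a}). X a b $$ (i,j) * u b a $$ (j,i))"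
    by (intro sum.cong refl sum.Sigma) (simp_all add: finite_nbrs)
  also have "\<dots> = (\<Sum>(b,a,i,j)\<in>edge_entries n p M V. X a b $$ (i,j) * u b a $$ (j,i))"
    unfolding edge_entries_def using supp_finite[OF M] finite_nbrs
    by (intro sum.Sigma) (auto intro!: finite_SigmaI)
  finally show ?thesis by simp
qed

lemma nbr_inj_cancel:
  fixes A :: "'k::field qrep"
  assumes A: "is_rep n p A" "nbr_inj n p A" and x: "\<not> is_sink p x" "tvert n x"
    and G: "G \<in> carrier_mat (rdim A x) d" "G' \<in> carrier_mat (rdim A x) d"
    and e: "\<And>b. b \<in> nbrs n x \<Longrightarrow> rmap A x b * G = rmap A x b * G'"
  shows "G = G'"
proof (rule mat_col_eqI)
  fix j assume "j < dim_col G'"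
  then have j: "j < d" using G by simp
  define w where "w = col G j - col G' j"
  have c: "col G j \<in> carrier_vec (rdim A x)" "col G' j \<in> carrier_vec (rdim A x)"
    using G by (auto intro!: carrier_vecI)
  have w: "w \<in> carrier_vec (rdim A x)" using c by (simp add: w_def)
  have "rmap A x b *\<^sub>v w = 0\<^sub>v (rdim A b)" if b: "b \<in> nbrs n x" for b
  proof -
    note r = repD[OF A(1) source_nbr_arrow[OF x(1) b]]
    have "rmap A x b *\<^sub>v col G j = rmap A x b *\<^sub>v col G' j"
      using col_mult2[OF r G(1) j] col_mult2[OF r G(2) j] e[OF b] by simp
    then have "rmap A x b *\<^sub>v w = rmap A x b *\<^sub>v col G' j - rmap A x b *\<^sub>v col G' j"
      unfolding w_def using mult_minus_distrib_mat_vec[OF r c] by simp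
    also have "\<dots> = 0\<^sub>v (rdim A b)" using mult_mat_vec_carrier[OF r c(2)] by (rule minus_cancel_vec)
    finally show ?thesis .
  qed
  then have w0: "w = 0\<^sub>v (rdim A x)" using A(2) x w unfolding nbr_inj_def by blast
  show "col G j = col G' j"
  proof (rule eq_vecI)
    fix i assume "i < dim_vec (col G' j)"
    then have ii: "i < rdim A x" "i < dim_vec (col G' j)" using G by auto
    have "w $ i = 0" using w0 ii by simp
    moreover have "w $ i = col G j $ i - col G' j $ i" unfolding w_def by (rule index_minus_vec(1)[OF ii(2)])
    ultimately show "col G j $ i = col G' j $ i" by simp
  qed (use G in auto)
qed (use G in auto)

text \<open>By cyclicity of the trace the pairing is a sum over sinks of traces of
  \<open>M * N * c\<close> minus a sum over sources of traces of \<open>N * T * c\<close>. Each part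
  vanishes because consecutive maps in a reflection sequence compose to zero.\<close>

lemma coboundary_pairing:
  fixes M N T :: "'k::field qrep"
  assumes MN: "pre_refl n p M N" and NT: "pre_refl n (\<not> p) N T" and u: "coboundary n p M T u"
  shows "pairing n p M N (hid T) u = 0"
proof -
  note D = pre_reflD[OF MN] and D' = pre_reflD[OF NT]
  note rM = D(1) and rN = D(2)
  have rT: "is_rep n p T" using D'(2) by simp
  obtain c where c: "\<And>x. c x \<in> carrier_mat (rdim T x) (rdim M x)"
    and uc: "\<And>b a. arrow n p b a \<Longrightarrow> u b a = c a * rmap M b a - rmap T b a * c b"
    using u unfolding coboundary_def by blast
  define Bs where "Bs = {b\<in>supp M. \<not> is_sink p b}"
  have fB: "finite Bs" using supp_finite[OF rM] by (simp add: Bs_def)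
  have TN: "rdim T a = rdim N a" if "is_sink p a" for a using D'(3)[of a] that by (simp add: is_sink_not)
  have NM: "rdim N b = rdim M b" if "\<not> is_sink p b" for b using D(3)[OF that] .
  have eq: "ptr (rmap N a b * hid T a) (u b a) = ptr (rmap M b a * rmap N a b) (c a) - ptr (rmap N a b * rmap T b a) (c b)"
    if b: "b \<in> Bs" and a: "a \<in> nbrs n b" for a b
  proof -
    have nb: "\<not> is_sink p b" using b by (simp add: Bs_def)
    note ar = source_nbr_arrow[OF nb a]
    have sa: "is_sink p a" using ar by (simp add: arrow_def)
    have Nc: "rmap N a b \<in> carrier_mat (rdim M b) (rdim T a)" using repD[OF rN, of a b] ar NM[OF nb] TN[OF sa] by (simp add: arrow_flip)
    note Mc = repD[OF rM ar] and Tc = repD[OF rT ar]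
    have 1: "rmap N a b * hid T a = rmap N a b" using Nc by (simp add: hid_def)
    have "ptr (rmap N a b) (u b a) = ptr (rmap N a b) (c a * rmap M b a) - ptr (rmap N a b) (rmap T b a * c b)"
      unfolding uc[OF ar] using Nc Mc Tc c[of a] c[of b] by (intro ptr_add(2)[where a = "rdim M b" and b = "rdim T a"]) auto
    also have "ptr (rmap N a b) (rmap T b a * c b) = ptr (rmap N a b * rmap T b a) (c b)"
      by (rule ptr_assoc[OF Nc Tc c, symmetric])
    also have "ptr (rmap N a b) (c a * rmap M b a) = ptr (c a * rmap M b a) (rmap N a b)"
      by (rule ptr_sym[OF Nc]) (use c[of a] Mc in auto)
    also have "\<dots> = ptr (c a) (rmap M b a * rmap N a b)" by (rule ptr_assoc[OF c Mc Nc])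
    also have "\<dots> = ptr (rmap M b a * rmap N a b) (c a)"
      by (rule ptr_sym[OF c]) (use Mc Nc in auto)
    finally show ?thesis using 1 by simp
  qed
  have z2: "(\<Sum>a\<in>nbrs n b. ptr (rmap N a b * rmap T b a) (c b)) = 0" if b: "b \<in> Bs" for b
  proof -
    have nb: "\<not> is_sink p b" "tvert n b" using b supp_tvert[OF rM] by (auto simp: Bs_def)
    then have sb: "is_sink (\<not> p) b" by (simp add: is_sink_not)
    have carr: "rmap N a b \<in> carrier_mat (rdim N b) (rdim N a)" "rmap T b a \<in> carrier_mat (rdim N a) (rdim T b)" if "a \<in> nbrs n b" for a
    proof -
      note ar = source_nbr_arrow[OF nb(1) that]
      have sa: "is_sink p a" using ar by (simp add: arrow_def)
      show "rmap N a b \<in> carrier_mat (rdim N b) (rdim N a)" using repD[OF rN, of a b] ar by (simp add: arrow_flip)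
      show "rmap T b a \<in> carrier_mat (rdim N a) (rdim T b)" using repD[OF rT ar] TN[OF sa] by simp
    qed
    have cb: "c b \<in> carrier_mat (rdim T b) (rdim N b)" using c[of b] NM[OF nb(1)] by simp
    have cc: "col (c b) l \<in> carrier_vec (rdim T b)" for l using cb by (auto intro!: carrier_vecI)
    have tc: "rmap T b a *\<^sub>v col (c b) l \<in> carrier_vec (rdim N a)" if "a \<in> nbrs n b" for a l
      using carr(2)[OF that] cc by (rule mult_mat_vec_carrier)
    have "(\<Sum>a\<in>nbrs n b. ptr (rmap N a b * rmap T b a) (c b)) = (\<Sum>a\<in>nbrs n b. \<Sum>l<rdim N b. (rmap N a b *\<^sub>v (rmap T b a *\<^sub>v col (c b) l)) $ l)"
    proof (rule sum.cong[OF refl])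
      fix a assume a: "a \<in> nbrs n b"
      have "ptr (rmap N a b * rmap T b a) (c b) = (\<Sum>l<rdim N b. ((rmap N a b * rmap T b a) *\<^sub>v col (c b) l) $ l)"
        by (rule ptr_columns[OF mult_carrier_mat[OF carr[OF a]] cb])
      then show "ptr (rmap N a b * rmap T b a) (c b) = (\<Sum>l<rdim N b. (rmap N a b *\<^sub>v (rmap T b a *\<^sub>v col (c b) l)) $ l)"
        by (simp only: assoc_mult_mat_vec[OF carr[OF a] cc])
    qed
    also have "\<dots> = (\<Sum>l<rdim N b. \<Sum>a\<in>nbrs n b. (rmap N a b *\<^sub>v (rmap T b a *\<^sub>v col (c b) l)) $ l)" by (rule sum.swap)
    also have "\<dots> = (\<Sum>l<rdim N b. nsum n N b (\<lambda>a. rmap T b a *\<^sub>v col (c b) l) $ l)"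
    proof (rule sum.cong[OF refl])
      fix l assume "l \<in> {..<rdim N b}"
      then have l: "l < rdim N b" by simp
      have pi: "(\<lambda>a. rmap N a b *\<^sub>v (rmap T b a *\<^sub>v col (c b) l)) \<in> nbrs n b \<rightarrow> carrier_vec (rdim N b)"
        using carr(1) tc mult_mat_vec_carrier by blast
      show "(\<Sum>a\<in>nbrs n b. (rmap N a b *\<^sub>v (rmap T b a *\<^sub>v col (c b) l)) $ l) = nsum n N b (\<lambda>a. rmap T b a *\<^sub>v col (c b) l) $ l"
        unfolding nsum_def by (rule index_finsum_vec[OF finite_nbrs l pi, symmetric])
    qed
    also have "\<dots> = 0" using D'(4)[OF sb nb(2) cc] by simp
    finally show ?thesis .
  qed
  \<comment> \<open>The finite set of sinks that allows the order of summation to be exchanged. A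
    neighbour of such a sink outside \<open>Bs\<close> contributes zero, because \<open>M\<close>
    vanishes there.\<close>
  define As where "As = (\<Union>b\<in>Bs. nbrs n b)"
  have fA: "finite As" using fB finite_nbrs by (auto simp: As_def)
  have z1: "(\<Sum>b\<in>Bs. \<Sum>a\<in>nbrs n b. ptr (rmap M b a * rmap N a b) (c a)) = 0"
  proof -
    have "(\<Sum>b\<in>Bs. \<Sum>a\<in>nbrs n b. ptr (rmap M b a * rmap N a b) (c a)) = (\<Sum>b\<in>Bs. \<Sum>a\<in>{a\<in>As. a \<in> nbrs n b}. ptr (rmap M b a * rmap N a b) (c a))"
      by (intro sum.cong refl) (auto simp: As_def)
    also have "\<dots> = (\<Sum>a\<in>As. \<Sum>b\<in>{b\<in>Bs. a \<in> nbrs n b}. ptr (rmap M b a * rmap N a b) (c a))"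
      by (rule sum.swap_restrict[OF fB fA])
    also have "\<dots> = (\<Sum>a\<in>As. 0)"
    proof (rule sum.cong[OF refl])
      fix a assume "a \<in> As"
      then obtain b0 where b0: "b0 \<in> Bs" "a \<in> nbrs n b0" by (auto simp: As_def)
      then have sa: "is_sink p a" and ta: "tvert n a" using source_nbr_arrow[of p b0 a n] arrow_nbrs[of n p b0 a] by (auto simp: Bs_def)
      have carr: "rmap M b a \<in> carrier_mat (rdim M a) (rdim M b)" "rmap N a b \<in> carrier_mat (rdim M b) (rdim N a)" if "b \<in> nbrs n a" for b
        using repD[OF rM nbrs_arrow(1)[OF that sa]] repD[OF rN nbrs_arrow(2)[OF that sa]] NM[OF nbrs_arrow(3)[OF that sa]] by auto
      have ca: "c a \<in> carrier_mat (rdim N a) (rdim M a)" using c[of a] TN[OF sa] by simp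
      have cc: "col (c a) l \<in> carrier_vec (rdim N a)" for l using ca by (auto intro!: carrier_vecI)
      have tc: "rmap N a b *\<^sub>v col (c a) l \<in> carrier_vec (rdim M b)" if "b \<in> nbrs n a" for b l
        using carr(2)[OF that] cc by (rule mult_mat_vec_carrier)
      have pc: "ptr (rmap M b a * rmap N a b) (c a) = (\<Sum>l<rdim M a. (rmap M b a *\<^sub>v (rmap N a b *\<^sub>v col (c a) l)) $ l)" if b: "b \<in> nbrs n a" for b
      proof -
        have "ptr (rmap M b a * rmap N a b) (c a) = (\<Sum>l<rdim M a. ((rmap M b a * rmap N a b) *\<^sub>v col (c a) l) $ l)"
          by (rule ptr_columns[OF mult_carrier_mat[OF carr[OF b]] ca])
        then show ?thesis by (simp only: assoc_mult_mat_vec[OF carr[OF b] cc])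
      qed
      have sub: "{b\<in>Bs. a \<in> nbrs n b} \<subseteq> nbrs n a" using nbrs_sym by blast
      have "(\<Sum>b\<in>{b\<in>Bs. a \<in> nbrs n b}. ptr (rmap M b a * rmap N a b) (c a)) = (\<Sum>b\<in>nbrs n a. ptr (rmap M b a * rmap N a b) (c a))"
      proof (rule sum.mono_neutral_left[OF finite_nbrs sub], intro ballI)
        fix b assume b: "b \<in> nbrs n a - {b\<in>Bs. a \<in> nbrs n b}"
        then have "b \<notin> Bs" "\<not> is_sink p b" using nbrs_sym nbrs_arrow(3)[OF _ sa] by blast+
        then have z: "rdim M b = 0" by (auto simp: Bs_def supp_def)
        have bn: "b \<in> nbrs n a" using b by blast
        have "rmap M b a * rmap N a b = 0\<^sub>m (rdim M a) (rdim N a)"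
          by (rule mat_mult_empty) (use carr[OF bn] z in auto)
        then show "ptr (rmap M b a * rmap N a b) (c a) = 0" by (simp add: ptr_def)
      qed
      also have "\<dots> = (\<Sum>b\<in>nbrs n a. \<Sum>l<rdim M a. (rmap M b a *\<^sub>v (rmap N a b *\<^sub>v col (c a) l)) $ l)"
        by (rule sum.cong[OF refl pc])
      also have "\<dots> = (\<Sum>l<rdim M a. \<Sum>b\<in>nbrs n a. (rmap M b a *\<^sub>v (rmap N a b *\<^sub>v col (c a) l)) $ l)" by (rule sum.swap)
      also have "\<dots> = (\<Sum>l<rdim M a. nsum n M a (\<lambda>b. rmap N a b *\<^sub>v col (c a) l) $ l)"
      proof (rule sum.cong[OF refl])
        fix l assume "l \<in> {..<rdim M a}"
        then have l: "l < rdim M a" by simp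
        have pi: "(\<lambda>b. rmap M b a *\<^sub>v (rmap N a b *\<^sub>v col (c a) l)) \<in> nbrs n a \<rightarrow> carrier_vec (rdim M a)"
          using carr(1) tc mult_mat_vec_carrier by blast
        show "(\<Sum>b\<in>nbrs n a. (rmap M b a *\<^sub>v (rmap N a b *\<^sub>v col (c a) l)) $ l) = nsum n M a (\<lambda>b. rmap N a b *\<^sub>v col (c a) l) $ l"
          unfolding nsum_def by (rule index_finsum_vec[OF finite_nbrs l pi, symmetric])
      qed
      also have "\<dots> = 0" using D(4)[OF sa ta cc] by simp
      finally show "(\<Sum>b\<in>{b\<in>Bs. a \<in> nbrs n b}. ptr (rmap M b a * rmap N a b) (c a)) = 0" .
    qed
    finally show ?thesis by simp
  qed
  have "pairing n p M N (hid T) u = (\<Sum>b\<in>Bs. \<Sum>a\<in>nbrs n b. ptr (rmap M b a * rmap N a b) (c a) - ptr (rmap N a b * rmap T b a) (c b))"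
    unfolding pairing_def Bs_def[symmetric] by (intro sum.cong refl eq)
  also have "\<dots> = 0" using z1 z2 by (simp add: sum_subtractf)
  finally show ?thesis .
qed

text \<open>A functional separates \<open>u\<close> from the coboundaries; its coefficients form
  matrices \<open>X a b\<close> from \<open>V_a\<close> to \<open>M_b\<close>. Vanishing on
  coboundaries supported at sinks lifts \<open>X\<close> to maps \<open>G a\<close> into
  \<open>N_a\<close>, and vanishing on those supported at sources lifts these to maps
  \<open>H b\<close> into \<open>T_b\<close>. Together they are a homomorphism to \<open>T\<close>
  that pairs nontrivially with \<open>u\<close>.\<close>

lemma pairing_nondegenerate:
  fixes M N T V :: "'k::field qrep"
  assumes MN: "pre_refl n p M N" and NT: "pre_refl n (\<not> p) N T" and V: "is_rep n p V" and u: "cochain n p M V u"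
    and z: "\<And>h. is_hom n p V T h \<Longrightarrow> pairing n p M N h u = 0"
  shows "coboundary n p M V u"
proof (rule ccontr)
  assume nc: "\<not> coboundary n p M V u"
  note D = pre_reflD[OF MN] and D' = pre_reflD[OF NT]
  note rM = D(1) and rN = D(2)
  have rT: "is_rep n p T" using D'(2) by simp
  have TN: "rdim T a = rdim N a" if "is_sink p a" for a using D'(3)[of a] that by (simp add: is_sink_not)
  have NM: "rdim N b = rdim M b" if "\<not> is_sink p b" for b using D(3)[OF that] .
  define Bs where "Bs = {b\<in>supp M. \<not> is_sink p b}"
  have fB: "finite Bs" using supp_finite[OF rM] by (simp add: Bs_def)
  define F where "F = edge_entries n p M V"
  have fF: "finite F" using finite_edge_entries[OF rM] by (simp add: F_def)
  define cf where "cf w = (\<lambda>(b,a,i,j). if (b,a,i,j) \<in> F then w b a $$ (j,i) else (0::'k))" for w :: "nat list \<Rightarrow> nat list \<Rightarrow> 'k mat"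
  define Fam where "Fam = {c. \<forall>x. (c x :: 'k mat) \<in> carrier_mat (rdim V x) (rdim M x)}"
  define cob where "cob c = (\<lambda>b a. c a * rmap M b a - rmap V b a * c b)" for c
  define S where "S = (\<lambda>c. cf (cob c)) ` Fam"
  have Farr: "arrow n p b a" if "(b,a,i,j) \<in> F" for b a i j
    using that source_nbr_arrow by (auto simp: F_def edge_entries_iff)
  have Fc: "dim_row (c x) = rdim V x" "dim_col (c x) = rdim M x" if "c \<in> Fam" for c x
    using that by (auto simp: Fam_def)
  have cobe: "cob c b a $$ (j,i) = (c a * rmap M b a) $$ (j,i) - (rmap V b a * c b) $$ (j,i)"
    if "c \<in> Fam" "(b,a,i,j) \<in> F" for c b a i j
    using that rep_dims[OF V Farr[OF that(2)]] rep_dims[OF rM Farr[OF that(2)]]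
    by (simp add: cob_def Fc F_def edge_entries_iff del: index_mult_mat(1))
  have entry: "cf (cob c) x = (case x of (b,a,i,j) \<Rightarrow> if (b,a,i,j) \<in> F then
      (\<Sum>k<rdim M a. c a $$ (j,k) * rmap M b a $$ (k,i)) - (\<Sum>k<rdim V b. rmap V b a $$ (j,k) * c b $$ (k,i)) else 0)"
    if c: "c \<in> Fam" for c x
  proof -
    obtain b a i j where x: "x = (b,a,i,j)" by (cases x) auto
    show ?thesis
    proof (cases "x \<in> F")
      case True
      then have f: "(b,a,i,j) \<in> F" using x by simp
      then have ij: "i < rdim M b" "j < rdim V a" by (auto simp: F_def edge_entries_iff)
      show ?thesis using f ij cobe[OF c f] rep_dims[OF V Farr[OF f]] rep_dims[OF rM Farr[OF f]]
        by (simp add: x cf_def Fc[OF c] scalar_prod_def atLeast0LessThan)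
    qed (simp add: x cf_def)
  qed
  have "\<exists>y. (\<forall>s\<in>S. (\<Sum>i\<in>F. y i * s i) = 0) \<and> (\<Sum>i\<in>F. y i * cf u i) \<noteq> 0"
  proof (rule separating_functional[OF fF])
    have z0: "(\<lambda>x. 0\<^sub>m (rdim V x) (rdim M x)) \<in> Fam" by (simp add: Fam_def)
    moreover have "cf (cob (\<lambda>x. 0\<^sub>m (rdim V x) (rdim M x))) = (\<lambda>_. 0)"
    proof (rule ext)
      fix x :: "nat list \<times> nat list \<times> nat \<times> nat"
      obtain b a i j where x: "x = (b,a,i,j)" by (cases x) auto
      show "cf (cob (\<lambda>x. 0\<^sub>m (rdim V x) (rdim M x))) x = 0"
        unfolding entry[OF z0] x by (auto simp: F_def edge_entries_iff intro!: sum.neutral)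
    qed
    ultimately show "(\<lambda>_. 0) \<in> S" unfolding S_def by (metis (no_types, lifting) image_eqI)
  next
    fix s t assume "s \<in> S" "t \<in> S"
    then obtain c d where c: "c \<in> Fam" "d \<in> Fam" and st: "s = cf (cob c)" "t = cf (cob d)" by (auto simp: S_def)
    have cd: "(\<lambda>x. c x + d x) \<in> Fam" using c by (simp add: Fam_def)
    have "(\<lambda>i. s i + t i) = cf (cob (\<lambda>x. c x + d x))"
    proof (rule ext)
      fix x :: "nat list \<times> nat list \<times> nat \<times> nat"
      obtain b a i j where x: "x = (b,a,i,j)" by (cases x) auto
      show "s x + t x = cf (cob (\<lambda>x. c x + d x)) x"
        unfolding st entry[OF c(1)] entry[OF c(2)] entry[OF cd] x
        by (simp add: Fc[OF c(1)] Fc[OF c(2)] ring_distribs sum.distrib F_def edge_entries_iff)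
    qed
    then show "(\<lambda>i. s i + t i) \<in> S" using cd unfolding S_def by simp
  next
    fix k s assume "s \<in> S"
    then obtain c where c: "c \<in> Fam" and s: "s = cf (cob c)" by (auto simp: S_def)
    have cd: "(\<lambda>x. k \<cdot>\<^sub>m c x) \<in> Fam" using c by (simp add: Fam_def)
    have "(\<lambda>i. k * s i) = cf (cob (\<lambda>x. k \<cdot>\<^sub>m c x))"
    proof (rule ext)
      fix x :: "nat list \<times> nat list \<times> nat \<times> nat"
      obtain b a i j where x: "x = (b,a,i,j)" by (cases x) auto
      show "k * s x = cf (cob (\<lambda>x. k \<cdot>\<^sub>m c x)) x"
        unfolding s entry[OF c] entry[OF cd] x
        by (simp add: Fc[OF c] right_diff_distrib sum_distrib_left F_def edge_entries_iff algebra_simps)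
    qed
    then show "(\<lambda>i. k * s i) \<in> S" using cd unfolding S_def by simp
  next
    show "s i = 0" if "s \<in> S" "i \<notin> F" for s i using that by (cases i) (auto simp: S_def cf_def)
    show "cf u i = 0" if "i \<notin> F" for i using that by (cases i) (auto simp: cf_def)
    show "cf u \<notin> S"
    proof
      assume "cf u \<in> S"
      then obtain c where c: "c \<in> Fam" and e: "cf u = cf (cob c)" by (auto simp: S_def)
      have "u b a = cob c b a" if ar: "arrow n p b a" for b a
      proof (rule eq_matI)
        note d = rep_dims[OF V ar] rep_dims[OF rM ar]
        have uc: "u b a \<in> carrier_mat (rdim V a) (rdim M b)" using u ar by (simp add: cochain_def)
        show "dim_row (u b a) = dim_row (cob c b a)" "dim_col (u b a) = dim_col (cob c b a)"
          using uc d Fc[OF c] by (auto simp: cob_def)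
        fix j i assume "j < dim_row (cob c b a)" "i < dim_col (cob c b a)"
        then have ji: "j < rdim V a" "i < rdim M b" using d Fc[OF c] by (auto simp: cob_def)
        have "a \<in> nbrs n b" "\<not> is_sink p b" using ar nbrs_sym arrow_nbrs[OF ar] by blast+
        then have "(b,a,i,j) \<in> F" using ji by (auto simp: F_def edge_entries_iff)
        then show "u b a $$ (j,i) = cob c b a $$ (j,i)" using fun_cong[OF e, of "(b,a,i,j)"] by (simp add: cf_def)
      qed
      then have "coboundary n p M V u" unfolding coboundary_def using c by (auto simp: Fam_def cob_def)
      then show False using nc by blast
    qed
  qed
  then obtain y where y0: "\<And>s. s\<in>S \<Longrightarrow> (\<Sum>i\<in>F. y i * s i) = 0" and yu: "(\<Sum>i\<in>F. y i * cf u i) \<noteq> 0" by blast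
  define X where "X a b = mat (rdim M b) (rdim V a) (\<lambda>(i,j). y (b,a,i,j))" for a b
  have X: "X a b \<in> carrier_mat (rdim M b) (rdim V a)" for a b by (simp add: X_def)
  have yX: "(\<Sum>i\<in>F. y i * cf w i) = (\<Sum>b\<in>Bs. \<Sum>a\<in>nbrs n b. ptr (X a b) (w b a))" for w
  proof -
    have "(\<Sum>i\<in>F. y i * cf w i) = (\<Sum>(b,a,i,j)\<in>F. X a b $$ (i,j) * w b a $$ (j,i))"
      by (rule sum.cong) (auto simp: cf_def X_def F_def edge_entries_iff)
    then show ?thesis unfolding F_def Bs_def using sum_edge_entries[OF rM, of X V w] X by simp
  qed
  have yc: "(\<Sum>b\<in>Bs. \<Sum>a\<in>nbrs n b. ptr (X a b) (cob c b a)) = 0" if "c \<in> Fam" for c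
    using y0[of "cf (cob c)"] that yX[of "cob c"] by (simp add: S_def)
  \<comment> \<open>Testing with \<open>rank_one\<close> families at the sink \<open>a\<close> shows
    that the vectors \<open>X a b *\<^sub>v w\<close>, taken over the neighbours \<open>b\<close>,
    form an element of the kernel that \<open>N_a\<close> represents.\<close>
  have sinkz: "nsum n M a (\<lambda>b. X a b *\<^sub>v w) = 0\<^sub>v (rdim M a)"
    if a: "is_sink p a" "tvert n a" and w: "w \<in> carrier_vec (rdim V a)" for a w
  proof (rule eq_vecI)
    have Xw: "X a b *\<^sub>v w \<in> carrier_vec (rdim M b)" for b using X w by (rule mult_mat_vec_carrier)
    have nc: "nsum n M a (\<lambda>b. X a b *\<^sub>v w) \<in> carrier_vec (rdim M a)" by (rule nsum_carrier[OF rM a(1)]) (rule Xw)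
    then show "dim_vec (nsum n M a (\<lambda>b. X a b *\<^sub>v w)) = dim_vec (0\<^sub>v (rdim M a))" by simp
    fix l assume "l < dim_vec (0\<^sub>v (rdim M a) :: 'k vec)" then have l: "l < rdim M a" by simp
    define c where "c x = (if x = a then rank_one (rdim V a) (rdim M a) l w else 0\<^sub>m (rdim V x) (rdim M x))" for x
    have c: "c \<in> Fam" by (simp add: Fam_def c_def rank_one_def)
    have t: "ptr (X a' b) (cob c b a') = (if a' = a then (rmap M b a *\<^sub>v (X a b *\<^sub>v w)) $ l else 0)"
      if b: "b \<in> Bs" "a' \<in> nbrs n b" for a' b
    proof -
      have nb: "\<not> is_sink p b" using b by (simp add: Bs_def)
      note ar = source_nbr_arrow[OF nb b(2)]
      note Mc = repD[OF rM ar] and Vc = repD[OF V ar]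
      have ba: "b \<noteq> a" using nb a by auto
      have c1: "cob c b a' = c a' * rmap M b a'"
      proof -
        have "rmap V b a' * c b = 0\<^sub>m (rdim V a') (rdim M b)" using ba Vc by (simp add: c_def)
        moreover have "c a' * rmap M b a' \<in> carrier_mat (rdim V a') (rdim M b)"
          by (rule carrier_matI) (use Fc[OF c] Mc in auto)
        ultimately show ?thesis using mat_minus_zero by (simp add: cob_def)
      qed
      show ?thesis
      proof (cases "a' = a")
        case True
        have R: "rank_one (rdim V a) (rdim M a) l w \<in> carrier_mat (rdim V a) (rdim M a)" by (simp add: rank_one_def)
        have Mc': "rmap M b a \<in> carrier_mat (rdim M a) (rdim M b)" using Mc True by simp
        have "ptr (X a b) (rank_one (rdim V a) (rdim M a) l w * rmap M b a) = ptr (X a b * rank_one (rdim V a) (rdim M a) l w) (rmap M b a)"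
          by (rule ptr_assoc[OF X R Mc', symmetric])
        also have "\<dots> = ptr (rmap M b a) (X a b * rank_one (rdim V a) (rdim M a) l w)"
          by (rule ptr_sym[OF mult_carrier_mat[OF X R] Mc'])
        also have "\<dots> = ptr (rmap M b a * X a b) (rank_one (rdim V a) (rdim M a) l w)"
          by (rule ptr_assoc[OF Mc' X R, symmetric])
        also have "\<dots> = ((rmap M b a * X a b) *\<^sub>v w) $ l"
          by (rule ptr_rank_one[OF mult_carrier_mat[OF Mc' X] w l])
        also have "(rmap M b a * X a b) *\<^sub>v w = rmap M b a *\<^sub>v (X a b *\<^sub>v w)" by (rule assoc_mult_mat_vec[OF Mc' X w])
        finally show ?thesis using True c1 by (simp add: c_def)
      next
        case False
        then have "c a' * rmap M b a' = 0\<^sub>m (rdim V a') (rdim M b)" using Mc by (simp add: c_def)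
        then show ?thesis using c1 False ptr_zero[OF X] by simp
      qed
    qed
    have "0 = (\<Sum>b\<in>Bs. \<Sum>a'\<in>nbrs n b. if a' = a then (rmap M b a *\<^sub>v (X a b *\<^sub>v w)) $ l else 0)"
      using yc[OF c] t by simp
    also have "\<dots> = (\<Sum>b\<in>Bs. if a \<in> nbrs n b then (rmap M b a *\<^sub>v (X a b *\<^sub>v w)) $ l else 0)"
      by (simp add: finite_nbrs)
    also have "\<dots> = (\<Sum>b\<in>{b\<in>Bs. a \<in> nbrs n b}. (rmap M b a *\<^sub>v (X a b *\<^sub>v w)) $ l)"
      using fB by (simp add: sum.If_cases Int_def)
    also have "\<dots> = (\<Sum>b\<in>nbrs n a. (rmap M b a *\<^sub>v (X a b *\<^sub>v w)) $ l)"
    proof (rule sum.mono_neutral_left[OF finite_nbrs])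
      show "{b\<in>Bs. a \<in> nbrs n b} \<subseteq> nbrs n a" using nbrs_sym by blast
      show "\<forall>b\<in>nbrs n a - {b\<in>Bs. a \<in> nbrs n b}. (rmap M b a *\<^sub>v (X a b *\<^sub>v w)) $ l = 0"
      proof
        fix b assume b: "b \<in> nbrs n a - {b\<in>Bs. a \<in> nbrs n b}"
        then have "b \<notin> Bs" "\<not> is_sink p b" using nbrs_sym nbrs_arrow(3)[OF _ a(1)] by blast+
        then have zb: "rdim M b = 0" by (auto simp: Bs_def supp_def)
        have "rmap M b a \<in> carrier_mat (rdim M a) 0" using repD[OF rM nbrs_arrow(1)[OF _ a(1)], of b] b zb by auto
        then show "(rmap M b a *\<^sub>v (X a b *\<^sub>v w)) $ l = 0" using l X[of a b] zb by (auto simp: scalar_prod_def)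
      qed
    qed
    also have "\<dots> = nsum n M a (\<lambda>b. X a b *\<^sub>v w) $ l"
    proof -
      have pi: "(\<lambda>b. rmap M b a *\<^sub>v (X a b *\<^sub>v w)) \<in> nbrs n a \<rightarrow> carrier_vec (rdim M a)"
        using repD[OF rM nbrs_arrow(1)[OF _ a(1)]] Xw mult_mat_vec_carrier by blast
      show ?thesis unfolding nsum_def by (rule index_finsum_vec[OF finite_nbrs l pi, symmetric])
    qed
    finally show "nsum n M a (\<lambda>b. X a b *\<^sub>v w) $ l = 0\<^sub>v (rdim M a) $ l" using l by simp
  qed
  have "\<exists>G\<in>carrier_mat (rdim N a) (rdim V a). \<forall>b\<in>nbrs n a. rmap N a b * G = X a b"
    if a: "is_sink p a" "tvert n a" for a
  proof (rule lift_columns[where e = "rdim M"])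
    fix b assume b: "b \<in> nbrs n a"
    show "rmap N a b \<in> carrier_mat (rdim M b) (rdim N a)"
      using repD[OF rN nbrs_arrow(2)[OF b a(1)]] NM[OF nbrs_arrow(3)[OF b a(1)]] by simp
    show "X a b \<in> carrier_mat (rdim M b) (rdim V a)" by (rule X)
  next
    fix w :: "'k vec" assume w: "w \<in> carrier_vec (rdim V a)"
    show "\<exists>z\<in>carrier_vec (rdim N a). \<forall>b\<in>nbrs n a. rmap N a b *\<^sub>v z = X a b *\<^sub>v w"
      by (rule D(5)[OF a _ sinkz[OF a w]]) (rule mult_mat_vec_carrier[OF X w])
  qed
  then obtain G where G: "\<And>a. is_sink p a \<Longrightarrow> tvert n a \<Longrightarrow> G a \<in> carrier_mat (rdim N a) (rdim V a)"
    "\<And>a b. is_sink p a \<Longrightarrow> tvert n a \<Longrightarrow> b\<in>nbrs n a \<Longrightarrow> rmap N a b * G a = X a b" by metis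
  have nbr_sink: "is_sink p a \<and> tvert n a \<and> b \<in> nbrs n a \<and> arrow n p b a" if "\<not> is_sink p b" "a \<in> nbrs n b" for a b
    using source_nbr_arrow[OF that] arrow_nbrs[of n p b a] by blast
  \<comment> \<open>The same test at a source \<open>b\<close>, now one reflection further: the
    relation obtained is membership in the kernel that \<open>T_b\<close> represents. The minus sign
    of the coboundary only changes the sign of a sum that is zero.\<close>
  have srcz: "nsum n N b (\<lambda>a. G a *\<^sub>v (rmap V b a *\<^sub>v w)) = 0\<^sub>v (rdim N b)"
    if b: "\<not> is_sink p b" "tvert n b" and w: "w \<in> carrier_vec (rdim V b)" for b w
  proof (rule eq_vecI)
    have sb: "is_sink (\<not> p) b" using b by (simp add: is_sink_not)
    have Vw: "rmap V b a *\<^sub>v w \<in> carrier_vec (rdim V a)" if "a \<in> nbrs n b" for a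
      using repD[OF V] nbr_sink[OF b(1) that] w by (metis mult_mat_vec_carrier)
    have GV: "G a *\<^sub>v (rmap V b a *\<^sub>v w) \<in> carrier_vec (rdim N a)" if "a \<in> nbrs n b" for a
      using G(1) nbr_sink[OF b(1) that] Vw[OF that] by (metis mult_mat_vec_carrier)
    have nc: "nsum n N b (\<lambda>a. G a *\<^sub>v (rmap V b a *\<^sub>v w)) \<in> carrier_vec (rdim N b)" by (rule nsum_carrier[OF rN sb]) (rule GV)
    then show "dim_vec (nsum n N b (\<lambda>a. G a *\<^sub>v (rmap V b a *\<^sub>v w))) = dim_vec (0\<^sub>v (rdim N b))" by simp
    fix l assume "l < dim_vec (0\<^sub>v (rdim N b) :: 'k vec)" then have l: "l < rdim N b" "l < rdim M b" using NM[OF b(1)] by auto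
    then have bB: "b \<in> Bs" using b by (auto simp: Bs_def supp_def)
    define c where "c x = (if x = b then rank_one (rdim V b) (rdim M b) l w else 0\<^sub>m (rdim V x) (rdim M x))" for x
    have c: "c \<in> Fam" by (simp add: Fam_def c_def rank_one_def)
    have t: "ptr (X a b') (cob c b' a) = (if b' = b then - (X a b *\<^sub>v (rmap V b a *\<^sub>v w)) $ l else 0)"
      if b': "b' \<in> Bs" "a \<in> nbrs n b'" for a b'
    proof -
      have nb: "\<not> is_sink p b'" using b' by (simp add: Bs_def)
      note ns = nbr_sink[OF nb b'(2)]
      note Mc = repD[OF rM, of b' a] and Vc = repD[OF V, of b' a]
      have ba: "a \<noteq> b" using ns b by auto
      have ca: "c a * rmap M b' a = 0\<^sub>m (rdim V a) (rdim M b')" using ba Mc ns by (simp add: c_def)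
      have Vcc: "rmap V b' a * c b' \<in> carrier_mat (rdim V a) (rdim M b')"
        by (rule carrier_matI) (use Fc[OF c] Vc ns in auto)
      have "ptr (X a b') (cob c b' a) = ptr (X a b') (0\<^sub>m (rdim V a) (rdim M b')) - ptr (X a b') (rmap V b' a * c b')"
        unfolding cob_def ca by (rule ptr_add(2)[OF X _ Vcc]) simp
      then have 1: "ptr (X a b') (cob c b' a) = - ptr (X a b') (rmap V b' a * c b')" using ptr_zero[OF X] by simp
      show ?thesis
      proof (cases "b' = b")
        case True
        have R: "rank_one (rdim V b) (rdim M b) l w \<in> carrier_mat (rdim V b) (rdim M b)" by (simp add: rank_one_def)
        have Vc': "rmap V b a \<in> carrier_mat (rdim V a) (rdim V b)" using Vc ns True by simp
        have "ptr (X a b) (rmap V b a * rank_one (rdim V b) (rdim M b) l w) = ptr (X a b * rmap V b a) (rank_one (rdim V b) (rdim M b) l w)"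
          by (rule ptr_assoc[OF X Vc' R, symmetric])
        also have "\<dots> = ((X a b * rmap V b a) *\<^sub>v w) $ l" by (rule ptr_rank_one[OF mult_carrier_mat[OF X Vc'] w l(2)])
        also have "(X a b * rmap V b a) *\<^sub>v w = X a b *\<^sub>v (rmap V b a *\<^sub>v w)" by (rule assoc_mult_mat_vec[OF X Vc' w])
        finally show ?thesis using True 1 by (simp add: c_def)
      next
        case False
        then have "rmap V b' a * c b' = 0\<^sub>m (rdim V a) (rdim M b')" using Vc ns by (simp add: c_def)
        then show ?thesis using 1 False ptr_zero[OF X] by simp
      qed
    qed
    have "0 = (\<Sum>b'\<in>Bs. \<Sum>a\<in>nbrs n b'. if b' = b then - (X a b *\<^sub>v (rmap V b a *\<^sub>v w)) $ l else 0)"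
      using yc[OF c] t by simp
    also have "\<dots> = (\<Sum>b'\<in>Bs. if b' = b then \<Sum>a\<in>nbrs n b. - (X a b *\<^sub>v (rmap V b a *\<^sub>v w)) $ l else 0)"
      by (intro sum.cong) auto
    also have "\<dots> = - (\<Sum>a\<in>nbrs n b. (X a b *\<^sub>v (rmap V b a *\<^sub>v w)) $ l)" using fB bB by (simp add: sum_negf)
    also have "(\<Sum>a\<in>nbrs n b. (X a b *\<^sub>v (rmap V b a *\<^sub>v w)) $ l) = (\<Sum>a\<in>nbrs n b. (rmap N a b *\<^sub>v (G a *\<^sub>v (rmap V b a *\<^sub>v w))) $ l)"
    proof (rule sum.cong[OF refl])
      fix a assume a: "a \<in> nbrs n b"
      note ns = nbr_sink[OF b(1) a]
      have Nc: "rmap N a b \<in> carrier_mat (rdim N b) (rdim N a)" using repD[OF rN, of a b] ns by (simp add: arrow_flip)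
      have Gc: "G a \<in> carrier_mat (rdim N a) (rdim V a)" using G(1) ns by blast
      have "rmap N a b * G a = X a b" using G(2) ns by blast
      then show "(X a b *\<^sub>v (rmap V b a *\<^sub>v w)) $ l = (rmap N a b *\<^sub>v (G a *\<^sub>v (rmap V b a *\<^sub>v w))) $ l"
        using assoc_mult_mat_vec[OF Nc Gc Vw[OF a]] by simp
    qed
    also have "\<dots> = nsum n N b (\<lambda>a. G a *\<^sub>v (rmap V b a *\<^sub>v w)) $ l"
    proof -
      have pi: "(\<lambda>a. rmap N a b *\<^sub>v (G a *\<^sub>v (rmap V b a *\<^sub>v w))) \<in> nbrs n b \<rightarrow> carrier_vec (rdim N b)"
        using repD[OF rN nbrs_arrow(1)[OF _ sb]] GV mult_mat_vec_carrier by blast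
      show ?thesis unfolding nsum_def by (rule index_finsum_vec[OF finite_nbrs l(1) pi, symmetric])
    qed
    finally show "nsum n N b (\<lambda>a. G a *\<^sub>v (rmap V b a *\<^sub>v w)) $ l = 0\<^sub>v (rdim N b) $ l" using l by simp
  qed
  have "\<exists>H\<in>carrier_mat (rdim T b) (rdim V b). \<forall>a\<in>nbrs n b. rmap T b a * H = G a * rmap V b a"
    if b: "\<not> is_sink p b" "tvert n b" for b
  proof (rule lift_columns[where e = "rdim N"])
    have sb: "is_sink (\<not> p) b" using b by (simp add: is_sink_not)
    {
      fix a assume a: "a \<in> nbrs n b"
      note ns = nbr_sink[OF b(1) a]
      show "rmap T b a \<in> carrier_mat (rdim N a) (rdim T b)" using repD[OF rT, of b a] ns TN[of a] by simp
      show "G a * rmap V b a \<in> carrier_mat (rdim N a) (rdim V b)" using G(1) repD[OF V] ns by (metis mult_carrier_mat)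
    }
    fix w :: "'k vec" assume w: "w \<in> carrier_vec (rdim V b)"
    have c1: "G a *\<^sub>v (rmap V b a *\<^sub>v w) \<in> carrier_vec (rdim N a)" if "a \<in> nbrs n b" for a
      using G(1) repD[OF V] nbr_sink[OF b(1) that] w by (metis mult_mat_vec_carrier)
    obtain z where z: "z \<in> carrier_vec (rdim T b)" "\<And>a. a \<in> nbrs n b \<Longrightarrow> rmap T b a *\<^sub>v z = G a *\<^sub>v (rmap V b a *\<^sub>v w)"
      using D'(5)[OF sb b(2) c1 srcz[OF b w]] by blast
    have "rmap T b a *\<^sub>v z = (G a * rmap V b a) *\<^sub>v w" if "a \<in> nbrs n b" for a
      using z(2)[OF that] assoc_mult_mat_vec[OF G(1) repD[OF V] w, of a] nbr_sink[OF b(1) that] by simp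
    then show "\<exists>z\<in>carrier_vec (rdim T b). \<forall>a\<in>nbrs n b. rmap T b a *\<^sub>v z = (G a * rmap V b a) *\<^sub>v w" using z(1) by blast
  qed
  then obtain H where H: "\<And>b. \<not> is_sink p b \<Longrightarrow> tvert n b \<Longrightarrow> H b \<in> carrier_mat (rdim T b) (rdim V b)"
    "\<And>b a. \<not> is_sink p b \<Longrightarrow> tvert n b \<Longrightarrow> a\<in>nbrs n b \<Longrightarrow> rmap T b a * H b = G a * rmap V b a" by metis
  define h where "h x = (if tvert n x then if is_sink p x then G x else H x else 0\<^sub>m (rdim T x) (rdim V x))" for x
  have h: "is_hom n p V T h"
  proof (rule homI[OF V rT])
    show "h x \<in> carrier_mat (rdim T x) (rdim V x)" for x
      using G(1)[of x] H(1)[of x] TN[of x] by (auto simp: h_def)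
    fix b a assume ar: "arrow n p b a"
    note an = arrow_nbrs[OF ar]
    have tb: "tvert n b" "a \<in> nbrs n b" using an nbrs_arrow(6)[of b n a p] nbrs_sym by blast+
    show "h a * rmap V b a = rmap T b a * h b" using H(2)[of b a] an tb by (simp add: h_def)
  qed
  have "pairing n p M N h u = (\<Sum>b\<in>Bs. \<Sum>a\<in>nbrs n b. ptr (X a b) (u b a))"
    unfolding pairing_def Bs_def[symmetric]
  proof (intro sum.cong refl)
    fix b a assume b: "b \<in> Bs" and a: "a \<in> nbrs n b"
    then have "\<not> is_sink p b" by (simp add: Bs_def)
    note ns = nbr_sink[OF this a]
    have "rmap N a b * h a = X a b" using G(2)[of a b] ns by (simp add: h_def)
    then show "ptr (rmap N a b * h a) (u b a) = ptr (X a b) (u b a)" by simp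
  qed
  then show False using z[OF h] yu yX[of u] by simp
qed

section \<open>The almost split class and its extension\<close>

text \<open>If \<open>r\<close> inverts \<open>g + h\<close>, then \<open>r * h = 1 - r * g\<close>.
  Since \<open>r * g\<close> is not an automorphism, locality makes the right-hand side one, and
  then \<open>h\<close> is invertible.\<close>

lemma non_automorphism_add:
  fixes T :: "'k::field qrep"
  assumes T: "indecomposable n p T" and g: "is_hom n p T T g" "\<not> automorphism n p T g" and h: "is_hom n p T T h" "\<not> automorphism n p T h"
  shows "\<not> automorphism n p T (\<lambda>x. g x + h x)"
proof
  assume "automorphism n p T (\<lambda>x. g x + h x)"
  then obtain r where r: "is_hom n p T T r" and e: "hcomp r (\<lambda>x. g x + h x) = hid T" unfolding automorphism_def by blast
  have ex: "r x * g x + r x * h x = 1\<^sub>m (rdim T x)" for x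
    using fun_cong[OF e, of x] homD(4,5)[OF r] homD(4,5)[OF g(1)] homD(4,5)[OF h(1)] by (simp add: hcomp_def hid_def mat_distrib)
  have na: "\<not> automorphism n p T (hcomp r k)" if k: "is_hom n p T T k" "\<not> automorphism n p T k" for k
  proof
    assume "automorphism n p T (hcomp r k)"
    then obtain s where s: "is_hom n p T T s" "hcomp s (hcomp r k) = hid T" unfolding automorphism_def by blast
    then have "hcomp (hcomp s r) k = hid T" using hcomp_assoc[OF k(1) r s(1)] by simp
    then show False using automorphismI[OF k(1) hom_comp[OF r s(1)]] k(2) by blast
  qed
  have "automorphism n p T (\<lambda>x. 1\<^sub>m (rdim T x) - hcomp r g x)"
    by (rule one_minus_automorphism[OF T hom_comp[OF g(1) r] na[OF g]])
  moreover have "(\<lambda>x. 1\<^sub>m (rdim T x) - hcomp r g x) = hcomp r h"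
  proof (rule ext)
    fix x
    have d: "dim_row (r x * g x) = rdim T x" "dim_col (r x * g x) = rdim T x" "dim_row (r x * h x) = rdim T x" "dim_col (r x * h x) = rdim T x"
      using homD(4,5)[OF r] homD(4,5)[OF g(1)] homD(4,5)[OF h(1)] by simp_all
    show "1\<^sub>m (rdim T x) - hcomp r g x = hcomp r h x"
      unfolding ex[symmetric] hcomp_def by (rule eq_matI) (simp_all add: d del: index_mult_mat)
  qed
  ultimately show False using na[OF h] by simp
qed

text \<open>By locality the non-automorphisms form a subspace of the endomorphisms of
  \<open>T\<close> that does not contain the identity. A functional vanishing on this subspace but
  not at the identity is represented through the pairing by a cochain \<open>e\<close>, the class of
  the almost split sequence ending in \<open>M\<close>.\<close>

lemma ar_class_exists:
  fixes M N T :: "'k::field qrep"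
  assumes MN: "full_refl n p M N" and NT: "full_refl n (\<not> p) N T" and T: "indecomposable n p T"
  shows "\<exists>e. cochain n p M T e \<and> (\<forall>h. is_hom n p T T h \<longrightarrow> \<not> automorphism n p T h \<longrightarrow> pairing n p M N h e = 0) \<and>
    pairing n p M N (hid T) e \<noteq> 0"
proof -
  note F = full_reflD[OF MN] and F' = full_reflD[OF NT]
  note D = pre_reflD[OF F(1)] and D' = pre_reflD[OF F'(1)]
  note rM = D(1) and rN = D(2)
  have rT: "is_rep n p T" using D'(2) by simp
  have iT: "nbr_inj n p T" using F'(3) by simp
  have TN: "rdim T a = rdim N a" if "is_sink p a" for a using D'(3)[of a] that by (simp add: is_sink_not)
  have NM: "rdim N b = rdim M b" if "\<not> is_sink p b" for b using D(3)[OF that] .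
  define E where "E = edge_entries n p M T"
  have fE: "finite E" using finite_edge_entries[OF rM] by (simp add: E_def)
  define cf where "cf h = (\<lambda>(b,a,i,j). if (b,a,i,j) \<in> E then (rmap N a b * h a) $$ (i,j) else (0::'k))" for h :: "nat list \<Rightarrow> 'k mat"
  have Ecar: "rmap N a b \<in> carrier_mat (rdim M b) (rdim T a)" if "\<not> is_sink p b" "a \<in> nbrs n b" for a b
  proof -
    note ar = source_nbr_arrow[OF that]
    have "is_sink p a" using ar by (simp add: arrow_def)
    then show ?thesis using repD[OF rN, of a b] ar NM[OF that(1)] TN by (simp add: arrow_flip)
  qed
  have cfe: "cf h x = (case x of (b,a,i,j) \<Rightarrow> if (b,a,i,j) \<in> E then \<Sum>k<rdim T a. rmap N a b $$ (i,k) * h a $$ (k,j) else 0)"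
    if h: "is_hom n p T T h" for h x
  proof -
    obtain b a i j where x: "x = (b,a,i,j)" by (cases x) auto
    show ?thesis
    proof (cases "x \<in> E")
      case True
      then have f: "(b,a,i,j) \<in> E" using x by simp
      then have ij: "i < rdim M b" "j < rdim T a" "\<not> is_sink p b" "a \<in> nbrs n b" by (auto simp: E_def edge_entries_iff)
      show ?thesis using f ij Ecar[OF ij(3,4)] homD(4,5)[OF h]
        by (auto simp: x cf_def scalar_prod_def atLeast0LessThan)
    qed (simp add: x cf_def)
  qed
  define NA where "NA = {h. is_hom n p T T h \<and> \<not> automorphism n p T h}"
  define S where "S = cf ` NA"
  have "\<exists>y. (\<forall>s\<in>S. (\<Sum>i\<in>E. y i * s i) = 0) \<and> (\<Sum>i\<in>E. y i * cf (hid T) i) \<noteq> 0"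
  proof (rule separating_functional[OF fE])
    have z: "is_hom n p T T (\<lambda>x. 0\<^sub>m (rdim T x) (rdim T x))" using hom_zero[OF rT rT] .
    have "\<not> automorphism n p T (\<lambda>x. 0\<^sub>m (rdim T x) (rdim T x))"
    proof
      assume "automorphism n p T (\<lambda>x. 0\<^sub>m (rdim T x) (rdim T x))"
      then obtain r where r: "is_hom n p T T r" "hcomp r (\<lambda>x. 0\<^sub>m (rdim T x) (rdim T x)) = hid T" unfolding automorphism_def by blast
      obtain x where x: "rdim T x \<noteq> 0" using T by (auto simp: indecomposable_def is_zero_rep_def)
      have "(1\<^sub>m (rdim T x) :: 'k mat) = 0\<^sub>m (rdim T x) (rdim T x)"
        using fun_cong[OF r(2), of x] homD(4,5)[OF r(1)] by (simp add: hcomp_def hid_def)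
      then show False using one_mat_ne_zero[OF x, where 'k = 'k] by simp
    qed
    then have "(\<lambda>x. 0\<^sub>m (rdim T x) (rdim T x)) \<in> NA" using z by (simp add: NA_def)
    moreover have "cf (\<lambda>x. 0\<^sub>m (rdim T x) (rdim T x)) = (\<lambda>_. 0)"
      by (rule ext) (auto simp: cfe[OF z] E_def edge_entries_iff intro!: sum.neutral)
    ultimately show "(\<lambda>_. 0) \<in> S" unfolding S_def by (metis (no_types, lifting) image_eqI)
  next
    fix s t assume "s \<in> S" "t \<in> S"
    then obtain g h where g: "g \<in> NA" and h: "h \<in> NA" and st: "s = cf g" "t = cf h" by (auto simp: S_def)
    have gh: "is_hom n p T T g" "is_hom n p T T h" using g h by (auto simp: NA_def)
    note s' = hom_add(1)[OF gh]
    have "(\<lambda>x. g x + h x) \<in> NA" using g h s' non_automorphism_add[OF T, of g h] by (auto simp: NA_def)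
    moreover have "(\<lambda>i. s i + t i) = cf (\<lambda>x. g x + h x)"
    proof (rule ext)
      fix x :: "nat list \<times> nat list \<times> nat \<times> nat"
      obtain b a i j where x: "x = (b,a,i,j)" by (cases x) auto
      show "s x + t x = cf (\<lambda>x. g x + h x) x"
        unfolding st cfe[OF gh(1)] cfe[OF gh(2)] cfe[OF s'] x
        by (simp add: homD(4,5)[OF gh(1)] homD(4,5)[OF gh(2)] ring_distribs sum.distrib E_def edge_entries_iff)
    qed
    ultimately show "(\<lambda>i. s i + t i) \<in> S" unfolding S_def by simp
  next
    fix k s assume "s \<in> S"
    then obtain g where g: "is_hom n p T T g" "\<not> automorphism n p T g" and s: "s = cf g" by (auto simp: S_def NA_def)
    note s' = hom_smult[OF g(1), of k]
    have "\<not> automorphism n p T (\<lambda>x. k \<cdot>\<^sub>m g x)"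
    proof
      assume "automorphism n p T (\<lambda>x. k \<cdot>\<^sub>m g x)"
      then obtain r where r: "is_hom n p T T r" "hcomp r (\<lambda>x. k \<cdot>\<^sub>m g x) = hid T" unfolding automorphism_def by blast
      have "hcomp (\<lambda>x. k \<cdot>\<^sub>m r x) g = hid T"
      proof (rule ext)
        fix x
        have "k \<cdot>\<^sub>m r x * g x = r x * (k \<cdot>\<^sub>m g x)"
          using mult_smult_assoc_mat[OF homD(3)[OF r(1), of x] homD(3)[OF g(1), of x], of k]
            mult_smult_distrib[OF homD(3)[OF r(1), of x] homD(3)[OF g(1), of x], of k] by simp
        then show "hcomp (\<lambda>x. k \<cdot>\<^sub>m r x) g x = hid T x" using fun_cong[OF r(2), of x] by (simp add: hcomp_def)
      qed
      then show False using automorphismI[OF g(1) hom_smult[OF r(1)]] g(2) by blast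
    qed
    then have "(\<lambda>x. k \<cdot>\<^sub>m g x) \<in> NA" using s' by (simp add: NA_def)
    moreover have "(\<lambda>i. k * s i) = cf (\<lambda>x. k \<cdot>\<^sub>m g x)"
    proof (rule ext)
      fix x :: "nat list \<times> nat list \<times> nat \<times> nat"
      obtain b a i j where x: "x = (b,a,i,j)" by (cases x) auto
      show "k * s x = cf (\<lambda>x. k \<cdot>\<^sub>m g x) x"
        unfolding s cfe[OF g(1)] cfe[OF s'] x
        by (simp add: homD(4,5)[OF g(1)] sum_distrib_left E_def edge_entries_iff mult.left_commute)
    qed
    ultimately show "(\<lambda>i. k * s i) \<in> S" unfolding S_def by simp
  next
    show "s i = 0" if "s \<in> S" "i \<notin> E" for s i using that by (cases i) (auto simp: S_def cf_def)
    show "cf (hid T) i = 0" if "i \<notin> E" for i using that by (cases i) (auto simp: cf_def)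
    show "cf (hid T) \<notin> S"
    proof
      assume "cf (hid T) \<in> S"
      then obtain h where h: "is_hom n p T T h" "\<not> automorphism n p T h" and e: "cf (hid T) = cf h" by (auto simp: S_def NA_def)
      \<comment> \<open>An endomorphism is determined by the entries that \<open>cf\<close> records:
        the maps out of \<open>N_a\<close> are jointly injective, and so are the maps out of the
        spaces of \<open>T\<close> at the sources of \<open>p\<close>.\<close>
      have "hid T = h"
      proof (rule hom_eq_nbr_inj[OF hom_id[OF rT] h(1) iT])
        fix a assume a: "is_sink p a"
        show "hid T a = h a"
        proof (cases "tvert n a")
          case True
          show ?thesis
          proof (rule nbr_inj_cancel[OF rN F(3) _ True])
            show "\<not> is_sink (\<not> p) a" using a by (simp add: is_sink_not)
            show "hid T a \<in> carrier_mat (rdim N a) (rdim T a)" "h a \<in> carrier_mat (rdim N a) (rdim T a)"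
              using homD(3)[OF h(1), of a] TN[OF a] by (auto simp: hid_def)
            fix b assume b: "b \<in> nbrs n a"
            have b': "\<not> is_sink p b" "a \<in> nbrs n b" using nbrs_arrow(3)[OF b a] b nbrs_sym by blast+
            note Nc = Ecar[OF b']
            show "rmap N a b * hid T a = rmap N a b * h a"
            proof (rule eq_matI)
              fix i j assume "i < dim_row (rmap N a b * h a)" "j < dim_col (rmap N a b * h a)"
              then have ij: "i < rdim M b" "j < rdim T a" using Nc homD(5)[OF h(1)] by auto
              then have "(b,a,i,j) \<in> E" using b' by (auto simp: E_def edge_entries_iff)
              then show "(rmap N a b * hid T a) $$ (i,j) = (rmap N a b * h a) $$ (i,j)"
                using fun_cong[OF e, of "(b,a,i,j)"] by (simp add: cf_def)
            qed (use Nc homD(5)[OF h(1)] in \<open>auto simp: hid_def\<close>)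
          qed
        next
          case False
          then have "rdim T a = 0" using rT by (auto simp: is_rep_def)
          then show ?thesis using homD(4,5)[OF h(1), of a] by (intro zero_dim_mat_eq) (auto simp: hid_def)
        qed
      qed
      then show False using h(2) automorphismI[OF h(1) hom_id[OF rT]] hcomp_id[OF hom_id[OF rT]] by simp
    qed
  qed
  then obtain y where y0: "\<And>s. s\<in>S \<Longrightarrow> (\<Sum>i\<in>E. y i * s i) = 0" and y1: "(\<Sum>i\<in>E. y i * cf (hid T) i) \<noteq> 0" by blast
  define e where "e b a = mat (rdim T a) (rdim M b) (\<lambda>(j,i). y (b,a,i,j))" for b a
  have ye: "(\<Sum>i\<in>E. y i * cf h i) = pairing n p M N h e" if h: "is_hom n p T T h" for h
  proof -
    have "(\<Sum>i\<in>E. y i * cf h i) = (\<Sum>(b,a,i,j)\<in>E. (rmap N a b * h a) $$ (i,j) * e b a $$ (j,i))"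
      by (rule sum.cong) (auto simp: cf_def e_def E_def edge_entries_iff simp del: index_mult_mat)
    also have "\<dots> = pairing n p M N h e"
      unfolding E_def pairing_def
      by (rule sum_edge_entries[OF rM, of "\<lambda>a b. rmap N a b * h a"]) (use Ecar homD(3)[OF h] mult_carrier_mat in blast)
    finally show ?thesis .
  qed
  show ?thesis
  proof (intro exI[of _ e] conjI allI impI)
    show "cochain n p M T e" by (simp add: cochain_def e_def)
    show "pairing n p M N h e = 0" if "is_hom n p T T h" "\<not> automorphism n p T h" for h
      using y0[of "cf h"] ye[OF that(1)] that by (simp add: S_def NA_def)
    show "pairing n p M N (hid T) e \<noteq> 0" using y1 ye[OF hom_id[OF rT]] by simp
  qed
qed

lemma mat_biproduct:
  "\<exists>i1 i2 p1 p2. i1 \<in> carrier_mat (t + m) t \<and> i2 \<in> carrier_mat (t + m) m \<and> p1 \<in> carrier_mat t (t + m) \<and> p2 \<in> carrier_mat m (t + m) \<and>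
    p1 * i1 = 1\<^sub>m t \<and> p2 * i2 = (1\<^sub>m m :: 'k::comm_ring_1 mat) \<and> p1 * i2 = 0\<^sub>m t m \<and> p2 * i1 = 0\<^sub>m m t"
proof -
  define i1 i2 p1 p2 :: "'k mat" where "i1 = mat (t + m) t (\<lambda>(i,j). if i = j then 1 else 0)"
    and "i2 = mat (t + m) m (\<lambda>(i,j). if i = t + j then 1 else 0)"
    and "p1 = mat t (t + m) (\<lambda>(i,j). if j = i then 1 else 0)"
    and "p2 = mat m (t + m) (\<lambda>(i,j). if j = t + i then 1 else 0)"
  note defs = i1_def i2_def p1_def p2_def
  have c: "i1 \<in> carrier_mat (t + m) t" "i2 \<in> carrier_mat (t + m) m" "p1 \<in> carrier_mat t (t + m)" "p2 \<in> carrier_mat m (t + m)"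
    by (auto simp: defs)
  have "p1 * i1 = 1\<^sub>m t" "p2 * i2 = 1\<^sub>m m" "p1 * i2 = 0\<^sub>m t m" "p2 * i1 = 0\<^sub>m m t"
    by (rule eq_matI; simp add: defs scalar_prod_def atLeast0LessThan mult_indicator)+
  then show ?thesis using c by blast
qed

text \<open>Block-triangular structure maps with \<open>e\<close> in the corner. \<open>i1\<close>
  and \<open>p2\<close> are homomorphisms, and \<open>e\<close> is exactly the defect of
  \<open>i2\<close> and \<open>p1\<close>.\<close>

lemma extension_rep:
  fixes T M :: "'k::field qrep"
  assumes T: "is_rep n p T" and M: "is_rep n p M" and e: "cochain n p M T e"
  shows "\<exists>E i1 i2 p1 p2. is_hom n p T E i1 \<and> is_hom n p E M p2 \<and>
    (\<forall>x. i2 x \<in> carrier_mat (rdim E x) (rdim M x)) \<and> (\<forall>x. p1 x \<in> carrier_mat (rdim T x) (rdim E x)) \<and>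
    (\<forall>x. p1 x * i1 x = 1\<^sub>m (rdim T x)) \<and> (\<forall>x. p2 x * i2 x = 1\<^sub>m (rdim M x)) \<and>
    (\<forall>x. p1 x * i2 x = 0\<^sub>m (rdim T x) (rdim M x)) \<and> (\<forall>x. p2 x * i1 x = 0\<^sub>m (rdim M x) (rdim T x)) \<and>
    (\<forall>b a. arrow n p b a \<longrightarrow> rmap E b a * i2 b = i2 a * rmap M b a + i1 a * e b a) \<and>
    (\<forall>b a. arrow n p b a \<longrightarrow> p1 a * rmap E b a = rmap T b a * p1 b + e b a * p2 b)"
proof -
  have "\<forall>x. \<exists>i1 i2 p1 p2. i1 \<in> carrier_mat (rdim T x + rdim M x) (rdim T x) \<and> i2 \<in> carrier_mat (rdim T x + rdim M x) (rdim M x) \<and>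
    p1 \<in> carrier_mat (rdim T x) (rdim T x + rdim M x) \<and> p2 \<in> carrier_mat (rdim M x) (rdim T x + rdim M x) \<and>
    p1 * i1 = 1\<^sub>m (rdim T x) \<and> p2 * i2 = (1\<^sub>m (rdim M x) :: 'k mat) \<and> p1 * i2 = 0\<^sub>m (rdim T x) (rdim M x) \<and> p2 * i1 = 0\<^sub>m (rdim M x) (rdim T x)"
    by (intro allI mat_biproduct)
  then obtain i1 i2 p1 p2 where c: "\<And>x. i1 x \<in> carrier_mat (rdim T x + rdim M x) (rdim T x)" "\<And>x. i2 x \<in> carrier_mat (rdim T x + rdim M x) (rdim M x)"
    "\<And>x. p1 x \<in> carrier_mat (rdim T x) (rdim T x + rdim M x)" "\<And>x. p2 x \<in> carrier_mat (rdim M x) (rdim T x + rdim M x)"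
    and b: "\<And>x. p1 x * i1 x = 1\<^sub>m (rdim T x)" "\<And>x. p2 x * i2 x = (1\<^sub>m (rdim M x) :: 'k mat)"
      "\<And>x. p1 x * i2 x = 0\<^sub>m (rdim T x) (rdim M x)" "\<And>x. p2 x * i1 x = 0\<^sub>m (rdim M x) (rdim T x)" by metis
  define E where "E = \<lparr>rdim = \<lambda>x. rdim T x + rdim M x,
    rmap = \<lambda>b a. i1 a * (rmap T b a * p1 b) + i1 a * (e b a * p2 b) + i2 a * (rmap M b a * p2 b)\<rparr>"
  have E: "rdim E x = rdim T x + rdim M x" "rmap E b a = i1 a * (rmap T b a * p1 b) + i1 a * (e b a * p2 b) + i2 a * (rmap M b a * p2 b)" for x b a
    by (simp_all add: E_def)
  have d: "dim_row (i1 x) = rdim T x + rdim M x" "dim_col (i1 x) = rdim T x" "dim_row (i2 x) = rdim T x + rdim M x" "dim_col (i2 x) = rdim M x"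
    "dim_row (p1 x) = rdim T x" "dim_col (p1 x) = rdim T x + rdim M x" "dim_row (p2 x) = rdim M x" "dim_col (p2 x) = rdim T x + rdim M x" for x
    using c by blast+
  have de: "dim_row (e b a) = rdim T a" "dim_col (e b a) = rdim M b" if "arrow n p b a" for b a
    using e that unfolding cochain_def by blast+
  have sub: "{x. rdim E x \<noteq> 0} \<subseteq> supp T \<union> supp M" by (auto simp: E supp_def)
  have rE: "is_rep n p E"
    unfolding is_rep_def
  proof (intro conjI allI impI)
    show "rdim E x = 0" if "\<not> tvert n x" for x using that T M by (simp add: E is_rep_def)
    show "finite {x. rdim E x \<noteq> 0}" by (rule finite_subset[OF sub]) (use supp_finite[OF T] supp_finite[OF M] in simp)
    show "rmap E x y \<in> carrier_mat (rdim E y) (rdim E x)" for x y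
      by (rule carrier_matI) (simp_all add: E d)
  qed
  have abs: "p1 y * (i1 y * Z) = Z" "p2 y * (i1 y * Z) = 0\<^sub>m (rdim M y) (dim_col Z)" if "dim_row Z = rdim T y" for y Z
    using that d by (simp_all add: mat_assoc[symmetric] b)
  have abs': "p2 y * (i2 y * Z) = Z" "p1 y * (i2 y * Z) = 0\<^sub>m (rdim T y) (dim_col Z)" if "dim_row Z = rdim M y" for y Z
    using that d by (simp_all add: mat_assoc[symmetric] b)
  have h1: "is_hom n p T E i1"
  proof (rule homI[OF T rE])
    fix x y assume a: "arrow n p x y"
    note d' = d de[OF a] rep_dims[OF T a] rep_dims[OF M a]
    have "rmap E x y * i1 x = i1 y * (rmap T x y * (p1 x * i1 x)) + i1 y * (e x y * (p2 x * i1 x)) + i2 y * (rmap M x y * (p2 x * i1 x))"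
      by (simp add: E mat_distrib mat_assoc d')
    also have "\<dots> = i1 y * rmap T x y" unfolding b by (rule eq_matI) (simp_all add: d' del: index_mult_mat(1))
    finally show "i1 y * rmap T x y = rmap E x y * i1 x" by simp
  qed (use c E in simp)
  have h2: "is_hom n p E M p2"
  proof (rule homI[OF rE M])
    fix x y assume a: "arrow n p x y"
    note d' = d de[OF a] rep_dims[OF T a] rep_dims[OF M a]
    have "p2 y * rmap E x y = p2 y * (i1 y * (rmap T x y * p1 x)) + p2 y * (i1 y * (e x y * p2 x)) + p2 y * (i2 y * (rmap M x y * p2 x))"
      by (simp add: E mat_distrib d')
    also have "\<dots> = rmap M x y * p2 x" by (rule eq_matI) (simp_all add: abs abs' d' del: index_mult_mat(1))
    finally show "p2 y * rmap E x y = rmap M x y * p2 x" .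
  qed (use c E in simp)
  have r2: "rmap E x y * i2 x = i2 y * rmap M x y + i1 y * e x y" if a: "arrow n p x y" for x y
  proof -
    note d' = d de[OF a] rep_dims[OF T a] rep_dims[OF M a]
    have "rmap E x y * i2 x = i1 y * (rmap T x y * (p1 x * i2 x)) + i1 y * (e x y * (p2 x * i2 x)) + i2 y * (rmap M x y * (p2 x * i2 x))"
      by (simp add: E mat_distrib mat_assoc d')
    also have "\<dots> = i2 y * rmap M x y + i1 y * e x y" unfolding b by (rule eq_matI) (simp_all add: d' del: index_mult_mat(1))
    finally show ?thesis .
  qed
  have r1: "p1 y * rmap E x y = rmap T x y * p1 x + e x y * p2 x" if a: "arrow n p x y" for x y
  proof -
    note d' = d de[OF a] rep_dims[OF T a] rep_dims[OF M a]
    have "p1 y * rmap E x y = p1 y * (i1 y * (rmap T x y * p1 x)) + p1 y * (i1 y * (e x y * p2 x)) + p1 y * (i2 y * (rmap M x y * p2 x))"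
      by (simp add: E mat_distrib d')
    also have "\<dots> = rmap T x y * p1 x + e x y * p2 x" by (rule eq_matI) (simp_all add: abs abs' d' del: index_mult_mat(1))
    finally show ?thesis .
  qed
  show ?thesis
    by (intro exI[of _ E] exI[of _ i1] exI[of _ i2] exI[of _ p1] exI[of _ p2]) (use h1 h2 c b r1 r2 E in simp)
qed

lemma coboundaryI:
  fixes M V :: "'k::field qrep"
  assumes "\<And>x. c x \<in> carrier_mat (rdim V x) (rdim M x)" "\<And>b a. arrow n p b a \<Longrightarrow> u b a = c a * rmap M b a - rmap V b a * c b"
  shows "coboundary n p M V u"
  using assms unfolding coboundary_def by blast

lemma coboundaryI':
  fixes M V :: "'k::field qrep"
  assumes M: "is_rep n p M" and V: "is_rep n p V" and c: "\<And>x. c x \<in> carrier_mat (rdim V x) (rdim M x)"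
    and e: "\<And>b a. arrow n p b a \<Longrightarrow> u b a = rmap V b a * c b - c a * rmap M b a"
  shows "coboundary n p M V u"
proof (rule coboundaryI[where c = "\<lambda>x. - c x"])
  show "- c x \<in> carrier_mat (rdim V x) (rdim M x)" for x using c[of x] by simp
  fix b a assume a: "arrow n p b a"
  have d: "dim_row (c x) = rdim V x" "dim_col (c x) = rdim M x" for x using c by blast+
  show "u b a = - c a * rmap M b a - rmap V b a * - c b"
    unfolding e[OF a] by (rule eq_matI) (simp_all add: d rep_dims[OF M a] rep_dims[OF V a] del: index_mult_mat(1))
qed

lemma coboundaryE:
  assumes "coboundary n p M V u"
  obtains c where "\<And>x. c x \<in> carrier_mat (rdim V x) (rdim M x)" "\<And>x. dim_row (c x) = rdim V x" "\<And>x. dim_col (c x) = rdim M x"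
    "\<And>b a. arrow n p b a \<Longrightarrow> u b a = c a * rmap M b a - rmap V b a * c b"
  using assms unfolding coboundary_def by (metis carrier_matD)

text \<open>If an irreducible map \<open>M \<rightarrow> M'\<close> exists, it is a component of the almost split sequence
  \<open>0 \<rightarrow> T \<rightarrow> E \<rightarrow> M' \<rightarrow> 0\<close>, so the component \<open>T \<rightarrow> M\<close> of the other map is irreducible as well.\<close>

lemma irreducible_from_almost_split:
  fixes T M M' :: "'k::field qrep"
  assumes T: "indecomposable n p T" and M: "indecomposable n p M" and M': "indecomposable n p M'"
    and e: "cochain n p M' T e" and ne: "\<not> coboundary n p M' T e"
    and as: "\<And>V v. is_hom n p T V v \<Longrightarrow> \<not> split_mono n p T V v \<Longrightarrow> coboundary n p M' V (\<lambda>b a. v a * e b a)"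
    and f: "irreducible_map n p M M' f"
  shows "\<exists>j. irreducible_map n p T M j"
proof -
  note If = irreducibleD[OF f]
  note rT = indecomposable_rep[OF T] and rM = indecomposable_rep[OF M] and rM' = indecomposable_rep[OF M']
  note df = homD(4,5)[OF If(1)]
  have de: "dim_row (e b a) = rdim T a" "dim_col (e b a) = rdim M' b" if "arrow n p b a" for b a
    using e that unfolding cochain_def by blast+
  have ef: "cochain n p M T (\<lambda>b a. e b a * f b)"
    unfolding cochain_def using de df by (auto intro!: carrier_matI)
  \<comment> \<open>The class of \<open>e\<close> vanishes when pulled back along \<open>f\<close>.
    If the pulled-back extension \<open>W\<close> did not split, the almost split property would
    make \<open>i1 * e\<close> a coboundary; its family \<open>c\<close> yields a map from
    \<open>M'\<close> to \<open>M\<close> and in the end a splitting of \<open>e\<close>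
    itself.\<close>
  have "coboundary n p M T (\<lambda>b a. e b a * f b)"
  proof -
    obtain W i1 i2 p1 p2 where i1: "is_hom n p T W i1" and p2: "is_hom n p W M p2"
      and i2: "\<And>x. i2 x \<in> carrier_mat (rdim W x) (rdim M x)" and p1: "\<And>x. p1 x \<in> carrier_mat (rdim T x) (rdim W x)"
      and bi: "\<And>x. p1 x * i1 x = 1\<^sub>m (rdim T x)" "\<And>x. p2 x * i2 x = 1\<^sub>m (rdim M x)"
        "\<And>x. p1 x * i2 x = 0\<^sub>m (rdim T x) (rdim M x)" "\<And>x. p2 x * i1 x = 0\<^sub>m (rdim M x) (rdim T x)"
      and Wi2: "\<And>b a. arrow n p b a \<Longrightarrow> rmap W b a * i2 b = i2 a * rmap M b a + i1 a * (e b a * f b)"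
      and p1W: "\<And>b a. arrow n p b a \<Longrightarrow> p1 a * rmap W b a = rmap T b a * p1 b + e b a * f b * p2 b"
      using extension_rep[OF rT rM ef] by metis
    note dd = homD(4,5)[OF i1] homD(4,5)[OF p2]
    have d2: "dim_row (i2 x) = rdim W x" "dim_col (i2 x) = rdim M x" "dim_row (p1 x) = rdim T x" "dim_col (p1 x) = rdim W x" for x
      using i2 p1 by blast+
    have rW: "is_rep n p W" using homD(2)[OF i1] .
    have "split_mono n p T W i1"
    proof (rule ccontr)
      assume "\<not> split_mono n p T W i1"
      from as[OF i1 this] obtain c where "\<And>x. c x \<in> carrier_mat (rdim W x) (rdim M' x)"
        and dc: "\<And>x. dim_row (c x) = rdim W x" "\<And>x. dim_col (c x) = rdim M' x"
        and c: "\<And>b a. arrow n p b a \<Longrightarrow> i1 a * e b a = c a * rmap M' b a - rmap W b a * c b"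
        by (rule coboundaryE) (rule that)
      \<comment> \<open>The sign is chosen so that \<open>e * (1 - f * c2)\<close> is a coboundary.
        As \<open>f\<close> is not a split epimorphism, \<open>f * c2\<close> is not an
        automorphism, so \<open>1 - f * c2\<close> can be inverted.\<close>
      define c2 where "c2 x = (-1) \<cdot>\<^sub>m (p2 x * c x)" for x
      have "is_hom n p M' M (\<lambda>x. p2 x * c x)"
      proof (rule homI[OF rM' rM])
        show "p2 x * c x \<in> carrier_mat (rdim M x) (rdim M' x)" for x by (rule carrier_matI) (simp_all add: dd dc)
        fix b a assume ar: "arrow n p b a"
        note d = dd d2 dc de[OF ar] rep_dims[OF rM ar] rep_dims[OF rM' ar] rep_dims[OF rW ar]
        have "p2 a * (i1 a * e b a) = p2 a * (c a * rmap M' b a) - (p2 a * rmap W b a) * c b"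
          unfolding c[OF ar] by (simp add: mat_distrib mat_assoc d)
        also have "(p2 a * rmap W b a) * c b = rmap M b a * (p2 b * c b)" by (simp add: homD(6)[OF p2 ar] mat_assoc d)
        finally have eq: "p2 a * (i1 a * e b a) = p2 a * (c a * rmap M' b a) - rmap M b a * (p2 b * c b)" .
        have z: "p2 a * (i1 a * e b a) = 0\<^sub>m (rdim M a) (rdim M' b)" by (simp add: mat_assoc[symmetric] d bi)
        show "p2 a * c a * rmap M' b a = rmap M b a * (p2 b * c b)"
        proof (rule eq_matI)
          fix i j assume "i < dim_row (rmap M b a * (p2 b * c b))" "j < dim_col (rmap M b a * (p2 b * c b))"
          then have ij: "i < rdim M a" "j < rdim M' b" by (simp_all add: d)
          have "(p2 a * (c a * rmap M' b a) - rmap M b a * (p2 b * c b)) $$ (i,j) = 0"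
            unfolding eq[symmetric] z using ij by simp
          then show "(p2 a * c a * rmap M' b a) $$ (i,j) = (rmap M b a * (p2 b * c b)) $$ (i,j)"
            using ij by (simp add: mat_assoc d del: index_mult_mat(1))
        qed (simp_all add: d)
      qed
      then have c2: "is_hom n p M' M c2" unfolding c2_def[abs_def] by (rule hom_smult)
      note dc2 = homD(4,5)[OF c2]
      have fc: "is_hom n p M' M' (hcomp f c2)" by (rule hom_comp[OF c2 If(1)])
      have "\<not> automorphism n p M' (hcomp f c2)"
      proof
        assume "automorphism n p M' (hcomp f c2)"
        then obtain r where r: "is_hom n p M' M' r" "hcomp (hcomp f c2) r = hid M'" unfolding automorphism_def by blast
        then have "hcomp f (hcomp c2 r) = hid M'" using hcomp_assoc[OF r(1) c2 If(1)] by simp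
        then show False using If(1,3) hom_comp[OF r(1) c2] unfolding split_epi_def by blast
      qed
      from one_minus_automorphism[OF M' fc this] obtain r where r: "is_hom n p M' M' r"
        and r1: "hcomp (\<lambda>x. 1\<^sub>m (rdim M' x) - hcomp f c2 x) r = hid M'" unfolding automorphism_def by blast
      note dr = homD(4,5)[OF r]
      have r1': "(1\<^sub>m (rdim M' x) - f x * c2 x) * r x = 1\<^sub>m (rdim M' x)" for x
        using fun_cong[OF r1, of x] by (simp add: hcomp_def hid_def)
      have "coboundary n p M' T e"
      proof (rule coboundaryI[where c = "\<lambda>x. p1 x * (c x * r x)"])
        show "p1 x * (c x * r x) \<in> carrier_mat (rdim T x) (rdim M' x)" for x by (rule carrier_matI) (simp_all add: d2 dr)
        fix b a assume ar: "arrow n p b a"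
        note d = dd d2 dc dc2 dr df de[OF ar] rep_dims[OF rM ar] rep_dims[OF rM' ar] rep_dims[OF rW ar] rep_dims[OF rT ar]
        have "p1 a * (i1 a * e b a) = p1 a * (c a * rmap M' b a) - (p1 a * rmap W b a) * c b"
          unfolding c[OF ar] by (simp add: mat_distrib mat_assoc d)
        also have "p1 a * (i1 a * e b a) = e b a" by (simp add: mat_assoc[symmetric] d bi)
        also have "(p1 a * rmap W b a) * c b = rmap T b a * (p1 b * c b) + e b a * (f b * (p2 b * c b))"
          unfolding p1W[OF ar] by (simp add: mat_distrib mat_assoc d)
        also have "e b a * (f b * (p2 b * c b)) = - (e b a * (f b * c2 b))"
        proof -
          have "p2 b * c b = - c2 b" by (rule eq_matI) (simp_all add: c2_def d)
          then show ?thesis using d by simp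
        qed
        finally have eq: "e b a = p1 a * (c a * rmap M' b a) - (rmap T b a * (p1 b * c b) + - (e b a * (f b * c2 b)))" .
        have eq2: "e b a - e b a * (f b * c2 b) = p1 a * (c a * rmap M' b a) - rmap T b a * (p1 b * c b)"
        proof (rule eq_matI)
          fix i j assume "i < dim_row (p1 a * (c a * rmap M' b a) - rmap T b a * (p1 b * c b))" "j < dim_col (p1 a * (c a * rmap M' b a) - rmap T b a * (p1 b * c b))"
          then have ij: "i < rdim T a" "j < rdim M' b" by (simp_all add: d)
          have "e b a $$ (i,j) = (p1 a * (c a * rmap M' b a) - (rmap T b a * (p1 b * c b) + - (e b a * (f b * c2 b)))) $$ (i,j)"
            using eq by (rule arg_cong)
          then show "(e b a - e b a * (f b * c2 b)) $$ (i,j) = (p1 a * (c a * rmap M' b a) - rmap T b a * (p1 b * c b)) $$ (i,j)"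
            using ij by (simp add: d del: index_mult_mat(1))
        qed (simp_all add: d)
        have "e b a = e b a * ((1\<^sub>m (rdim M' b) - f b * c2 b) * r b)" by (simp add: r1' d)
        also have "\<dots> = (e b a - e b a * (f b * c2 b)) * r b" by (simp add: mat_distrib mat_assoc d)
        also have "\<dots> = p1 a * (c a * (rmap M' b a * r b)) - rmap T b a * (p1 b * (c b * r b))"
          unfolding eq2 by (simp add: mat_distrib mat_assoc d)
        finally show "e b a = p1 a * (c a * r a) * rmap M' b a - rmap T b a * (p1 b * (c b * r b))"
          by (simp add: mat_assoc d homD(6)[OF r ar])
      qed
      then show False using ne by blast
    qed
    then obtain r where r: "is_hom n p W T r" "hcomp r i1 = hid T" unfolding split_mono_def by blast
    have r1: "r x * i1 x = 1\<^sub>m (rdim T x)" for x using fun_cong[OF r(2), of x] by (simp add: hcomp_def hid_def)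
    note dr = homD(4,5)[OF r(1)]
    show ?thesis
    proof (rule coboundaryI'[OF rM rT, where c = "\<lambda>x. r x * i2 x"])
      show "r x * i2 x \<in> carrier_mat (rdim T x) (rdim M x)" for x by (rule carrier_matI) (simp_all add: dr d2)
      fix b a assume ar: "arrow n p b a"
      note d = dd d2 dr df de[OF ar] rep_dims[OF rM ar] rep_dims[OF rM' ar] rep_dims[OF rW ar] rep_dims[OF rT ar]
      have "rmap T b a * (r b * i2 b) = (r a * rmap W b a) * i2 b" by (simp add: homD(6)[OF r(1) ar] mat_assoc d)
      also have "\<dots> = r a * (rmap W b a * i2 b)" by (simp add: mat_assoc d)
      also have "\<dots> = r a * (i2 a * rmap M b a) + (r a * i1 a) * (e b a * f b)"
        unfolding Wi2[OF ar] by (simp add: mat_distrib mat_assoc d)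
      also have "\<dots> = r a * i2 a * rmap M b a + e b a * f b" by (simp add: r1 d mat_assoc)
      finally have eq: "rmap T b a * (r b * i2 b) = r a * i2 a * rmap M b a + e b a * f b" .
      show "e b a * f b = rmap T b a * (r b * i2 b) - r a * i2 a * rmap M b a"
        unfolding eq by (rule eq_matI) (simp_all add: d del: index_mult_mat(1))
    qed
  qed
  then obtain c where "\<And>x. c x \<in> carrier_mat (rdim T x) (rdim M x)"
    and dc: "\<And>x. dim_row (c x) = rdim T x" "\<And>x. dim_col (c x) = rdim M x"
    and c: "\<And>b a. arrow n p b a \<Longrightarrow> e b a * f b = c a * rmap M b a - rmap T b a * c b"
    by (rule coboundaryE) (rule that)
  have cM: "c a * rmap M b a = rmap T b a * c b + e b a * f b" if ar: "arrow n p b a" for b a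
    unfolding c[OF ar] by (rule eq_matI) (simp_all add: dc rep_dims[OF rM ar] rep_dims[OF rT ar] del: index_mult_mat(1))
  obtain E i1 i2 p1 p2 where i1: "is_hom n p T E i1" and p2: "is_hom n p E M' p2"
    and i2: "\<And>x. i2 x \<in> carrier_mat (rdim E x) (rdim M' x)" and p1: "\<And>x. p1 x \<in> carrier_mat (rdim T x) (rdim E x)"
    and bi: "\<And>x. p1 x * i1 x = 1\<^sub>m (rdim T x)" "\<And>x. p2 x * i2 x = 1\<^sub>m (rdim M' x)"
      "\<And>x. p1 x * i2 x = 0\<^sub>m (rdim T x) (rdim M' x)" "\<And>x. p2 x * i1 x = 0\<^sub>m (rdim M' x) (rdim T x)"
    and Ei2: "\<And>b a. arrow n p b a \<Longrightarrow> rmap E b a * i2 b = i2 a * rmap M' b a + i1 a * e b a"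
    and p1E: "\<And>b a. arrow n p b a \<Longrightarrow> p1 a * rmap E b a = rmap T b a * p1 b + e b a * p2 b"
    using extension_rep[OF rT rM' e] by metis
  note dd = homD(4,5)[OF i1] homD(4,5)[OF p2]
  have d2: "dim_row (i2 x) = rdim E x" "dim_col (i2 x) = rdim M' x" "dim_row (p1 x) = rdim T x" "dim_col (p1 x) = rdim E x" for x
    using i2 p1 by blast+
  have rE: "is_rep n p E" using homD(2)[OF i1] .
  have i1_not_split: "hcomp q i1 \<noteq> hid T" if q: "is_hom n p E T q" for q
  proof
    assume "hcomp q i1 = hid T"
    then have q1: "q x * i1 x = 1\<^sub>m (rdim T x)" for x by (metis hcomp_def hid_def)
    note dq = homD(4,5)[OF q]
    have "coboundary n p M' T e"
    proof (rule coboundaryI'[OF rM' rT, where c = "\<lambda>x. q x * i2 x"])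
      show "q x * i2 x \<in> carrier_mat (rdim T x) (rdim M' x)" for x by (rule carrier_matI) (simp_all add: dq d2)
      fix b a assume ar: "arrow n p b a"
      note d = dd d2 dq de[OF ar] rep_dims[OF rM' ar] rep_dims[OF rE ar] rep_dims[OF rT ar]
      have "rmap T b a * (q b * i2 b) = (q a * rmap E b a) * i2 b" by (simp add: homD(6)[OF q ar] mat_assoc d)
      also have "\<dots> = q a * (rmap E b a * i2 b)" by (simp add: mat_assoc d)
      also have "\<dots> = q a * (i2 a * rmap M' b a) + (q a * i1 a) * e b a"
        unfolding Ei2[OF ar] by (simp add: mat_distrib mat_assoc d)
      also have "\<dots> = q a * i2 a * rmap M' b a + e b a" by (simp add: q1 d mat_assoc)
      finally have eq: "rmap T b a * (q b * i2 b) = q a * i2 a * rmap M' b a + e b a" .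
      show "e b a = rmap T b a * (q b * i2 b) - q a * i2 a * rmap M' b a"
        unfolding eq by (rule eq_matI) (simp_all add: d del: index_mult_mat(1))
    qed
    then show False using ne by blast
  qed
  \<comment> \<open>The family \<open>c\<close> lifts \<open>f\<close> to the middle term:
    \<open>p2 * s = f\<close>. As the sequence does not split, irreducibility makes \<open>s\<close>
    a split monomorphism; its retraction \<open>r\<close> restricted to \<open>T\<close> is the
    wanted map \<open>j\<close>.\<close>
  define s where "s x = i1 x * c x + i2 x * f x" for x
  have s: "is_hom n p M E s"
  proof (rule homI[OF rM rE])
    show "s x \<in> carrier_mat (rdim E x) (rdim M x)" for x unfolding s_def by (rule carrier_matI) (simp_all add: d2 df)
    fix b a assume ar: "arrow n p b a"
    note d = dd d2 dc df de[OF ar] rep_dims[OF rM ar] rep_dims[OF rM' ar] rep_dims[OF rE ar] rep_dims[OF rT ar]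
    have "s a * rmap M b a = i1 a * (c a * rmap M b a) + i2 a * (f a * rmap M b a)"
      by (simp add: s_def mat_distrib mat_assoc d)
    also have "\<dots> = i1 a * (rmap T b a * c b) + i1 a * (e b a * f b) + i2 a * (rmap M' b a * f b)"
      unfolding cM[OF ar] homD(6)[OF If(1) ar] by (simp add: mat_distrib d)
    finally have 1: "s a * rmap M b a = i1 a * (rmap T b a * c b) + i1 a * (e b a * f b) + i2 a * (rmap M' b a * f b)" .
    have "rmap E b a * s b = (rmap E b a * i1 b) * c b + (rmap E b a * i2 b) * f b"
      by (simp add: s_def mat_distrib mat_assoc d)
    also have "\<dots> = (i1 a * rmap T b a) * c b + (i2 a * rmap M' b a + i1 a * e b a) * f b"
      by (simp only: homD(6)[OF i1 ar] Ei2[OF ar])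
    also have "\<dots> = i1 a * (rmap T b a * c b) + (i2 a * (rmap M' b a * f b) + i1 a * (e b a * f b))"
      by (simp add: mat_distrib mat_assoc d)
    finally have 2: "rmap E b a * s b = i1 a * (rmap T b a * c b) + (i2 a * (rmap M' b a * f b) + i1 a * (e b a * f b))" .
    show "s a * rmap M b a = rmap E b a * s b"
      unfolding 1 2 by (rule eq_matI) (simp_all add: d del: index_mult_mat(1))
  qed
  have "hcomp p2 s = f"
  proof (rule ext)
    fix x
    note d = dd d2 dc df
    have "p2 x * s x = (p2 x * i1 x) * c x + (p2 x * i2 x) * f x" by (simp add: s_def mat_distrib mat_assoc d)
    also have "\<dots> = f x" unfolding bi by (rule eq_matI) (simp_all add: d)
    finally show "hcomp p2 s x = f x" by (simp add: hcomp_def)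
  qed
  from If(4)[OF s p2 this] have "split_mono n p M E s"
  proof
    assume "split_epi n p E M' p2"
    then obtain q where q: "is_hom n p M' E q" "hcomp p2 q = hid M'" unfolding split_epi_def by blast
    have q1: "p2 x * q x = 1\<^sub>m (rdim M' x)" for x using fun_cong[OF q(2), of x] by (simp add: hcomp_def hid_def)
    note dq = homD(4,5)[OF q(1)]
    have "coboundary n p M' T e"
    proof (rule coboundaryI[where c = "\<lambda>x. p1 x * q x"])
      show "p1 x * q x \<in> carrier_mat (rdim T x) (rdim M' x)" for x by (rule carrier_matI) (simp_all add: dq d2)
      fix b a assume ar: "arrow n p b a"
      note d = dd d2 dq de[OF ar] rep_dims[OF rM' ar] rep_dims[OF rE ar] rep_dims[OF rT ar]
      have "p1 a * q a * rmap M' b a = (p1 a * rmap E b a) * q b" by (simp add: homD(6)[OF q(1) ar] mat_assoc d)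
      also have "\<dots> = rmap T b a * (p1 b * q b) + e b a" unfolding p1E[OF ar] by (simp add: mat_distrib mat_assoc d q1)
      finally have eq: "p1 a * q a * rmap M' b a = rmap T b a * (p1 b * q b) + e b a" .
      show "e b a = p1 a * q a * rmap M' b a - rmap T b a * (p1 b * q b)"
        unfolding eq by (rule eq_matI) (simp_all add: d del: index_mult_mat(1))
    qed
    then show ?thesis using ne by blast
  qed
  then obtain r where r: "is_hom n p E M r" and rs: "hcomp r s = hid M" unfolding split_mono_def by blast
  note dr = homD(4,5)[OF r]
  define j where "j = hcomp r i1"
  have j: "is_hom n p T M j" unfolding j_def by (rule hom_comp[OF i1 r])
  define r2 where "r2 x = r x * i2 x" for x
  have dj: "dim_row (r2 x) = rdim M x" "dim_col (r2 x) = rdim M' x" for x by (simp_all add: r2_def dr d2)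
  have jr: "j x * c x + r2 x * f x = 1\<^sub>m (rdim M x)" for x
  proof -
    note d = dd d2 dc df dr
    have "r x * s x = j x * c x + r2 x * f x" by (simp add: s_def j_def r2_def hcomp_def mat_distrib mat_assoc d)
    then show ?thesis using fun_cong[OF rs, of x] by (simp add: hcomp_def hid_def)
  qed
  have Mr2: "rmap M b a * r2 b = r2 a * rmap M' b a + j a * e b a" if ar: "arrow n p b a" for b a
  proof -
    note d = dd d2 dr de[OF ar] rep_dims[OF rM ar] rep_dims[OF rM' ar] rep_dims[OF rE ar] rep_dims[OF rT ar]
    have "rmap M b a * r2 b = (r a * rmap E b a) * i2 b" by (simp add: r2_def homD(6)[OF r ar] mat_assoc d)
    also have "\<dots> = r a * (rmap E b a * i2 b)" by (simp add: mat_assoc d)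
    also have "\<dots> = r2 a * rmap M' b a + j a * e b a"
      unfolding Ei2[OF ar] by (simp add: mat_distrib mat_assoc d r2_def j_def hcomp_def)
    finally show ?thesis .
  qed
  have not_sm: "\<not> split_mono n p T M j"
  proof
    assume "split_mono n p T M j"
    then obtain q where q: "is_hom n p M T q" "hcomp q j = hid T" unfolding split_mono_def by blast
    then have "hcomp (hcomp q r) i1 = hid T" using hcomp_assoc[OF i1 r q(1)] by (simp add: j_def)
    then show False using i1_not_split[OF hom_comp[OF r q(1)]] by blast
  qed
  \<comment> \<open>A section \<open>q\<close> of \<open>j\<close> makes \<open>q * j\<close> an
    idempotent of \<open>T\<close>. It is not zero because \<open>M\<close> is nonzero, and if it is
    the identity then \<open>j\<close> is a split monomorphism.\<close>
  have not_se: "\<not> split_epi n p T M j"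
  proof
    assume "split_epi n p T M j"
    then obtain q where q: "is_hom n p M T q" "hcomp j q = hid M" unfolding split_epi_def by blast
    have jq: "j x * q x = 1\<^sub>m (rdim M x)" for x using fun_cong[OF q(2), of x] by (simp add: hcomp_def hid_def)
    note d = homD(4,5)[OF j] homD(4,5)[OF q(1)]
    note qj = hom_comp[OF j q(1)]
    have "hcomp (hcomp q j) (hcomp q j) = hcomp q j"
    proof (rule ext)
      fix x
      have "(q x * j x) * (q x * j x) = q x * ((j x * q x) * j x)" by (simp add: mat_assoc d)
      then show "hcomp (hcomp q j) (hcomp q j) x = hcomp q j x" by (simp add: hcomp_def jq d)
    qed
    then consider "hcomp q j = hzero T T" | "hcomp q j = hid T" using indecomposable_idempotent[OF T qj] by blast
    then show False
    proof cases
      case 1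
      obtain x where x: "rdim M x \<noteq> 0" using M by (auto simp: indecomposable_def is_zero_rep_def)
      have "q x * j x = 0\<^sub>m (rdim T x) (rdim T x)" using fun_cong[OF 1, of x] by (simp add: hcomp_def hzero_def)
      moreover have "(j x * q x) * (j x * q x) = j x * (q x * j x) * q x" by (simp add: mat_assoc d)
      ultimately have "(1\<^sub>m (rdim M x) :: 'k mat) = 0\<^sub>m (rdim M x) (rdim M x)" by (simp add: jq d)
      then show False using one_mat_ne_zero[OF x, where 'k = 'k] by simp
    next
      case 2
      then show False using not_sm j q(1) unfolding split_mono_def by blast
    qed
  qed
  have "split_mono n p T X g \<or> split_epi n p X M h"
    if g: "is_hom n p T X g" and h: "is_hom n p X M h" and hg: "hcomp h g = j" for X g h
  proof (unfold disj_imp, rule impI)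
    assume "\<not> split_mono n p T X g"
    from as[OF g this] obtain c' where "\<And>x. c' x \<in> carrier_mat (rdim X x) (rdim M' x)"
      and dc': "\<And>x. dim_row (c' x) = rdim X x" "\<And>x. dim_col (c' x) = rdim M' x"
      and c': "\<And>b a. arrow n p b a \<Longrightarrow> g a * e b a = c' a * rmap M' b a - rmap X b a * c' b"
      by (rule coboundaryE) (rule that)
    note rX = homD(2)[OF g]
    have hgx: "h x * g x = j x" for x using fun_cong[OF hg, of x] by (simp add: hcomp_def)
    note d0 = homD(4,5)[OF g] homD(4,5)[OF h] homD(4,5)[OF j] dc dc' df dj
    have c'M: "c' a * rmap M' b a = g a * e b a + rmap X b a * c' b" if ar: "arrow n p b a" for b a
      unfolding c'[OF ar] by (rule eq_matI) (simp_all add: dc' rep_dims[OF rM' ar] rep_dims[OF rX ar] del: index_mult_mat(1))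
    \<comment> \<open>The defects of the two summands cancel, so \<open>k\<close> is a homomorphism
      from \<open>M'\<close> to \<open>M\<close>. Since \<open>f\<close> is not a split
      monomorphism, \<open>k * f\<close> is not an automorphism.\<close>
    define k where "k x = h x * c' x + r2 x" for x
    have dk: "dim_row (k x) = rdim M x" "dim_col (k x) = rdim M' x" for x by (simp_all add: k_def dj)
    have k: "is_hom n p M' M k"
    proof (rule homI[OF rM' rM])
      show "k x \<in> carrier_mat (rdim M x) (rdim M' x)" for x by (rule carrier_matI) (simp_all add: dk)
      fix b a assume ar: "arrow n p b a"
      note d = d0 de[OF ar] rep_dims[OF rM ar] rep_dims[OF rM' ar] rep_dims[OF rX ar] rep_dims[OF rT ar]
      have "k a * rmap M' b a = h a * (c' a * rmap M' b a) + r2 a * rmap M' b a" by (simp add: k_def mat_distrib mat_assoc d)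
      also have "\<dots> = (h a * g a) * e b a + (h a * rmap X b a) * c' b + r2 a * rmap M' b a"
        unfolding c'M[OF ar] by (simp add: mat_distrib mat_assoc d)
      also have "\<dots> = j a * e b a + rmap M b a * (h b * c' b) + r2 a * rmap M' b a"
        by (simp add: hgx homD(6)[OF h ar] mat_assoc d)
      finally have 1: "k a * rmap M' b a = j a * e b a + rmap M b a * (h b * c' b) + r2 a * rmap M' b a" .
      have "rmap M b a * k b = rmap M b a * (h b * c' b) + rmap M b a * r2 b" by (simp add: k_def mat_distrib d)
      also have "\<dots> = rmap M b a * (h b * c' b) + (r2 a * rmap M' b a + j a * e b a)" unfolding Mr2[OF ar] ..
      finally have 2: "rmap M b a * k b = rmap M b a * (h b * c' b) + (r2 a * rmap M' b a + j a * e b a)" .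
      show "k a * rmap M' b a = rmap M b a * k b"
        unfolding 1 2 by (rule eq_matI) (simp_all add: d del: index_mult_mat(1))
    qed
    have kf: "is_hom n p M M (hcomp k f)" by (rule hom_comp[OF If(1) k])
    have "\<not> automorphism n p M (hcomp k f)"
    proof
      assume "automorphism n p M (hcomp k f)"
      then obtain q where q: "is_hom n p M M q" "hcomp q (hcomp k f) = hid M" unfolding automorphism_def by blast
      then have "hcomp (hcomp q k) f = hid M" using hcomp_assoc[OF If(1) k q(1)] by simp
      then show False using If(1,2) hom_comp[OF k q(1)] unfolding split_mono_def by blast
    qed
    from one_minus_automorphism[OF M kf this] obtain q where q: "is_hom n p M M q"
      and q1: "hcomp (\<lambda>x. 1\<^sub>m (rdim M x) - hcomp k f x) q = hid M" unfolding automorphism_def by blast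
    \<comment> \<open>Chosen so that \<open>h * t = 1 - k * f\<close>; the inverse of the right-hand
      side turns \<open>t\<close> into a section of \<open>h\<close>.\<close>
    define t where "t x = g x * c x - c' x * f x" for x
    have t: "is_hom n p M X t"
    proof (rule homI[OF rM rX])
      show "t x \<in> carrier_mat (rdim X x) (rdim M x)" for x unfolding t_def by (rule carrier_matI) (simp_all add: d0)
      fix b a assume ar: "arrow n p b a"
      note d = d0 de[OF ar] rep_dims[OF rM ar] rep_dims[OF rM' ar] rep_dims[OF rX ar] rep_dims[OF rT ar]
      have "t a * rmap M b a = g a * (c a * rmap M b a) - c' a * (f a * rmap M b a)" by (simp add: t_def mat_distrib mat_assoc d)
      also have "\<dots> = (g a * rmap T b a) * c b + g a * (e b a * f b) - (c' a * rmap M' b a) * f b"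
        unfolding cM[OF ar] homD(6)[OF If(1) ar] by (simp add: mat_distrib mat_assoc d)
      also have "\<dots> = rmap X b a * (g b * c b) + g a * (e b a * f b) - (g a * (e b a * f b) + rmap X b a * (c' b * f b))"
        unfolding c'M[OF ar] homD(6)[OF g ar] by (simp add: mat_distrib mat_assoc d)
      finally have 1: "t a * rmap M b a = rmap X b a * (g b * c b) + g a * (e b a * f b) - (g a * (e b a * f b) + rmap X b a * (c' b * f b))" .
      have 2: "rmap X b a * t b = rmap X b a * (g b * c b) - rmap X b a * (c' b * f b)" by (simp add: t_def mat_distrib d)
      show "t a * rmap M b a = rmap X b a * t b"
        unfolding 1 2 by (rule eq_matI) (simp_all add: d del: index_mult_mat(1))
    qed
    have ht: "hcomp h t = (\<lambda>x. 1\<^sub>m (rdim M x) - hcomp k f x)"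
    proof (rule ext)
      fix x
      note d = d0
      have 1: "h x * t x = j x * c x - h x * (c' x * f x)" by (simp add: t_def mat_distrib d hgx[symmetric] mat_assoc)
      have 2: "k x * f x = h x * (c' x * f x) + r2 x * f x" by (simp add: k_def mat_distrib mat_assoc d)
      have "h x * t x = (j x * c x + r2 x * f x) - k x * f x"
        unfolding 1 2 by (rule eq_matI) (simp_all add: d del: index_mult_mat(1))
      then show "hcomp h t x = 1\<^sub>m (rdim M x) - hcomp k f x" by (simp add: hcomp_def jr)
    qed
    have "hcomp h (hcomp t q) = hid M" using hcomp_assoc[OF q t h] q1 ht by simp
    then show "split_epi n p X M h" using h hom_comp[OF q t] unfolding split_epi_def by blast
  qed
  then have "irreducible_map n p T M j" using j not_sm not_se unfolding irreducible_map_def by blast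
  then show ?thesis by blast
qed

text \<open>\<open>T\<close> is a model of \<open>\<sigma>\<^sup>2M'\<close>. Pairing
  \<open>h\<close> with \<open>v * e\<close> equals pairing \<open>h * v\<close> with
  \<open>e\<close>, and \<open>h * v\<close> is not an automorphism when \<open>v\<close> is not a
  split monomorphism. So \<open>v * e\<close> pairs to zero with every \<open>h\<close> and is a
  coboundary by nondegeneracy: this is the almost split property of \<open>e\<close>.\<close>

lemma irreducible_from_translate:
  fixes M M' N T :: "'k::field qrep"
  assumes M: "indecomposable n p M" and M': "indecomposable n p M'" and f: "irreducible_map n p M M' f"
    and MN: "full_refl n p M' N" and NT: "full_refl n (\<not> p) N T"
  shows "\<exists>j. irreducible_map n p T M j"
proof -
  note F = full_reflD[OF MN] and F' = full_reflD[OF NT]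
  have "indecomposable n (\<not> p) N" using full_refl_indecomposable[OF MN] M' by blast
  then have T: "indecomposable n p T" using full_refl_indecomposable[OF NT] by simp
  obtain e where e: "cochain n p M' T e" and e0: "\<And>h. is_hom n p T T h \<Longrightarrow> \<not> automorphism n p T h \<Longrightarrow> pairing n p M' N h e = 0"
    and e1: "pairing n p M' N (hid T) e \<noteq> 0"
    using ar_class_exists[OF MN NT T] by blast
  show ?thesis
  proof (rule irreducible_from_almost_split[OF T M M' e _ _ f])
    show "\<not> coboundary n p M' T e" using coboundary_pairing[OF F(1) F'(1), of e] e1 by blast
    fix V v assume v: "is_hom n p T V v" and ns: "\<not> split_mono n p T V v"
    show "coboundary n p M' V (\<lambda>b a. v a * e b a)"
    proof (rule pairing_nondegenerate[OF F(1) F'(1) homD(2)[OF v]])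
      show "cochain n p M' V (\<lambda>b a. v a * e b a)"
        using e homD(3)[OF v] unfolding cochain_def by (metis mult_carrier_mat)
      fix h assume h: "is_hom n p V T h"
      note hv = hom_comp[OF v h]
      have na: "\<not> automorphism n p T (hcomp h v)"
      proof
        assume "automorphism n p T (hcomp h v)"
        then obtain r where r: "is_hom n p T T r" "hcomp r (hcomp h v) = hid T" unfolding automorphism_def by blast
        then have "hcomp (hcomp r h) v = hid T" using hcomp_assoc[OF v h r(1)] by simp
        then show False using ns v hom_comp[OF h r(1)] unfolding split_mono_def by blast
      qed
      have "pairing n p M' N h (\<lambda>b a. v a * e b a) = pairing n p M' N (hcomp h v) e"
        unfolding pairing_def
      proof (intro sum.cong refl)
        fix b a assume "b \<in> {b \<in> supp M'. \<not> is_sink p b}" and a: "a \<in> nbrs n b"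
        then have nb: "\<not> is_sink p b" by simp
        note ar = source_nbr_arrow[OF nb a]
        have sa: "is_sink p a" using ar by (simp add: arrow_def)
        have Nc: "rmap N a b \<in> carrier_mat (rdim M' b) (rdim T a)"
          using repD[OF pre_reflD(2)[OF F(1)], of a b] ar pre_reflD(3)[OF F(1) nb] pre_reflD(3)[OF F'(1), of a] sa by (simp add: arrow_flip is_sink_not)
        have ec: "e b a \<in> carrier_mat (rdim T a) (rdim M' b)" using e ar by (simp add: cochain_def)
        have "ptr (rmap N a b * hcomp h v a) (e b a) = ptr ((rmap N a b * h a) * v a) (e b a)"
          using assoc_mult_mat[OF Nc homD(3)[OF h] homD(3)[OF v]] by (simp add: hcomp_def)
        also have "\<dots> = ptr (rmap N a b * h a) (v a * e b a)"
          by (rule ptr_assoc[OF mult_carrier_mat[OF Nc homD(3)[OF h]] homD(3)[OF v] ec])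
        finally show "ptr (rmap N a b * h a) (v a * e b a) = ptr (rmap N a b * hcomp h v a) (e b a)" by simp
      qed
      then show "pairing n p M' N h (\<lambda>b a. v a * e b a) = 0" using e0[OF hv na] by simp
    qed
  qed
qed

section \<open>Centers of sink modules\<close>

text \<open>A path-free form of a sink module: \<open>c\<close> is the center of the support,
  \<open>r\<close> its radius, and the last clause says that support points at distance
  \<open>r\<close> from \<open>c\<close> are sinks.\<close>

definition sink_center :: "bool \<Rightarrow> nat list set \<Rightarrow> nat list \<Rightarrow> nat \<Rightarrow> bool" where
  "sink_center p S c r \<longleftrightarrow> (\<forall>v\<in>S. tdist c v \<le> r) \<and> (\<exists>u\<in>S. \<exists>w\<in>S. tdist u w = 2 * r) \<and> (is_sink p c \<longleftrightarrow> even r)"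

lemma sink_centerE:
  assumes "sink_center p S c r"
  obtains u w where "u \<in> S" "w \<in> S" "tdist u w = 2 * r" "tdist c u = r" "tdist c w = r"
proof -
  obtain u w where uw: "u \<in> S" "w \<in> S" "tdist u w = 2 * r" using assms by (auto simp: sink_center_def)
  have "tdist c u \<le> r" "tdist c w \<le> r" using assms uw by (auto simp: sink_center_def)
  moreover have "tdist u w \<le> tdist c u + tdist c w" using tdist_triangle[of u w c] by (simp add: tdist_sym)
  ultimately show thesis using that[OF uw] uw(3) by linarith
qed

lemma supp_path_ends: "supp_path n M ps \<Longrightarrow> hd ps \<in> supp M \<and> last ps \<in> supp M"
  by (auto simp: supp_path_def)

text \<open>Through \<open>c\<close> any two support points are at distance at most
  \<open>2 * r\<close>, so both ends of a diameter path are at distance exactly \<open>r\<close>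
  from \<open>c\<close>, where the parity clause makes them sinks.\<close>

lemma sink_center_sink_module:
  fixes M :: "'k::field qrep"
  assumes M: "indecomposable n p M" and s: "sink_center p (supp M) c r"
  shows "sink_module n p M" "radius n M = r"
proof -
  obtain u w where uw: "u \<in> supp M" "w \<in> supp M" "tdist u w = 2 * r" using sink_centerE[OF s] .
  have ball: "tdist c v \<le> r" if "v \<in> supp M" for v using s that by (simp add: sink_center_def)
  have len: "length ps - 1 \<le> 2 * r" if ps: "supp_path n M ps" for ps
  proof -
    have "tdist (hd ps) (last ps) \<le> tdist c (hd ps) + tdist c (last ps)"
      using tdist_triangle[of "hd ps" "last ps" c] by (simp add: tdist_sym)
    moreover have "tdist c (hd ps) \<le> r" "tdist c (last ps) \<le> r" using ball supp_path_ends[OF ps] by blast+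
    ultimately show ?thesis using supp_path_length[OF ps] by linarith
  qed
  obtain ps where ps: "supp_path n M ps" "hd ps = u" "last ps = w" using supp_path_exists[OF M uw(1,2)] by blast
  have "diam n M = 2 * r"
    unfolding diam_def
  proof (rule Max_eqI)
    show "finite {length ps - 1 |ps. supp_path n M ps}"
      by (rule finite_subset[of _ "{..2*r}"]) (use len in auto)
    show "y \<le> 2 * r" if "y \<in> {length ps - 1 |ps. supp_path n M ps}" for y using that len by blast
    have "length ps - 1 = 2 * r" using supp_path_length[OF ps(1)] ps uw by simp
    then show "2 * r \<in> {length ps - 1 |ps. supp_path n M ps}" using ps(1) by (metis (mono_tags, lifting) mem_Collect_eq)
  qed
  then show "radius n M = r" by (simp add: radius_def)
  show "sink_module n p M"
    unfolding sink_module_def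
  proof (intro allI impI)
    fix ps assume "diam_path n M ps"
    then have ps: "supp_path n M ps" "length ps - 1 = 2 * r" using \<open>diam n M = 2 * r\<close> by (auto simp: diam_path_def)
    have "tdist (hd ps) (last ps) = 2 * r" using supp_path_length[OF ps(1)] ps(2) by simp
    moreover have "tdist (hd ps) (last ps) \<le> tdist c (hd ps) + tdist c (last ps)"
      using tdist_triangle[of "hd ps" "last ps" c] by (simp add: tdist_sym)
    moreover have "tdist c (hd ps) \<le> r" "tdist c (last ps) \<le> r" using ball supp_path_ends[OF ps(1)] by blast+
    ultimately have "tdist c (hd ps) = r" "tdist c (last ps) = r" by linarith+
    then show "is_sink p (hd ps) \<and> is_sink p (last ps)"
      using s is_sink_tdist[of p c "hd ps"] is_sink_tdist[of p c "last ps"] by (auto simp: sink_center_def)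
  qed
qed

lemma tdist_between:
  assumes "tvert n u" "tvert n w" "k \<le> tdist u w"
  shows "\<exists>c. tvert n c \<and> tdist u c = k \<and> tdist c w = tdist u w - k"
  using assms(3)
proof (induction k)
  case 0 then show ?case using assms(1) by (intro exI[of _ u]) simp
next
  case (Suc k)
  then obtain c where c: "tvert n c" "tdist u c = k" "tdist c w = tdist u w - k" by auto
  then have "c \<noteq> w" using Suc.prems by (auto simp: tdist_eq_0[symmetric])
  then obtain c' where c': "tadj n c c'" "tdist c w = Suc (tdist c' w)" using tdist_closer[OF c(1) assms(2)] by blast
  have "tdist u c' = Suc k"
    using tadj_tdist_cases[OF c'(1), of u] c c' tdist_triangle[of u w c'] Suc.prems by auto
  then show ?case using tadj_tvert[OF c'(1)] c c' by (intro exI[of _ c']) auto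
qed

text \<open>The diameter is even because both ends of a diameter path are sinks, so it has a middle
  vertex \<open>c\<close>. A support vertex farther than \<open>r\<close> from \<open>c\<close>
  would, by the four-point condition, be too far from one of the ends.\<close>

lemma sink_module_center:
  fixes M :: "'k::field qrep"
  assumes M: "indecomposable n p M" and s: "sink_module n p M"
  shows "\<exists>c r. tvert n c \<and> sink_center p (supp M) c r"
proof -
  note rM = indecomposable_rep[OF M]
  let ?L = "{length ps - 1 |ps. supp_path n M ps}"
  have "?L \<subseteq> {..card (supp M)}"
  proof
    fix l assume "l \<in> ?L"
    then obtain ps where ps: "l = length ps - 1" "supp_path n M ps" by blast
    then have "length ps \<le> card (supp M)"
      using distinct_card[of ps] card_mono[OF supp_finite[OF rM], of "set ps"] by (simp add: supp_path_def)
    then show "l \<in> {..card (supp M)}" using ps by simp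
  qed
  then have fin: "finite ?L" by (rule finite_subset) simp
  obtain x where "x \<in> supp M" using M by (auto simp: indecomposable_def is_zero_rep_def supp_def)
  then have "supp_path n M [x]" by (simp add: supp_path_def)
  then have "?L \<noteq> {}" by blast
  from Max_in[OF fin this] obtain ps where ps: "supp_path n M ps" "diam n M = length ps - 1" unfolding diam_def by blast
  then have dp: "diam_path n M ps" by (simp add: diam_path_def)
  define u w where "u = hd ps" and "w = last ps"
  have uw: "u \<in> supp M" "w \<in> supp M" "tdist u w = diam n M" using supp_path_ends[OF ps(1)] supp_path_length[OF ps(1)] ps(2) by (auto simp: u_def w_def)
  have su: "is_sink p u" "is_sink p w" using s dp by (auto simp: sink_module_def u_def w_def)
  then have "even (tdist u w)" using is_sink_tdist[of p u w] by simp
  then obtain r where r: "tdist u w = 2 * r" by blast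
  obtain c where c: "tvert n c" "tdist u c = r" "tdist c w = r"
    using tdist_between[OF supp_tvert[OF rM uw(1)] supp_tvert[OF rM uw(2)], of r] r by auto
  have le: "tdist a b \<le> 2 * r" if ab: "a \<in> supp M" "b \<in> supp M" for a b
  proof -
    obtain qs where qs: "supp_path n M qs" "hd qs = a" "last qs = b" using supp_path_exists[OF M ab] by blast
    then have "tdist a b \<in> ?L" using supp_path_length[OF qs(1)] by (metis (mono_tags, lifting) mem_Collect_eq)
    then have "tdist a b \<le> diam n M" unfolding diam_def by (rule Max_ge[OF fin])
    then show ?thesis using uw r by simp
  qed
  have "tdist c v \<le> r" if v: "v \<in> supp M" for v
  proof -
    have "tdist u w + tdist c v \<le> max (tdist u c + tdist w v) (tdist u v + tdist w c)" by (rule four_point)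
    then show ?thesis using le[OF uw(1) v] le[OF uw(2) v] c r by (auto simp: tdist_sym)
  qed
  moreover have "is_sink p c \<longleftrightarrow> even r" using is_sink_tdist[of p c u] su c by (simp add: tdist_sym)
  ultimately show ?thesis using c(1) uw r unfolding sink_center_def by blast
qed

lemma nbr_surj_supp:
  fixes M :: "'k::field qrep"
  assumes "is_rep n p M" "nbr_surj n p M" "is_sink p a" "a \<in> supp M"
  shows "\<exists>b\<in>nbrs n a. b \<in> supp M"
proof (rule ccontr)
  assume "\<not> ?thesis"
  then have "rdim M b = 0" if "b \<in> nbrs n a" for b using that by (simp add: supp_def)
  then have "rdim M a = 0" by (rule nbr_surj_empty[OF assms(1-3)])
  then show False using assms(4) by (simp add: supp_def)
qed

section \<open>Supports under reflections\<close>

text \<open>At a sink outside the support of \<open>A\<close> the neighbour sum maps to zero, so its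
  kernel \<open>N_a\<close> is the full direct sum of the neighbour spaces and maps onto each of
  them.\<close>

lemma refl_supp:
  fixes A N :: "'k::field qrep"
  assumes F: "full_refl n p A N"
  shows "\<And>b. \<not> is_sink p b \<Longrightarrow> b \<in> supp N \<longleftrightarrow> b \<in> supp A"
    "\<And>a. is_sink p a \<Longrightarrow> a \<in> supp A \<Longrightarrow> \<exists>b\<in>nbrs n a. b \<in> supp A"
    "\<And>a b u. is_sink p a \<Longrightarrow> a \<notin> supp A \<Longrightarrow> b \<in> nbrs n a \<Longrightarrow> u \<in> carrier_vec (rdim N b) \<Longrightarrow>
       \<exists>w\<in>carrier_vec (rdim N a). rmap N a b *\<^sub>v w = u"
    "\<And>a b. is_sink p a \<Longrightarrow> a \<notin> supp A \<Longrightarrow> b \<in> nbrs n a \<Longrightarrow> b \<in> supp A \<Longrightarrow> a \<in> supp N"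
proof -
  note D = full_reflD[OF F]
  note P = pre_reflD[OF D(1)]
  show s: "b \<in> supp N \<longleftrightarrow> b \<in> supp A" if "\<not> is_sink p b" for b using P(3)[OF that] by (simp add: supp_def)
  show "\<exists>b\<in>nbrs n a. b \<in> supp A" if "is_sink p a" "a \<in> supp A" for a
    by (rule nbr_surj_supp[OF P(1) D(2) that])
  show R4: "\<exists>w\<in>carrier_vec (rdim N a). rmap N a b *\<^sub>v w = u"
    if a: "is_sink p a" "a \<notin> supp A" and b: "b \<in> nbrs n a" and u: "u \<in> carrier_vec (rdim N b)" for a b u
  proof -
    have ta: "tvert n a" using b by (auto simp: nbrs_def tadj_def)
    define v where "v x = (if x = b then u else 0\<^sub>v (rdim A x))" for x
    have v: "v x \<in> carrier_vec (rdim A x)" if "x \<in> nbrs n a" for x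
      using u P(3)[OF nbrs_arrow(3)[OF b a(1)]] by (auto simp: v_def)
    have z: "rdim A a = 0" using a(2) by (simp add: supp_def)
    have "nsum n A a v \<in> carrier_vec (rdim A a)" by (rule nsum_carrier[OF P(1) a(1) v])
    then have "nsum n A a v = 0\<^sub>v (rdim A a)" using z by (intro eq_vecI) auto
    from P(5)[OF a(1) ta v this] obtain w where "w\<in>carrier_vec (rdim N a)" "rmap N a b *\<^sub>v w = v b" using b by blast
    then show ?thesis by (auto simp: v_def)
  qed
  show "a \<in> supp N" if a: "is_sink p a" "a \<notin> supp A" and b: "b \<in> nbrs n a" and bA: "b \<in> supp A" for a b
  proof (rule ccontr)
    assume "a \<notin> supp N"
    then have z: "rdim N a = 0" by (simp add: supp_def)
    have nb: "\<not> is_sink p b" by (rule nbrs_arrow(3)[OF b a(1)])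
    have k: "rdim N b \<noteq> 0" using s[OF nb] bA by (simp add: supp_def)
    obtain w where w: "w\<in>carrier_vec (rdim N a)" "rmap N a b *\<^sub>v w = unit_vec (rdim N b) 0"
      using R4[OF a b unit_vec_carrier] by blast
    have r: "rmap N a b \<in> carrier_mat (rdim N b) (rdim N a)" by (rule repD[OF P(2) nbrs_arrow(2)[OF b a(1)]])
    have "(rmap N a b *\<^sub>v w) $ 0 = row (rmap N a b) 0 \<bullet> w" by (rule index_mult_mat_vec) (use r k in auto)
    also have "\<dots> = 0" using w(1) z by (simp add: scalar_prod_def)
    finally have "(rmap N a b *\<^sub>v w) $ 0 = 0" .
    then show False using w k by simp
  qed
qed

text \<open>The points of \<open>N\<close> at distance \<open>r\<close> keep their spaces, while
  \<open>N\<close> vanishes just beyond them. If \<open>A\<close> vanished there as well, the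
  reflected space \<open>N_y\<close> would contain a nonzero neighbour space. So the support moves
  outward by one around the same center.\<close>

lemma sink_center_refl_minus:
  fixes A N :: "'k::field qrep"
  assumes n: "n \<ge> 3" and F: "full_refl n p A N" and c: "sink_center (\<not> p) (supp N) c r"
  shows "sink_center p (supp A) c (Suc r)"
proof -
  note R = refl_supp[OF F]
  note rN = pre_reflD(2)[OF full_reflD(1)[OF F]]
  have ball: "tdist c v \<le> r" if "v \<in> supp N" for v using c that by (simp add: sink_center_def)
  have par: "is_sink p c \<longleftrightarrow> odd r" using c by (auto simp: sink_center_def is_sink_not)
  obtain u w where uw: "u \<in> supp N" "w \<in> supp N" "tdist u w = 2 * r" "tdist c u = r" "tdist c w = r" using sink_centerE[OF c] .
  have ns: "\<not> is_sink p u" "\<not> is_sink p w" using is_sink_tdist[of p c u] is_sink_tdist[of p c w] par uw by auto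
  have bA: "tdist c v \<le> Suc r" if v: "v \<in> supp A" for v
  proof (cases "is_sink p v")
    case True
    then obtain b where b: "b \<in> nbrs n v" "b \<in> supp A" using R(2) v by blast
    then have "tdist c b \<le> r" using R(1)[OF nbrs_arrow(3)[OF b(1) True]] ball by blast
    then show ?thesis using tadj_tdist_cases[of n v b c] b(1) by (auto simp: nbrs_def)
  qed (use R(1) v ball le_SucI in blast)
  have far: "y \<in> supp A" if x: "x \<in> supp N" "\<not> is_sink p x" and y: "tadj n x y" "r < tdist c y" for x y
  proof (rule ccontr)
    assume "y \<notin> supp A"
    moreover have "is_sink p y" using tadj_sink[OF y(1)] x by blast
    moreover have "x \<in> nbrs n y" using tadj_sym[OF y(1)] by (simp add: nbrs_def)
    ultimately have "y \<in> supp N" using R(4) R(1)[OF x(2)] x(1) by blast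
    then show False using ball y(2) by fastforce
  qed
  obtain y where y: "tadj n u y" "tdist w y = Suc (tdist w u)" using farther_nbr[OF n supp_tvert[OF rN uw(1)]] .
  have yr: "r < tdist c y" using tdist_triangle[of w y c] y uw by (simp add: tdist_sym)
  \<comment> \<open>Moving away from \<open>y\<close>, which is already displaced, makes the two
    displacements add up to \<open>tdist y w' = 2 * Suc r\<close>.\<close>
  obtain w' where w': "tadj n w w'" "tdist y w' = Suc (tdist y w)" using farther_nbr[OF n supp_tvert[OF rN uw(2)]] .
  have yA: "y \<in> supp A" by (rule far[OF uw(1) ns(1) y(1) yr])
  have "r < tdist c w'" using tdist_triangle[of y w' c] w' y uw bA[OF yA] by (simp add: tdist_sym)
  then have "w' \<in> supp A" by (rule far[OF uw(2) ns(2) w'(1)])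
  moreover have "tdist y w' = 2 * Suc r" using w' y uw by (simp add: tdist_sym)
  ultimately show ?thesis using yA bA par unfolding sink_center_def by auto
qed

section \<open>Irreducible maps and supports\<close>

text \<open>Factor \<open>f\<close> through the module with \<open>N'_b\<close> at \<open>b\<close>
  that agrees with \<open>N\<close> elsewhere. If the first factor splits, \<open>f b\<close> has a
  left inverse; if the second one splits, \<open>f\<close> has a section away from
  \<open>b\<close>.\<close>

lemma sink_factor:
  fixes N N' :: "'k::field qrep"
  assumes f: "irreducible_map n q N N' f" and b: "is_sink q b"
  shows "(\<exists>L\<in>carrier_mat (rdim N b) (rdim N' b). L * f b = 1\<^sub>m (rdim N b)) \<or>
    (\<exists>s. (\<forall>x. s x \<in> carrier_mat (rdim N x) (rdim N' x)) \<and> (\<forall>x. x \<noteq> b \<longrightarrow> f x * s x = 1\<^sub>m (rdim N' x)) \<and>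
      (\<forall>x y. arrow n q x y \<longrightarrow> y \<noteq> b \<longrightarrow> s y * rmap N' x y = rmap N x y * s x))"
proof -
  note I = irreducibleD[OF f]
  note rN = homD(1)[OF I(1)] and rN' = homD(2)[OF I(1)] and d = homD(4,5)[OF I(1)]
  define X where "X = \<lparr>rdim = \<lambda>x. if x = b then rdim N' b else rdim N x,
    rmap = \<lambda>x y. if y = b then f b * rmap N x b else rmap N x y\<rparr>"
  have X: "rdim X x = (if x = b then rdim N' b else rdim N x)" "rmap X x y = (if y = b then f b * rmap N x b else rmap N x y)" for x y
    by (simp_all add: X_def)
  have nb: "x \<noteq> b" if "arrow n q x y" for x y using arrow_nbrs[OF that] b by blast
  have rX: "is_rep n q X"
    unfolding is_rep_def
  proof (intro conjI allI impI)
    show "rdim X x = 0" if "\<not> tvert n x" for x using that rN rN' by (auto simp: X is_rep_def)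
    have "{x. rdim X x \<noteq> 0} \<subseteq> insert b (supp N)" by (auto simp: X supp_def)
    then show "finite {x. rdim X x \<noteq> 0}" using supp_finite[OF rN] finite_subset by blast
    show "rmap X x y \<in> carrier_mat (rdim X y) (rdim X x)" if a: "arrow n q x y" for x y
      using nb[OF a] repD[OF rN a] homD(3)[OF I(1), of b] by (auto simp: X)
  qed
  define h where "h x = (if x = b then f b else 1\<^sub>m (rdim N x))" for x
  define g where "g x = (if x = b then 1\<^sub>m (rdim N' b) else f x)" for x
  have h: "is_hom n q N X h"
    by (rule homI[OF rN rX]) (use nb rep_dims[OF rN] homD(3)[OF I(1)] in \<open>auto simp: h_def X\<close>)
  have g: "is_hom n q X N' g"
  proof (rule homI[OF rX rN'])
    show "g x \<in> carrier_mat (rdim N' x) (rdim X x)" for x using homD(3)[OF I(1), of x] by (auto simp: g_def X)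
    fix x y assume a: "arrow n q x y"
    show "g y * rmap X x y = rmap N' x y * g x"
      using nb[OF a] homD(6)[OF I(1) a] rep_dims[OF rN a] d by (auto simp: g_def X)
  qed
  have "hcomp g h = f" using d by (auto simp: hcomp_def g_def h_def)
  from I(4)[OF h g this] show ?thesis
  proof
    assume "split_mono n q N X h"
    then obtain r where r: "is_hom n q X N r" "hcomp r h = hid N" unfolding split_mono_def by blast
    have "r b * f b = 1\<^sub>m (rdim N b)" using fun_cong[OF r(2), of b] by (simp add: hcomp_def hid_def h_def)
    moreover have "r b \<in> carrier_mat (rdim N b) (rdim N' b)" using homD(3)[OF r(1), of b] by (simp add: X)
    ultimately show ?thesis by blast
  next
    assume "split_epi n q X N' g"
    then obtain r where r: "is_hom n q N' X r" "hcomp g r = hid N'" unfolding split_epi_def by blast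
    define s where "s x = (if x = b then 0\<^sub>m (rdim N b) (rdim N' b) else r x)" for x
    have "s x \<in> carrier_mat (rdim N x) (rdim N' x)" for x using homD(3)[OF r(1), of x] by (auto simp: s_def X)
    moreover have "f x * s x = 1\<^sub>m (rdim N' x)" if "x \<noteq> b" for x
      using fun_cong[OF r(2), of x] that by (simp add: hcomp_def hid_def g_def s_def)
    moreover have "s y * rmap N' x y = rmap N x y * s x" if "arrow n q x y" "y \<noteq> b" for x y
      using homD(6)[OF r(1) that(1)] that nb[OF that(1)] by (simp add: s_def X)
    ultimately show ?thesis by blast
  qed
qed

text \<open>Dual to the sink case: the middle module has \<open>N_b\<close> at \<open>b\<close> and
  agrees with \<open>N'\<close> elsewhere, and the second alternative is a retraction away from
  \<open>b\<close>.\<close>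

lemma source_factor:
  fixes N N' :: "'k::field qrep"
  assumes f: "irreducible_map n q N N' f" and b: "\<not> is_sink q b"
  shows "(\<exists>R\<in>carrier_mat (rdim N b) (rdim N' b). f b * R = 1\<^sub>m (rdim N' b)) \<or>
    (\<exists>s. (\<forall>x. s x \<in> carrier_mat (rdim N x) (rdim N' x)) \<and> (\<forall>x. x \<noteq> b \<longrightarrow> s x * f x = 1\<^sub>m (rdim N x)) \<and>
      (\<forall>x y. arrow n q x y \<longrightarrow> x \<noteq> b \<longrightarrow> s y * rmap N' x y = rmap N x y * s x))"
proof -
  note I = irreducibleD[OF f]
  note rN = homD(1)[OF I(1)] and rN' = homD(2)[OF I(1)] and d = homD(4,5)[OF I(1)]
  define X where "X = \<lparr>rdim = \<lambda>x. if x = b then rdim N b else rdim N' x,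
    rmap = \<lambda>x y. if x = b then f y * rmap N b y else rmap N' x y\<rparr>"
  have X: "rdim X x = (if x = b then rdim N b else rdim N' x)" "rmap X x y = (if x = b then f y * rmap N b y else rmap N' x y)" for x y
    by (simp_all add: X_def)
  have nb: "y \<noteq> b" if "arrow n q x y" for x y using arrow_nbrs[OF that] b by blast
  have rX: "is_rep n q X"
    unfolding is_rep_def
  proof (intro conjI allI impI)
    show "rdim X x = 0" if "\<not> tvert n x" for x using that rN rN' by (auto simp: X is_rep_def)
    have "{x. rdim X x \<noteq> 0} \<subseteq> insert b (supp N')" by (auto simp: X supp_def)
    then show "finite {x. rdim X x \<noteq> 0}" using supp_finite[OF rN'] finite_subset by blast
    show "rmap X x y \<in> carrier_mat (rdim X y) (rdim X x)" if a: "arrow n q x y" for x y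
      using nb[OF a] repD[OF rN a] repD[OF rN' a] homD(3)[OF I(1), of y] by (auto simp: X)
  qed
  define h where "h x = (if x = b then 1\<^sub>m (rdim N b) else f x)" for x
  define g where "g x = (if x = b then f b else 1\<^sub>m (rdim N' x))" for x
  have h: "is_hom n q N X h"
  proof (rule homI[OF rN rX])
    show "h x \<in> carrier_mat (rdim X x) (rdim N x)" for x using homD(3)[OF I(1), of x] by (auto simp: h_def X)
    fix x y assume a: "arrow n q x y"
    show "h y * rmap N x y = rmap X x y * h x"
      using nb[OF a] homD(6)[OF I(1) a] rep_dims[OF rN a] d by (auto simp: h_def X)
  qed
  have g: "is_hom n q X N' g"
  proof (rule homI[OF rX rN'])
    show "g x \<in> carrier_mat (rdim N' x) (rdim X x)" for x using homD(3)[OF I(1), of x] by (auto simp: g_def X)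
    fix x y assume a: "arrow n q x y"
    show "g y * rmap X x y = rmap N' x y * g x"
      using nb[OF a] homD(6)[OF I(1) a] rep_dims[OF rN a] rep_dims[OF rN' a] d by (auto simp: g_def X)
  qed
  have "hcomp g h = f" using d by (auto simp: hcomp_def g_def h_def)
  from I(4)[OF h g this] show ?thesis
  proof
    assume "split_epi n q X N' g"
    then obtain r where r: "is_hom n q N' X r" "hcomp g r = hid N'" unfolding split_epi_def by blast
    have "f b * r b = 1\<^sub>m (rdim N' b)" using fun_cong[OF r(2), of b] by (simp add: hcomp_def hid_def g_def)
    moreover have "r b \<in> carrier_mat (rdim N b) (rdim N' b)" using homD(3)[OF r(1), of b] by (simp add: X)
    ultimately show ?thesis by blast
  next
    assume "split_mono n q N X h"
    then obtain r where r: "is_hom n q X N r" "hcomp r h = hid N" unfolding split_mono_def by blast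
    define s where "s x = (if x = b then 0\<^sub>m (rdim N b) (rdim N' b) else r x)" for x
    have "s x \<in> carrier_mat (rdim N x) (rdim N' x)" for x using homD(3)[OF r(1), of x] by (auto simp: s_def X)
    moreover have "s x * f x = 1\<^sub>m (rdim N x)" if "x \<noteq> b" for x
      using fun_cong[OF r(2), of x] that by (simp add: hcomp_def hid_def h_def s_def)
    moreover have "s y * rmap N' x y = rmap N x y * s x" if "arrow n q x y" "x \<noteq> b" for x y
      using homD(6)[OF r(1) that(1)] that nb[OF that(1)] by (simp add: s_def X)
    ultimately show ?thesis by blast
  qed
qed

text \<open>Otherwise \<open>N'\<close> vanishes around \<open>b\<close> and by surjectivity also at
  \<open>b\<close>. Then \<open>f b\<close> has no left inverse, and the section away from
  \<open>b\<close> is a section of all of \<open>f\<close>, which is not a split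
  epimorphism.\<close>

lemma irreducible_sink_nbr:
  fixes N N' :: "'k::field qrep"
  assumes f: "irreducible_map n q N N' f" and s: "nbr_surj n q N'" and b: "is_sink q b" "b \<in> supp N"
  shows "\<exists>y\<in>nbrs n b. y \<in> supp N'"
proof (rule ccontr)
  assume "\<not> ?thesis"
  then have z: "rdim N' y = 0" if "y \<in> nbrs n b" for y using that by (auto simp: supp_def)
  note I = irreducibleD[OF f]
  note rN = homD(1)[OF I(1)] and rN' = homD(2)[OF I(1)] and d = homD(4,5)[OF I(1)]
  have zb: "rdim N' b = 0" by (rule nbr_surj_empty[OF rN' s b(1) z])
  from sink_factor[OF f b(1)] show False
  proof
    assume "\<exists>L\<in>carrier_mat (rdim N b) (rdim N' b). L * f b = 1\<^sub>m (rdim N b)"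
    then obtain L where L: "L \<in> carrier_mat (rdim N b) (rdim N' b)" "L * f b = 1\<^sub>m (rdim N b)" by blast
    have "L * f b = 0\<^sub>m (rdim N b) (rdim N b)"
      by (rule mat_mult_empty) (use L zb homD(3)[OF I(1), of b] in auto)
    then show False using L one_mat_ne_zero[of "rdim N b", where 'k = 'k] b(2) by (simp add: supp_def)
  next
    assume "\<exists>s. (\<forall>x. s x \<in> carrier_mat (rdim N x) (rdim N' x)) \<and> (\<forall>x. x \<noteq> b \<longrightarrow> f x * s x = 1\<^sub>m (rdim N' x)) \<and>
      (\<forall>x y. arrow n q x y \<longrightarrow> y \<noteq> b \<longrightarrow> s y * rmap N' x y = rmap N x y * s x)"
    then obtain s where s: "\<And>x. s x \<in> carrier_mat (rdim N x) (rdim N' x)" "\<And>x. x \<noteq> b \<Longrightarrow> f x * s x = 1\<^sub>m (rdim N' x)"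
      "\<And>x y. arrow n q x y \<Longrightarrow> y \<noteq> b \<Longrightarrow> s y * rmap N' x y = rmap N x y * s x" by blast
    have ds: "dim_row (s x) = rdim N x" "dim_col (s x) = rdim N' x" for x using s(1)[of x] by auto
    have "is_hom n q N' N s"
    proof (rule homI[OF rN' rN s(1)])
      fix x y assume a: "arrow n q x y"
      show "s y * rmap N' x y = rmap N x y * s x"
      proof (cases "y = b")
        case True
        then have "rdim N' x = 0" using arrow_nbrs[OF a] z by blast
        then show ?thesis by (intro zero_dim_mat_eq) (simp_all add: ds rep_dims[OF rN a] rep_dims[OF rN' a])
      qed (rule s(3)[OF a])
    qed
    moreover have "hcomp f s = hid N'"
    proof (rule ext)
      fix x
      show "hcomp f s x = hid N' x"
      proof (cases "x = b")
        case True
        then show ?thesis unfolding hcomp_def hid_def by (intro zero_dim_mat_eq) (simp_all add: ds d zb)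
      qed (simp add: hcomp_def hid_def s(2))
    qed
    ultimately show False using I(1,3) unfolding split_epi_def by blast
  qed
qed

text \<open>Otherwise \<open>N\<close> vanishes around \<open>b\<close> and by injectivity also at
  \<open>b\<close>. Then \<open>f b\<close> has no right inverse, and the retraction away from
  \<open>b\<close> is a retraction of all of \<open>f\<close>.\<close>

lemma irreducible_source_nbr:
  fixes N N' :: "'k::field qrep"
  assumes f: "irreducible_map n q N N' f" and i: "nbr_inj n q N" and b: "\<not> is_sink q b" "b \<in> supp N'"
  shows "\<exists>y\<in>nbrs n b. y \<in> supp N"
proof (rule ccontr)
  assume "\<not> ?thesis"
  then have z: "rdim N y = 0" if "y \<in> nbrs n b" for y using that by (auto simp: supp_def)
  note I = irreducibleD[OF f]
  note rN = homD(1)[OF I(1)] and rN' = homD(2)[OF I(1)] and d = homD(4,5)[OF I(1)]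
  have zb: "rdim N b = 0" by (rule nbr_inj_empty[OF rN i b(1) z])
  from source_factor[OF f b(1)] show False
  proof
    assume "\<exists>R\<in>carrier_mat (rdim N b) (rdim N' b). f b * R = 1\<^sub>m (rdim N' b)"
    then obtain R where R: "R \<in> carrier_mat (rdim N b) (rdim N' b)" "f b * R = 1\<^sub>m (rdim N' b)" by blast
    have "f b * R = 0\<^sub>m (rdim N' b) (rdim N' b)"
      by (rule mat_mult_empty) (use R zb homD(3)[OF I(1), of b] in auto)
    then show False using R one_mat_ne_zero[of "rdim N' b", where 'k = 'k] b(2) by (simp add: supp_def)
  next
    assume "\<exists>s. (\<forall>x. s x \<in> carrier_mat (rdim N x) (rdim N' x)) \<and> (\<forall>x. x \<noteq> b \<longrightarrow> s x * f x = 1\<^sub>m (rdim N x)) \<and>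
      (\<forall>x y. arrow n q x y \<longrightarrow> x \<noteq> b \<longrightarrow> s y * rmap N' x y = rmap N x y * s x)"
    then obtain s where s: "\<And>x. s x \<in> carrier_mat (rdim N x) (rdim N' x)" "\<And>x. x \<noteq> b \<Longrightarrow> s x * f x = 1\<^sub>m (rdim N x)"
      "\<And>x y. arrow n q x y \<Longrightarrow> x \<noteq> b \<Longrightarrow> s y * rmap N' x y = rmap N x y * s x" by blast
    have ds: "dim_row (s x) = rdim N x" "dim_col (s x) = rdim N' x" for x using s(1)[of x] by auto
    have "is_hom n q N' N s"
    proof (rule homI[OF rN' rN s(1)])
      fix x y assume a: "arrow n q x y"
      show "s y * rmap N' x y = rmap N x y * s x"
      proof (cases "x = b")
        case True
        have "y \<in> nbrs n x" using a by (simp add: arrow_def nbrs_def)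
        then have "rdim N y = 0" using True z by blast
        then show ?thesis by (intro zero_dim_mat_eq) (simp_all add: ds rep_dims[OF rN a] rep_dims[OF rN' a])
      qed (rule s(3)[OF a])
    qed
    moreover have "hcomp s f = hid N"
    proof (rule ext)
      fix x
      show "hcomp s f x = hid N x"
      proof (cases "x = b")
        case True
        then show ?thesis unfolding hcomp_def hid_def by (intro zero_dim_mat_eq) (simp_all add: ds d zb)
      qed (simp add: hcomp_def hid_def s(2))
    qed
    ultimately show False using I(1,2) unfolding split_mono_def by blast
  qed
qed

text \<open>Some neighbour \<open>b\<close> of \<open>y\<close> has no left inverse of
  \<open>f b\<close>; otherwise all maps out of \<open>N_y\<close> would vanish, against
  injectivity. Then \<open>sink_factor\<close> gives a section away from \<open>b\<close>, and at
  \<open>b\<close> itself every vector is a sum of images from the neighbours.\<close>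

lemma irreducible_surjective:
  fixes N N' :: "'k::field qrep"
  assumes f: "irreducible_map n q N N' f" and i: "nbr_inj n q N" and s: "nbr_surj n q N'"
    and y: "\<not> is_sink q y" "y \<in> supp N" "y \<notin> supp N'" and t: "t \<in> carrier_vec (rdim N' x)"
  shows "\<exists>w\<in>carrier_vec (rdim N x). f x *\<^sub>v w = t"
proof -
  note I = irreducibleD[OF f]
  note rN = homD(1)[OF I(1)] and rN' = homD(2)[OF I(1)] and d = homD(4,5)[OF I(1)]
  have zy: "rdim N' y = 0" using y by (simp add: supp_def)
  have ny: "rdim N y \<noteq> 0" "tvert n y" using y supp_tvert[OF rN] by (auto simp: supp_def)
  have "\<exists>b\<in>nbrs n y. \<not> (\<exists>L\<in>carrier_mat (rdim N b) (rdim N' b). L * f b = 1\<^sub>m (rdim N b))"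
  proof (rule ccontr)
    assume "\<not> ?thesis"
    then have L: "\<exists>L\<in>carrier_mat (rdim N b) (rdim N' b). L * f b = 1\<^sub>m (rdim N b)" if "b \<in> nbrs n y" for b using that by blast
    have "rmap N y b *\<^sub>v unit_vec (rdim N y) 0 = 0\<^sub>v (rdim N b)" if b: "b \<in> nbrs n y" for b
    proof -
      note a = source_nbr_arrow[OF y(1) b]
      obtain L where L: "L \<in> carrier_mat (rdim N b) (rdim N' b)" "L * f b = 1\<^sub>m (rdim N b)" using L[OF b] by blast
      have "rmap N' y b * f y = 0\<^sub>m (rdim N' b) (rdim N y)"
        by (rule mat_mult_empty) (use repD[OF rN' a] homD(3)[OF I(1), of y] zy in auto)
      then have fz: "f b * rmap N y b = 0\<^sub>m (rdim N' b) (rdim N y)" using homD(6)[OF I(1) a] by simp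
      have dL: "dim_col L = rdim N' b" "dim_row L = rdim N b" using L by auto
      have "rmap N y b = (L * f b) * rmap N y b" using L rep_dims[OF rN a] by simp
      also have "\<dots> = L * (f b * rmap N y b)" by (rule mat_assoc) (simp_all add: dL d rep_dims[OF rN a])
      also have "\<dots> = 0\<^sub>m (rdim N b) (rdim N y)" unfolding fz by (simp add: dL)
      finally have "rmap N y b = 0\<^sub>m (rdim N b) (rdim N y)" .
      then show ?thesis by (intro eq_vecI) auto
    qed
    then have "unit_vec (rdim N y) 0 = (0\<^sub>v (rdim N y) :: 'k vec)"
      using i y(1) ny unit_vec_carrier unfolding nbr_inj_def by blast
    then show False using ny by simp
  qed
  then obtain b where b: "b \<in> nbrs n y" "\<not> (\<exists>L\<in>carrier_mat (rdim N b) (rdim N' b). L * f b = 1\<^sub>m (rdim N b))" by blast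
  have sb: "is_sink q b" using source_nbr_arrow[OF y(1) b(1)] by (simp add: arrow_def)
  obtain r where r: "\<And>x. r x \<in> carrier_mat (rdim N x) (rdim N' x)" "\<And>x. x \<noteq> b \<Longrightarrow> f x * r x = 1\<^sub>m (rdim N' x)"
    using sink_factor[OF f sb] b(2) by blast
  have sj: "r x *\<^sub>v t \<in> carrier_vec (rdim N x)" "f x *\<^sub>v (r x *\<^sub>v t) = t" if "x \<noteq> b" "t \<in> carrier_vec (rdim N' x)" for x t
  proof -
    show "r x *\<^sub>v t \<in> carrier_vec (rdim N x)" using r(1) that(2) by (rule mult_mat_vec_carrier)
    have "(f x * r x) *\<^sub>v t = f x *\<^sub>v (r x *\<^sub>v t)" by (rule assoc_mult_mat_vec[OF homD(3)[OF I(1)] r(1) that(2)])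
    then show "f x *\<^sub>v (r x *\<^sub>v t) = t" using r(2)[OF that(1)] that(2) by simp
  qed
  show ?thesis
  proof (cases "x = b")
    case False
    then show ?thesis using sj[OF False t] by blast
  next
    case True
    have tb: "tvert n b" using b by (auto simp: nbrs_def tadj_def)
    obtain v where v: "\<And>z. z\<in>nbrs n b \<Longrightarrow> v z \<in> carrier_vec (rdim N' z)" "nsum n N' b v = t"
      using s tb sb t True unfolding nbr_surj_def by blast
    have nz: "z \<noteq> b" if "z \<in> nbrs n b" for z using nbrs_arrow(4)[OF that sb] .
    have c: "r z *\<^sub>v v z \<in> carrier_vec (rdim N z)" if "z \<in> nbrs n b" for z using sj(1)[OF nz[OF that] v(1)[OF that]] .
    have "t = nsum n N' b (\<lambda>z. f z *\<^sub>v (r z *\<^sub>v v z))"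
      unfolding v(2)[symmetric] by (rule nsum_cong[OF rN' sb v(1)]) (use sj(2) nz v(1) in auto)
    also have "\<dots> = f b *\<^sub>v nsum n N b (\<lambda>z. r z *\<^sub>v v z)" by (rule nsum_hom[OF I(1) sb c])
    finally show ?thesis using nsum_carrier[OF rN sb, of "\<lambda>z. r z *\<^sub>v v z"] c True by auto
  qed
qed

text \<open>The support of \<open>A\<close> lies within distance \<open>Suc r\<close> of
  \<open>c\<close>. How it fills this ball decides the outcome: center \<open>c\<close> with radius
  \<open>Suc r\<close> or \<open>r - 1\<close>, or a neighbour of \<open>c\<close> with radius
  \<open>r\<close>.\<close>

lemma irreducible_sink_center:
  fixes A A' N N' :: "'k::field qrep"
  assumes n: "n \<ge> 3" and F: "full_refl n p A N" and F': "full_refl n p A' N'"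
    and f: "irreducible_map n (\<not> p) N N' f" and g: "irreducible_map n p A A' g"
    and sN': "nbr_surj n (\<not> p) N'" and iA: "nbr_inj n p A"
    and c: "sink_center (\<not> p) (supp N') c r" and tc: "tvert n c"
  shows "\<exists>c r. sink_center p (supp A) c r"
proof -
  note R = refl_supp[OF F] and R' = refl_supp[OF F']
  note D = full_reflD[OF F] and D' = full_reflD[OF F']
  note rA = pre_reflD(1)[OF D(1)] and rN = pre_reflD(2)[OF D(1)] and rN' = pre_reflD(2)[OF D'(1)]
  have ball': "tdist c v \<le> r" if "v \<in> supp N'" for v using c that by (simp add: sink_center_def)
  have pc: "is_sink p c \<longleftrightarrow> odd r" using c by (auto simp: sink_center_def is_sink_not)
  have par: "is_sink p x \<longleftrightarrow> odd (r + tdist c x)" for x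
    using is_sink_tdist[of p x c] pc by (auto simp: tdist_sym)
  obtain u w where uw: "u \<in> supp N'" "w \<in> supp N'" "tdist u w = 2 * r" "tdist c u = r" "tdist c w = r" using sink_centerE[OF c] .
  have ns: "\<not> is_sink p u" "\<not> is_sink p w" using par uw by simp_all
  have tu: "tvert n u" "tvert n w" using supp_tvert[OF rN'] uw by blast+
  \<comment> \<open>Such a vertex is adjacent to the support of \<open>N'\<close>, hence within
    distance \<open>Suc r\<close>, and parity excludes equality.\<close>
  have sinkN: "tdist c b \<le> r" if b: "b \<in> supp N" "\<not> is_sink p b" for b
  proof -
    have "is_sink (\<not> p) b" using b by (simp add: is_sink_not)
    then obtain y where y: "y \<in> nbrs n b" "y \<in> supp N'" using irreducible_sink_nbr[OF f sN'] b(1) by blast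
    have "tdist c b \<le> Suc r" using tadj_tdist_cases[of n b y c] y ball'[OF y(2)] by (auto simp: nbrs_def)
    moreover have "tdist c b \<noteq> Suc r" using par[of b] b by auto
    ultimately show ?thesis by simp
  qed
  have bA: "tdist c v \<le> Suc r" if v: "v \<in> supp A" for v
  proof (cases "is_sink p v")
    case True
    then obtain b where b: "b \<in> nbrs n v" "b \<in> supp A" using R(2) v by blast
    have nb: "\<not> is_sink p b" by (rule nbrs_arrow(3)[OF b(1) True])
    then have "tdist c b \<le> r" using R(1)[OF nb] b sinkN by blast
    then show ?thesis using tadj_tdist_cases[of n v b c] b(1) by (auto simp: nbrs_def)
  next
    case False
    then have "v \<in> supp N" using R(1) v by blast
    then show ?thesis using sinkN[OF _ False] by fastforce
  qed
  show ?thesis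
  proof (cases "\<exists>y0\<in>supp N. r < tdist c y0")
    case True
    then obtain y0 where y0: "y0 \<in> supp N" "r < tdist c y0" by blast
    have y0s: "\<not> is_sink (\<not> p) y0" using sinkN[of y0] y0 by (fastforce simp: is_sink_not)
    have y0N: "y0 \<notin> supp N'" using ball' y0(2) by fastforce
    note sur = irreducible_surjective[OF f D(3) sN' y0s y0(1) y0N]
    \<comment> \<open>If \<open>y\<close> were missing from \<open>A\<close>, the map
      \<open>rmap N y x\<close> would be surjective, and with it its composite with the surjective
      \<open>f x\<close>. But the composite factors through \<open>N'_y\<close>, which is zero
      beyond radius \<open>r\<close>.\<close>
    have far: "y \<in> supp A" if x: "x \<in> supp N'" "\<not> is_sink p x" and y: "tadj n x y" "r < tdist c y" for x y
    proof (rule ccontr)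
      assume nA: "y \<notin> supp A"
      have sy: "is_sink p y" using tadj_sink[OF y(1)] x by blast
      have xy: "x \<in> nbrs n y" using tadj_sym[OF y(1)] by (simp add: nbrs_def)
      note ar = nbrs_arrow(2)[OF xy sy]
      note If = irreducibleD(1)[OF f]
      have zy: "rdim N' y = 0" using ball'[of y] y(2) by (fastforce simp: supp_def)
      have nx: "rdim N' x \<noteq> 0" using x by (simp add: supp_def)
      obtain z where z: "z \<in> carrier_vec (rdim N x)" "f x *\<^sub>v z = unit_vec (rdim N' x) 0" using sur[OF unit_vec_carrier] by blast
      obtain w0 where w0: "w0 \<in> carrier_vec (rdim N y)" "rmap N y x *\<^sub>v w0 = z" using R(3)[OF sy nA xy z(1)] by blast
      have "rmap N' y x * f y = 0\<^sub>m (rdim N' x) (rdim N y)"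
        by (rule mat_mult_empty) (use repD[OF rN' ar] homD(3)[OF If, of y] zy in auto)
      then have "(f x * rmap N y x) *\<^sub>v w0 = 0\<^sub>v (rdim N' x)" using homD(6)[OF If ar] w0(1) by (intro eq_vecI) auto
      then have "f x *\<^sub>v z = 0\<^sub>v (rdim N' x)" using assoc_mult_mat_vec[OF homD(3)[OF If] repD[OF rN ar] w0(1)] w0(2) by simp
      then show False using z(2) nx by simp
    qed
    obtain y where y: "tadj n u y" "tdist w y = Suc (tdist w u)" using farther_nbr[OF n tu(1)] .
    have yr: "r < tdist c y" using tdist_triangle[of w y c] y uw by (simp add: tdist_sym)
    obtain w' where w': "tadj n w w'" "tdist y w' = Suc (tdist y w)" using farther_nbr[OF n tu(2)] .
    have yA: "y \<in> supp A" by (rule far[OF uw(1) ns(1) y(1) yr])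
    have "r < tdist c w'" using tdist_triangle[of y w' c] w' y uw bA[OF yA] by (simp add: tdist_sym)
    then have "w' \<in> supp A" by (rule far[OF uw(2) ns(2) w'(1)])
    moreover have "tdist y w' = 2 * Suc r" using w' y uw by (simp add: tdist_sym)
    ultimately have "sink_center p (supp A) c (Suc r)" using yA bA pc unfolding sink_center_def by auto
    then show ?thesis by blast
  next
    case False
    then have ballN: "tdist c v \<le> r" if "v \<in> supp N" for v using that by fastforce
    have r1: "r \<ge> 1"
    proof (rule ccontr)
      assume "\<not> r \<ge> 1"
      then have r0: "r = 0" by simp
      have "is_sink (\<not> p) u" using ns by (simp add: is_sink_not)
      then obtain y where y: "y \<in> nbrs n u" "y \<in> supp N'" using nbr_surj_supp[OF rN' sN' _ uw(1)] by blast
      then have "tdist c y = 0" "tdist c u = 0" using ball'[OF y(2)] uw r0 by auto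
      then have "y = u" by (simp add: tdist_eq_0)
      then show False using y(1) tadj_tdist[of n u u] by (simp add: nbrs_def)
    qed
    \<comment> \<open>Now \<open>N\<close> stays inside the ball of radius \<open>r\<close>, so the
      outward neighbours of a point of \<open>A\<close> at distance \<open>r\<close> cannot be
      missing from \<open>A\<close>.\<close>
    have out: "y \<in> supp A" if v: "v \<in> supp A" "tdist c v = r" and y: "tadj n v y" "tdist c y = Suc r" for v y
    proof (rule ccontr)
      assume nA: "y \<notin> supp A"
      have "is_sink p y" using par[of y] y by simp
      moreover have "v \<in> nbrs n y" using tadj_sym[OF y(1)] by (simp add: nbrs_def)
      ultimately have "y \<in> supp N" using R(4) nA v(1) by blast
      then show False using ballN y(2) by fastforce
    qed
    have outex: "\<exists>y\<in>supp A. tadj n v y \<and> tdist c y = Suc r" if v: "v \<in> supp A" "tdist c v = r" for v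
    proof -
      obtain y where y: "tadj n v y" "tdist c y = Suc (tdist c v)" using farther_nbr[OF n supp_tvert[OF rA v(1)]] .
      then show ?thesis using out[OF v y(1)] v by auto
    qed
    \<comment> \<open>The irreducible map from \<open>A\<close> to \<open>A'\<close> enters here: an
      extreme point of \<open>N'\<close> lies in \<open>A'\<close>, and therefore has a neighbour in
      \<open>A\<close>.\<close>
    have inn: "\<exists>z\<in>supp A. tadj n x z" if x: "x \<in> supp N'" "\<not> is_sink p x" for x
    proof -
      have "x \<in> supp A'" using R'(1)[OF x(2)] x(1) by blast
      from irreducible_source_nbr[OF g iA x(2) this] show ?thesis by (auto simp: nbrs_def)
    qed
    obtain zu where zu: "zu \<in> supp A" "tadj n u zu" using inn[OF uw(1) ns(1)] by blast
    obtain zw where zw: "zw \<in> supp A" "tadj n w zw" using inn[OF uw(2) ns(2)] by blast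
    show ?thesis
    proof (cases "\<exists>y1\<in>supp A. \<exists>y2\<in>supp A. tdist y1 y2 = 2 * Suc r")
      case True
      then have "sink_center p (supp A) c (Suc r)" using bA pc unfolding sink_center_def by auto
      then show ?thesis by blast
    next
      case nofar: False
      show ?thesis
      proof (cases "\<exists>y1\<in>supp A. tdist c y1 = Suc r")
        case False
        \<comment> \<open>Distance \<open>r\<close> is excluded as well, since a point there would
          have an outward neighbour in \<open>A\<close>.\<close>
        then have lt: "tdist c v \<le> r - 1" if "v \<in> supp A" for v
          using bA[OF that] outex[OF that] that by (metis One_nat_def Suc_diff_1 Suc_le_eq le_SucE le_neq_implies_less less_Suc_eq_le r1)
        have "tdist zu zw \<le> (r - 1) + (r - 1)"
          using tdist_triangle[of zu zw c] lt[OF zu(1)] lt[OF zw(1)] by (simp add: tdist_sym)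
        moreover have "tdist u w \<le> tdist u zu + tdist zu zw + tdist zw w"
          using tdist_triangle[of u w zu] tdist_triangle[of zu w zw] by linarith
        moreover have "tdist u zu = 1" "tdist zw w = 1" using tadj_tdist[OF zu(2)] tadj_tdist[OF tadj_sym[OF zw(2)]] by auto
        ultimately have "tdist zu zw = 2 * (r - 1)" using uw(3) by linarith
        moreover have "is_sink p c \<longleftrightarrow> even (r - 1)" using pc r1 by simp
        ultimately have "sink_center p (supp A) c (r - 1)" using lt zu(1) zw(1) unfolding sink_center_def by blast
        then show ?thesis by blast
      next
        case True
        then obtain y1 where y1: "y1 \<in> supp A" "tdist c y1 = Suc r" by blast
        have "c \<noteq> y1" using y1 by auto
        then obtain c' where c': "tadj n c c'" "tdist c y1 = Suc (tdist c' y1)"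
          using tdist_closer[OF tc supp_tvert[OF rA y1(1)]] by blast
        have cy: "tdist c' y1 = r" using c' y1 by simp
        have cc: "tdist c c' = 1" by (rule tadj_tdist[OF c'(1)])
        have c'd: "tdist c' v = Suc (tdist c v) \<or> tdist c v = Suc (tdist c' v)" for v
          using tadj_tdist_cases[OF c'(1), of v] by (simp add: tdist_sym)
        have far_in: "tdist c' v = r" if v: "v \<in> supp A" "tdist c v = Suc r" for v
        proof (rule ccontr)
          assume "tdist c' v \<noteq> r"
          then have e: "tdist c' v = Suc (Suc r)" using c'd[of v] v by auto
          have "tdist v c' + tdist c y1 \<le> max (tdist v c + tdist c' y1) (tdist v y1 + tdist c' c)" by (rule four_point)
          then have "2 * r + 2 \<le> tdist v y1" using e v y1 cy cc by (auto simp: tdist_sym)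
          moreover have "tdist v y1 \<le> 2 * Suc r" using tdist_triangle[of v y1 c] v y1 by (simp add: tdist_sym)
          ultimately show False using nofar v(1) y1(1) by auto
        qed
        have ball2: "tdist c' v \<le> r" if v: "v \<in> supp A" for v
        proof -
          consider "tdist c v = Suc r" | "tdist c v = r" | "tdist c v < r" using bA[OF v] by linarith
          then show ?thesis
          proof cases
            case 1 then show ?thesis using far_in[OF v] by simp
          next
            case 2
            then obtain y where y: "y \<in> supp A" "tadj n v y" "tdist c y = Suc r" using outex[OF v] by blast
            have "tdist c y + tdist c' v \<le> max (tdist c c' + tdist y v) (tdist c v + tdist y c')" by (rule four_point)
            moreover have "tdist v y = 1" by (rule tadj_tdist[OF y(2)])
            ultimately have "tdist c' v \<le> max (Suc 0) (r + r) - r \<or> tdist c' v \<le> r" using 2 y far_in[OF y(1,3)] cc r1 by (auto simp: tdist_sym)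
            then show ?thesis using 2 c'd[of v] r1 by auto
          next
            case 3 then show ?thesis using c'd[of v] by auto
          qed
        qed
        \<comment> \<open>One of the antipodal points \<open>u\<close> and \<open>w\<close> lies on
          the side of \<open>c\<close> away from \<open>y1\<close>, at distance
          \<open>2 * r + 1\<close> from it; passing to its neighbour in \<open>A\<close> costs at
          most one.\<close>
        have "\<exists>z\<in>supp A. 2 * r \<le> tdist z y1"
        proof -
          have "tdist u w + tdist c y1 \<le> max (tdist u c + tdist w y1) (tdist u y1 + tdist w c)" by (rule four_point)
          then have "2 * r + 1 \<le> tdist w y1 \<or> 2 * r + 1 \<le> tdist u y1" using uw y1 by (auto simp: tdist_sym)
          then show ?thesis
          proof
            assume "2 * r + 1 \<le> tdist w y1"
            moreover have "tdist w y1 \<le> Suc (tdist zw y1)" using tdist_triangle[of w y1 zw] tadj_tdist[OF zw(2)] by simp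
            ultimately show ?thesis using zw(1) by (intro bexI[of _ zw]) auto
          next
            assume "2 * r + 1 \<le> tdist u y1"
            moreover have "tdist u y1 \<le> Suc (tdist zu y1)" using tdist_triangle[of u y1 zu] tadj_tdist[OF zu(2)] by simp
            ultimately show ?thesis using zu(1) by (intro bexI[of _ zu]) auto
          qed
        qed
        then obtain z where z: "z \<in> supp A" "2 * r \<le> tdist z y1" by blast
        have "tdist z y1 \<le> r + r" using tdist_triangle[of z y1 c'] ball2[OF z(1)] cy by (simp add: tdist_sym)
        then have "tdist z y1 = 2 * r" using z(2) by simp
        moreover have "is_sink p c' \<longleftrightarrow> even r" using pc tadj_sink[OF c'(1), of p] by auto
        ultimately have "sink_center p (supp A) c' r" using ball2 z(1) y1(1) unfolding sink_center_def by blast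
        then show ?thesis by blast
      qed
    qed
  qed
qed

section \<open>Growth of eccentricities under repeated reflection\<close>

text \<open>Of two neighbours leading away from \<open>z\<close>, at most one leads towards
  \<open>z'\<close>.\<close>

lemma farther_nbr2:
  assumes n: "n \<ge> 3" and v: "tvert n v"
  shows "\<exists>y. tadj n v y \<and> tdist z y = Suc (tdist z v) \<and> tdist z' y = Suc (tdist z' v)"
proof -
  obtain y y' where y: "tadj n v y" "tadj n v y'" "y \<noteq> y'" "tdist z y = Suc (tdist z v)" "tdist z y' = Suc (tdist z v)"
    using two_farther_nbrs[OF assms] by blast
  show ?thesis
  proof (cases "tdist z' y = Suc (tdist z' v)")
    case True
    then show ?thesis using y by blast
  next
    case False
    then have "tdist z' v = Suc (tdist z' y)" using tadj_tdist_cases[OF y(1), of z'] by simp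
    then have "tdist z' v \<noteq> Suc (tdist z' y')" using tdist_closer_unique[OF y(1,2)] y(3) by blast
    then show ?thesis using tadj_tdist_cases[OF y(2), of z'] y by blast
  qed
qed

definition ecc :: "nat list set \<Rightarrow> nat list \<Rightarrow> nat" where
  "ecc S x = Max (tdist x ` S)"

lemma ecc_ge: "finite S \<Longrightarrow> v \<in> S \<Longrightarrow> tdist x v \<le> ecc S x"
  unfolding ecc_def by (rule Max_ge) auto

lemma ecc_attained: "finite S \<Longrightarrow> S \<noteq> {} \<Longrightarrow> \<exists>v\<in>S. tdist x v = ecc S x"
  unfolding ecc_def using Max_in[of "tdist x ` S"] by fastforce

lemma ecc_le: "finite S \<Longrightarrow> S \<noteq> {} \<Longrightarrow> (\<And>v. v \<in> S \<Longrightarrow> tdist x v \<le> k) \<Longrightarrow> ecc S x \<le> k"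
  unfolding ecc_def by (subst Max_le_iff) auto

text \<open>Applied to \<open>V t = supp (\<sigma>\<^sup>-\<^sup>t M)\<close>. For every vertex \<open>c\<close> the eccentricity eventually grows by one in
  each step, so \<open>ecc (V t) c - t\<close> stabilizes, and these limits are bounded below because two farthest
  points can be pushed apart. A vertex minimizing the limit is a center: otherwise all farthest
  points lie behind one neighbour, whose limit is smaller by parity.\<close>

lemma sink_growth:
  assumes n: "n \<ge> 3" and fin: "\<And>t. finite (V t)" and ne: "\<And>t. V t \<noteq> {}" and tv: "\<And>t v. v \<in> V t \<Longrightarrow> tvert n v"
    and q: "\<And>t. q (Suc t) = (\<not> q t)"
    and R1: "\<And>t b. is_sink (q t) b \<Longrightarrow> b \<in> V t \<longleftrightarrow> b \<in> V (Suc t)"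
    and R2: "\<And>t a. \<not> is_sink (q t) a \<Longrightarrow> a \<in> V (Suc t) \<Longrightarrow> \<exists>b\<in>nbrs n a. b \<in> V (Suc t)"
    and R3: "\<And>t a b. \<not> is_sink (q t) a \<Longrightarrow> b \<in> nbrs n a \<Longrightarrow> b \<in> V t \<Longrightarrow> a \<notin> V t \<Longrightarrow> a \<in> V (Suc t)"
  shows "\<exists>t c r. sink_center (q t) (V t) c r"
proof -
  \<comment> \<open>\<open>P c t\<close> says that the points of \<open>V t\<close> farthest from
    \<open>c\<close> are sinks of \<open>q t\<close>.\<close>
  define P where "P c t \<longleftrightarrow> (is_sink (q t) c \<longleftrightarrow> even (ecc (V t) c))" for c t
  have nb: "tadj n a b" "is_sink (q t) b \<longleftrightarrow> \<not> is_sink (q t) a" if "b \<in> nbrs n a" for a b t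
    using that tadj_sink[of n a b "q t"] by (auto simp: nbrs_def)
  have nbd: "tdist c a \<le> Suc (tdist c b)" if "b \<in> nbrs n a" for a b c
    using tadj_tdist_cases[OF nb(1)[OF that], of c] by auto
  have sk: "is_sink (q t) x \<longleftrightarrow> (is_sink (q t) c \<longleftrightarrow> even (tdist c x))" for t x c
    using is_sink_tdist[of "q t" x c] by (simp add: tdist_sym)
  \<comment> \<open>Farthest points that are sinks acquire outward neighbours in the next set.
    Eccentricity and orientation then change parity together, so the property persists.\<close>
  have grow: "ecc (V (Suc t)) c = Suc (ecc (V t) c) \<and> P c (Suc t)"
    and grow_far: "\<And>v y. v \<in> V t \<Longrightarrow> tdist c v = ecc (V t) c \<Longrightarrow> tadj n v y \<Longrightarrow> tdist c y = Suc (tdist c v) \<Longrightarrow> y \<in> V (Suc t)"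
    if Pt: "P c t" for c t
  proof -
    show far: "y \<in> V (Suc t)" if v: "v \<in> V t" "tdist c v = ecc (V t) c" and y: "tadj n v y" "tdist c y = Suc (tdist c v)" for v y
    proof -
      have "is_sink (q t) v" using sk[of t v c] Pt v by (simp add: P_def)
      then have "\<not> is_sink (q t) y" using tadj_sink[OF y(1)] by blast
      moreover have "v \<in> nbrs n y" using tadj_sym[OF y(1)] by (simp add: nbrs_def)
      moreover have "y \<notin> V t" using ecc_ge[OF fin, of y t c] y v by auto
      ultimately show ?thesis using R3 v(1) by blast
    qed
    obtain v where v: "v \<in> V t" "tdist c v = ecc (V t) c" using ecc_attained[OF fin ne] by blast
    obtain y where y: "tadj n v y" "tdist c y = Suc (tdist c v)" using farther_nbr[OF n tv[OF v(1)]] .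
    have "Suc (ecc (V t) c) \<le> ecc (V (Suc t)) c"
      using ecc_ge[OF fin far[OF v y], of c] y v by simp
    moreover have "ecc (V (Suc t)) c \<le> Suc (ecc (V t) c)"
    proof (rule ecc_le[OF fin ne])
      fix x assume x: "x \<in> V (Suc t)"
      show "tdist c x \<le> Suc (ecc (V t) c)"
      proof (cases "is_sink (q t) x")
        case True
        then have "x \<in> V t" using R1 x by blast
        then show ?thesis using ecc_ge[OF fin, of x t c] by simp
      next
        case False
        then obtain b where b: "b \<in> nbrs n x" "b \<in> V (Suc t)" using R2 x by blast
        then have "b \<in> V t" using R1 nb(2)[OF b(1)] False by blast
        then show ?thesis using ecc_ge[OF fin, of b t c] nbd[OF b(1), of c] by simp
      qed
    qed
    ultimately have e: "ecc (V (Suc t)) c = Suc (ecc (V t) c)" by simp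
    moreover have "P c (Suc t)" using Pt e unfolding P_def q is_sink_not by simp
    ultimately show "ecc (V (Suc t)) c = Suc (ecc (V t) c) \<and> P c (Suc t)" by blast
  qed
  \<comment> \<open>Here no sink is farthest, so points new in the next set, being adjacent to
    sinks, do not exceed the old eccentricity. If the eccentricity stays equal, reversing the
    orientation makes the farthest points sinks.\<close>
  have shrink: "P c (Suc t) \<or> ecc (V (Suc t)) c < ecc (V t) c" if nP: "\<not> P c t" for c t
  proof -
    have le: "tdist c b < ecc (V t) c" if b: "b \<in> V t" "is_sink (q t) b" for b
    proof -
      have "tdist c b \<noteq> ecc (V t) c" using sk[of t b c] nP b(2) by (auto simp: P_def)
      then show ?thesis using ecc_ge[OF fin b(1), of c] by simp
    qed
    have "ecc (V (Suc t)) c \<le> ecc (V t) c"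
    proof (rule ecc_le[OF fin ne])
      fix x assume x: "x \<in> V (Suc t)"
      show "tdist c x \<le> ecc (V t) c"
      proof (cases "is_sink (q t) x")
        case True
        then have "x \<in> V t" using R1 x by blast
        then show ?thesis using ecc_ge[OF fin, of x t c] by simp
      next
        case False
        then obtain b where b: "b \<in> nbrs n x" "b \<in> V (Suc t)" using R2 x by blast
        then have bs: "is_sink (q t) b" using nb(2)[OF b(1)] False by blast
        then have "b \<in> V t" using R1 b by blast
        then show ?thesis using le[OF _ bs] nbd[OF b(1), of c] by simp
      qed
    qed
    moreover have "P c (Suc t)" if "ecc (V (Suc t)) c = ecc (V t) c"
      using nP that unfolding P_def q is_sink_not by simp
    ultimately show ?thesis by linarith
  qed
  have ex: "\<exists>t. P c t" for c
  proof (rule ccontr)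
    assume "\<not> ?thesis"
    then have d: "ecc (V (Suc t)) c < ecc (V t) c" for t using shrink by blast
    have "ecc (V t) c + t \<le> ecc (V 0) c" for t
    proof (induction t)
      case (Suc t) then show ?case using d[of t] by simp
    qed simp
    from this[of "Suc (ecc (V 0) c)"] show False by simp
  qed
  have stay: "P c (t + s) \<and> ecc (V (t + s)) c = ecc (V t) c + s" if "P c t" for c t s
  proof (induction s)
    case (Suc s) then show ?case using grow[of c "t + s"] by simp
  qed (use that in simp)
  obtain t1 where t1: "P [] t1" using ex by blast
  \<comment> \<open>Two points, equal at the start, move outward in each step. By
    \<open>farther_nbr2\<close> both stay farthest from the empty word while their mutual distance
    grows by two.\<close>
  have pair: "\<exists>y1\<in>V (t1 + s). \<exists>y2\<in>V (t1 + s). tdist [] y1 = ecc (V (t1+s)) [] \<and> tdist [] y2 = ecc (V (t1+s)) [] \<and> 2 * s \<le> tdist y1 y2" for s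
  proof (induction s)
    case 0
    then show ?case using ecc_attained[OF fin ne, of t1 "[]"] by auto
  next
    case (Suc s)
    then obtain y1 y2 where y: "y1 \<in> V (t1 + s)" "y2 \<in> V (t1 + s)" "tdist [] y1 = ecc (V (t1+s)) []" "tdist [] y2 = ecc (V (t1+s)) []" "2 * s \<le> tdist y1 y2"
      by blast
    have Ps: "P [] (t1 + s)" using stay[OF t1] by blast
    obtain x1 where x1: "tadj n y1 x1" "tdist [] x1 = Suc (tdist [] y1)" "tdist y2 x1 = Suc (tdist y2 y1)"
      using farther_nbr2[OF n tv[OF y(1)]] by blast
    obtain x2 where x2: "tadj n y2 x2" "tdist [] x2 = Suc (tdist [] y2)" "tdist x1 x2 = Suc (tdist x1 y2)"
      using farther_nbr2[OF n tv[OF y(2)]] by blast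
    have "x1 \<in> V (t1 + Suc s)" "x2 \<in> V (t1 + Suc s)"
      using grow_far[OF Ps y(1) y(3) x1(1,2)] grow_far[OF Ps y(2) y(4) x2(1,2)] by simp_all
    moreover have "2 * Suc s \<le> tdist x1 x2" using x1 x2 y(5) by (simp add: tdist_sym)
    moreover have "tdist [] x1 = ecc (V (t1 + Suc s)) []" "tdist [] x2 = ecc (V (t1 + Suc s)) []"
      using grow[OF Ps] x1 x2 y by simp_all
    ultimately show ?case by blast
  qed
  have low: "s \<le> ecc (V (t1 + s)) c" for s c
  proof -
    obtain y1 y2 where y: "y1 \<in> V (t1 + s)" "y2 \<in> V (t1 + s)" "2 * s \<le> tdist y1 y2" using pair by blast
    then show ?thesis using ecc_ge[OF fin y(1), of c] ecc_ge[OF fin y(2), of c] tdist_triangle[of y1 y2 c] by (simp add: tdist_sym)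
  qed
  \<comment> \<open>The offset \<open>t1\<close> makes the limit of eccentricity minus time a
    natural number; \<open>low\<close> guarantees that it is nonnegative.\<close>
  define K where "K c k \<longleftrightarrow> (\<exists>T. \<forall>t\<ge>T. P c t \<and> ecc (V t) c + t1 = t + k)" for c k
  have Kex: "\<exists>k. K c k" for c
  proof -
    obtain t0 where t0: "P c t0" using ex by blast
    have *: "P c (t0 + s) \<and> ecc (V (t0 + s)) c = ecc (V t0) c + s" for s by (rule stay[OF t0])
    have "t0 \<le> ecc (V t0) c + t1"
    proof -
      have "t0 \<le> ecc (V (t1 + t0)) c" by (rule low)
      also have "\<dots> = ecc (V t0) c + t1" using *[of t1] by (simp add: add.commute)
      finally show ?thesis .
    qed
    then have "P c t \<and> ecc (V t) c + t1 = t + (ecc (V t0) c + t1 - t0)" if "t \<ge> t0" for t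
      using *[of "t - t0"] that by simp
    then show ?thesis unfolding K_def by blast
  qed
  define k where "k = (LEAST k. \<exists>c. tvert n c \<and> K c k)"
  have "\<exists>k c. tvert n c \<and> K c k" using Kex[of "[]"] by (auto simp: tvert_def intro!: exI[of _ "[]"])
  then have "\<exists>c. tvert n c \<and> K c k" unfolding k_def by (rule LeastI_ex)
  then obtain c where c: "tvert n c" "K c k" by blast
  have kmin: "k \<le> k'" if "tvert n c'" "K c' k'" for c' k'
    unfolding k_def by (rule Least_le) (use that in blast)
  obtain T where T: "\<And>t. t \<ge> T \<Longrightarrow> P c t \<and> ecc (V t) c + t1 = t + k" using c(2) unfolding K_def by blast
  have "\<exists>T k'. \<forall>t\<ge>T. P b t \<and> ecc (V t) b + t1 = t + k'" for b using Kex[of b] unfolding K_def by blast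
  then obtain U where U: "\<And>b. \<exists>k'. \<forall>t\<ge>U b. P b t \<and> ecc (V t) b + t1 = t + k'" by metis
  \<comment> \<open>A time past the stabilisation at \<open>c\<close> and at all its neighbours; the
    extra 1 beyond \<open>t1\<close> ensures \<open>r \<ge> 1\<close>.\<close>
  define t where "t = t1 + 1 + T + (\<Sum>b\<in>nbrs n c. U b)"
  have tU: "t \<ge> U b" if "b \<in> nbrs n c" for b
    using member_le_sum[OF that, of U] finite_nbrs by (simp add: t_def)
  have tT: "t \<ge> T" by (simp add: t_def)
  define r where "r = ecc (V t) c"
  have Pt: "P c t" and et: "r + t1 = t + k" using T[OF tT] by (simp_all add: r_def)
  have r1: "r \<ge> 1" using et by (simp add: t_def)
  have ball: "tdist c v \<le> r" if "v \<in> V t" for v using ecc_ge[OF fin that] by (simp add: r_def)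
  obtain u where u: "u \<in> V t" "tdist c u = r" using ecc_attained[OF fin ne] by (auto simp: r_def)
  have "c \<noteq> u" using u r1 by auto
  then obtain c' where c': "tadj n c c'" "tdist c u = Suc (tdist c' u)" using tdist_closer[OF c(1) tv[OF u(1)]] by blast
  have cn: "c' \<in> nbrs n c" using c' by (simp add: nbrs_def)
  have cc: "tdist c' c = 1" using tadj_tdist[OF c'(1)] by (simp add: tdist_sym)
  obtain k' where k': "\<And>t. t \<ge> U c' \<Longrightarrow> P c' t \<and> ecc (V t) c' + t1 = t + k'" using U[of c'] by blast
  then have "K c' k'" unfolding K_def by blast
  then have kk: "k \<le> k'" using kmin tadj_tvert[OF c'(1)] by blast
  have P': "P c' t" and e': "ecc (V t) c' + t1 = t + k'" using k'[OF tU[OF cn]] by blast+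
  \<comment> \<open>Adjacent vertices have opposite parity, so their eccentricities differ.
    Minimality of \<open>k\<close> makes that of \<open>c'\<close> the larger one, and a point
    farthest from \<open>c'\<close> then lies opposite to \<open>u\<close>.\<close>
  have "ecc (V t) c' \<noteq> r" using Pt P' tadj_sink[OF c'(1), of "q t"] by (auto simp: P_def r_def)
  then have "r < ecc (V t) c'" using e' et kk by linarith
  moreover obtain w where w: "w \<in> V t" "tdist c' w = ecc (V t) c'" using ecc_attained[OF fin ne] by blast
  ultimately have w': "tdist c w = r" "tdist c' w = Suc r"
    using tadj_tdist_cases[OF c'(1), of w] ball[OF w(1)] by (auto simp: tdist_sym)
  have "tdist c' w + tdist c u \<le> max (tdist c' c + tdist w u) (tdist c' u + tdist w c)" by (rule four_point)
  then have "2 * r \<le> tdist w u" using w' u c' cc by (auto simp: tdist_sym)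
  moreover have "tdist w u \<le> 2 * r" using tdist_triangle[of w u c] w' u by (simp add: tdist_sym)
  ultimately have "tdist w u = 2 * r" by simp
  then have "sink_center (q t) (V t) c r" using ball u w Pt unfolding sink_center_def P_def r_def by blast
  then show ?thesis by blast
qed

section \<open>Shift orbits\<close>

definition orient :: "bool \<Rightarrow> int \<Rightarrow> bool" where
  "orient p s = (if even s then p else \<not> p)"

lemma orient_simps: "orient p 0 = p" "orient p (s + 1) = (\<not> orient p s)" "orient p (s - 1) = (\<not> orient p s)" "orient p (s + 2) = orient p s"
  by (auto simp: orient_def)

lemma orient_Suc: "orient p (- 1 - int t) = (\<not> orient p (- int t))"
  by (auto simp: orient_def)

text \<open>One chosen model of every shift: \<open>X s\<close> stands for
  \<open>\<sigma>\<^sup>s\<close> of \<open>X 0\<close>, also for negative \<open>s\<close>.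
  Fullness of each step allows passing between neighbours in both directions.\<close>

definition shift_chain :: "nat \<Rightarrow> bool \<Rightarrow> (int \<Rightarrow> 'k::field qrep) \<Rightarrow> bool" where
  "shift_chain n p X \<longleftrightarrow> (\<forall>s. indecomposable n (orient p s) (X s) \<and> full_refl n (orient p s) (X s) (X (s + 1)))"

lemma shift_chainD:
  assumes "shift_chain n p X"
  shows "indecomposable n (orient p s) (X s)" "full_refl n (orient p s) (X s) (X (s + 1))" "is_rep n (orient p s) (X s)"
  using assms indecomposable_rep by (auto simp: shift_chain_def)

text \<open>Dependent choice in both directions from \<open>M\<close>. Regularity keeps each
  reflected module nonzero, which makes the step full, and fullness makes the next module
  indecomposable again.\<close>

lemma regular_shift_chain:
  fixes M :: "'k::field qrep"
  assumes M: "regular n p M"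
  shows "\<exists>X. shift_chain n p X \<and> X 0 = M"
proof -
  have iM: "indecomposable n p M" and nz: "\<And>t q N. shifts n p M t q N \<Longrightarrow> \<not> is_zero_rep N" using M by (auto simp: regular_def)
  have b: "shifts n p M 0 p M" by (rule shifts.base[OF indecomposable_rep[OF iM]])
  define PF where "PF t N \<longleftrightarrow> shifts n p M (int t) (orient p (int t)) N \<and> indecomposable n (orient p (int t)) N \<and> (t = 0 \<longrightarrow> N = M)" for t N
  define PG where "PG t N \<longleftrightarrow> shifts n p M (- int t) (orient p (- int t)) N \<and> indecomposable n (orient p (- int t)) N \<and> (t = 0 \<longrightarrow> N = M)" for t N
  have "\<exists>F. \<forall>t. PF t (F t) \<and> full_refl n (orient p (int t)) (F t) (F (Suc t))"
  proof (rule dependent_nat_choice)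
    show "\<exists>x. PF 0 x" using b iM by (auto simp: PF_def orient_simps)
    fix N t assume N: "PF t N"
    let ?q = "orient p (int t)"
    have iN: "indecomposable n ?q N" and sN: "shifts n p M (int t) ?q N" using N by (auto simp: PF_def)
    obtain A where A: "refl_plus n ?q N A" using refl_plus_exists[OF indecomposable_rep[OF iN]] by blast
    have sA: "shifts n p M (int t + 1) (\<not> ?q) A" by (rule shifts.fwd[OF sN _ A]) simp
    have F: "full_refl n ?q N A" by (rule refl_plus_full[OF iN A nz[OF sA]])
    have "indecomposable n (\<not> ?q) A" using full_refl_indecomposable[OF F] iN by blast
    moreover have "orient p (int (Suc t)) = (\<not> ?q)" using orient_simps(2)[of p "int t"] by (simp add: add.commute)
    moreover have "int (Suc t) = int t + 1" by simp
    ultimately have "PF (Suc t) A" using sA by (simp add: PF_def add.commute)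
    then show "\<exists>A. PF (Suc t) A \<and> full_refl n ?q N A" using F by blast
  qed
  then obtain F where F: "\<And>t. PF t (F t)" "\<And>t. full_refl n (orient p (int t)) (F t) (F (Suc t))" by blast
  have "\<exists>G. \<forall>t. PG t (G t) \<and> full_refl n (\<not> orient p (- int t)) (G (Suc t)) (G t)"
  proof (rule dependent_nat_choice)
    show "\<exists>x. PG 0 x" using b iM by (auto simp: PG_def orient_simps)
    fix N t assume N: "PG t N"
    let ?q = "orient p (- int t)"
    have iN: "indecomposable n ?q N" and sN: "shifts n p M (- int t) ?q N" using N by (auto simp: PG_def)
    obtain A where A: "refl_minus n ?q N A" using refl_minus_exists[OF indecomposable_rep[OF iN]] by blast
    have sA: "shifts n p M (- int t - 1) (\<not> ?q) A" by (rule shifts.bwd[OF sN _ A]) simp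
    have F: "full_refl n (\<not> ?q) A N" by (rule refl_minus_full[OF _ _ nz[OF sA]]) (simp_all add: iN A)
    have "indecomposable n (\<not> ?q) A" using full_refl_indecomposable[OF F] iN by simp
    moreover have "orient p (- int (Suc t)) = (\<not> ?q)" by (simp add: orient_Suc)
    moreover have "- int (Suc t) = - int t - 1" by simp
    then have "shifts n p M (- int (Suc t)) (\<not> ?q) A" using sA by (simp only:)
    ultimately have "PG (Suc t) A" unfolding PG_def by (simp only:) simp
    then show "\<exists>A. PG (Suc t) A \<and> full_refl n (\<not> ?q) A N" using F by blast
  qed
  then obtain G where G: "\<And>t. PG t (G t)" "\<And>t. full_refl n (\<not> orient p (- int t)) (G (Suc t)) (G t)" by blast
  have G0: "G 0 = M" and F0: "F 0 = M" using G(1)[of 0] F(1)[of 0] by (auto simp: PG_def PF_def)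
  define X where "X s = (if s \<ge> 0 then F (nat s) else G (nat (- s)))" for s :: int
  have X0: "X 0 = M" by (simp add: X_def F0)
  have "indecomposable n (orient p s) (X s) \<and> full_refl n (orient p s) (X s) (X (s + 1))" for s
  proof (cases "s \<ge> 0")
    case True
    then show ?thesis using F(1)[of "nat s"] F(2)[of "nat s"] by (simp add: PF_def X_def nat_add_distrib)
  next
    case False
    define t where "t = nat (- s - 1)"
    have s: "s = - int (Suc t)" using False by (simp add: t_def)
    have "X s = G (Suc t)" using s by (simp add: X_def nat_add_distrib)
    moreover have "X (s + 1) = G t" using s G0 F0 by (cases "t = 0") (simp_all add: X_def)
    moreover have "orient p s = (\<not> orient p (- int t))" using s by (simp add: orient_Suc)
    ultimately show ?thesis using G(1)[of "Suc t"] G(2)[of t] s by (simp add: PG_def)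
  qed
  then show ?thesis using X0 unfolding shift_chain_def by blast
qed

section \<open>Independence of the chosen models\<close>

lemma is_iso_refl: "is_rep n p M \<Longrightarrow> is_iso n p M M"
  unfolding is_iso_def using hom_id[of n p M] hcomp_id(1)[OF hom_id[of n p M]] by blast

lemma is_iso_sym: "is_iso n p M N \<Longrightarrow> is_iso n p N M"
  unfolding is_iso_def by blast

lemma is_iso_trans:
  assumes "is_iso n p M N" "is_iso n p N K" shows "is_iso n p M K"
proof -
  obtain f g where fg: "is_hom n p M N f" "is_hom n p N M g" "hcomp g f = hid M" "hcomp f g = hid N"
    using assms(1) unfolding is_iso_def by blast
  obtain f' g' where fg': "is_hom n p N K f'" "is_hom n p K N g'" "hcomp g' f' = hid N" "hcomp f' g' = hid K"
    using assms(2) unfolding is_iso_def by blast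
  have a: "is_hom n p M K (hcomp f' f)" "is_hom n p K M (hcomp g g')"
    using hom_comp[OF fg(1) fg'(1)] hom_comp[OF fg'(2) fg(2)] by blast+
  have "hcomp (hcomp g g') (hcomp f' f) = hid M"
    using hcomp_assoc[OF a(1) fg'(2) fg(2)] hcomp_assoc[OF fg(1) fg'(1) fg'(2)] fg fg' hcomp_id(2)[OF fg(1)] by metis
  moreover have "hcomp (hcomp f' f) (hcomp g g') = hid K"
    using hcomp_assoc[OF a(2) fg(1) fg'(1)] hcomp_assoc[OF fg'(2) fg(2) fg(1)] fg fg' hcomp_id(2)[OF fg'(2)] by metis
  ultimately show ?thesis using a unfolding is_iso_def by blast
qed

lemma is_iso_supp:
  fixes M N :: "'k::field qrep"
  assumes "is_iso n p M N" shows "supp M = supp N"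
proof -
  have sub: "supp M \<subseteq> supp N" if i: "is_iso n p M N" for M N :: "'k qrep"
  proof
    fix x assume x: "x \<in> supp M"
    obtain f g where fg: "is_hom n p M N f" "is_hom n p N M g" "hcomp g f = hid M" using i unfolding is_iso_def by blast
    have e: "g x * f x = 1\<^sub>m (rdim M x)" using fun_cong[OF fg(3), of x] by (simp add: hcomp_def hid_def)
    show "x \<in> supp N"
    proof (rule ccontr)
      assume "x \<notin> supp N"
      then have "rdim N x = 0" by (simp add: supp_def)
      then have "g x * f x = 0\<^sub>m (rdim M x) (rdim M x)"
        by (intro mat_mult_empty) (use homD(3)[OF fg(1), of x] homD(3)[OF fg(2), of x] in auto)
      then show False using e one_mat_ne_zero[of "rdim M x", where 'k = 'k] x by (simp add: supp_def)
    qed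
  qed
  show ?thesis using sub[OF assms] sub[OF is_iso_sym[OF assms]] by blast
qed

lemma supp_eq_sink_module: "supp M = supp N \<Longrightarrow> sink_module n p M = sink_module n p N \<and> radius n M = radius n N"
  by (simp add: sink_module_def radius_def diam_path_def diam_def supp_path_def)

lemma shift_chain_shifts:
  assumes X: "shift_chain n p X"
  shows "shifts n (orient p a) (X a) t (orient p (a + t)) (X (a + t))"
proof -
  have b: "shifts n (orient p a) (X a) 0 (orient p a) (X a)" by (rule shifts.base[OF shift_chainD(3)[OF X]])
  have f: "shifts n (orient p a) (X a) (int k) (orient p (a + int k)) (X (a + int k))" for k
  proof (induction k)
    case (Suc k)
    have "shifts n (orient p a) (X a) (int k + 1) (\<not> orient p (a + int k)) (X (a + int k + 1))"
      by (rule shifts.fwd[OF Suc.IH _ full_reflD(4)[OF shift_chainD(2)[OF X]]]) simp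
    then show ?case by (simp add: orient_simps(2)[symmetric] ac_simps)
  qed (use b in simp)
  have g: "shifts n (orient p a) (X a) (- int k) (orient p (a - int k)) (X (a - int k))" for k
  proof (induction k)
    case (Suc k)
    have e: "(\<not> orient p (a - int k - 1)) = orient p (a - int k)" "a - int k - 1 + 1 = a - int k" by (simp_all add: orient_simps)
    have "refl_minus n (orient p (a - int k)) (X (a - int k)) (X (a - int k - 1))"
      using full_reflD(5)[OF shift_chainD(2)[OF X], of "a - int k - 1"] unfolding e .
    then have "shifts n (orient p a) (X a) (- int k - 1) (\<not> orient p (a - int k)) (X (a - int k - 1))"
      by (intro shifts.bwd[OF Suc.IH]) simp_all
    moreover have "- int (Suc k) = - int k - 1" "a - int (Suc k) = a - int k - 1" by simp_all
    ultimately show ?case by (simp only: orient_simps)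
  qed (use b in simp)
  show ?thesis using f[of "nat t"] g[of "nat (- t)"] by (cases "t \<ge> 0") simp_all
qed

text \<open>Both kinds of reflection respect isomorphisms, so by induction along
  \<open>shifts\<close> the choices made for the chain affect shifts only up to isomorphism.\<close>

lemma shift_chain_unique:
  fixes X :: "int \<Rightarrow> 'k::field qrep"
  assumes X: "shift_chain n p X" and Y: "is_iso n (orient p a) Y (X a)" and s: "shifts n (orient p a) Y t q N"
  shows "q = orient p (a + t) \<and> is_iso n q N (X (a + t))"
  using s
proof induction
  case base
  then show ?case using Y by simp
next
  case (fwd t q N N')
  have q: "q = orient p (a + t)" and i: "is_iso n q N (X (a + t))" using fwd.IH by blast+
  have "refl_plus n q (X (a + t)) (X (a + t + 1))" unfolding q by (rule full_reflD(4)[OF shift_chainD(2)[OF X]])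
  from iso_refl_plus[OF fwd.hyps(3) this i] show ?case using q orient_simps(2)[of p "a + t"] by (simp add: add.assoc)
next
  case (bwd t q N N')
  have q: "q = orient p (a + t)" and i: "is_iso n q N (X (a + t))" using bwd.IH by blast+
  have e: "(\<not> orient p (a + t - 1)) = q" "a + t - 1 + 1 = a + t" by (simp_all add: orient_simps q)
  have "refl_minus n q (X (a + t)) (X (a + t - 1))"
    using full_reflD(5)[OF shift_chainD(2)[OF X], of "a + t - 1"] unfolding e .
  from iso_refl_minus[OF bwd.hyps(3) this i] show ?case using q orient_simps(3)[of p "a + t"] by (simp add: add_diff_eq)
qed

lemma shift_chain_sink_step:
  fixes X :: "int \<Rightarrow> 'k::field qrep"
  assumes n: "n \<ge> 3" and X: "shift_chain n p X" and s: "sink_module n (orient p (s + 1)) (X (s + 1))"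
  shows "sink_module n (orient p s) (X s) \<and> radius n (X s) = Suc (radius n (X (s + 1)))"
proof -
  obtain c r where c: "sink_center (orient p (s + 1)) (supp (X (s + 1))) c r"
    using sink_module_center[OF shift_chainD(1)[OF X] s] by blast
  have r: "radius n (X (s + 1)) = r" by (rule sink_center_sink_module(2)[OF shift_chainD(1)[OF X] c])
  have "sink_center (orient p s) (supp (X s)) c (Suc r)"
    by (rule sink_center_refl_minus[OF n shift_chainD(2)[OF X]]) (use c in \<open>simp add: orient_simps\<close>)
  from sink_center_sink_module[OF shift_chainD(1)[OF X] this] show ?thesis using r by simp
qed

lemma shift_chain_sink_below:
  fixes X :: "int \<Rightarrow> 'k::field qrep"
  assumes n: "n \<ge> 3" and X: "shift_chain n p X" and s: "sink_module n (orient p s) (X s)"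
  shows "sink_module n (orient p (s - int k)) (X (s - int k)) \<and> radius n (X (s - int k)) = radius n (X s) + k"
proof (induction k)
  case (Suc k)
  have e: "s - int (Suc k) + 1 = s - int k" by simp
  show ?case using shift_chain_sink_step[OF n X, of "s - int (Suc k)"] Suc.IH unfolding e by simp
qed (use s in simp)

lemma shift_chain_sink_exists:
  fixes X :: "int \<Rightarrow> 'k::field qrep"
  assumes n: "n \<ge> 3" and X: "shift_chain n p X"
  shows "\<exists>s. sink_module n (orient p s) (X s)"
proof -
  note I = shift_chainD[OF X]
  have F: "full_refl n (\<not> orient p (- int t)) (X (- int (Suc t))) (X (- int t))" for t
    using I(2)[of "- int (Suc t)"] by (simp add: orient_Suc)
  have "\<exists>t c r. sink_center (orient p (- int t)) (supp (X (- int t))) c r"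
  proof (rule sink_growth[OF n])
    show "finite (supp (X (- int t)))" for t by (rule supp_finite[OF I(3)])
    show "supp (X (- int t)) \<noteq> {}" for t using I(1)[of "- int t"] by (auto simp: indecomposable_def is_zero_rep_def supp_def)
    show "tvert n v" if "v \<in> supp (X (- int t))" for t v using supp_tvert[OF I(3) that] .
    show "orient p (- int (Suc t)) = (\<not> orient p (- int t))" for t by (simp add: orient_Suc)
    show "b \<in> supp (X (- int t)) \<longleftrightarrow> b \<in> supp (X (- int (Suc t)))" if "is_sink (orient p (- int t)) b" for t b
      by (rule refl_supp(1)[OF F]) (use that in \<open>simp add: is_sink_not\<close>)
    show "\<exists>b\<in>nbrs n a. b \<in> supp (X (- int (Suc t)))" if "\<not> is_sink (orient p (- int t)) a" "a \<in> supp (X (- int (Suc t)))" for t a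
      by (rule refl_supp(2)[OF F _ that(2)]) (use that(1) in \<open>simp add: is_sink_not\<close>)
    show "a \<in> supp (X (- int (Suc t)))" if a: "\<not> is_sink (orient p (- int t)) a" and b: "b \<in> nbrs n a" "b \<in> supp (X (- int t))" and na: "a \<notin> supp (X (- int t))" for t a b
    proof (rule ccontr)
      assume "a \<notin> supp (X (- int (Suc t)))"
      moreover have a': "is_sink (\<not> orient p (- int t)) a" using a by (simp add: is_sink_not)
      moreover have "b \<in> supp (X (- int (Suc t)))" using refl_supp(1)[OF F nbrs_arrow(3)[OF b(1) a']] b(2) by blast
      ultimately show False using refl_supp(4)[OF F] b(1) na by blast
    qed
  qed
  then show ?thesis using sink_center_sink_module(1)[OF I(1)] by blast
qed

section \<open>The last sink module and the index\<close>

definition top_sink :: "nat \<Rightarrow> bool \<Rightarrow> (int \<Rightarrow> 'k::field qrep) \<Rightarrow> int \<Rightarrow> bool" where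
  "top_sink n p X s0 \<longleftrightarrow> sink_module n (orient p s0) (X s0) \<and> (\<forall>s. sink_module n (orient p s) (X s) \<longrightarrow> s \<le> s0)"

text \<open>Below a sink module the radius grows by one in each step. Hence a sink module
  \<open>k\<close> steps above \<open>X a\<close> has a radius smaller by \<open>k\<close>, and
  \<open>k\<close> is bounded by the radius of \<open>X a\<close>.\<close>

lemma top_sink_exists:
  fixes X :: "int \<Rightarrow> 'k::field qrep"
  assumes n: "n \<ge> 3" and X: "shift_chain n p X"
  shows "\<exists>s0. top_sink n p X s0"
proof -
  obtain a where a: "sink_module n (orient p a) (X a)" using shift_chain_sink_exists[OF assms] by blast
  define S where "S = {k. sink_module n (orient p (a + int k)) (X (a + int k))}"
  have "S \<subseteq> {..radius n (X a)}"
  proof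
    fix k assume "k \<in> S"
    then have "radius n (X a) = radius n (X (a + int k)) + k"
      using shift_chain_sink_below[OF n X, of "a + int k" k] by (simp add: S_def)
    then show "k \<in> {..radius n (X a)}" by simp
  qed
  then have fin: "finite S" by (rule finite_subset) simp
  have "0 \<in> S" using a by (simp add: S_def)
  then have m: "Max S \<in> S" using Max_in[OF fin] by blast
  have "s \<le> a + int (Max S)" if s: "sink_module n (orient p s) (X s)" for s
  proof (cases "s \<ge> a")
    case True
    then have "nat (s - a) \<in> S" using s by (simp add: S_def)
    then show ?thesis using Max_ge[OF fin, of "nat (s - a)"] by linarith
  qed simp
  then show ?thesis using m unfolding top_sink_def S_def by blast
qed

text \<open>Any other sink module of smallest radius in the orbit is isomorphic to
  \<open>X s0\<close>, since the radii at different indices differ. For uniqueness of the index it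
  remains to see that no other shift of it is isomorphic to \<open>X 0\<close>.\<close>

lemma iota_shift_chain:
  fixes X :: "int \<Rightarrow> 'k::field qrep"
  assumes n: "n \<ge> 3" and X: "shift_chain n p X" and s0: "top_sink n p X s0"
  shows "iota n p (X 0) = - s0"
proof -
  have sk: "sink_module n (orient p s0) (X s0)" and mx: "\<And>s. sink_module n (orient p s) (X s) \<Longrightarrow> s \<le> s0"
    using s0 by (auto simp: top_sink_def)
  have rad: "radius n (X s) = radius n (X s0) + nat (s0 - s)" if "s \<le> s0" for s
    using shift_chain_sink_below[OF n X sk, of "nat (s0 - s)"] that by simp
  have iX: "is_iso n (orient p a) (X a) (X a)" for a by (rule is_iso_refl[OF shift_chainD(3)[OF X]])
  have un: "q = orient p s \<and> is_iso n q N (X s)" if "shifts n p (X 0) s q N" for s q N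
    using shift_chain_unique[OF X iX, of 0 s q N] that unfolding orient_simps add_0 by blast
  have un_sink: "sink_module n (orient p s) (X s) \<and> radius n N = radius n (X s)"
    if "shifts n p (X 0) s q N" "sink_module n q N" for s q N
  proof -
    note q = un[OF that(1), THEN conjunct1] and i = un[OF that(1), THEN conjunct2]
    show ?thesis using supp_eq_sink_module[OF is_iso_supp[OF i], of n q] that(2) q by simp
  qed
  have M0: "is_M0 n p (X 0) (orient p s0) (X s0)"
    unfolding is_M0_def
  proof (intro conjI allI impI)
    show "\<exists>s. shifts n p (X 0) s (orient p s0) (X s0)" using shift_chain_shifts[OF X, of 0 s0] by (auto simp: orient_simps)
    show "sink_module n (orient p s0) (X s0)" by (rule sk)
    show "radius n (X s0) \<le> radius n N" if "shifts n p (X 0) s q N" "sink_module n q N" for s q N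
      using un_sink[OF that] rad[OF mx, of s] by simp
  qed
  have "index_rel n p (X 0) (- s0)"
    unfolding index_rel_def using M0 shift_chain_shifts[OF X, of s0 "- s0"] iX[of 0] by (auto simp: orient_simps)
  moreover have "t = - s0" if ir: "index_rel n p (X 0) t" for t
  proof -
    obtain q0 M0' N where M0': "is_M0 n p (X 0) q0 M0'" and N: "shifts n q0 M0' t p N" and i: "is_iso n p (X 0) N"
      using ir unfolding index_rel_def by blast
    obtain s where s: "shifts n p (X 0) s q0 M0'" using M0' by (auto simp: is_M0_def)
    have sm: "sink_module n q0 M0'" and le: "radius n M0' \<le> radius n (X s0)"
      using M0' M0 by (auto simp: is_M0_def)
    have S: "sink_module n (orient p s) (X s)" "radius n M0' = radius n (X s)" using un_sink[OF s sm] by blast+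
    have "s \<le> s0" by (rule mx[OF S(1)])
    then have "s = s0" using rad[of s] S(2) le by simp
    then have q0: "q0 = orient p s0" and i0: "is_iso n q0 M0' (X s0)" using un[OF s] by blast+
    \<comment> \<open>If \<open>X 0\<close> is isomorphic to \<open>X u\<close>, the set of indices
      of sink modules is invariant under translation by \<open>u\<close>. As it has a greatest
      element, \<open>u\<close> is 0.\<close>
    define u where "u = s0 + t"
    have pu: "p = orient p u" and iN: "is_iso n p N (X u)"
      using shift_chain_unique[OF X i0[unfolded q0] N[unfolded q0]] by (auto simp: u_def)
    have iu: "is_iso n (orient p u) (X 0) (X u)" using is_iso_trans[OF i iN] pu by simp
    have per: "sink_module n (orient p v) (X v) \<longleftrightarrow> sink_module n (orient p (u + v)) (X (u + v))" for v
    proof -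
      have "shifts n (orient p u) (X 0) v (orient p v) (X v)" using shift_chain_shifts[OF X, of 0 v] pu by (simp add: orient_simps)
      note o = shift_chain_unique[OF X iu this, THEN conjunct1] and i = shift_chain_unique[OF X iu this, THEN conjunct2]
      show ?thesis using supp_eq_sink_module[OF is_iso_supp[OF i], of n "orient p v"] o by simp
    qed
    have "u + s0 \<le> s0" using per[of s0] sk mx by blast
    moreover have "s0 - u \<le> s0" using per[of "s0 - u"] sk mx[of "s0 - u"] by simp
    ultimately show ?thesis by (simp add: u_def)
  qed
  ultimately show ?thesis unfolding iota_def by (rule the_equality)
qed

lemma shift_chain_irreducible:
  fixes X Y :: "int \<Rightarrow> 'k::field qrep"
  assumes X: "shift_chain n p X" and Y: "shift_chain n p Y" and f: "irreducible_map n p (X 0) (Y 0) f"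
  shows "\<exists>g. irreducible_map n (orient p s) (X s) (Y s) g"
proof -
  have fw: "\<exists>g. irreducible_map n (orient p (int k)) (X (int k)) (Y (int k)) g" for k
  proof (induction k)
    case 0 show ?case using f by (auto simp: orient_simps)
  next
    case (Suc k)
    then obtain g where "irreducible_map n (orient p (int k)) (X (int k)) (Y (int k)) g" by blast
    from irreducible_refl_plus[OF shift_chainD(2)[OF X] shift_chainD(2)[OF Y] this]
    show ?case using orient_simps(2)[of p "int k"] by (simp add: add.commute)
  qed
  have bw: "\<exists>g. irreducible_map n (orient p (- int k)) (X (- int k)) (Y (- int k)) g" for k
  proof (induction k)
    case 0 show ?case using f by (auto simp: orient_simps)
  next
    case (Suc k)
    have e: "- int (Suc k) + 1 = - int k" "orient p (- int k) = (\<not> orient p (- int (Suc k)))"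
      by (simp_all add: orient_Suc)
    obtain g where "irreducible_map n (\<not> orient p (- int (Suc k))) (X (- int k)) (Y (- int k)) g" using Suc e(2) by auto
    from irreducible_refl_minus[OF shift_chainD(2)[OF X, of "- int (Suc k)", unfolded e(1)] shift_chainD(2)[OF Y, of "- int (Suc k)", unfolded e(1)] this]
    show ?case .
  qed
  show ?thesis using fw[of "nat s"] bw[of "nat (- s)"] by (cases "s \<ge> 0") simp_all
qed

text \<open>The members of both chains at \<open>b - 1\<close> and \<open>b\<close> form the square
  of \<open>irreducible_sink_center\<close>; its two extra exactness conditions come from the step
  at \<open>b\<close> in \<open>Y\<close> and the step at \<open>b - 2\<close> in
  \<open>X\<close>.\<close>

lemma top_sink_irreducible:
  fixes X Y :: "int \<Rightarrow> 'k::field qrep"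
  assumes n: "n \<ge> 3" and X: "shift_chain n p X" and Y: "shift_chain n p Y" and f: "irreducible_map n p (X 0) (Y 0) f"
    and a: "top_sink n p X a" and b: "top_sink n p Y b"
  shows "b \<le> a + 1"
proof -
  let ?q = "orient p (b - 1)"
  have e: "orient p b = (\<not> ?q)" "b - 1 + 1 = b" by (simp_all add: orient_simps)
  have F: "full_refl n ?q (X (b - 1)) (X b)" and F': "full_refl n ?q (Y (b - 1)) (Y b)"
    using shift_chainD(2)[OF X, of "b - 1"] shift_chainD(2)[OF Y, of "b - 1"] by simp_all
  obtain h where h: "irreducible_map n (\<not> ?q) (X b) (Y b) h" using shift_chain_irreducible[OF X Y f, of b] e by auto
  obtain g where g: "irreducible_map n ?q (X (b - 1)) (Y (b - 1)) g" using shift_chain_irreducible[OF X Y f, of "b - 1"] by blast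
  have sj: "nbr_surj n (\<not> ?q) (Y b)" using full_reflD(2)[OF shift_chainD(2)[OF Y, of b]] e by simp
  have ij: "nbr_inj n ?q (X (b - 1))"
    using full_reflD(3)[OF shift_chainD(2)[OF X, of "b - 2"]] orient_simps(2)[of p "b - 2"] by simp
  obtain c r where c: "tvert n c" "sink_center (\<not> ?q) (supp (Y b)) c r"
    using sink_module_center[OF shift_chainD(1)[OF Y, of b]] b e by (auto simp: top_sink_def)
  obtain c' r' where "sink_center ?q (supp (X (b - 1))) c' r'"
    using irreducible_sink_center[OF n F F' h g sj ij c(2,1)] by blast
  from sink_center_sink_module(1)[OF shift_chainD(1)[OF X] this] show ?thesis using a by (auto simp: top_sink_def)
qed

theorem theorem3:
  fixes n :: nat and p :: bool
    and M M' :: "'k::field qrep" and f :: "nat list \<Rightarrow> 'k mat"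
  assumes "n \<ge> 3"
    and "regular n p M" and "regular n p M'"
    and "irreducible_map n p M M' f"
  shows "iota n p M' = iota n p M - 1"
proof -
  obtain X Y where X: "shift_chain n p X" "X 0 = M" and Y: "shift_chain n p Y" "Y 0 = M'"
    using regular_shift_chain assms(2,3) by metis
  obtain a b where a: "top_sink n p X a" and b: "top_sink n p Y b" using top_sink_exists[OF assms(1)] X(1) Y(1) by metis
  have "b \<le> a + 1"
    by (rule top_sink_irreducible[OF assms(1) X(1) Y(1) _ a b]) (use assms(4) X Y in simp)
  moreover have "a \<le> b - 1"
  proof -
    \<comment> \<open>The orbit of \<open>Y\<close> re-indexed to start at
      \<open>\<sigma>\<^sup>2M'\<close>. The even shift leaves the orientation unchanged, and the
      last sink module of \<open>Z\<close> is at \<open>b - 2\<close>.\<close>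
    define Z where "Z s = Y (s + 2)" for s
    have Z: "shift_chain n p Z"
      unfolding shift_chain_def
    proof
      fix s :: int
      have "s + 2 + 1 = s + 1 + 2" by simp
      then show "indecomposable n (orient p s) (Z s) \<and> full_refl n (orient p s) (Z s) (Z (s + 1))"
        using shift_chainD(1,2)[OF Y(1), of "s + 2"] by (simp add: Z_def orient_simps)
    qed
    have "indecomposable n p M" "indecomposable n p M'" using assms(2,3) by (auto simp: regular_def)
    moreover have "full_refl n p M' (Y 1)" "full_refl n (\<not> p) (Y 1) (Z 0)"
      using shift_chainD(2)[OF Y(1), of 0] shift_chainD(2)[OF Y(1), of 1] Y(2) by (simp_all add: Z_def orient_def)
    ultimately obtain j where "irreducible_map n p (Z 0) (X 0) j"
      using irreducible_from_translate[OF _ _ assms(4)] X(2) by metis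
    moreover have "top_sink n p Z (b - 2)"
      unfolding top_sink_def
    proof (intro conjI allI impI)
      show "sink_module n (orient p (b - 2)) (Z (b - 2))" using b by (simp add: top_sink_def Z_def orient_def)
      show "s \<le> b - 2" if "sink_module n (orient p s) (Z s)" for s
      proof -
        have "sink_module n (orient p (s + 2)) (Y (s + 2))" using that by (simp add: Z_def orient_simps)
        then have "s + 2 \<le> b" using b by (simp add: top_sink_def)
        then show ?thesis by simp
      qed
    qed
    ultimately show ?thesis using top_sink_irreducible[OF assms(1) Z X(1) _ _ a] by fastforce
  qed
  ultimately have "b = a + 1" by simp
  then show ?thesis using iota_shift_chain[OF assms(1) X(1) a] iota_shift_chain[OF assms(1) Y(1) b] X(2) Y(2) by simp
qed

end
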